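(* Let $\mathcal{I}$ be a set of degree sequence intervals that is weakly $P$-stable and such that every $[\ell,u]\in\mathcal{I}$ is thin. Then the degree interval Markov chain $\mathbb{G}(\ell,u)$ is rapidly mixing for every $[\ell,u]\in\mathcal{I}$; that is, there is a polynomial (depending only on $\mathcal{I}$) such that for every $[\ell,u]\in\mathcal{I}$ on $n$ vertices and every $\varepsilon>0$, the mixing time $\tau_{\mathbb{G}(\ell,u)}(\varepsilon)$ (the number of steps after which the distribution of the chain is within $\varepsilon$ in $\ell_1$-distance of its uniform stationary distribution on $\mathcal{G}(\ell,u)$, from any starting state) is bounded by that polynomial evaluated at $n$ and $\log(1/\varepsilon)$.
   Context: Graphs are simple (no loops, no parallel edges) with labelled vertex set $[n]=\{1,\dots,n\}$. A degree sequence on $n$ vertices is a vector $d\in\mathbb{N}^n$ with all coordinates at most $n-1$; $\mathcal{G}(d)$ is the set of graphs on $[n]$ with $\deg(i)=d_i$ for all $i$. For $\ell,u\in\mathbb{N}^n$ write $\ell\le u$ if $\ell_i\le u_i$ for all $i$, and $[\ell,u]=\{d\in\mathbb{N}^n:\ell\le d\le u\}$. If $\ell\le u$ are degree sequences, $[\ell,u]$ is a degree sequence interval, with realizations $\mathcal{G}(\ell,u)=\bigcup_{d\in[\ell,u]}\mathcal{G}(d)$. It is thin if $u_i\le \ell_i+1$ for all $i$. For $S\subseteq[n]$, $\mathds{1}_S$ denotes the characteristic vector of $S$. Given a polynomial $p$, $[\ell,u]$ is weakly $p$-stable if $\left|\bigcup_{\{i,j\}\in\binom{[n]}{2}}\mathcal{G}(\ell,u+\mathds{1}_{\{i,j\}})\right|\le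 p(n)\,|\mathcal{G}(\ell,u)|$; a set $\mathcal{I}$ of degree sequence intervals is weakly $P$-stable if there is a single polynomial $p$ such that every member is weakly $p$-stable. For a graph $G$ and a set $R$ of vertex pairs, $G\triangle R$ is the graph on $[n]$ with edge set $E(G)\triangle R$. The degree interval Markov chain $\mathbb{G}(\ell,u)$ has state space $\mathcal{G}(\ell,u)$; from state $G$: with probability $1/2$ it stays at $G$; with probability $1/6$ it picks vertices $a,b,c,d$ uniformly at random and moves to $G'=G\triangle\{ab,cd,ac,bd\}$ if $\deg_{G'}=\deg_G$ (a switch), otherwise stays; with probability $1/6$ it picks vertices $a,b,c$ uniformly at random and moves to $G''=G\triangle\{ab,bc\}$ if $G''$ has the same number of edges as $G$ and $G''\in\mathcal{G}(\ell,u)$ (a hinge-flip), otherwise stays; with probability $1/6$ it picks a pair $a,b$ uniformly at random and moves to $G'''=G\triangle\{ab\}$ if $G'''\in\mathcal{G}(\ell,u)$ (an edge-toggle), otherwise stays. *)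

theory Defs
  imports "HOL-Probability.Probability" "HOL-Library.Ramsey"
    "HOL-Computational_Algebra.Polynomial"
begin

section \<open>Graphs and degree sequence intervals\<close>

text \<open>
  A simple graph on the vertex set \<open>{1..n}\<close> is identified with its edge set, a set of
  two-element subsets of \<open>{1..n}\<close>. Vectors indexed by \<open>{1..n}\<close> are functions on \<open>nat\<close>
  of which only the values on \<open>{1..n}\<close> are ever inspected.
\<close>

type_synonym graph = "nat set set"

definition graphs :: "nat \<Rightarrow> graph set" where
  "graphs n = {G. G \<subseteq> nsets {1..n} 2}"

definition deg :: "graph \<Rightarrow> nat \<Rightarrow> nat" where
  "deg G v = card {e \<in> G. v \<in> e}"

definition degree_sequence :: "nat \<Rightarrow> (nat \<Rightarrow> nat) \<Rightarrow> bool" where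
  "degree_sequence n d \<longleftrightarrow> (\<forall>i\<in>{1..n}. d i \<le> n - 1)"

definition realizations :: "nat \<Rightarrow> (nat \<Rightarrow> nat) \<Rightarrow> graph set" where
  "realizations n d = {G \<in> graphs n. \<forall>i\<in>{1..n}. deg G i = d i}"

definition vec_interval :: "nat \<Rightarrow> (nat \<Rightarrow> nat) \<Rightarrow> (nat \<Rightarrow> nat) \<Rightarrow> (nat \<Rightarrow> nat) set" where
  "vec_interval n l u = {d. \<forall>i\<in>{1..n}. l i \<le> d i \<and> d i \<le> u i}"

definition interval_realizations ::
    "nat \<Rightarrow> (nat \<Rightarrow> nat) \<Rightarrow> (nat \<Rightarrow> nat) \<Rightarrow> graph set" where
  "interval_realizations n l u = (\<Union>d \<in> vec_interval n l u. realizations n d)"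

definition degree_sequence_interval :: "nat \<Rightarrow> (nat \<Rightarrow> nat) \<Rightarrow> (nat \<Rightarrow> nat) \<Rightarrow> bool" where
  "degree_sequence_interval n l u \<longleftrightarrow>
     degree_sequence n l \<and> degree_sequence n u \<and> (\<forall>i\<in>{1..n}. l i \<le> u i)"

definition thin :: "nat \<Rightarrow> (nat \<Rightarrow> nat) \<Rightarrow> (nat \<Rightarrow> nat) \<Rightarrow> bool" where
  "thin n l u \<longleftrightarrow> (\<forall>i\<in>{1..n}. u i \<le> l i + 1)"

definition weakly_stable ::
    "real poly \<Rightarrow> nat \<Rightarrow> (nat \<Rightarrow> nat) \<Rightarrow> (nat \<Rightarrow> nat) \<Rightarrow> bool" where
  "weakly_stable p n l u \<longleftrightarrow>
     real (card (\<Union>S \<in> nsets {1..n} 2. interval_realizations n l (\<lambda>i. u i + indicator S i)))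
       \<le> poly p (real n) * real (card (interval_realizations n l u))"

definition weakly_P_stable :: "(nat \<times> (nat \<Rightarrow> nat) \<times> (nat \<Rightarrow> nat)) set \<Rightarrow> bool" where
  "weakly_P_stable \<I> \<longleftrightarrow> (\<exists>p. \<forall>(n, l, u) \<in> \<I>. weakly_stable p n l u)"


section \<open>The degree interval Markov chain\<close>

text \<open>
  The symmetric difference may produce a singleton (a loop) when the chosen vertices are not
  distinct; membership in \<open>graphs n\<close> (or in \<open>interval_realizations n l u\<close>) rejects this.
\<close>

definition switch :: "nat \<Rightarrow> graph \<Rightarrow> nat \<times> nat \<times> nat \<times> nat \<Rightarrow> graph" where
  "switch n G = (\<lambda>(a, b, c, d).
     let G' = sym_diff G {{a, b}, {c, d}, {a, c}, {b, d}}
     in if G' \<in> graphs n \<and> (\<forall>i\<in>{1..n}. deg G' i = deg G i) then G' else G)"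

definition hinge_flip ::
    "nat \<Rightarrow> (nat \<Rightarrow> nat) \<Rightarrow> (nat \<Rightarrow> nat) \<Rightarrow> graph \<Rightarrow> nat \<times> nat \<times> nat \<Rightarrow> graph" where
  "hinge_flip n l u G = (\<lambda>(a, b, c).
     let G' = sym_diff G {{a, b}, {b, c}}
     in if card G' = card G \<and> G' \<in> interval_realizations n l u then G' else G)"

definition edge_toggle ::
    "nat \<Rightarrow> (nat \<Rightarrow> nat) \<Rightarrow> (nat \<Rightarrow> nat) \<Rightarrow> graph \<Rightarrow> nat set \<Rightarrow> graph" where
  "edge_toggle n l u G e =
     (let G' = sym_diff G {e} in if G' \<in> interval_realizations n l u then G' else G)"

text \<open>
  The guard only matters in degenerate cases (no vertices, or no pair of vertices), where there
  is nothing to choose from and the chain stays put.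
\<close>

definition uniform_move :: "'c set \<Rightarrow> ('c \<Rightarrow> 's) \<Rightarrow> 's \<Rightarrow> 's pmf" where
  "uniform_move C f x = (if C = {} then return_pmf x else map_pmf f (pmf_of_set C))"

definition interval_chain ::
    "nat \<Rightarrow> (nat \<Rightarrow> nat) \<Rightarrow> (nat \<Rightarrow> nat) \<Rightarrow> graph \<Rightarrow> graph pmf" where
  "interval_chain n l u G = (let V = {1..n} in join_pmf (pmf_of_list
     [(return_pmf G, 1/2),
      (uniform_move (V \<times> V \<times> V \<times> V) (switch n G) G, 1/6),
      (uniform_move (V \<times> V \<times> V) (hinge_flip n l u G) G, 1/6),
      (uniform_move (nsets V 2) (edge_toggle n l u G) G, 1/6)]))"


section \<open>Mixing time\<close>

definition steps :: "('s \<Rightarrow> 's pmf) \<Rightarrow> nat \<Rightarrow> 's \<Rightarrow> 's pmf" where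
  "steps K t x = ((\<lambda>\<mu>. bind_pmf \<mu> K) ^^ t) (return_pmf x)"

definition l1_dist :: "'s set \<Rightarrow> 's pmf \<Rightarrow> 's pmf \<Rightarrow> real" where
  "l1_dist \<Omega> \<mu> \<nu> = (\<Sum>y\<in>\<Omega>. \<bar>pmf \<mu> y - pmf \<nu> y\<bar>)"

text \<open>
  Mixing time of a kernel \<open>K\<close> on a finite state space \<open>\<Omega>\<close> with respect to the uniform
  distribution; it is \<open>\<infinity>\<close> if the chain does not get and stay \<open>\<epsilon>\<close>-close to uniform.
\<close>

definition mixing_time :: "'s set \<Rightarrow> ('s \<Rightarrow> 's pmf) \<Rightarrow> real \<Rightarrow> enat" where
  "mixing_time \<Omega> K \<epsilon> =
     Inf {enat t |t. \<forall>s\<ge>t. \<forall>x\<in>\<Omega>. l1_dist \<Omega> (steps K s x) (pmf_of_set \<Omega>) \<le> \<epsilon>}"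

text \<open>
  Evaluation of a bivariate polynomial \<open>\<Sum>i. c\<^sub>i(Y) X^i\<close>, whose coefficients \<open>c\<^sub>i\<close> are
  polynomials in \<open>Y\<close>, at \<open>X = x\<close> and \<open>Y = y\<close>.
\<close>

definition poly2 :: "real poly poly \<Rightarrow> real \<Rightarrow> real \<Rightarrow> real" where
  "poly2 q x y = poly (poly q [:x:]) y"

definition rapidly_mixing_family :: "(nat \<times> (nat \<Rightarrow> nat) \<times> (nat \<Rightarrow> nat)) set \<Rightarrow> bool" where
  "rapidly_mixing_family \<I> \<longleftrightarrow>
     (\<exists>q. \<forall>(n, l, u) \<in> \<I>. \<forall>\<epsilon>>0.
        ereal_of_enat (mixing_time (interval_realizations n l u) (interval_chain n l u) \<epsilon>)
          \<le> ereal (poly2 q (real n) (ln (1 / \<epsilon>))))"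

end

theory Submission
  imports Defs
begin

text \<open>
  The proof is a flow argument in the style of Jerrum and Sinclair. For realizations \<open>X\<close>, \<open>Y\<close>, pair
  the edges of \<open>X \<triangle> Y\<close> at every vertex, as far as possible an edge of \<open>X\<close> with one of \<open>Y\<close>; by
  thinness at most one edge per vertex remains unpaired. A pairing splits \<open>X \<triangle> Y\<close> into alternating
  trails, which are flipped one after the other. A trail is cut into excursions from its first
  vertex \<open>c\<close>, and an excursion is flipped by switches along chords at \<open>c\<close>. In this way every
  intermediate graph arises from \<open>X\<close> by flipping a bounded number of prefixes of the list of all
  trail edges and a bounded number of further edges.

  The flow from \<open>X\<close> to \<open>Y\<close> is spread over all pairings. A state \<open>Z\<close> together with the pairing and
  \<open>X \<triangle> Y \<triangle> Z\<close> determines \<open>X\<close> and \<open>Y\<close> up to polynomially many choices, and the degrees of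
  \<open>X \<triangle> Y \<triangle> Z\<close> violate the bounds \<open>l\<close>, \<open>u\<close> by a bounded amount in total. So it remains to count
  graphs whose degrees exceed \<open>u\<close> by at most \<open>k\<close> in total. If \<open>E\<^sub>k\<close> is the set of these, flipping the trail
  at an excess vertex shows that \<open>\<bar>E\<^sub>k\<bar> \<bar>E\<^sub>0\<bar>\<close> is at most \<open>\<bar>E\<^sub>k\<^sub>-\<^sub>1\<bar> (\<bar>E\<^sub>0\<bar> + r \<bar>E\<^sub>2\<bar>)\<close> with \<open>r\<close> polynomial in
  \<open>n\<close>, while weak stability bounds \<open>\<bar>E\<^sub>2\<bar>\<close> by a polynomial multiple of \<open>\<bar>E\<^sub>0\<bar>\<close>. The resulting
  Poincare inequality bounds the mixing time, since the chain is symmetric and lazy.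
\<close>

section \<open>Edge sets and local moves\<close>

text \<open>Every degree has at most two admissible values, so the path that flips a trail may only
  take the degrees of its two ends. Switches preserve degrees, and a single toggle or hinge flip
  changes them; hence the alternative \<open>eqdeg\<close> to one end or the other in all path
  lemmas. The obstacle is a chord that is already an edge, or that coincides with another chord
  because the trail revisits a vertex; this causes the case distinctions in the sweeps.

  Averaging over pairings pays for remembering the pairing when \<open>X\<close> and
  \<open>Y\<close> are reconstructed. Their number is governed by \<open>pairing_weight\<close>, one
  factorial per vertex, which depends on \<open>X \<triangle> Y\<close> only. A pairing adapted to
  \<open>X\<close> stays adapted to an intermediate graph except at boundedly many vertices, where
  polynomial factors may be lost. At all other vertices the count must be exact, as even a factor 2
  per vertex would be exponential; having at most one unpaired edge there makes this possible.

  The excess induction involves \<open>E\<^sub>2\<close> because a trail has two ends, each of which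
  may push a degree above \<open>u\<close>.\<close>

definition sd :: "'a set \<Rightarrow> 'a set \<Rightarrow> 'a set" where
  "sd A B = (A - B) \<union> (B - A)"

lemma in_sd [simp]: "x \<in> sd A B \<longleftrightarrow> (x \<in> A) \<noteq> (x \<in> B)"
  by (auto simp: sd_def)

lemma sd_commute: "sd A B = sd B A"
  and sd_assoc: "sd (sd A B) C = sd A (sd B C)"
  and sd_left_commute: "sd B (sd A C) = sd A (sd B C)"
  by (auto simp: set_eq_iff)

lemmas sd_ac = sd_assoc sd_commute sd_left_commute

lemma sd_self [simp]: "sd A A = {}" "sd A (sd A B) = B" "sd A {} = A" "sd {} A = A"
  by (auto simp: set_eq_iff)

lemma sd_disjoint: "A \<inter> B = {} \<Longrightarrow> sd A B = A \<union> B"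
  by (auto simp: set_eq_iff)

lemma finite_sd [intro]: "finite A \<Longrightarrow> finite B \<Longrightarrow> finite (sd A B)"
  by (simp add: sd_def)

lemma card_sd_le: "finite A \<Longrightarrow> finite B \<Longrightarrow> card (sd A B) \<le> card A + card B"
  unfolding sd_def by (metis (no_types, lifting) Diff_subset Un_mono card_Un_le card_mono finite_UnI le_trans)

lemma sd_subset: "A \<subseteq> C \<Longrightarrow> B \<subseteq> C \<Longrightarrow> sd A B \<subseteq> C"
  by auto

lemma doubleton_nsets: "{a, b} \<in> nsets V 2 \<longleftrightarrow> a \<in> V \<and> b \<in> V \<and> a \<noteq> b"
  by (auto simp: nsets_def card_insert_if)

lemma nsets2E:
  assumes "e \<in> nsets V 2" obtains a b where "e = {a, b}" "a \<in> V" "b \<in> V" "a \<noteq> b"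
  using assms by (auto simp: nsets_def card_2_iff)

lemma graphs_sd: "G \<in> graphs n \<Longrightarrow> S \<subseteq> nsets {1..n} 2 \<Longrightarrow> sd G S \<in> graphs n"
  by (auto simp: graphs_def)

lemma finite_pairs [simp]: "finite (nsets {1..n::nat} k)"
  by (rule finite_imp_finite_nsets) simp

lemma finite_graph: "G \<in> graphs n \<Longrightarrow> finite G"
  unfolding graphs_def using finite_subset[OF _ finite_pairs] by blast

lemma finite_graphs [simp]: "finite (graphs n)"
  unfolding graphs_def Pow_def[symmetric] by (rule finite_Pow_iff[THEN iffD2]) (rule finite_pairs)

lemma deg_toggle:
  assumes "finite U"
  shows "int (deg (sd U {e}) v) =
    int (deg U v) + (if v \<in> e then if e \<in> U then -1 else 1 else 0)"
proof (cases "v \<in> e")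
  case True
  show ?thesis
  proof (cases "e \<in> U")
    case eU: True
    have "{e' \<in> sd U {e}. v \<in> e'} = {e' \<in> U. v \<in> e'} - {e}" using eU by auto
    moreover have "card {e' \<in> U. v \<in> e'} > 0" using True eU assms by (auto simp: card_gt_0_iff)
    ultimately show ?thesis using True eU assms by (auto simp: deg_def of_nat_diff)
  next
    case eU: False
    have "{e' \<in> sd U {e}. v \<in> e'} = insert e {e' \<in> U. v \<in> e'}" using eU True by auto
    then show ?thesis using True eU assms by (auto simp: deg_def)
  qed
next
  case False
  then have "{e' \<in> sd U {e}. v \<in> e'} = {e' \<in> U. v \<in> e'}" by auto
  then show ?thesis using False by (simp add: deg_def)
qed

text \<open>The acceptance tests that involve the interval are left out. \<open>conn\<close> puts
  them back as membership in a set of graphs, so that paths can be built before an interval is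
  fixed; what remains is symmetric in \<open>U\<close> and \<open>U'\<close>.\<close>

definition move :: "nat \<Rightarrow> graph \<Rightarrow> graph \<Rightarrow> bool" where
  "move n U U' \<longleftrightarrow>
     (\<exists>a\<in>{1..n}. \<exists>b\<in>{1..n}. \<exists>c\<in>{1..n}. \<exists>d\<in>{1..n}.
        U' = sd U {{a, b}, {c, d}, {a, c}, {b, d}} \<and> (\<forall>v\<in>{1..n}. deg U' v = deg U v)) \<or>
     (\<exists>a\<in>{1..n}. \<exists>b\<in>{1..n}. \<exists>c\<in>{1..n}. U' = sd U {{a, b}, {b, c}} \<and> card U' = card U) \<or>
     (\<exists>e\<in>nsets {1..n} 2. U' = sd U {e})"

lemma move_sym: "move n U U' \<Longrightarrow> move n U' U"
proof -
  have *: "U' = sd U S \<Longrightarrow> U = sd U' S" for U U' S :: graph by (auto simp: set_eq_iff)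
  show "move n U U' \<Longrightarrow> move n U' U"
    unfolding move_def using * by metis
qed

text \<open>No length is recorded: the sets \<open>A\<close> will be polynomially small, and within
  such a set reachability alone bounds the length of a path, see
  \<open>conn_difference_bound\<close>.\<close>

definition conn :: "nat \<Rightarrow> graph set \<Rightarrow> graph \<Rightarrow> graph \<Rightarrow> bool" where
  "conn n A = (\<lambda>U U'. U \<in> A \<and> U' \<in> A \<and> move n U U')\<^sup>*\<^sup>*"

lemma conn_refl [simp]: "conn n A U U"
  by (simp add: conn_def)

lemma conn_trans [trans]: "conn n A U U' \<Longrightarrow> conn n A U' U'' \<Longrightarrow> conn n A U U''"
  unfolding conn_def by (rule rtranclp_trans)

lemma conn_sym: "conn n A U U' \<Longrightarrow> conn n A U' U"
  unfolding conn_def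
  by (rule sympD[OF symp_rtranclp]) (auto intro!: sympI dest: move_sym)

lemma conn_mono: "conn n A U U' \<Longrightarrow> A \<subseteq> B \<Longrightarrow> conn n B U U'"
  unfolding conn_def by (erule rtranclp_mono[THEN predicate2D, rotated]) auto

lemma conn_move: "U \<in> A \<Longrightarrow> U' \<in> A \<Longrightarrow> move n U U' \<Longrightarrow> conn n A U U'"
  unfolding conn_def by auto

lemma conn_mem: "conn n A U U' \<Longrightarrow> U \<in> A \<Longrightarrow> U' \<in> A"
  unfolding conn_def by (induction rule: rtranclp_induct) auto

lemma deg_sd4:
  assumes "finite U" "e1 \<in> U" "e2 \<in> U" "e3 \<notin> U" "e4 \<notin> U" "e1 \<noteq> e2" "e3 \<noteq> e4"
  shows "int (deg (sd U {e1, e2, e3, e4}) v) =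
    int (deg U v) - of_bool (v \<in> e1) - of_bool (v \<in> e2) + of_bool (v \<in> e3) + of_bool (v \<in> e4)"
proof -
  have ne: "e1 \<noteq> e3" "e1 \<noteq> e4" "e2 \<noteq> e3" "e2 \<noteq> e4" using assms by auto
  have "sd U {e1, e2, e3, e4} = sd (sd (sd (sd U {e1}) {e2}) {e3}) {e4}"
    using assms(6,7) ne by (intro set_eqI) (simp only: in_sd insert_iff empty_iff, blast)
  moreover have "e2 \<in> sd U {e1}" "e3 \<notin> sd (sd U {e1}) {e2}" "e4 \<notin> sd (sd (sd U {e1}) {e2}) {e3}"
    using assms ne by simp_all
  ultimately show ?thesis using assms(1,2) by (simp add: deg_toggle finite_sd)
qed

lemma switch_step:
  assumes U: "U \<in> graphs n" and V: "a \<in> {1..n}" "b \<in> {1..n}" "c \<in> {1..n}" "d \<in> {1..n}"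
    and dist: "distinct [a, b, c, d]"
    and e: "{a, b} \<in> U" "{c, d} \<in> U" "{a, c} \<notin> U" "{b, d} \<notin> U"
  shows "move n U (sd U {{a, b}, {c, d}, {a, c}, {b, d}})"
    and "sd U {{a, b}, {c, d}, {a, c}, {b, d}} \<in> graphs n"
    and "deg (sd U {{a, b}, {c, d}, {a, c}, {b, d}}) v = deg U v"
proof -
  have ne: "{a, b} \<noteq> {c, d}" "{a, c} \<noteq> {b, d}" using dist by (auto simp: doubleton_eq_iff)
  have d: "deg (sd U {{a, b}, {c, d}, {a, c}, {b, d}}) v = deg U v" for v
  proof -
    have "int (deg (sd U {{a, b}, {c, d}, {a, c}, {b, d}}) v) = int (deg U v)"
      using deg_sd4[OF finite_graph[OF U] e(1,2,3,4) ne] dist by auto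
    then show ?thesis by simp
  qed
  show "deg (sd U {{a, b}, {c, d}, {a, c}, {b, d}}) v = deg U v" by (rule d)
  show "sd U {{a, b}, {c, d}, {a, c}, {b, d}} \<in> graphs n"
    using U V dist by (intro graphs_sd) (auto simp: doubleton_nsets)
  show "move n U (sd U {{a, b}, {c, d}, {a, c}, {b, d}})"
    unfolding move_def using V d by blast
qed

section \<open>Flipping an excursion by switches at chords\<close>

definition trail_edge :: "(nat \<Rightarrow> nat) \<Rightarrow> nat \<Rightarrow> nat set" where
  "trail_edge w i = {w i, w (Suc i)}"

definition pfx_edges :: "(nat \<Rightarrow> nat) \<Rightarrow> nat \<Rightarrow> graph" where
  "pfx_edges w i = trail_edge w ` {..<i}"

definition eqdeg :: "nat \<Rightarrow> graph \<Rightarrow> graph \<Rightarrow> bool" where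
  "eqdeg n Z U \<longleftrightarrow> U \<in> graphs n \<and> (\<forall>v\<in>{1..n}. deg U v = deg Z v)"

lemma pfx_seg:
  assumes "inj_on (trail_edge w) {..<J}" "m \<le> j" "j \<le> J"
  shows "sd (pfx_edges w m) (pfx_edges w j) = trail_edge w ` {m..<j}"
proof -
  have "trail_edge w x \<notin> trail_edge w ` {..<m}" if "x \<in> {m..<j}" for x
  proof
    assume "trail_edge w x \<in> trail_edge w ` {..<m}"
    then obtain y where "y < m" "trail_edge w x = trail_edge w y" by auto
    then show False using inj_onD[OF assms(1), of x y] that assms by auto
  qed
  then have "trail_edge w ` {..<m} \<inter> trail_edge w ` {m..<j} = {}" by blast
  moreover have "{..<j} = {..<m} \<union> {m..<j}" using assms by auto
  ultimately show ?thesis unfolding pfx_edges_def sd_def by (simp only: image_Un) blast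
qed

text \<open>\<open>W\<close> after flipping the closed walk from \<open>c\<close> over the chord to
  \<open>w m\<close>, along the trail to \<open>w j\<close> and over the chord back to
  \<open>c\<close>. For odd \<open>m\<close> and \<open>j\<close> its length is even, so it can
  alternate. The two chords are toggled separately and cancel when \<open>w m = w j\<close>.\<close>

definition sweep_state :: "(nat \<Rightarrow> nat) \<Rightarrow> nat \<Rightarrow> graph \<Rightarrow> nat \<Rightarrow> nat \<Rightarrow> graph" where
  "sweep_state w c W j m = sd (sd (sd W (trail_edge w ` {m..<j})) {{c, w m}}) {{c, w j}}"

text \<open>
  The switches are carried out backwards from the chord at \<open>w j\<close>, which is absent, to the one
  at \<open>w i\<close>, which is present; each switch moves the missing chord two steps towards \<open>i\<close>.
\<close>

lemma sweep_pass:
  assumes W: "W \<in> graphs n"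
    and ij: "odd i" "odd j" "i \<le> j"
    and c: "c \<in> {1..n}"
    and V: "\<And>m. i \<le> m \<Longrightarrow> m \<le> j \<Longrightarrow> w m \<in> {1..n} \<and> w m \<noteq> c"
    and inj: "inj_on (trail_edge w) {i..<j}"
    and alt: "\<And>m. i \<le> m \<Longrightarrow> m < j \<Longrightarrow> trail_edge w m \<in> W \<longleftrightarrow> even m"
    and loopless: "\<And>m. i \<le> m \<Longrightarrow> m < j \<Longrightarrow> w m \<noteq> w (Suc m)"
    and absent: "{c, w j} \<notin> W"
    and present: "\<And>m. odd m \<Longrightarrow> i \<le> m \<Longrightarrow> m < j \<Longrightarrow> {c, w m} \<in> W \<or> w m = w j"
  shows "conn n {U. eqdeg n W U \<and> (\<exists>m\<in>{i..j}. U = sweep_state w c W j m)} W (sweep_state w c W j i)"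
    (is "conn n ?A _ _")
proof -
  define st where "st m = sweep_state w c W j m" for m
  have stj: "st j = W" by (auto simp: st_def sweep_state_def set_eq_iff)
  have WA: "W \<in> ?A"
    using W stj ij by (auto simp: eqdeg_def st_def intro!: bexI[of _ j])
  have "2 * d + i \<le> j \<Longrightarrow> conn n ?A W (st (j - 2 * d))" for d
  proof (induction d)
    case 0
    show ?case using stj by simp
  next
    case (Suc d)
    define m where "m = j - 2 * Suc d"
    have m2: "m + 2 = j - 2 * d" and mj: "m + 2 \<le> j" and im: "i \<le> m" using Suc.prems by (auto simp: m_def)
    have "even (j - m)" using Suc.prems by (simp add: m_def)
    moreover have "m \<le> j" using mj by simp
    ultimately have om: "odd m" using ij(2) by (metis even_add le_add_diff_inverse)
    have IH: "conn n ?A W (st (m + 2))" using Suc m2 by simp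
    then have mem: "st (m + 2) \<in> ?A" using conn_mem WA by blast
    then have G: "st (m + 2) \<in> graphs n" and D: "\<And>v. v \<in> {1..n} \<Longrightarrow> deg (st (m + 2)) v = deg W v"
      by (auto simp: eqdeg_def)
    let ?a = "w m" and ?b = c and ?c = "w (m + 1)" and ?d = "w (m + 2)"
    have e1: "trail_edge w m = {?a, ?c}" and e2: "trail_edge w (m + 1) = {?c, ?d}"
      by (auto simp: trail_edge_def)
    have ne: "trail_edge w m \<noteq> trail_edge w (m + 1)"
      using inj_onD[OF inj, of m "m+1"] im mj by auto
    have V3: "?a \<in> {1..n}" "?c \<in> {1..n}" "?d \<in> {1..n}" "?a \<noteq> c" "?c \<noteq> c" "?d \<noteq> c"
      using V[of m] V[of "m+1"] V[of "m+2"] im mj by auto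
    have l1: "?a \<noteq> ?c" and l2: "?c \<noteq> ?d" using loopless[of m] loopless[of "m+1"] im mj by auto
    have ad: "?a \<noteq> ?d" using ne e1 e2 by auto
    have nc: "c \<notin> trail_edge w k" if "i \<le> k" "k < j" for k
      using V[of k] V[of "Suc k"] that by (auto simp: trail_edge_def)
    have cnot: "{c, x} \<notin> trail_edge w ` {k..<j}" if "i \<le> k" for x k
      using nc that by (metis (no_types, lifting) atLeastLessThan_iff imageE insertI1 order_trans)
    have segnot: "trail_edge w k \<notin> trail_edge w ` {m + 2..<j}" if "i \<le> k" "k < m + 2" for k
    proof
      assume "trail_edge w k \<in> trail_edge w ` {m + 2..<j}"
      then obtain y where "y \<in> {m+2..<j}" "trail_edge w k = trail_edge w y" by auto
      then show False using inj_onD[OF inj, of k y] that mj by auto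
    qed
    have notc: "trail_edge w k \<noteq> {c, x}" if "i \<le> k" "k < j" for k x using nc[OF that] by auto
    have mem_e: "trail_edge w k \<in> st (m + 2) \<longleftrightarrow> trail_edge w k \<in> W" if "i \<le> k" "k < m + 2" for k
      using segnot[OF that] notc[of k] that mj by (simp add: st_def sweep_state_def)
    have s1: "{?a, ?c} \<notin> st (m + 2)" using mem_e[of m] alt[of m] im mj om e1 by auto
    have s2: "{?c, ?d} \<in> st (m + 2)" using mem_e[of "m+1"] alt[of "m+1"] im mj om e2 by auto
    have mem_c: "{c, x} \<in> st (m + 2) \<longleftrightarrow> ((({c, x} \<in> W) \<noteq> (x = ?d)) \<noteq> (x = w j))" for x
      using cnot[of "m+2" x] im V3 V[of j] ij by (auto simp: st_def sweep_state_def doubleton_eq_iff)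
    have s3: "{?a, c} \<in> st (m + 2)"
      using mem_c[of ?a] ad present[OF om im] absent mj by (auto simp: insert_commute)
    \<comment> \<open>The chord at \<open>w (m + 2)\<close> is missing by now: it belonged to
      \<open>W\<close> and has been removed, or it is the chord at \<open>w j\<close>, absent from
      \<open>W\<close> and toggled twice.\<close>
    have s4: "{c, ?d} \<notin> st (m + 2)"
    proof (cases "m + 2 = j")
      case True then show ?thesis using mem_c[of ?d] absent by auto
    next
      case False then show ?thesis using mem_c[of ?d] absent present[of "m+2"] om mj im by auto
    qed
    have dist: "distinct [?a, ?b, ?c, ?d]" using V3 l1 l2 ad by auto
    let ?S = "{{?a, ?b}, {?c, ?d}, {?a, ?c}, {?b, ?d}}"
    note step = switch_step[OF G V3(1) c V3(2) V3(3) dist s3 s2 s1 s4]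
    have seg: "trail_edge w ` {m..<j} = insert {?a, ?c} (insert {?c, ?d} (trail_edge w ` {m+2..<j}))"
    proof -
      have "{m..<j} = insert m (insert (m+1) {m+2..<j})" using mj by auto
      then show ?thesis using e1 e2 by simp
    qed
    have sn: "{?a, ?c} \<notin> trail_edge w ` {m+2..<j}" "{?c, ?d} \<notin> trail_edge w ` {m+2..<j}"
      using segnot[of m] segnot[of "m+1"] im e1 e2 by auto
    have n1: "{?a, ?c} \<noteq> {?c, ?d}" using ne e1 e2 by simp
    have seg': "trail_edge w ` {m..<j} = sd {{?a, ?c}} (sd {{?c, ?d}} (trail_edge w ` {m+2..<j}))"
      unfolding seg using sn n1 by (simp add: sd_disjoint insert_commute)
    have "{?a, c} \<noteq> {?c, ?d}" "{?a, c} \<noteq> {?a, ?c}" "{?a, c} \<noteq> {c, ?d}" "{?c, ?d} \<noteq> {c, ?d}" "{?a, ?c} \<noteq> {c, ?d}"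
      using dist by (auto simp: doubleton_eq_iff)
    then have S: "?S = sd {{c, ?a}} (sd {{?c, ?d}} (sd {{?a, ?c}} {{c, ?d}}))"
      using n1 by (simp add: sd_disjoint insert_commute)
    have eq: "sd (st (m + 2)) ?S = st m"
      unfolding st_def sweep_state_def seg' S by (simp add: sd_ac)
    have "st m \<in> ?A"
      unfolding eq[symmetric] mem_Collect_eq
    proof
      show "eqdeg n W (sd (st (m + 2)) ?S)"
        using step(2,3) D by (simp add: eqdeg_def)
      show "\<exists>k\<in>{i..j}. sd (st (m + 2)) ?S = sweep_state w c W j k"
        unfolding eq using im mj by (intro bexI[of _ m]) (auto simp: st_def)
    qed
    then have "conn n ?A (st (m + 2)) (st m)"
      using mem step(1) eq by (intro conn_move) auto
    then show ?case using IH conn_trans unfolding m_def by blast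
  qed
  note * = this[of "(j - i) div 2"]
  have "even (j - i)" using ij by simp
  then have "2 * ((j - i) div 2) = j - i" by simp
  then show ?thesis using * ij by (simp add: st_def)
qed

section \<open>Stops of a sweep and the prefixes that describe them\<close>

primrec pset :: "(nat \<Rightarrow> nat) \<Rightarrow> nat list \<Rightarrow> graph" where
  "pset w [] = {}"
| "pset w (b # bs) = sd (pfx_edges w b) (pset w bs)"

text \<open>Three prefixes: a sweep that started from the stop \<open>i\<close>, aims at
  \<open>j\<close> and is now at position \<open>m\<close> is described by the prefixes of lengths
  \<open>i\<close>, \<open>m\<close>, \<open>j\<close> and the chords at these positions.\<close>

definition near_trail :: "nat \<Rightarrow> (nat \<Rightarrow> nat) \<Rightarrow> nat \<Rightarrow> nat \<Rightarrow> graph set" where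
  "near_trail n w J r = {sd (pset w bs) R |bs R. length bs \<le> 3 \<and> set bs \<subseteq> {..J} \<and>
     R \<subseteq> nsets {1..n} 2 \<and> card R \<le> r}"

lemma near_trailI:
  "length bs \<le> 3 \<Longrightarrow> set bs \<subseteq> {..J} \<Longrightarrow> R \<subseteq> nsets {1..n} 2 \<Longrightarrow> card R \<le> r \<Longrightarrow>
    S = sd (pset w bs) R \<Longrightarrow> S \<in> near_trail n w J r"
  unfolding near_trail_def by blast

lemma near_trail_mono: "J \<le> J' \<Longrightarrow> r \<le> r' \<Longrightarrow> near_trail n w J r \<subseteq> near_trail n w J' r'"
  unfolding near_trail_def by fastforce

lemma near_trail_sd:
  assumes "S \<in> near_trail n w J r" "F \<subseteq> nsets {1..n} 2" "card F \<le> q"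
  shows "sd S F \<in> near_trail n w J (r + q)"
proof -
  obtain bs R where *: "length bs \<le> 3" "set bs \<subseteq> {..J}" "R \<subseteq> nsets {1..n} 2" "card R \<le> r"
    "S = sd (pset w bs) R" using assms(1) unfolding near_trail_def by blast
  have "finite R" "finite F" using *(3) assms(2) finite_subset[OF _ finite_pairs] by blast+
  then have "card (sd R F) \<le> r + q" using card_sd_le[of R F] *(4) assms(3) by linarith
  moreover have "sd R F \<subseteq> nsets {1..n} 2" using *(3) assms(2) by (rule sd_subset)
  ultimately show ?thesis using * by (intro near_trailI[where bs = bs and R = "sd R F"]) (auto simp: sd_assoc)
qed

lemma card3_le: "card (sd {x} (sd {y} {z})) \<le> 3"
proof -
  have "sd {x} (sd {y} {z}) \<subseteq> {x, y, z}" by auto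
  then have "card (sd {x} (sd {y} {z})) \<le> card {x, y, z}" by (intro card_mono) auto
  also have "\<dots> \<le> 3" by (auto simp: card_insert_if)
  finally show ?thesis .
qed

text \<open>In the application \<open>w 0 = c\<close>, and this is \<open>Z\<close> with the closed
  walk along the trail to \<open>w i\<close> and back over the chord flipped. These graphs are the
  resting points between sweeps.\<close>

definition chord_state :: "(nat \<Rightarrow> nat) \<Rightarrow> nat \<Rightarrow> graph \<Rightarrow> nat \<Rightarrow> graph" where
  "chord_state w c Z i = sd (sd Z (pfx_edges w i)) {{c, w i}}"

text \<open>Sweeping the segment from \<open>j\<close> back to \<open>i\<close> trades the chord at
  \<open>w i\<close> for the chord at \<open>w j\<close>. Trail edges from position 1 on avoid
  \<open>c\<close>, so no other edge at \<open>c\<close> changes; the last conclusion keeps this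
  account, from which the next stop is chosen.\<close>

lemma sweep_advance:
  assumes c: "c \<in> {1..n}"
    and V: "\<And>m. 1 \<le> m \<Longrightarrow> m \<le> J \<Longrightarrow> w m \<in> {1..n} \<and> w m \<noteq> c"
    and inj: "inj_on (trail_edge w) {..<J}"
    and alt: "\<And>m. 1 \<le> m \<Longrightarrow> m < J \<Longrightarrow> trail_edge w m \<in> Z \<longleftrightarrow> even m"
    and loopless: "\<And>m. 1 \<le> m \<Longrightarrow> m < J \<Longrightarrow> w m \<noteq> w (Suc m)"
    and ij: "odd i" "odd j" "i < j" "j \<le> J"
    and eqd: "eqdeg n Z (chord_state w c Z i)"
    and pres_i: "{c, w i} \<in> chord_state w c Z i"
    and abs_j: "{c, w j} \<notin> chord_state w c Z i"
    and pres: "\<And>m. odd m \<Longrightarrow> i < m \<Longrightarrow> m < j \<Longrightarrow> {c, w m} \<in> chord_state w c Z i \<or> w m = w j"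
  shows "conn n {U. eqdeg n Z U \<and> sd Z U \<in> near_trail n w J 3} (chord_state w c Z i) (chord_state w c Z j)"
    and "eqdeg n Z (chord_state w c Z j)"
    and "\<And>x. x \<noteq> c \<Longrightarrow> {c, x} \<in> chord_state w c Z j \<longleftrightarrow>
          ((({c, x} \<in> chord_state w c Z i) \<noteq> (x = w i)) \<noteq> (x = w j))"
proof -
  let ?W = "chord_state w c Z i"
  have i1: "1 \<le> i" using ij by (metis One_nat_def Suc_leI odd_pos)
  have nc: "c \<notin> trail_edge w k" if "1 \<le> k" "k < J" for k
    using V[of k] V[of "Suc k"] that by (auto simp: trail_edge_def)
  have enot: "trail_edge w m \<notin> pfx_edges w i" if "i \<le> m" "m < J" for m
  proof
    assume "trail_edge w m \<in> pfx_edges w i"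
    then obtain y where "y < i" "trail_edge w m = trail_edge w y" by (auto simp: pfx_edges_def)
    then show False using inj_onD[OF inj, of m y] that by auto
  qed
  have inj': "inj_on (trail_edge w) {i..<j}" by (rule inj_on_subset[OF inj]) (use ij in auto)
  have altW: "trail_edge w m \<in> ?W \<longleftrightarrow> even m" if "i \<le> m" "m < j" for m
  proof -
    have "trail_edge w m \<noteq> {c, w i}" using nc[of m] that i1 ij by auto
    then show ?thesis using enot[of m] alt[of m] that i1 ij by (auto simp: chord_state_def)
  qed
  have seg: "trail_edge w ` {m..<j} = sd (pfx_edges w m) (pfx_edges w j)" if "m \<le> j" for m
    using pfx_seg[OF inj that] ij by simp
  have stt: "sweep_state w c ?W j m = sd Z (sd (pset w [i, m, j]) (sd {{c, w i}} (sd {{c, w m}} {{c, w j}})))"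
    if "m \<le> j" for m
    unfolding sweep_state_def chord_state_def seg[OF that] by (simp add: sd_ac)
  have fin: "sweep_state w c ?W j i = chord_state w c Z j"
    using ij unfolding sweep_state_def chord_state_def by (simp add: seg sd_ac)
  have "conn n {U. eqdeg n ?W U \<and> (\<exists>m\<in>{i..j}. U = sweep_state w c ?W j m)} ?W (sweep_state w c ?W j i)"
  proof (rule sweep_pass)
    show "?W \<in> graphs n" using eqd by (simp add: eqdeg_def)
    show "odd i" "odd j" "i \<le> j" "c \<in> {1..n}" using ij c by auto
    show "\<And>m. i \<le> m \<Longrightarrow> m \<le> j \<Longrightarrow> w m \<in> {1..n} \<and> w m \<noteq> c" using V i1 ij by simp
    show "inj_on (trail_edge w) {i..<j}" by fact
    show "\<And>m. i \<le> m \<Longrightarrow> m < j \<Longrightarrow> trail_edge w m \<in> ?W \<longleftrightarrow> even m" by (rule altW)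
    show "\<And>m. i \<le> m \<Longrightarrow> m < j \<Longrightarrow> w m \<noteq> w (Suc m)" using loopless i1 ij by simp
    show "{c, w j} \<notin> ?W" by fact
    show "{c, w m} \<in> ?W \<or> w m = w j" if "odd m" "i \<le> m" "m < j" for m
      using pres[of m] pres_i that by (cases "m = i") auto
  qed
  moreover have "{U. eqdeg n ?W U \<and> (\<exists>m\<in>{i..j}. U = sweep_state w c ?W j m)}
      \<subseteq> {U. eqdeg n Z U \<and> sd Z U \<in> near_trail n w J 3}"
  proof safe
    fix m assume m: "m \<in> {i..j}" and e: "eqdeg n ?W (sweep_state w c ?W j m)"
    show "eqdeg n Z (sweep_state w c ?W j m)" using e eqd by (simp add: eqdeg_def)
    let ?R = "sd {{c, w i}} (sd {{c, w m}} {{c, w j}})"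
    have "?R \<subseteq> nsets {1..n} 2"
      using V[of i] V[of m] V[of j] c i1 ij m by (intro sd_subset) (auto simp: doubleton_nsets)
    then show "sd Z (sweep_state w c ?W j m) \<in> near_trail n w J 3"
      unfolding stt[of m, OF conjunct2[OF m[unfolded atLeastAtMost_iff]]] using m ij card3_le
      by (intro near_trailI[where bs = "[i, m, j]" and R = ?R]) (auto simp del: in_sd)
  qed
  ultimately show conn: "conn n {U. eqdeg n Z U \<and> sd Z U \<in> near_trail n w J 3} ?W (chord_state w c Z j)"
    unfolding fin by (rule conn_mono)
  have "sd Z ?W \<in> near_trail n w J 3"
    using V[of i] c i1 ij
    by (intro near_trailI[where bs = "[i]" and R = "{{c, w i}}"]) (auto simp: chord_state_def sd_assoc doubleton_nsets)
  then have "chord_state w c Z j \<in> {U. eqdeg n Z U \<and> sd Z U \<in> near_trail n w J 3}"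
    using conn_mem[OF conn] eqd by blast
  then show "eqdeg n Z (chord_state w c Z j)" by simp
  fix x assume "x \<noteq> c"
  have "c \<notin> e" if "e \<in> trail_edge w ` {i..<j}" for e
    using that nc i1 ij by force
  then have "{c, x} \<notin> trail_edge w ` {i..<j}" by blast
  then have "{c, x} \<notin> sd (pfx_edges w i) (pfx_edges w j)"
    using seg[of i] ij by simp
  then have *: "{c, x} \<in> pfx_edges w j \<longleftrightarrow> {c, x} \<in> pfx_edges w i" by simp
  have **: "{c, x} = {c, y} \<longleftrightarrow> x = y" for y by (auto simp: doubleton_eq_iff)
  show "{c, x} \<in> chord_state w c Z j \<longleftrightarrow> ((({c, x} \<in> ?W) \<noteq> (x = w i)) \<noteq> (x = w j))"
    unfolding chord_state_def in_sd * singleton_iff ** by argo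
qed

text \<open>
  A pass to a target \<open>j\<close> requires every chord in between to be present or equal to the chord at
  \<open>w j\<close>. Stopping at a vertex equal to \<open>w J\<close> would insert the final chord too early, so from such
  a stop one moves on to the next missing chord, which removes it again.
\<close>

lemma sweep_route:
  assumes c: "c \<in> {1..n}"
    and V: "\<And>m. 1 \<le> m \<Longrightarrow> m \<le> J \<Longrightarrow> w m \<in> {1..n} \<and> w m \<noteq> c"
    and inj: "inj_on (trail_edge w) {..<J}"
    and alt: "\<And>m. 1 \<le> m \<Longrightarrow> m < J \<Longrightarrow> trail_edge w m \<in> Z \<longleftrightarrow> even m"
    and loopless: "\<And>m. 1 \<le> m \<Longrightarrow> m < J \<Longrightarrow> w m \<noteq> w (Suc m)"
    and J: "odd J"
    and "odd i" "i \<le> J"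
    and "eqdeg n Z (chord_state w c Z i)"
    and "{c, w i} \<in> chord_state w c Z i"
    and "i = J \<or> {c, w J} \<notin> chord_state w c Z i"
  shows "conn n {U. eqdeg n Z U \<and> sd Z U \<in> near_trail n w J 3} (chord_state w c Z i) (chord_state w c Z J)"
  using assms(7-)
proof (induction "J - i" arbitrary: i rule: less_induct)
  case less
  let ?CS = "chord_state w c Z"
  note adv = sweep_advance[where w = w and Z = Z and n = n and c = c and J = J, OF c V inj alt loopless]
  have Vne: "w m \<noteq> c" if "odd m" "m \<le> J" for m using V[of m] that odd_pos[of m] by auto
  show ?case
  proof (cases "i = J")
    case True then show ?thesis by simp
  next
    case False
    then have iJ: "i < J" and abJ: "{c, w J} \<notin> ?CS i" using less.prems by auto
    \<comment> \<open>The odd positions ahead whose chord is missing. If all of them carry the final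
      chord, one pass reaches \<open>J\<close>; otherwise the sweep stops at the first of
      them.\<close>
    define ab where "ab m \<longleftrightarrow> odd m \<and> i < m \<and> m < J \<and> {c, w m} \<notin> ?CS i" for m
    have neJ: "w J \<noteq> w i" using abJ less.prems(4) by auto
    show ?thesis
    proof (cases "\<forall>m. ab m \<longrightarrow> w m = w J")
      case True
      show ?thesis
        by (rule adv(1)[of i J]) (use less.prems iJ J abJ True ab_def in auto)
    next
      case False
      then obtain k where k: "ab k" "w k \<noteq> w J" by auto
      define m1 where "m1 = (LEAST m. ab m)"
      have m1: "ab m1" unfolding m1_def using k(1) by (rule LeastI)
      have min1: "\<not> ab m" if "m < m1" for m using that unfolding m1_def by (rule not_less_Least)
      have m1': "odd m1" "i < m1" "m1 < J" "{c, w m1} \<notin> ?CS i" using m1 by (auto simp: ab_def)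
      have ne1: "w m1 \<noteq> w i" using m1'(4) less.prems(4) by auto
      note a1 = adv[of i m1]
      have pre: "\<And>m. odd m \<Longrightarrow> i < m \<Longrightarrow> m < m1 \<Longrightarrow> {c, w m} \<in> ?CS i \<or> w m = w m1"
        using min1 m1'(3) by (auto simp: ab_def)
      have c1: "conn n {U. eqdeg n Z U \<and> sd Z U \<in> near_trail n w J 3} (?CS i) (?CS m1)"
        and d1: "eqdeg n Z (?CS m1)"
        and s1: "\<And>x. x \<noteq> c \<Longrightarrow> {c, x} \<in> ?CS m1 \<longleftrightarrow> ((({c, x} \<in> ?CS i) \<noteq> (x = w i)) \<noteq> (x = w m1))"
        using a1[OF _ _ _ _ _ _ less.prems(1) m1'(1,2) _ less.prems(3,4) m1'(4) pre] m1'(3) by simp_all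
      have p1: "{c, w m1} \<in> ?CS m1" using s1[OF Vne] m1' ne1 by auto
      show ?thesis
      proof (cases "w m1 = w J")
        case False
        then have "{c, w J} \<notin> ?CS m1" using s1[OF Vne[OF J]] abJ neJ by auto
        then have "conn n {U. eqdeg n Z U \<and> sd Z U \<in> near_trail n w J 3} (?CS m1) (?CS J)"
          using less.hyps[of m1] m1' d1 p1 by simp
        then show ?thesis using c1 conn_trans by blast
      next
        case True
        define ab2 where "ab2 m \<longleftrightarrow> odd m \<and> m1 < m \<and> m < J \<and> {c, w m} \<notin> ?CS m1" for m
        \<comment> \<open>Since \<open>w k\<close> differs from \<open>w J\<close>, there is a
          second stop \<open>m2\<close> beyond \<open>m1\<close>. The chord at \<open>w J\<close> is
          present after the first stop, so \<open>w m2\<close> differs from \<open>w J\<close> as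
          well.\<close>
        have "k \<noteq> m1" using k True by auto
        then have "m1 < k" using k(1) min1 by (meson linorder_neqE_nat)
        moreover have "{c, w k} \<notin> ?CS m1"
          using s1[OF Vne[of k]] k True less.prems(4) by (auto simp: ab_def)
        ultimately have "ab2 k" using k by (auto simp: ab_def ab2_def)
        define m2 where "m2 = (LEAST m. ab2 m)"
        have m2: "ab2 m2" unfolding m2_def using \<open>ab2 k\<close> by (rule LeastI)
        have min2: "\<not> ab2 m" if "m < m2" for m using that unfolding m2_def by (rule not_less_Least)
        have m2': "odd m2" "m1 < m2" "m2 < J" "{c, w m2} \<notin> ?CS m1" using m2 by (auto simp: ab2_def)
        have pre2: "\<And>m. odd m \<Longrightarrow> m1 < m \<Longrightarrow> m < m2 \<Longrightarrow> {c, w m} \<in> ?CS m1 \<or> w m = w m2"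
          using min2 m2'(3) by (auto simp: ab2_def)
        have c2: "conn n {U. eqdeg n Z U \<and> sd Z U \<in> near_trail n w J 3} (?CS m1) (?CS m2)"
          and d2: "eqdeg n Z (?CS m2)"
          and s2: "\<And>x. x \<noteq> c \<Longrightarrow> {c, x} \<in> ?CS m2 \<longleftrightarrow> ((({c, x} \<in> ?CS m1) \<noteq> (x = w m1)) \<noteq> (x = w m2))"
          using adv[of m1 m2, OF _ _ _ _ _ _ m1'(1) m2'(1,2) _ d1 p1 m2'(4) pre2] m2'(3) by simp_all
        have ne2: "w m2 \<noteq> w m1" using m2'(4) p1 by auto
        have p2: "{c, w m2} \<in> ?CS m2" using s2[OF Vne[of m2]] m2' ne2 by auto
        have "{c, w J} \<notin> ?CS m2" using s2[OF Vne[OF J]] p1 True ne2 by auto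
        then have "conn n {U. eqdeg n Z U \<and> sd Z U \<in> near_trail n w J 3} (?CS m2) (?CS J)"
          using less.hyps[of m2] m1' m2' d2 p2 by simp
        then show ?thesis using c1 c2 conn_trans by blast
      qed
    qed
  qed
qed

lemma eqdeg_trans: "eqdeg n A B \<Longrightarrow> eqdeg n B C \<Longrightarrow> eqdeg n A C"
  by (simp add: eqdeg_def)

lemma eqdeg_sym: "A \<in> graphs n \<Longrightarrow> eqdeg n A B \<Longrightarrow> eqdeg n B A"
  by (simp add: eqdeg_def)

lemma pfx_edges_Suc: "pfx_edges w (Suc k) = insert (trail_edge w k) (pfx_edges w k)"
  by (simp add: pfx_edges_def lessThan_Suc)

lemma pfx_edges_1: "pfx_edges w (Suc 0) = {trail_edge w 0}" "pfx_edges w 0 = {}"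
  by (auto simp: pfx_edges_def lessThan_Suc)

section \<open>A whole excursion, including the final toggle or hinge flip\<close>

lemma hinge_move:
  assumes U: "U \<in> graphs n" and V: "a \<in> {1..n}" "b \<in> {1..n}" "c \<in> {1..n}"
    and x: "({a, b} \<in> U) \<noteq> ({b, c} \<in> U)"
  shows "move n U (sd U {{a, b}, {b, c}})"
proof -
  have f: "finite U" using U by (rule finite_graph)
  have "card (sd U {{a, b}, {b, c}}) = card U"
  proof (cases "{a, b} \<in> U")
    case True
    then have "{b, c} \<notin> U" using x by simp
    have "sd U {{a, b}, {b, c}} = insert {b, c} (U - {{a, b}})"
      by (intro set_eqI) (simp only: in_sd insert_iff empty_iff Diff_iff, use True \<open>{b, c} \<notin> U\<close> in metis)
    moreover have "card U > 0" using f True by (auto simp: card_gt_0_iff)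
    ultimately show ?thesis using f True \<open>{b, c} \<notin> U\<close> by simp
  next
    case False
    then have "{b, c} \<in> U" using x by simp
    have "sd U {{a, b}, {b, c}} = insert {a, b} (U - {{b, c}})"
      by (intro set_eqI) (simp only: in_sd insert_iff empty_iff Diff_iff, use False \<open>{b, c} \<in> U\<close> in metis)
    moreover have "card U > 0" using f \<open>{b, c} \<in> U\<close> by (auto simp: card_gt_0_iff)
    ultimately show ?thesis using f False \<open>{b, c} \<in> U\<close> by simp
  qed
  then show ?thesis unfolding move_def using V by blast
qed

text \<open>
  The chord \<open>g\<close> from \<open>c\<close> to the last odd vertex of the trail closes it up to a final toggle or
  hinge flip \<open>F\<close>, which is done first if \<open>g\<close> is present and last if it is absent.
\<close>

lemma excursion_fun:
  assumes Z: "Z \<in> graphs n" and c: "w 0 = c" and s: "1 \<le> s"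
    and V: "\<And>m. m \<le> s \<Longrightarrow> w m \<in> {1..n}"
    and nc: "\<And>m. 1 \<le> m \<Longrightarrow> m < s \<Longrightarrow> w m \<noteq> c"
    and inj: "inj_on (trail_edge w) {..<s}"
    and loopless: "\<And>m. m < s \<Longrightarrow> w m \<noteq> w (Suc m)"
    and alt: "\<And>m. m < s \<Longrightarrow> trail_edge w m \<in> Z \<longleftrightarrow> even m"
    and closed: "w s = c \<Longrightarrow> even s"
  shows "conn n {U. (eqdeg n Z U \<or> eqdeg n (sd Z (pfx_edges w s)) U) \<and> sd Z U \<in> near_trail n w s 5}
           Z (sd Z (pfx_edges w s))" (is "conn n ?A Z ?Z'")
    and "w s = c \<Longrightarrow> eqdeg n Z (sd Z (pfx_edges w s))"
proof -
  define J where "J = (if odd s then s else s - 1)"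
  have J: "odd J" "J \<le> s" "1 \<le> J" "s \<le> Suc J" using s by (auto simp: J_def)
  define g where "g = {c, w J}"
  define F where "F = (if odd s then {g} else {g, trail_edge w J})"
  have cV: "c \<in> {1..n}" using V[of 0] c by auto
  have wJc: "w J \<noteq> c"
  proof (cases "odd s")
    case True then show ?thesis using closed by (auto simp: J_def)
  next
    case False then show ?thesis using nc[of J] J by (auto simp: J_def)
  qed
  have VJ: "\<And>m. 1 \<le> m \<Longrightarrow> m \<le> J \<Longrightarrow> w m \<in> {1..n} \<and> w m \<noteq> c"
  proof -
    fix m assume "1 \<le> m" "m \<le> J"
    then show "w m \<in> {1..n} \<and> w m \<noteq> c"
      using V[of m] nc[of m] wJc J(2) by (cases "m = J") auto
  qed
  have injJ: "inj_on (trail_edge w) {..<J}" by (rule inj_on_subset[OF inj]) (use J in auto)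
  have llJ: "\<And>m. 1 \<le> m \<Longrightarrow> m < J \<Longrightarrow> w m \<noteq> w (Suc m)" using loopless J by simp
  have altJ: "\<And>m. 1 \<le> m \<Longrightarrow> m < J \<Longrightarrow> trail_edge w m \<in> Z \<longleftrightarrow> even m" using alt J by simp
  have e0: "trail_edge w 0 = {c, w 1}" using c by (simp add: trail_edge_def)
  have ecs: "{c, x} = {c, y} \<longleftrightarrow> x = y" for x y by (auto simp: doubleton_eq_iff)
  have nce: "c \<notin> trail_edge w m" if "1 \<le> m" "m < J" for m
    using VJ[of m] VJ[of "Suc m"] that by (auto simp: trail_edge_def)
  have e0Z: "{c, w 1} \<in> Z" using alt[of 0] s e0 by simp
  have edgeV: "trail_edge w m \<in> nsets {1..n} 2" if "m < s" for m
    using V[of m] V[of "Suc m"] loopless[of m] that by (auto simp: trail_edge_def doubleton_nsets)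
  have gV: "g \<in> nsets {1..n} 2" using cV VJ[of J] J by (auto simp: g_def doubleton_nsets)
  \<comment> \<open>The first trail edge is itself the chord at \<open>w 1\<close>, so the stop at
    position 1 is the unflipped graph and routes can start there.\<close>
  have CS1: "chord_state w c Y 1 = Y" for Y
    unfolding chord_state_def using e0 by (simp add: pfx_edges_1 sd_ac)
  have FV: "F \<subseteq> nsets {1..n} 2" and Fcard: "card F \<le> 2"
    using gV edgeV[of J] J by (auto simp: F_def J_def card_insert_if)
  have pfxV: "pfx_edges w k \<subseteq> nsets {1..n} 2" if "k \<le> s" for k
    using edgeV that by (auto simp: pfx_edges_def)
  have Z'g: "?Z' \<in> graphs n" using graphs_sd[OF Z pfxV] by simp
  have route: "conn n {U. eqdeg n Y U \<and> sd Y U \<in> near_trail n w J 3} (chord_state w c Y i) (chord_state w c Y J)"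
    if "\<And>m. 1 \<le> m \<Longrightarrow> m < J \<Longrightarrow> trail_edge w m \<in> Y \<longleftrightarrow> even m" "odd i" "i \<le> J"
      "eqdeg n Y (chord_state w c Y i)" "{c, w i} \<in> chord_state w c Y i" "i = J \<or> g \<notin> chord_state w c Y i" for Y i
    by (rule sweep_route[OF cV VJ injJ that(1) llJ J(1) that(2-5) that(6)[unfolded g_def]])
  have eqdeg_refl: "eqdeg n Y Y" if "Y \<in> graphs n" for Y using that by (simp add: eqdeg_def)
  have Z0: "sd Z Z \<in> near_trail n w s 5" by (rule near_trailI[of "[]" _ "{}"]) auto
  have ZA: "Z \<in> ?A" using Z eqdeg_refl Z0 by blast
  have Z'0: "sd Z ?Z' \<in> near_trail n w s 5" by (rule near_trailI[of "[s]" _ "{}"]) auto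
  have Z'A: "?Z' \<in> ?A" using Z'g eqdeg_refl Z'0 by blast
  have sub: "{U. eqdeg n Z U \<and> sd Z U \<in> near_trail n w J 3} \<subseteq> ?A"
    using near_trail_mono[of J s 3 5 n w] J by auto
  show conc: "conn n ?A Z ?Z'"
  proof (cases "w s = c")
    case True
    then have es: "even s" by (rule closed)
    then have sJ: "s = Suc J" using J by (auto simp: J_def)
    \<comment> \<open>A closed excursion has \<open>g\<close> as its last edge, so the stop at
      \<open>J\<close> is already the flipped graph and no \<open>F\<close> comes in.\<close>
    have eJ: "trail_edge w J = g" using True sJ by (auto simp: trail_edge_def g_def)
    have gZ: "g \<notin> Z" using alt[of J] J sJ eJ by auto
    have fin: "chord_state w c Z J = ?Z'"
    proof -
      have "g \<notin> pfx_edges w J"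
      proof
        assume "g \<in> pfx_edges w J"
        then obtain y where "y < J" "trail_edge w J = trail_edge w y" using eJ by (auto simp: pfx_edges_def)
        then show False using inj_onD[OF inj, of J y] sJ by auto
      qed
      then have "pfx_edges w s = sd (pfx_edges w J) {g}"
        unfolding sJ pfx_edges_Suc eJ by (simp add: sd_disjoint)
      then show ?thesis unfolding chord_state_def g_def by (simp add: sd_ac)
    qed
    have "conn n {U. eqdeg n Z U \<and> sd Z U \<in> near_trail n w J 3} Z ?Z'"
      using route[of Z 1, unfolded CS1 fin] altJ J eqdeg_refl[OF Z] e0Z gZ by auto
    then show ?thesis using sub by (rule conn_mono)
  next
    case False
    have Fmove: "move n U (sd U F)" if "U \<in> graphs n" "even s \<Longrightarrow> (g \<in> U) \<noteq> (trail_edge w J \<in> U)" for U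
    proof (cases "odd s")
      case True then show ?thesis using gV by (auto simp: F_def move_def)
    next
      case es: False
      then have "Suc J = s" using J by (auto simp: J_def)
      then have eq: "trail_edge w J = {w J, w s}" by (auto simp: trail_edge_def)
      show ?thesis using hinge_move[OF that(1) cV, of "w J" "w s"] VJ[of J] V[of s] J es that(2)
        by (auto simp: F_def eq g_def)
    qed
    have eJ: "trail_edge w J \<notin> Z" "trail_edge w J \<noteq> {c, x}" "trail_edge w J \<notin> pfx_edges w J" if "even s" for x
    proof -
      have "J < s" using that J by (auto simp: J_def)
      then show "trail_edge w J \<notin> Z" using alt[of J] J by auto
      show "trail_edge w J \<noteq> {c, x}"
      proof -
        have "Suc J = s" using \<open>J < s\<close> J by simp
        then show ?thesis using VJ[of J] J False by (auto simp: trail_edge_def doubleton_eq_iff)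
      qed
      show "trail_edge w J \<notin> pfx_edges w J"
      proof
        assume "trail_edge w J \<in> pfx_edges w J"
        then obtain y where "y < J" "trail_edge w J = trail_edge w y" by (auto simp: pfx_edges_def)
        then show False using inj_onD[OF inj, of J y] \<open>J < s\<close> by auto
      qed
    qed
    have fin: "sd (sd (sd Z F) (pfx_edges w J)) {g} = ?Z'"
    proof (cases "odd s")
      case True then show ?thesis by (simp add: F_def J_def sd_ac)
    next
      case es: False
      then have sJ: "s = Suc J" using J by (auto simp: J_def)
      have "F = sd {g} {trail_edge w J}" using eJ(2)[of "w J"] es by (auto simp: F_def g_def set_eq_iff)
      moreover have "pfx_edges w s = sd (pfx_edges w J) {trail_edge w J}"
        unfolding sJ pfx_edges_Suc using eJ es by (simp add: sd_disjoint)
      ultimately show ?thesis by (simp add: sd_ac)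
    qed
    have Fin: "x \<in> sd Z F \<longleftrightarrow> x \<in> Z" if "x \<noteq> g" "even s \<Longrightarrow> x \<noteq> trail_edge w J" for x
      using that by (auto simp: F_def)
    have altF: "trail_edge w m \<in> sd Z F \<longleftrightarrow> even m" if "1 \<le> m" "m < J" for m
    proof -
      have "trail_edge w m \<noteq> g" using nce[OF that] by (auto simp: g_def)
      moreover have "trail_edge w m \<noteq> trail_edge w J" if "even s"
        using eJ(3)[OF that] \<open>m < J\<close> by (auto simp: pfx_edges_def)
      ultimately show ?thesis using altJ[OF that] Fin by blast
    qed
    have gF: "g \<in> sd Z F \<longleftrightarrow> g \<notin> Z" using eJ(2)[of "w J"] by (auto simp: F_def g_def)
    have ZFg: "sd Z F \<in> graphs n" using graphs_sd[OF Z FV] .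
    \<comment> \<open>\<open>first\<close> performs \<open>F\<close> before the sweeps,
      \<open>last\<close> after them. In both cases \<open>F\<close> is the only move that changes
      degrees.\<close>
    have first: "conn n ?A Z ?Z'" if gZ: "g \<in> Z"
      and c2: "conn n {U. eqdeg n (sd Z F) U \<and> sd (sd Z F) U \<in> near_trail n w J 3} (sd Z F) ?Z'"
    proof -
      have m0: "sd Z F \<in> {U. eqdeg n (sd Z F) U \<and> sd (sd Z F) U \<in> near_trail n w J 3}"
        using eqdeg_refl[OF ZFg] near_trailI[of "[]" J "{}" n 3 "{}" w] by auto
      have "eqdeg n (sd Z F) ?Z'" using conn_mem[OF c2 m0] by simp
      then have e': "eqdeg n ?Z' (sd Z F)" using eqdeg_sym ZFg by blast
      have sub2: "{U. eqdeg n (sd Z F) U \<and> sd (sd Z F) U \<in> near_trail n w J 3} \<subseteq> ?A"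
      proof (intro subsetI)
        fix U assume "U \<in> {U. eqdeg n (sd Z F) U \<and> sd (sd Z F) U \<in> near_trail n w J 3}"
        then have "eqdeg n (sd Z F) U" and m: "sd (sd Z F) U \<in> near_trail n w J 3" by auto
        then have "eqdeg n ?Z' U" using e' eqdeg_trans by blast
        moreover
        have "sd (sd (sd Z F) U) F \<in> near_trail n w J (3 + 2)" using near_trail_sd[OF m FV Fcard] .
        then have "sd Z U \<in> near_trail n w s 5"
          using near_trail_mono[of J s 5 5 n w] J by (auto simp: sd_ac)
        ultimately show "U \<in> ?A" by blast
      qed
      have "move n Z (sd Z F)" using Fmove[OF Z] gZ eJ by blast
      then have "conn n ?A Z (sd Z F)" using ZA m0 sub2 by (intro conn_move) blast+
      then show ?thesis using conn_mono[OF c2 sub2] conn_trans by blast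
    qed
    have last: "conn n ?A Z ?Z'"
      if c1: "conn n {U. eqdeg n Z U \<and> sd Z U \<in> near_trail n w J 3} Z (chord_state w c Z J)"
        and gC: "g \<in> chord_state w c Z J"
    proof -
      have "Z \<in> {U. eqdeg n Z U \<and> sd Z U \<in> near_trail n w J 3}"
        using eqdeg_refl[OF Z] near_trailI[of "[]" J "{}" n 3 "{}" w] by auto
      then have m1: "chord_state w c Z J \<in> {U. eqdeg n Z U \<and> sd Z U \<in> near_trail n w J 3}"
        using conn_mem[OF c1] by blast
      then have gr: "chord_state w c Z J \<in> graphs n" by (auto simp: eqdeg_def)
      have "trail_edge w J \<notin> chord_state w c Z J" if "even s"
        using eJ[OF that] by (auto simp: chord_state_def)
      then have "move n (chord_state w c Z J) (sd (chord_state w c Z J) F)" using Fmove[OF gr] gC by blast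
      moreover have "sd (chord_state w c Z J) F = ?Z'"
        unfolding fin[symmetric] chord_state_def g_def by (simp add: sd_ac)
      ultimately have "conn n ?A (chord_state w c Z J) ?Z'"
        using m1 sub Z'A by (intro conn_move) auto
      then show ?thesis using conn_mono[OF c1 sub] conn_trans by blast
    qed
    have endF: "chord_state w c (sd Z F) J = ?Z'"
      unfolding fin[symmetric] chord_state_def g_def by simp
    show ?thesis
    proof (cases "g \<in> Z")
      case gZ: True
      show ?thesis
      \<comment> \<open>If \<open>w J = w 1\<close>, then \<open>g\<close> is the first trail edge,
        and doing \<open>F\<close> first would remove the very chord that a route from position 1
        requires.\<close>
      proof (cases "w J = w 1")
        case False
        have "{c, w 1} \<noteq> trail_edge w J" if "even s" using eJ(2)[OF that, of "w 1"] by simp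
        then have "{c, w 1} \<in> sd Z F" using Fin[of "{c, w 1}"] e0Z False by (auto simp: g_def doubleton_eq_iff)
        then show ?thesis
          using first[OF gZ] route[of "sd Z F" 1, unfolded CS1 endF] altF J eqdeg_refl[OF ZFg] gF gZ by auto
      next
        case eq1: True
        show ?thesis
        \<comment> \<open>If no other chord is missing, a single pass from \<open>J\<close> down to
          1 works all the same: at \<open>m = 1\<close> the clause \<open>w m = w J\<close> stands
          in for the missing chord.\<close>
        proof (cases "\<forall>m. odd m \<and> 1 < m \<and> m < J \<longrightarrow> {c, w m} \<in> Z \<or> w m = w J")
          case True
          have "sweep_state w c (sd Z F) J 1 = ?Z'"
          proof -
            have g0: "{g} = pfx_edges w 1" using e0 eq1 by (simp add: g_def pfx_edges_1)
            have "trail_edge w ` {1..<J} = sd (pfx_edges w 1) (pfx_edges w J)"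
              using pfx_seg[OF injJ, of 1 J] J by simp
            then show ?thesis unfolding fin[symmetric] sweep_state_def eq1 g0 by (simp add: sd_ac)
          qed
          moreover have "conn n {U. eqdeg n (sd Z F) U \<and> (\<exists>m\<in>{1..J}. U = sweep_state w c (sd Z F) J m)}
              (sd Z F) (sweep_state w c (sd Z F) J 1)"
          proof (rule sweep_pass)
            show "{c, w J} \<notin> sd Z F" using gF gZ by (simp add: g_def)
            show "{c, w m} \<in> sd Z F \<or> w m = w J" if m: "odd m" "1 \<le> m" "m < J" for m
            proof (cases "w m = w J")
              case False
              then have "m \<noteq> 1" using eq1 by auto
              then have "{c, w m} \<in> Z" using True m False by auto
              moreover have "{c, w m} \<noteq> g" using False by (simp add: g_def ecs)
              moreover have "{c, w m} \<noteq> trail_edge w J" if "even s" using eJ(2)[OF that, of "w m"] by simp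
              ultimately show ?thesis using Fin[of "{c, w m}"] by simp
            qed simp
            show "inj_on (trail_edge w) {1..<J}" by (rule inj_on_subset[OF injJ]) auto
          qed (use ZFg J cV VJ llJ altF in auto)
          moreover have "{U. eqdeg n (sd Z F) U \<and> (\<exists>m\<in>{1..J}. U = sweep_state w c (sd Z F) J m)}
              \<subseteq> {U. eqdeg n (sd Z F) U \<and> sd (sd Z F) U \<in> near_trail n w J 3}"
          proof safe
            fix m assume m: "m \<in> {1..J}"
            have seg: "trail_edge w ` {m..<J} = sd (pfx_edges w m) (pfx_edges w J)"
              using pfx_seg[OF injJ, of m J] m by simp
            let ?R = "sd {{c, w m}} {{c, w J}}"
            have "?R \<subseteq> nsets {1..n} 2"
              using VJ[of m] VJ[of J] cV m J by (intro sd_subset) (auto simp: doubleton_nsets)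
            moreover have "card ?R \<le> 3" using card_sd_le[of "{{c, w m}}" "{{c, w J}}"] by simp
            ultimately show "sd (sd Z F) (sweep_state w c (sd Z F) J m) \<in> near_trail n w J 3"
              using m by (intro near_trailI[where bs = "[m, J]" and R = ?R])
                (auto simp: sweep_state_def seg sd_ac simp del: in_sd)
          qed
          ultimately show ?thesis using first[OF gZ] conn_mono by (metis (no_types, lifting))
        next
          case False
          define ab where "ab m \<longleftrightarrow> odd m \<and> 1 < m \<and> m < J \<and> {c, w m} \<notin> Z \<and> w m \<noteq> w J" for m
          have ex: "\<exists>m. ab m" using False by (auto simp: ab_def)
          define m1 where "m1 = (LEAST m. ab m)"
          have m1: "ab m1" unfolding m1_def using ex by (metis LeastI)
          have min1: "\<not> ab m" if "m < m1" for m using that unfolding m1_def by (rule not_less_Least)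
          have m1': "odd m1" "1 < m1" "m1 < J" "{c, w m1} \<notin> Z" "w m1 \<noteq> w J" using m1 by (auto simp: ab_def)
          \<comment> \<open>The stop at the missing chord of \<open>m1\<close> removes the chord at
            \<open>w 1\<close>, which is \<open>g\<close>. From there the route to \<open>J\<close>
            is free, and \<open>F\<close> comes last.\<close>
          note adv = sweep_advance[where w = w and Z = Z and n = n and c = c and J = J and i = 1 and j = m1,
              OF cV VJ injJ altJ llJ _ m1'(1,2), unfolded CS1]
          have pre: "{c, w m} \<in> Z \<or> w m = w m1" if "odd m" "1 < m" "m < m1" for m
          proof (cases "w m = w J")
            case True then show ?thesis using gZ by (simp add: g_def)
          next
            case False then show ?thesis using min1[OF that(3)] that m1' by (auto simp: ab_def)
          qed
          have a1: "conn n {U. eqdeg n Z U \<and> sd Z U \<in> near_trail n w J 3} Z (chord_state w c Z m1)"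
            and a2: "eqdeg n Z (chord_state w c Z m1)"
            and a3: "\<And>x. x \<noteq> c \<Longrightarrow> {c, x} \<in> chord_state w c Z m1 \<longleftrightarrow> ((({c, x} \<in> Z) \<noteq> (x = w 1)) \<noteq> (x = w m1))"
            using adv m1' eqdeg_refl[OF Z] e0Z pre by simp_all
          have p1: "{c, w m1} \<in> chord_state w c Z m1"
            using a3[of "w m1"] VJ[of m1] m1' eq1 by auto
          have g1: "g \<notin> chord_state w c Z m1"
            using a3[of "w J"] VJ[of J] J m1' eq1 gZ by (auto simp: g_def)
          have r: "conn n {U. eqdeg n Z U \<and> sd Z U \<in> near_trail n w J 3} (chord_state w c Z m1) (chord_state w c Z J)"
            using route[of Z m1] altJ m1' a2 p1 g1 by auto
          have "e \<noteq> g" if "e \<in> trail_edge w ` {1..<J}" for e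
          proof -
            have "c \<notin> e" using that nce by auto
            then show ?thesis by (auto simp: g_def)
          qed
          then have "g \<notin> sd (pfx_edges w 1) (pfx_edges w J)" using pfx_seg[OF injJ, of 1 J] J by auto
          moreover have "g \<in> pfx_edges w 1" using e0 eq1 by (simp add: g_def pfx_edges_1)
          ultimately have "g \<in> pfx_edges w J" by simp
          then have "g \<in> chord_state w c Z J" using gZ by (simp add: chord_state_def g_def)
          then show ?thesis using last a1 r conn_trans by blast
        qed
      qed
    next
      case gZ: False
      then have ne: "w J \<noteq> w 1" using e0Z by (auto simp: g_def)
      have "conn n {U. eqdeg n Z U \<and> sd Z U \<in> near_trail n w J 3} Z (chord_state w c Z J)"
        using route[of Z 1, unfolded CS1] altJ J eqdeg_refl[OF Z] gZ e0Z by auto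
      moreover have "g \<in> chord_state w c Z J"
      proof -
        have "e \<noteq> g" if "e \<in> trail_edge w ` {1..<J}" for e
          proof -
            have "c \<notin> e" using that nce by auto
            then show ?thesis by (auto simp: g_def)
          qed
        then have "g \<notin> sd (pfx_edges w 1) (pfx_edges w J)" using pfx_seg[OF injJ, of 1 J] J by auto
        moreover have "g \<notin> pfx_edges w 1" using e0 ne by (simp add: g_def pfx_edges_1 ecs)
        ultimately have "g \<notin> pfx_edges w J" by simp
        then show ?thesis using gZ by (simp add: chord_state_def g_def)
      qed
      ultimately show ?thesis using last by blast
    qed
  qed
  show "eqdeg n Z ?Z'" if "w s = c"
  proof -
    have es: "even s" using that by (rule closed)
    then have sJ: "s = Suc J" using J by (auto simp: J_def)
    have eJ: "trail_edge w J = g" using that sJ by (auto simp: trail_edge_def g_def)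
    have gZ: "g \<notin> Z" using alt[of J] J sJ eJ by auto
    have "g \<notin> pfx_edges w J"
    proof
      assume "g \<in> pfx_edges w J"
      then obtain y where "y < J" "trail_edge w J = trail_edge w y" using eJ by (auto simp: pfx_edges_def)
      then show False using inj_onD[OF inj, of J y] sJ by auto
    qed
    then have "pfx_edges w s = sd (pfx_edges w J) {g}"
      unfolding sJ pfx_edges_Suc eJ by (simp add: sd_disjoint)
    then have fin: "chord_state w c Z J = ?Z'" unfolding chord_state_def g_def by (simp add: sd_ac)
    have "conn n {U. eqdeg n Z U \<and> sd Z U \<in> near_trail n w J 3} Z ?Z'"
      using route[of Z 1, unfolded CS1 fin] altJ J eqdeg_refl[OF Z] e0Z gZ by auto
    moreover have "Z \<in> {U. eqdeg n Z U \<and> sd Z U \<in> near_trail n w J 3}"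
      using eqdeg_refl[OF Z] near_trailI[of "[]" J "{}" n 3 "{}" w] by auto
    ultimately show ?thesis using conn_mem by blast
  qed
qed

section \<open>Flipping an alternating trail\<close>

fun el :: "nat list \<Rightarrow> nat set list" where
  "el (x # y # zs) = {x, y} # el (y # zs)"
| "el _ = []"

lemma length_el [simp]: "length (el xs) = length xs - 1"
  by (induction xs rule: el.induct) auto

lemma nth_el: "Suc i < length xs \<Longrightarrow> el xs ! i = {xs ! i, xs ! Suc i}"
proof (induction xs arbitrary: i rule: el.induct)
  case (1 x y zs)
  then show ?case by (cases i) auto
qed auto

lemma el_append: "el (xs @ v # ys) = el (xs @ [v]) @ el (v # ys)"
proof (induction xs)
  case (Cons a xs)
  then show ?case by (cases xs) auto
qed auto

lemma el_rev: "el (rev xs) = rev (el xs)"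
proof (induction xs rule: el.induct)
  case (1 x y zs)
  have "el (rev (x # y # zs)) = el (rev zs @ y # [x])" by simp
  also have "\<dots> = el (rev (y # zs)) @ [{y, x}]" using el_append[of "rev zs" y "[x]"] by simp
  finally show ?case using 1 by (simp add: insert_commute)
qed auto

lemma in_el: "e \<in> set (el xs) \<Longrightarrow> v \<in> e \<Longrightarrow> v \<in> set xs"
  by (induction xs rule: el.induct) auto

lemma el_vertices:
  assumes "2 \<le> length xs" "set (el xs) \<subseteq> nsets V 2"
  shows "set xs \<subseteq> V"
proof
  fix v assume "v \<in> set xs"
  then obtain i where i: "i < length xs" "v = xs ! i" by (auto simp: in_set_conv_nth)
  show "v \<in> V"
  proof (cases "Suc i < length xs")
    case True
    then have "el xs ! i \<in> set (el xs)" by (intro nth_mem) auto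
    then show ?thesis using assms(2) True i by (auto simp: nth_el)
  next
    case False
    then have j: "Suc (i - 1) < length xs" "Suc (i - 1) = i" using i assms(1) by auto
    then have "el xs ! (i - 1) \<in> set (el xs)" by (intro nth_mem) auto
    then have "el xs ! (i - 1) \<in> nsets V 2" using assms(2) by blast
    then show ?thesis using nth_el[OF j(1)] j(2) i by simp
  qed
qed

primrec alts :: "'a set \<Rightarrow> bool \<Rightarrow> 'a list \<Rightarrow> bool" where
  "alts Z b [] = True"
| "alts Z b (e # es) = ((e \<in> Z) = b \<and> alts Z (\<not> b) es)"

text \<open>\<open>b = even (length es)\<close> is the colour due after \<open>es\<close>:
  \<open>b\<close> itself after an even number of edges, its negation after an odd one.\<close>

lemma alts_append: "alts Z b (es @ fs) \<longleftrightarrow> alts Z b es \<and> alts Z (b = even (length es)) fs"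
proof (induction es arbitrary: b)
  case (Cons e es)
  have "((\<not> b) = even (length es)) = (b = even (length (e # es)))" by (cases b) simp_all
  note eq = this
  show ?case unfolding append_Cons alts.simps Cons eq by (rule conj_assoc[symmetric])
qed simp

text \<open>The last edge has the colour of the first exactly when the length is odd, so reversing
  an even list negates the starting colour.\<close>

lemma alts_rev: "alts Z b (rev es) \<longleftrightarrow> alts Z (b = odd (length es)) es"
proof (induction es arbitrary: b)
  case (Cons e es)
  have "(b = odd (length (e # es))) = (b = even (length es))" "(\<not> (b = even (length es))) = (b = odd (length es))"
    by (cases b; simp)+
  then show ?case unfolding rev.simps alts_append alts.simps Cons length_rev by (simp only: simp_thms) blast
qed simp

lemma alts_disjoint: "set es \<inter> S = {} \<Longrightarrow> alts (sd Z S) b es \<longleftrightarrow> alts Z b es"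
  by (induction es arbitrary: b) auto

lemma alts_flip: "set es \<subseteq> S \<Longrightarrow> alts (sd Z S) b es \<longleftrightarrow> alts Z (\<not> b) es"
  by (induction es arbitrary: b) auto

lemma alts_nth: "alts Z b es \<longleftrightarrow> (\<forall>i<length es. es ! i \<in> Z \<longleftrightarrow> even i = b)"
proof (induction es arbitrary: b)
  case (Cons e es)
  have "(even (Suc i) = b) = (even i = (\<not> b))" for i :: nat by auto
  then show ?case unfolding alts.simps Cons length_Cons All_less_Suc2 by simp
qed auto

text \<open>
  Graphs are described relative to a list \<open>L\<close> of edges by a few prefixes of \<open>L\<close> and a few single
  edges, so that for fixed \<open>L\<close> only polynomially many arise.
\<close>

primrec prefix_flip :: "'a list \<Rightarrow> nat list \<Rightarrow> 'a set" where
  "prefix_flip L [] = {}"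
| "prefix_flip L (b # bs) = sd (set (take b L)) (prefix_flip L bs)"

lemma prefix_flip_append: "prefix_flip L (as @ bs) = sd (prefix_flip L as) (prefix_flip L bs)"
  by (induction as) (auto simp: sd_assoc)

definition near_prefixes :: "nat \<Rightarrow> nat set list \<Rightarrow> nat \<Rightarrow> nat \<Rightarrow> graph set" where
  "near_prefixes n L k r = {sd (prefix_flip L bs) R |bs R. length bs \<le> k \<and> R \<subseteq> nsets {1..n} 2 \<and> card R \<le> r}"

lemma near_prefixesI:
  "length bs \<le> k \<Longrightarrow> R \<subseteq> nsets {1..n} 2 \<Longrightarrow> card R \<le> r \<Longrightarrow> S = sd (prefix_flip L bs) R \<Longrightarrow> S \<in> near_prefixes n L k r"
  unfolding near_prefixes_def by blast

lemma near_prefixes_mono: "k \<le> k' \<Longrightarrow> r \<le> r' \<Longrightarrow> S \<in> near_prefixes n L k r \<Longrightarrow> S \<in> near_prefixes n L k' r'"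
proof -
  assume a: "k \<le> k'" "r \<le> r'" "S \<in> near_prefixes n L k r"
  then obtain bs R where "length bs \<le> k" "R \<subseteq> nsets {1..n} 2" "card R \<le> r" "S = sd (prefix_flip L bs) R"
    unfolding near_prefixes_def by blast
  then show ?thesis using a by (intro near_prefixesI[where bs = bs and R = R]) auto
qed

text \<open>Both budgets add up under symmetric difference; this rule and its nested form
  \<open>near_prefixes_nested\<close> are the bookkeeping behind the constants below.\<close>

lemma near_prefixes_sd:
  assumes "S \<in> near_prefixes n L k r" "S' \<in> near_prefixes n L k' r'"
  shows "sd S S' \<in> near_prefixes n L (k + k') (r + r')"
proof -
  obtain bs R where 1: "length bs \<le> k" "R \<subseteq> nsets {1..n} 2" "card R \<le> r" "S = sd (prefix_flip L bs) R"
    using assms(1) unfolding near_prefixes_def by blast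
  obtain bs' R' where 2: "length bs' \<le> k'" "R' \<subseteq> nsets {1..n} 2" "card R' \<le> r'" "S' = sd (prefix_flip L bs') R'"
    using assms(2) unfolding near_prefixes_def by blast
  have "finite R" "finite R'" using 1 2 finite_subset[OF _ finite_pairs] by blast+
  then have "card (sd R R') \<le> r + r'" using card_sd_le[of R R'] 1 2 by linarith
  moreover have "sd R R' \<subseteq> nsets {1..n} 2" using 1 2 by (intro sd_subset)
  ultimately show ?thesis using 1 2
    by (intro near_prefixesI[where bs = "bs @ bs'" and R = "sd R R'"]) (auto simp: prefix_flip_append sd_ac)
qed

lemma near_prefixes_empty [simp]: "{} \<in> near_prefixes n L k r"
  by (rule near_prefixesI[of "[]" _ "{}"]) auto

lemma near_prefixes_take: "set (take j L) \<in> near_prefixes n L 1 0"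
  by (rule near_prefixesI[of "[j]" _ "{}"]) auto

text \<open>A rearranged trail \<open>M\<close> is no longer contiguous in \<open>L\<close>. If each
  of its prefixes is cheap relative to \<open>L\<close>, a description by prefixes of
  \<open>M\<close> turns into one by prefixes of \<open>L\<close>, as
  \<open>near_prefixes_nested\<close> makes precise.\<close>

definition pfx_ok :: "nat \<Rightarrow> nat set list \<Rightarrow> nat \<Rightarrow> nat \<Rightarrow> nat set list \<Rightarrow> bool" where
  "pfx_ok n L k r M \<longleftrightarrow> (\<forall>j. set (take j M) \<in> near_prefixes n L k r)"

lemma pfx_ok_set: "pfx_ok n L k r M \<Longrightarrow> set M \<in> near_prefixes n L k r"
  unfolding pfx_ok_def by (drule spec[of _ "length M"]) simp

lemma pfx_ok_append:
  assumes "pfx_ok n L k r M" "pfx_ok n L k' r' N" "set M \<inter> set N = {}"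
  shows "pfx_ok n L (k + k') (r + r') (M @ N)"
  unfolding pfx_ok_def
proof
  fix j
  have "set (take j M) \<inter> set (take (j - length M) N) = {}"
    using assms(3) set_take_subset by fast
  then have "set (take j (M @ N)) = sd (set (take j M)) (set (take (j - length M) N))"
    by (simp add: sd_disjoint)
  then show "set (take j (M @ N)) \<in> near_prefixes n L (k + k') (r + r')"
    using near_prefixes_sd[OF assms(1)[unfolded pfx_ok_def, rule_format, of j]
        assms(2)[unfolded pfx_ok_def, rule_format, of "j - length M"]] by simp
qed

lemma pfx_ok_single: "f \<in> nsets {1..n} 2 \<Longrightarrow> pfx_ok n L 0 1 [f]"
  unfolding pfx_ok_def
proof
  fix j assume f: "f \<in> nsets {1..n} 2"
  show "set (take j [f]) \<in> near_prefixes n L 0 1"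
    by (cases j; rule near_prefixesI[of "[]" _ "set (take j [f])"]) (use f in auto)
qed

definition chunk :: "'a list \<Rightarrow> 'a list \<Rightarrow> bool" where
  "chunk L M \<longleftrightarrow> (\<exists>A B. L = A @ M @ B \<or> L = A @ rev M @ B)"

lemma chunk_rev: "chunk L M \<Longrightarrow> chunk L (rev M)"
  by (auto simp: chunk_def)

lemma chunk_sub: "chunk L (M1 @ M2 @ M3) \<Longrightarrow> chunk L M2"
proof -
  assume "chunk L (M1 @ M2 @ M3)"
  then obtain A B where "L = A @ (M1 @ M2 @ M3) @ B \<or> L = A @ rev (M1 @ M2 @ M3) @ B"
    unfolding chunk_def by blast
  then have "L = (A @ M1) @ M2 @ (M3 @ B) \<or> L = (A @ rev M3) @ rev M2 @ (rev M1 @ B)" by auto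
  then show ?thesis unfolding chunk_def by blast
qed

lemma chunkI: "L = A @ M @ B \<Longrightarrow> chunk L M"
  by (auto simp: chunk_def)

lemma sd_take:
  assumes "distinct L" "a \<le> b"
  shows "sd (set (take a L)) (set (take b L)) = set (drop a (take b L))"
proof -
  have "take a (take b L) @ drop a (take b L) = take b L" by (rule append_take_drop_id)
  then have t: "take b L = take a L @ drop a (take b L)" using assms(2) by (simp add: min_def)
  then have "distinct (take a L @ drop a (take b L))" using assms(1) distinct_take by metis
  then have d: "set (take a L) \<inter> set (drop a (take b L)) = {}" by simp
  have "set (take b L) = set (take a L) \<union> set (drop a (take b L))" by (subst t) (rule set_append)
  then have "set (take b L) = sd (set (take a L)) (set (drop a (take b L)))" using sd_disjoint[OF d] by simp
  then show ?thesis by simp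
qed

text \<open>An interval of \<open>L\<close> is the difference of two prefixes of \<open>L\<close>. A
  prefix of \<open>M\<close> is such an interval, and so is a prefix of \<open>rev M\<close>, being
  an end part of \<open>M\<close>.\<close>

lemma pfx_ok_part:
  assumes d: "distinct L" and L: "L = A @ M @ B"
  shows "pfx_ok n L 2 0 M" "pfx_ok n L 2 0 (rev M)"
proof -
  have *: "set (drop a (take b L)) \<in> near_prefixes n L 2 0" if "a \<le> b" for a b
    using near_prefixes_sd[OF near_prefixes_take[of a L n] near_prefixes_take[of b L n]] sd_take[OF d that] by (simp add: numeral_2_eq_2)
  show "pfx_ok n L 2 0 M" unfolding pfx_ok_def
  proof
    fix j
    have "take j M = drop (length A) (take (length A + min j (length M)) L)"
      unfolding L by (simp add: min_def)
    then show "set (take j M) \<in> near_prefixes n L 2 0" using *[of "length A" "length A + min j (length M)"] by simp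
  qed
  show "pfx_ok n L 2 0 (rev M)" unfolding pfx_ok_def
  proof
    fix j
    have "set (take j (rev M)) = set (drop (length M - j) M)" by (simp add: take_rev)
    also have "drop (length M - j) M = drop (length A + (length M - j)) (take (length A + length M) L)"
      unfolding L by simp
    finally show "set (take j (rev M)) \<in> near_prefixes n L 2 0"
      using *[of "length A + (length M - j)" "length A + length M"] by simp
  qed
qed

lemma pfx_ok_chunk: "distinct L \<Longrightarrow> chunk L M \<Longrightarrow> pfx_ok n L 2 0 M"
proof -
  assume d: "distinct L" and "chunk L M"
  then obtain A B where "L = A @ M @ B \<or> L = A @ rev M @ B" unfolding chunk_def by blast
  then show ?thesis
  proof
    assume "L = A @ M @ B" then show ?thesis by (rule pfx_ok_part(1)[OF d])
  next
    assume "L = A @ rev M @ B" from pfx_ok_part(2)[OF d this] show ?thesis by simp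
  qed
qed

lemma near_prefixes_nested:
  assumes "pfx_ok n L k r M" "S \<in> near_prefixes n M k' r'"
  shows "S \<in> near_prefixes n L (k' * k) (k' * r + r')"
proof -
  have *: "prefix_flip M bs \<in> near_prefixes n L (length bs * k) (length bs * r)" for bs
  proof (induction bs)
    case (Cons b bs)
    have "set (take b M) \<in> near_prefixes n L k r" using assms(1) by (simp add: pfx_ok_def)
    from near_prefixes_sd[OF this Cons] show ?case by simp
  qed simp
  obtain bs R where 1: "length bs \<le> k'" "R \<subseteq> nsets {1..n} 2" "card R \<le> r'" "S = sd (prefix_flip M bs) R"
    using assms(2) unfolding near_prefixes_def by blast
  have "prefix_flip M bs \<in> near_prefixes n L (k' * k) (k' * r)"
    using near_prefixes_mono[OF _ _ *[of bs]] 1(1) by (simp add: mult_le_mono1)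
  moreover have "R \<in> near_prefixes n L 0 r'" by (rule near_prefixesI[of "[]" _ R]) (use 1 in auto)
  ultimately have "sd (prefix_flip M bs) R \<in> near_prefixes n L (k' * k + 0) (k' * r + r')" by (rule near_prefixes_sd)
  then show ?thesis using 1(4) by simp
qed

section \<open>Flipping one excursion, or two odd ones together\<close>

definition excursion_conn :: "nat \<Rightarrow> nat set list \<Rightarrow> nat \<Rightarrow> nat \<Rightarrow> graph \<Rightarrow> graph \<Rightarrow> bool" where
  "excursion_conn n L k r Z Z' \<longleftrightarrow>
     conn n {U. (eqdeg n Z U \<or> eqdeg n Z' U) \<and> sd Z U \<in> near_prefixes n L k r} Z Z'"

text \<open>\<open>excursion_fun\<close> for a walk given as a list. Each of its three prefixes
  costs \<open>k\<close> prefixes of \<open>L\<close> and \<open>r\<close> edges; the 5 further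
  edges are the three chords of a sweep and the two edges of \<open>F\<close>.\<close>

lemma excursion:
  assumes Z: "Z \<in> graphs n" and len: "2 \<le> length xs"
    and E: "set (el xs) \<subseteq> nsets {1..n} 2" and d: "distinct (el xs)" and alt: "alts Z True (el xs)"
    and nc: "hd xs \<notin> set (butlast (tl xs))"
    and closed: "last xs = hd xs \<longrightarrow> even (length (el xs))"
    and ok: "pfx_ok n L k r (el xs)"
  shows "excursion_conn n L (3 * k) (3 * r + 5) Z (sd Z (set (el xs)))"
    and "last xs = hd xs \<Longrightarrow> eqdeg n Z (sd Z (set (el xs)))"
proof -
  define w where "w i = xs ! i" for i
  define s where "s = length xs - 1"
  have s: "1 \<le> s" "length xs = Suc s" using len by (auto simp: s_def)
  have te: "trail_edge w i = el xs ! i" if "i < s" for i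
    using that s by (simp add: trail_edge_def w_def nth_el)
  have pe: "pfx_edges w b = set (take b (el xs))" if "b \<le> s" for b
  proof -
    have "pfx_edges w b = (!) (el xs) ` {..<b}" unfolding pfx_edges_def using te that by (intro image_cong) auto
    also have "\<dots> = set (take b (el xs))" 
    proof -
      have "b \<le> length (el xs)" using that s by simp
      from nth_image[OF this] show ?thesis unfolding atLeast0LessThan .
    qed
    finally show ?thesis .
  qed
  have ne: "xs \<noteq> []" using len by auto
  have h: "hd xs = w 0" "last xs = w s"
    using ne by (simp_all add: hd_conv_nth last_conv_nth w_def s_def)
  have all: "pfx_edges w s = set (el xs)" using pe[of s] s by simp
  have V: "w m \<in> {1..n}" if "m \<le> s" for m
  proof -
    have "xs ! m \<in> set xs" using that s by (intro nth_mem) simp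
    then show ?thesis using el_vertices[OF len E] by (auto simp: w_def)
  qed
  have nc': "w m \<noteq> hd xs" if "1 \<le> m" "m < s" for m
  proof -
    have *: "m - 1 < length (butlast (tl xs))" using that s by auto
    have "butlast (tl xs) ! (m - 1) = w m"
      using that s by (simp add: nth_butlast nth_tl w_def)
    then have "w m \<in> set (butlast (tl xs))" using nth_mem[OF *] by simp
    then show ?thesis using nc by auto
  qed
  have ll: "w m \<noteq> w (Suc m)" if "m < s" for m
  proof -
    have "el xs ! m \<in> set (el xs)" using that s by (intro nth_mem) simp
    then have "trail_edge w m \<in> nsets {1..n} 2" using E te[OF that] by auto
    then show ?thesis by (auto simp: trail_edge_def nsets_def)
  qed
  have inj: "inj_on (trail_edge w) {..<s}"
    using d te s by (intro inj_onI) (auto simp: nth_eq_iff_index_eq)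
  have alt': "trail_edge w m \<in> Z \<longleftrightarrow> even m" if "m < s" for m
    using alt te[OF that] that s by (auto simp: alts_nth)
  have closed': "even s" if "w s = hd xs" using closed that h s by auto
  note ex = excursion_fun[of Z n w "hd xs" s, OF Z h(1)[symmetric] s(1) V nc' inj ll alt' closed', unfolded all]
  have sub: "near_trail n w s 5 \<subseteq> near_prefixes n L (3 * k) (3 * r + 5)"
  proof
    fix S assume "S \<in> near_trail n w s 5"
    then obtain bs R where 1: "length bs \<le> 3" "set bs \<subseteq> {..s}" "R \<subseteq> nsets {1..n} 2" "card R \<le> 5"
      "S = sd (pset w bs) R" unfolding near_trail_def by blast
    have "pset w bs = prefix_flip (el xs) bs" using 1(2) by (induction bs) (auto simp: pe)
    then have "S \<in> near_prefixes n (el xs) 3 5" using 1 by (intro near_prefixesI) auto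
    then show "S \<in> near_prefixes n L (3 * k) (3 * r + 5)" using near_prefixes_nested[OF ok] by blast
  qed
  have "conn n {U. (eqdeg n Z U \<or> eqdeg n (sd Z (set (el xs))) U) \<and> sd Z U \<in> near_trail n w s 5}
      Z (sd Z (set (el xs)))"
    by (rule ex(1))
  then show "excursion_conn n L (3 * k) (3 * r + 5) Z (sd Z (set (el xs)))"
    unfolding excursion_conn_def by (rule conn_mono) (use sub in blast)
  show "eqdeg n Z (sd Z (set (el xs)))" if "last xs = hd xs"
    by (rule ex(2)) (use that h in auto)
qed

lemma excursion_conn_mono: "excursion_conn n L k r Z Z' \<Longrightarrow> k \<le> k' \<Longrightarrow> r \<le> r' \<Longrightarrow> excursion_conn n L k' r' Z Z'"
  unfolding excursion_conn_def by (erule conn_mono) (use near_prefixes_mono in blast)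

text \<open>If one of the two parts keeps the degrees, the middle graph has the degrees of an outer
  end, and the path still takes only the degrees of its two ends. The second part is described
  relative to \<open>Z1\<close>, and \<open>a\<close>, \<open>b\<close> pay for the shift to
  \<open>Z\<close>.\<close>

lemma excursion_conn_trans:
  assumes 1: "excursion_conn n L k r Z Z1" and 2: "excursion_conn n L k r Z1 Z2" and S: "sd Z Z1 \<in> near_prefixes n L a b"
    and Z: "Z \<in> graphs n" "Z1 \<in> graphs n" "Z2 \<in> graphs n"
    and eq: "eqdeg n Z Z1 \<or> eqdeg n Z1 Z2"
  shows "excursion_conn n L (a + k) (b + r) Z Z2"
proof -
  have "conn n {U. (eqdeg n Z U \<or> eqdeg n Z2 U) \<and> sd Z U \<in> near_prefixes n L (a + k) (b + r)} Z Z1"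
    using 1 unfolding excursion_conn_def
  proof (rule conn_mono, intro subsetI)
    fix U assume "U \<in> {U. (eqdeg n Z U \<or> eqdeg n Z1 U) \<and> sd Z U \<in> near_prefixes n L k r}"
    then have "eqdeg n Z U \<or> eqdeg n Z1 U" and *: "sd Z U \<in> near_prefixes n L k r" by auto
    then have "eqdeg n Z U \<or> eqdeg n Z2 U" using eq Z eqdeg_trans eqdeg_sym by blast
    moreover have "sd Z U \<in> near_prefixes n L (a + k) (b + r)" using near_prefixes_mono[OF _ _ *] by simp
    ultimately show "U \<in> {U. (eqdeg n Z U \<or> eqdeg n Z2 U) \<and> sd Z U \<in> near_prefixes n L (a + k) (b + r)}" by blast
  qed
  moreover have "conn n {U. (eqdeg n Z U \<or> eqdeg n Z2 U) \<and> sd Z U \<in> near_prefixes n L (a + k) (b + r)} Z1 Z2"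
    using 2 unfolding excursion_conn_def
  proof (rule conn_mono, intro subsetI)
    fix U assume "U \<in> {U. (eqdeg n Z1 U \<or> eqdeg n Z2 U) \<and> sd Z1 U \<in> near_prefixes n L k r}"
    then have "eqdeg n Z1 U \<or> eqdeg n Z2 U" and *: "sd Z1 U \<in> near_prefixes n L k r" by auto
    then have "eqdeg n Z U \<or> eqdeg n Z2 U" using eq Z eqdeg_trans eqdeg_sym by blast
    moreover have "sd Z U \<in> near_prefixes n L (a + k) (b + r)" using near_prefixes_sd[OF S *] by (simp add: sd_assoc)
    ultimately show "U \<in> {U. (eqdeg n Z U \<or> eqdeg n Z2 U) \<and> sd Z U \<in> near_prefixes n L (a + k) (b + r)}" by blast
  qed
  ultimately show ?thesis unfolding excursion_conn_def by (rule conn_trans)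
qed

text \<open>
  If the loop \<open>P\<close> and the trail \<open>Q\<close> meet in a vertex \<open>v\<close> other than \<open>c\<close>, re-pairing the four
  edges at \<open>v\<close> turns \<open>P \<union> Q\<close> into two trails that alternate at \<open>c\<close>.
\<close>

lemma combine_shared:
  assumes Z: "Z \<in> graphs n" and dL: "distinct L"
    and P: "P = c # x1 @ v # x2 @ [c]" and Q: "Q = c # y1 @ v # y2"
    and chP: "chunk L (el P)" and chQ: "chunk L (el Q)"
    and c: "c \<notin> set (x1 @ v # x2)" "c \<notin> set (butlast (y1 @ v # y2))"
    and E: "set (el P) \<subseteq> nsets {1..n} 2" "set (el Q) \<subseteq> nsets {1..n} 2"
    and d: "distinct (el P @ el Q)"
    and alt: "alts Z True (el P)" "alts Z False (el Q)"
    and oddP: "odd (length (el P))" and oddQ: "last Q = c \<longrightarrow> odd (length (el Q))"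
    and par: "even (length x1 + length y1)"
  shows "excursion_conn n L 16 9 Z (sd Z (set (el P @ el Q)))"
    and "last Q = c \<Longrightarrow> eqdeg n Z (sd Z (set (el P @ el Q)))"
proof -
  define P1 P2 Q1 Q2 where "P1 = el (c # x1 @ [v])" and "P2 = el (v # x2 @ [c])"
    and "Q1 = el (c # y1 @ [v])" and "Q2 = el (v # y2)"
  have eP: "el P = P1 @ P2" using el_append[of "c # x1" v "x2 @ [c]"] by (simp add: P P1_def P2_def)
  have eQ: "el Q = Q1 @ Q2" using el_append[of "c # y1" v y2] by (simp add: Q Q1_def Q2_def)
  \<comment> \<open>\<open>T1\<close> goes to \<open>v\<close> along \<open>P\<close> and returns
    along \<open>Q\<close>; \<open>T2\<close> takes the rest of \<open>P\<close> backwards and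
    continues on \<open>Q\<close>. By \<open>par\<close> the walk \<open>T1\<close> is even, and in
    both walks the two edges that meet at \<open>v\<close> differ in colour.\<close>
  define T1 T2 where "T1 = c # x1 @ v # rev y1 @ [c]" and "T2 = c # rev x2 @ v # y2"
  have e1: "el T1 = P1 @ rev Q1"
    using el_append[of "c # x1" v "rev y1 @ [c]"] el_rev[of "c # y1 @ [v]"]
    by (simp add: T1_def P1_def Q1_def)
  have e2: "el T2 = rev P2 @ Q2"
    using el_append[of "c # rev x2" v y2] el_rev[of "v # x2 @ [c]"]
    by (simp add: T2_def P2_def Q2_def)
  have lens: "length P1 = length x1 + 1" "length Q1 = length y1 + 1"
    "length P2 = length x2 + 1" "length Q2 = length y2"
    by (simp_all add: P1_def Q1_def P2_def Q2_def)
  have parP: "odd (length P1) \<longleftrightarrow> even (length P2)" using oddP eP by auto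
  have par': "odd (length P1) \<longleftrightarrow> odd (length Q1)" using par lens by auto
  have ch: "chunk L P1" "chunk L P2" "chunk L Q1" "chunk L Q2"
    using chunk_sub[of L "[]" P1 P2] chunk_sub[of L P1 P2 "[]"] chunk_sub[of L "[]" Q1 Q2]
      chunk_sub[of L Q1 Q2 "[]"] chP chQ eP eQ by simp_all
  have dd: "set P1 \<inter> set P2 = {}" "set P1 \<inter> set Q1 = {}" "set P1 \<inter> set Q2 = {}" "set P2 \<inter> set Q1 = {}"
    "set P2 \<inter> set Q2 = {}" "set Q1 \<inter> set Q2 = {}" "distinct P1" "distinct P2" "distinct Q1" "distinct Q2"
    using d unfolding eP eQ by auto
  have ok1: "pfx_ok n L 4 0 (el T1)" unfolding e1
    using pfx_ok_append[OF pfx_ok_chunk[OF dL ch(1)] pfx_ok_chunk[OF dL chunk_rev[OF ch(3)]]] dd by simp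
  have ok2: "pfx_ok n L 4 0 (el T2)" unfolding e2
    using pfx_ok_append[OF pfx_ok_chunk[OF dL chunk_rev[OF ch(2)]] pfx_ok_chunk[OF dL ch(4)]] dd by simp
  have aP: "alts Z True P1" "alts Z (even (length P1)) P2" using alt(1) unfolding eP alts_append by auto
  have aQ: "alts Z False Q1" "alts Z (odd (length Q1)) Q2" using alt(2) unfolding eQ alts_append by auto
  have a1: "alts Z True (el T1)" unfolding e1 alts_append alts_rev using aP aQ par' by auto
  have a2: "alts Z True (el T2)" unfolding e2 alts_append alts_rev using aP aQ par' parP by auto
  define Z1 where "Z1 = sd Z (set (el T1))"
  have E1: "set (el T1) \<subseteq> nsets {1..n} 2" and E2: "set (el T2) \<subseteq> nsets {1..n} 2"
    using E unfolding e1 e2 eP eQ by auto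
  have x1: "excursion_conn n L (3 * 4) (3 * 0 + 5) Z Z1" "eqdeg n Z Z1"
    unfolding Z1_def
  proof -
    have "c \<notin> set y1" using c(2) by (auto simp: butlast_append split: if_splits)
    then have nc1: "hd T1 \<notin> set (butlast (tl T1))" using c(1) by (auto simp: T1_def butlast_append)
    have len1: "2 \<le> length T1" "last T1 = hd T1" by (simp_all add: T1_def)
    have dT1: "distinct (el T1)" and cl1: "last T1 = hd T1 \<longrightarrow> even (length (el T1))" unfolding e1 using dd par' by auto
    show "excursion_conn n L (3 * 4) (3 * 0 + 5) Z (sd Z (set (el T1)))" "eqdeg n Z (sd Z (set (el T1)))"
      using excursion[OF Z len1(1) E1 dT1 a1 nc1 cl1 ok1] len1(2) by blast+
  qed
  have Z1g: "Z1 \<in> graphs n" unfolding Z1_def using graphs_sd[OF Z E1] .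
  have dis: "set (el T1) \<inter> set (el T2) = {}" unfolding e1 e2 using dd by auto
  have a2': "alts Z1 True (el T2)" unfolding Z1_def using alts_disjoint[of "el T2" "set (el T1)"] a2 dis by blast
  have fin: "sd Z1 (set (el T2)) = sd Z (set (el P @ el Q))"
  proof -
    have "set (el P @ el Q) = set (el T1) \<union> set (el T2)" unfolding e1 e2 eP eQ by auto
    then show ?thesis unfolding Z1_def sd_assoc by (simp only: sd_disjoint[OF dis])
  qed
  have nc2: "hd T2 \<notin> set (butlast (tl T2))"
  proof (cases "y2 = []")
    case True then show ?thesis using c by (simp add: T2_def butlast_append)
  next
    case False then show ?thesis using c by (auto simp: T2_def butlast_append)
  qed
  have h2: "hd T2 = c" by (simp add: T2_def)
  have lastT2: "last T2 = last Q" by (simp add: T2_def Q)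
  have cl2: "last T2 = hd T2 \<longrightarrow> even (length (el T2))"
    using oddQ lastT2 h2 parP par' unfolding e2 eQ by auto
  have len2: "2 \<le> length T2" by (simp add: T2_def)
  have dT2: "distinct (el T2)" unfolding e2 using dd by auto
  note X2 = excursion[OF Z1g len2 E2 dT2 a2' nc2 cl2 ok2, unfolded fin]
  have fg: "sd Z (set (el P @ el Q)) \<in> graphs n" using graphs_sd[OF Z, of "set (el P @ el Q)"] E by auto
  have "sd Z Z1 \<in> near_prefixes n L 4 0" unfolding Z1_def using pfx_ok_set[OF ok1] by simp
  \<comment> \<open>Each of \<open>T1\<close>, \<open>T2\<close> consists of two chunks of
    \<open>L\<close> and costs 4 prefixes: 4 for having flipped \<open>T1\<close>, then 3 times 4
    within \<open>T2\<close>. The 5 edges are rounded up to the 9 of the chord case.\<close>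
  then have "excursion_conn n L (4 + 3 * 4) (0 + (3 * 0 + 5)) Z (sd Z (set (el P @ el Q)))"
    by (intro excursion_conn_trans[OF x1(1) X2(1) _ Z Z1g fg disjI1[OF x1(2)]])
  then show "excursion_conn n L 16 9 Z (sd Z (set (el P @ el Q)))" by (rule excursion_conn_mono) auto
  show "eqdeg n Z (sd Z (set (el P @ el Q)))" if "last Q = c"
    by (rule eqdeg_trans[OF x1(2) X2(2)]) (use that lastT2 h2 in simp)
qed

text \<open>
  Otherwise the chord \<open>f = {x, y}\<close> between the first vertices of \<open>P\<close> and \<open>Q\<close> is not an edge of
  either; flipping \<open>T1\<close> and \<open>T2\<close>, which both contain \<open>f\<close>, flips \<open>P \<union> Q\<close>.
\<close>

lemma combine_chord:
  assumes Z: "Z \<in> graphs n" and dL: "distinct L"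
    and P: "P = c # x # xs @ [c]" and Q: "Q = c # y # ys"
    and chP: "chunk L (el P)" and chQ: "chunk L (el Q)"
    and c: "c \<notin> set (x # xs)" "c \<notin> set (butlast (y # ys))"
    and dis: "set (x # xs) \<inter> set (y # ys) \<subseteq> {c}"
    and E: "set (el P) \<subseteq> nsets {1..n} 2" "set (el Q) \<subseteq> nsets {1..n} 2"
    and d: "distinct (el P @ el Q)"
    and alt: "alts Z True (el P)" "alts Z False (el Q)"
    and oddP: "odd (length (el P))" and oddQ: "last Q = c \<longrightarrow> odd (length (el Q))"
  shows "excursion_conn n L 16 9 Z (sd Z (set (el P @ el Q)))"
    and "last Q = c \<Longrightarrow> eqdeg n Z (sd Z (set (el P @ el Q)))"
proof -
  define f where "f = {x, y}"
  define X Y where "X = el (x # xs @ [c])" and "Y = el (y # ys)"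
  define a b where "a = {c, x}" and "b = {c, y}"
  have eP: "el P = a # X" by (simp add: P X_def a_def)
  have eQ: "el Q = b # Y" by (simp add: Q Y_def b_def)
  have nsx: "{c, x} \<in> nsets {1..n} 2" and nsy: "{c, y} \<in> nsets {1..n} 2"
    using E unfolding eP eQ by (auto simp: a_def b_def)
  have yc: "y \<noteq> c" using nsy by (auto simp: doubleton_nsets)
  have xc: "x \<noteq> c" using c by auto
  have yx: "y \<notin> set (x # xs)" using dis yc by auto
  have xy: "x \<notin> set (y # ys)" using dis xc by auto
  have fns: "f \<in> nsets {1..n} 2" using nsx nsy yx by (auto simp: f_def doubleton_nsets)
  have fP: "f \<notin> set (el P)"
  proof
    assume "f \<in> set (el P)"
    then have "y \<in> set P" by (rule in_el) (simp add: f_def)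
    then show False using yx yc by (auto simp: P)
  qed
  have fQ: "f \<notin> set (el Q)"
  proof
    assume "f \<in> set (el Q)"
    then have "x \<in> set Q" by (rule in_el) (simp add: f_def)
    then show False using xy xc by (auto simp: Q)
  qed
  define T1 T2 where "T1 = c # rev xs @ [x, y, c]" and "T2 = c # x # y # ys"
  have e1: "el T1 = rev X @ [f, b]"
    using el_append[of "c # rev xs" x "[y, c]"] el_rev[of "x # xs @ [c]"]
    by (simp add: T1_def X_def f_def b_def insert_commute)
  have e2: "el T2 = a # f # Y" by (simp add: T2_def Y_def f_def a_def)
  have evX: "even (length X)" using oddP by (simp add: eP)
  have ch: "chunk L [a]" "chunk L X" "chunk L [b]" "chunk L Y"
    using chunk_sub[of L "[]" "[a]" X] chunk_sub[of L "[a]" X "[]"] chunk_sub[of L "[]" "[b]" Y]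
      chunk_sub[of L "[b]" Y "[]"] chP chQ eP eQ by simp_all
  have dd: "a \<notin> set X" "a \<noteq> b" "a \<notin> set Y" "b \<notin> set X" "b \<notin> set Y"
    "set X \<inter> set Y = {}" "distinct X" "distinct Y" using d unfolding eP eQ by auto
  have ff: "f \<notin> set X" "f \<notin> set Y" "f \<noteq> a" "f \<noteq> b" using fP fQ unfolding eP eQ by auto
  have ok1: "pfx_ok n L 4 1 (el T1)"
  proof -
    have ok: "pfx_ok n L (0 + 2) (1 + 0) ([f] @ [b])"
      by (rule pfx_ok_append[OF pfx_ok_single[OF fns] pfx_ok_chunk[OF dL ch(3)]]) (use ff in auto)
    have "pfx_ok n L (2 + (0 + 2)) (0 + (1 + 0)) (rev X @ ([f] @ [b]))"
      by (rule pfx_ok_append[OF pfx_ok_chunk[OF dL chunk_rev[OF ch(2)]] ok]) (use ff dd in auto)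
    then show ?thesis unfolding e1 by (simp del: One_nat_def)
  qed
  have ok2: "pfx_ok n L 4 1 (el T2)"
  proof -
    have ok: "pfx_ok n L (0 + 2) (1 + 0) ([f] @ Y)"
      by (rule pfx_ok_append[OF pfx_ok_single[OF fns] pfx_ok_chunk[OF dL ch(4)]]) (use ff in auto)
    have "pfx_ok n L (2 + (0 + 2)) (0 + (1 + 0)) ([a] @ ([f] @ Y))"
      by (rule pfx_ok_append[OF pfx_ok_chunk[OF dL ch(1)] ok]) (use ff dd in auto)
    then show ?thesis unfolding e2 by (simp del: One_nat_def)
  qed
  have aP: "a \<in> Z" "alts Z False X" using alt(1) unfolding eP by auto
  have aQ: "b \<notin> Z" "alts Z True Y" using alt(2) unfolding eQ by auto
  have E1: "set (el T1) \<subseteq> nsets {1..n} 2" and E2: "set (el T2) \<subseteq> nsets {1..n} 2"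
    using E fns unfolding e1 e2 eP eQ by auto
  have d1: "distinct (el T1)" and d2: "distinct (el T2)" unfolding e1 e2 using dd ff by auto
  have h2: "hd T2 = c" by (simp add: T2_def)
  have lastT2: "last T2 = last Q" by (simp add: T2_def Q)
  have nc1: "hd T1 \<notin> set (butlast (tl T1))" using c xc yc by (auto simp: T1_def butlast_append)
  have nc2: "hd T2 \<notin> set (butlast (tl T2))" using c xc by (auto simp: T2_def)
  have cl1: "last T1 = hd T1 \<longrightarrow> even (length (el T1))" unfolding e1 using evX by simp
  have cl2: "last T2 = hd T2 \<longrightarrow> even (length (el T2))"
    using oddQ lastT2 h2 unfolding e2 eQ by auto
  have len: "2 \<le> length T1" "2 \<le> length T2" "last T1 = hd T1" by (simp_all add: T1_def T2_def)
  let ?Z' = "sd Z (set (el P @ el Q))"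
  have both: "sd (set (el T1)) (set (el T2)) = set (el P @ el Q)"
    unfolding e1 e2 eP eQ using dd ff by (intro set_eqI) auto
  then have fin: "sd (sd Z (set (el T1))) (set (el T2)) = ?Z'" "sd (sd Z (set (el T2))) (set (el T1)) = ?Z'"
    by (metis sd_assoc, metis sd_assoc sd_commute)
  have fg: "?Z' \<in> graphs n" using graphs_sd[OF Z, of "set (el P @ el Q)"] E by auto
  have Zg: "sd Z (set (el T1)) \<in> graphs n" "sd Z (set (el T2)) \<in> graphs n"
    using graphs_sd[OF Z E1] graphs_sd[OF Z E2] by auto
  have S: "sd Z (sd Z (set (el T1))) \<in> near_prefixes n L 4 1" "sd Z (sd Z (set (el T2))) \<in> near_prefixes n L 4 1"
    using pfx_ok_set[OF ok1] pfx_ok_set[OF ok2] by simp_all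
  have "excursion_conn n L 16 9 Z ?Z' \<and> (last Q = c \<longrightarrow> eqdeg n Z ?Z')"
  \<comment> \<open>\<open>T1\<close> alternates if \<open>f\<close> is present, \<open>T2\<close>
    if it is absent. The one that fits goes first and leaves \<open>f\<close> in the state that the
    other needs.\<close>
  proof (cases "f \<in> Z")
    case True
    have a1: "alts Z True (el T1)"
      unfolding e1 alts_append alts_rev using aP aQ evX True by auto
    have nY: "set Y \<inter> set (el T1) = {}" unfolding e1 using dd ff by auto
    have a2: "alts (sd Z (set (el T1))) True (el T2)"
      unfolding e2 alts.simps using aP aQ True dd ff alts_disjoint[OF nY] unfolding e1 by auto
    note X1 = excursion[OF Z len(1) E1 d1 a1 nc1 cl1 ok1]
    note X2 = excursion[OF Zg(1) len(2) E2 d2 a2 nc2 cl2 ok2, unfolded fin]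
    have "excursion_conn n L (4 + 3 * 4) (1 + (3 * 1 + 5)) Z ?Z'"
      by (rule excursion_conn_trans[OF X1(1) X2(1) S(1) Z Zg(1) fg disjI1[OF X1(2)[OF len(3)]]])
    moreover have "eqdeg n Z ?Z'" if "last Q = c"
      by (rule eqdeg_trans[OF X1(2)[OF len(3)] X2(2)]) (use that lastT2 h2 in simp)
    ultimately show ?thesis by simp
  next
    case False
    have a2: "alts Z True (el T2)" unfolding e2 alts.simps using aP aQ False by auto
    have nX: "set X \<inter> set (el T2) = {}" unfolding e2 using dd ff by auto
    have a1: "alts (sd Z (set (el T2))) True (el T1)"
      unfolding e1 alts_append alts_rev using aP aQ evX False dd ff alts_disjoint[OF nX] unfolding e2 by auto
    note X2 = excursion[OF Z len(2) E2 d2 a2 nc2 cl2 ok2]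
    note X1 = excursion[OF Zg(2) len(1) E1 d1 a1 nc1 cl1 ok1, unfolded fin]
    have "excursion_conn n L (4 + 3 * 4) (1 + (3 * 1 + 5)) Z ?Z'"
      by (rule excursion_conn_trans[OF X2(1) X1(1) S(2) Z Zg(2) fg disjI2[OF X1(2)[OF len(3)]]])
    moreover have "eqdeg n Z ?Z'" if "last Q = c"
      by (rule eqdeg_trans[OF X2(2) X1(2)[OF len(3)]]) (use that lastT2 h2 in simp)
    ultimately show ?thesis by simp
  qed
  then show "excursion_conn n L 16 9 Z ?Z'" and "last Q = c \<Longrightarrow> eqdeg n Z ?Z'" by auto
qed

lemma combine:
  assumes Z: "Z \<in> graphs n" and dL: "distinct L"
    and P: "P = c # xs @ [c]" "c \<notin> set xs" and Q: "Q = c # ys" "ys \<noteq> []" "c \<notin> set (butlast ys)"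
    and chP: "chunk L (el P)" and chQ: "chunk L (el Q)"
    and E: "set (el P) \<subseteq> nsets {1..n} 2" "set (el Q) \<subseteq> nsets {1..n} 2"
    and d: "distinct (el P @ el Q)"
    and alt: "alts Z True (el P)" "alts Z False (el Q)"
    and oddP: "odd (length (el P))" and oddQ: "last Q = c \<longrightarrow> odd (length (el Q))"
  shows "excursion_conn n L 16 9 Z (sd Z (set (el P @ el Q))) \<and> (last Q = c \<longrightarrow> eqdeg n Z (sd Z (set (el P @ el Q))))"
proof (cases "set xs \<inter> set ys \<subseteq> {c}")
  case True
  have "xs \<noteq> []" using E(1) P by (auto simp: nsets_def)
  then obtain x xs' where xs: "xs = x # xs'" by (cases xs) auto
  obtain y ys' where ys: "ys = y # ys'" using Q by (cases ys) auto
  have "P = c # x # xs' @ [c]" "Q = c # y # ys'" "c \<notin> set (x # xs')" "c \<notin> set (butlast (y # ys'))"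
    "set (x # xs') \<inter> set (y # ys') \<subseteq> {c}" using P Q True xs ys by simp_all
  note * = combine_chord[OF Z dL this(1,2) chP chQ this(3-5) E d alt oddP oddQ]
  show ?thesis by (rule conjI[OF *(1) impI[OF *(2)]])
next
  case False
  then obtain v where v: "v \<in> set xs" "v \<in> set ys" "v \<noteq> c" by auto
  obtain x1 x2 where xs: "xs = x1 @ v # x2" using v by (meson split_list)
  obtain y1 y2 where ys: "ys = y1 @ v # y2" using v by (meson split_list)
  have Q': "Q = c # y1 @ v # y2" "c \<notin> set (butlast (y1 @ v # y2))" using Q ys by simp_all
  show ?thesis
  proof (cases "even (length x1 + length y1)")
    case True
    have P': "P = c # x1 @ v # x2 @ [c]" "c \<notin> set (x1 @ v # x2)" using P xs by simp_all
    note * = combine_shared[OF Z dL P'(1) Q'(1) chP chQ P'(2) Q'(2) E d alt oddP oddQ True]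
    show ?thesis by (rule conjI[OF *(1) impI[OF *(2)]])
  next
    case False
    \<comment> \<open>\<open>P\<close> has odd length, so \<open>x1\<close> and \<open>x2\<close>
      have different parities; traversing \<open>P\<close> backwards swaps them and restores the
      parity condition.\<close>
    have er: "el (rev P) = rev (el P)" by (rule el_rev)
    have "length (el P) = length x1 + length x2 + 2" using P xs by simp
    then have par: "even (length x2 + length y1)" using False oddP by presburger
    have P': "rev P = c # rev x2 @ v # rev x1 @ [c]" "c \<notin> set (rev x2 @ v # rev x1)" using P xs by simp_all
    have alt': "alts Z True (el (rev P))" unfolding er alts_rev using alt oddP by simp
    have ch': "chunk L (el (rev P))" unfolding er using chP by (rule chunk_rev)
    have r: "set (el (rev P)) \<subseteq> nsets {1..n} 2" "distinct (el (rev P) @ el Q)" "odd (length (el (rev P)))"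
      unfolding er using E d oddP by auto
    have eq: "set (el (rev P) @ el Q) = set (el P @ el Q)" unfolding er by simp
    have par': "even (length (rev x2) + length y1)" using par by simp
    note * = combine_shared[OF Z dL P'(1) Q'(1) ch' chQ P'(2) Q'(2) r(1) E(2) r(2) alt' alt(2) r(3) oddQ par', unfolded eq]
    show ?thesis by (rule conjI[OF *(1) impI[OF *(2)]])
  qed
qed

text \<open>19 = 3 + 16: at most 3 prefixes describe the graph at which a flip starts (the processed
  part of \<open>L\<close> without the held excursion), and 16 describe the joint flip of two odd
  excursions. The 9 comes from that joint flip too.\<close>

definition reach :: "nat \<Rightarrow> nat set list \<Rightarrow> graph \<Rightarrow> graph \<Rightarrow> graph \<Rightarrow> graph \<Rightarrow> graph \<Rightarrow> bool" where
  "reach n L X A B Z Z' \<longleftrightarrow>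
     conn n {U. (eqdeg n A U \<or> eqdeg n B U) \<and> sd X U \<in> near_prefixes n L 19 9} Z Z'"

lemma reach_trans: "reach n L X A B Z Z1 \<Longrightarrow> reach n L X A B Z1 Z2 \<Longrightarrow> reach n L X A B Z Z2"
  unfolding reach_def by (rule conn_trans)

lemma reach_eqdeg:
  assumes "reach n L X A B Z Z'" "\<And>U. eqdeg n A U \<or> eqdeg n B U \<Longrightarrow> eqdeg n A' U \<or> eqdeg n B' U"
  shows "reach n L X A' B' Z Z'"
  using assms(1) unfolding reach_def by (rule conn_mono) (use assms(2) in blast)

lemma reach_exc:
  assumes "excursion_conn n L k r Z Z'" "sd X Z \<in> near_prefixes n L a b" "a + k \<le> 19" "b + r \<le> 9"
  shows "reach n L X Z Z' Z Z'"
  using assms(1) unfolding excursion_conn_def reach_def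
proof (rule conn_mono, intro subsetI)
  fix U assume "U \<in> {U. (eqdeg n Z U \<or> eqdeg n Z' U) \<and> sd Z U \<in> near_prefixes n L k r}"
  then have "eqdeg n Z U \<or> eqdeg n Z' U" and S: "sd Z U \<in> near_prefixes n L k r" by auto
  moreover have "sd X U \<in> near_prefixes n L 19 9"
    using near_prefixes_mono[OF assms(3,4) near_prefixes_sd[OF assms(2) S]] by (simp add: sd_assoc)
  ultimately show "U \<in> {U. (eqdeg n Z U \<or> eqdeg n Z' U) \<and> sd X U \<in> near_prefixes n L 19 9}" by blast
qed

section \<open>Induction over the excursions of a trail\<close>

lemma split_loop:
  assumes "c \<in> set (butlast ts)"
  obtains t1 t2 where "ts = t1 @ c # t2" "c \<notin> set t1" "t2 \<noteq> []"
proof -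
  have ne: "ts \<noteq> []" using assms by auto
  obtain t1 t2 where t: "butlast ts = t1 @ c # t2" "c \<notin> set t1"
    using split_list_first[OF assms] by blast
  have "ts = t1 @ c # (t2 @ [last ts])" using append_butlast_last_id[OF ne] t(1) by simp
  then show ?thesis using that t(2) by blast
qed

text \<open>
  A trail is processed excursion by excursion from its first vertex \<open>c\<close>. An even excursion
  alternates at \<open>c\<close>. An odd one, \<open>P\<close>, is held back until the next odd one (or the final open
  part), which starts with the opposite colour; \<open>D\<close> collects what was processed in between.
\<close>

definition free_ok :: "nat \<Rightarrow> nat set list \<Rightarrow> graph \<Rightarrow> nat \<Rightarrow> bool" where
  "free_ok n L X m \<longleftrightarrow> (\<forall>T c ts L0 L1 Z. length T \<le> m \<longrightarrow> T = c # ts \<longrightarrow> ts \<noteq> [] \<longrightarrow>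
     L = L0 @ el T @ L1 \<longrightarrow> Z = sd X (set L0) \<longrightarrow> alts Z True (el T) \<longrightarrow>
     (last T = c \<longrightarrow> even (length (el T))) \<longrightarrow>
     reach n L X Z (sd Z (set (el T))) Z (sd Z (set (el T))) \<and>
     (last T = c \<longrightarrow> eqdeg n Z (sd Z (set (el T)))))"

definition held_ok :: "nat \<Rightarrow> nat set list \<Rightarrow> graph \<Rightarrow> nat \<Rightarrow> bool" where
  "held_ok n L X m \<longleftrightarrow> (\<forall>P Q c xs D qs L0 L1 Z. length Q \<le> m \<longrightarrow> Q = c # qs \<longrightarrow> qs \<noteq> [] \<longrightarrow>
     P = c # xs @ [c] \<longrightarrow> c \<notin> set xs \<longrightarrow> L = L0 @ el P @ D @ el Q @ L1 \<longrightarrow>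
     Z = sd X (set (L0 @ D)) \<longrightarrow> alts Z True (el P) \<longrightarrow> odd (length (el P)) \<longrightarrow>
     alts Z False (el Q) \<longrightarrow> (last Q = c \<longrightarrow> odd (length (el Q))) \<longrightarrow>
     reach n L X Z (sd Z (set (el P @ el Q))) Z (sd Z (set (el P @ el Q))) \<and>
     (last Q = c \<longrightarrow> eqdeg n Z (sd Z (set (el P @ el Q)))))"

text \<open>The two statements need each other: an odd excursion turns a free trail into a held one,
  and the next odd one turns it back. Each recursive call is for a walk shorter by one
  excursion.\<close>

lemma trail_reach_aux:
  fixes m :: nat
  assumes dL: "distinct L" and LE: "set L \<subseteq> nsets {1..n} 2" and X: "X \<in> graphs n"
  shows "free_ok n L X m \<and> held_ok n L X m"
proof (induction m)
  case 0
  show ?case by (simp add: free_ok_def held_ok_def)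
next
  case (Suc m)
  note IHC = Suc.IH[THEN conjunct1, unfolded free_ok_def, rule_format]
  note IHH = Suc.IH[THEN conjunct2, unfolded held_ok_def, rule_format]
  have gr: "sd X S \<in> graphs n" if "S \<subseteq> set L" for S
    using graphs_sd[OF X] that LE by blast
  have step: "reach n L X Z Z2 Z Z2 \<and> (q \<longrightarrow> eqdeg n Z Z2)"
    if "reach n L X Z Z1 Z Z1" "eqdeg n Z Z1" "Z \<in> graphs n" "reach n L X Z1 Z2 Z1 Z2" "q \<longrightarrow> eqdeg n Z1 Z2"
    for Z Z1 Z2 q
  proof
    have "Z1 \<in> graphs n" using that(2) by (simp add: eqdeg_def)
    have "reach n L X Z Z2 Z Z1" by (rule reach_eqdeg[OF that(1)]) (use that(2,3) eqdeg_trans eqdeg_sym in blast)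
    moreover have "reach n L X Z Z2 Z1 Z2" by (rule reach_eqdeg[OF that(4)]) (use that(2,3) eqdeg_trans eqdeg_sym in blast)
    ultimately show "reach n L X Z Z2 Z Z2" by (rule reach_trans)
    show "q \<longrightarrow> eqdeg n Z Z2" using that(2,5) eqdeg_trans by blast
  qed
  have C: "reach n L X Z (sd Z (set (el T))) Z (sd Z (set (el T))) \<and> (last T = c \<longrightarrow> eqdeg n Z (sd Z (set (el T))))"
    if T: "length T \<le> Suc m" "T = c # ts" "ts \<noteq> []" and L: "L = L0 @ el T @ L1" and Z: "Z = sd X (set L0)"
      and alt: "alts Z True (el T)" and cl: "last T = c \<longrightarrow> even (length (el T))" for T c ts L0 L1 Z
  proof -
    have Zg: "Z \<in> graphs n" unfolding Z by (rule gr) (simp add: L)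
    have base: "sd X Z \<in> near_prefixes n L 1 0" using near_prefixes_take[of "length L0" L n] by (simp add: Z L)
    have dT: "distinct (el T)" "set L0 \<inter> set (el T) = {}" using dL unfolding L by auto
    have ET: "set (el T) \<subseteq> nsets {1..n} 2" using LE unfolding L by auto
    show ?thesis
    proof (cases "c \<in> set (butlast ts)")
      case False
      have ok: "pfx_ok n L 2 0 (el T)" using pfx_ok_chunk[OF dL chunkI[OF L]] .
      have len: "2 \<le> length T" using T by (cases ts) auto
      have nc: "hd T \<notin> set (butlast (tl T))" and cl': "last T = hd T \<longrightarrow> even (length (el T))"
        using False T cl by auto
      note X = excursion[OF Zg len ET dT(1) alt nc cl' ok]
      have "reach n L X Z (sd Z (set (el T))) Z (sd Z (set (el T)))"
        using reach_exc[OF X(1) base] by simp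
      then show ?thesis using X(2) T by simp
    next
      case True
      then obtain t1 t2 where t: "ts = t1 @ c # t2" "c \<notin> set t1" "t2 \<noteq> []" by (rule split_loop)
      define E Q where "E = c # t1 @ [c]" and "Q = c # t2"
      have eT: "el T = el E @ el Q" using el_append[of "c # t1" c t2] by (simp add: T t E_def Q_def)
      have lQ: "length Q \<le> m" using T t by (simp add: Q_def)
      have lastQ: "last Q = last T" using T t by (simp add: Q_def)
      have aE: "alts Z True (el E)" and aQ: "alts Z (even (length (el E))) (el Q)"
        using alt unfolding eT alts_append by auto
      have dE: "distinct (el E)" "set (el E) \<inter> set (el Q) = {}" using dT unfolding eT by auto
      show ?thesis
      proof (cases "even (length (el E))")
        case True
        have ok: "pfx_ok n L 2 0 (el E)"
          using pfx_ok_chunk[OF dL] chunkI[of L L0 "el E" "el Q @ L1"] L eT by simp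
        have EE: "set (el E) \<subseteq> nsets {1..n} 2" using ET eT by auto
        have nc: "hd E \<notin> set (butlast (tl E))" "2 \<le> length E" "last E = hd E" using t by (auto simp: E_def butlast_append)
        note X = excursion[OF Zg nc(2) EE dE(1) aE nc(1) impI[OF True] ok]
        let ?Z1 = "sd Z (set (el E))"
        have r1: "reach n L X Z ?Z1 Z ?Z1" using reach_exc[OF X(1) base] by simp
        have Z1: "?Z1 = sd X (set (L0 @ el E))" using dT unfolding Z eT by (auto simp: set_eq_iff)
        have dE': "set (el Q) \<inter> set (el E) = {}" using dE by blast
        have a: "alts ?Z1 True (el Q)" unfolding alts_disjoint[OF dE'] using aQ True by simp
        have r2: "reach n L X ?Z1 (sd ?Z1 (set (el Q))) ?Z1 (sd ?Z1 (set (el Q))) \<and>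
            (last Q = c \<longrightarrow> eqdeg n ?Z1 (sd ?Z1 (set (el Q))))"
          by (intro IHC[OF lQ Q_def t(3), of "L0 @ el E" L1 ?Z1]) (use a Z1 L eT cl lastQ True in auto)
        have eq: "sd ?Z1 (set (el Q)) = sd Z (set (el T))"
          unfolding eT set_append sd_assoc by (simp only: sd_disjoint[OF dE(2)])
        show ?thesis
          using step[OF r1 X(2)[OF nc(3)] Zg conjunct1[OF r2] conjunct2[OF r2]] unfolding eq lastQ .
      next
        case False
        \<comment> \<open>The odd excursion becomes the held one, with nothing processed beyond it
          yet, hence \<open>D = []\<close>.\<close>
        have "reach n L X Z (sd Z (set (el E @ el Q))) Z (sd Z (set (el E @ el Q))) \<and>
            (last Q = c \<longrightarrow> eqdeg n Z (sd Z (set (el E @ el Q))))"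
          by (intro IHH[OF lQ Q_def t(3) E_def t(2), of L0 "[]" L1 Z]) (use L Z eT aE aQ False cl lastQ in auto)
        then show ?thesis using lastQ eT by simp
      qed
    qed
  qed
  have H: "reach n L X Z (sd Z (set (el P @ el Q))) Z (sd Z (set (el P @ el Q))) \<and>
      (last Q = c \<longrightarrow> eqdeg n Z (sd Z (set (el P @ el Q))))"
    if Q: "length Q \<le> Suc m" "Q = c # qs" "qs \<noteq> []" and P: "P = c # xs @ [c]" "c \<notin> set xs"
      and L: "L = L0 @ el P @ D @ el Q @ L1" and Z: "Z = sd X (set (L0 @ D))"
      and aP: "alts Z True (el P)" "odd (length (el P))" and aQ: "alts Z False (el Q)"
      and cl: "last Q = c \<longrightarrow> odd (length (el Q))" for P Q c xs D qs L0 L1 Z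
  proof -
    have dd: "distinct (el P)" "distinct (el Q)" "set (el P) \<inter> set (el Q) = {}" "set D \<inter> set (el Q) = {}"
      "set L0 \<inter> set D = {}" "set L0 \<inter> set (el P) = {}" "set L0 \<inter> set (el Q) = {}" "set D \<inter> set (el P) = {}"
      using dL unfolding L by auto
    have Zg: "Z \<in> graphs n" unfolding Z by (rule gr) (auto simp: L)
    have base: "sd X Z \<in> near_prefixes n L 3 0"
    proof -
      have "pfx_ok n L 2 0 D" using pfx_ok_chunk[OF dL] chunkI[of L "L0 @ el P" D "el Q @ L1"] L by simp
      then have D: "set D \<in> near_prefixes n L 2 0" by (rule pfx_ok_set)
      have "set L0 \<in> near_prefixes n L 1 0" using near_prefixes_take[of "length L0" L n] by (simp add: L)
      from near_prefixes_sd[OF this D] have "sd (set L0) (set D) \<in> near_prefixes n L 3 0" by (simp add: numeral_3_eq_3)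
      moreover have "sd X Z = sd (set L0) (set D)" unfolding Z set_append sd_self(2) by (rule sd_disjoint[OF dd(5), symmetric])
      ultimately show ?thesis by simp
    qed
    have chP: "chunk L (el P)" using chunkI[of L L0 "el P" "D @ el Q @ L1"] L by simp
    have EP: "set (el P) \<subseteq> nsets {1..n} 2" and EQ: "set (el Q) \<subseteq> nsets {1..n} 2" using LE unfolding L by auto
    show ?thesis
    proof (cases "c \<in> set (butlast qs)")
      case False
      have chQ: "chunk L (el Q)" using chunkI[of L "L0 @ el P @ D" "el Q" L1] L by simp
      have dPQ: "distinct (el P @ el Q)" using dd by simp
      note X = combine[OF Zg dL P Q(2,3) False chP chQ EP EQ dPQ aP(1) aQ aP(2) cl]
      then show ?thesis using reach_exc[OF _ base] by auto
    next
      case True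
      then obtain q1 q2 where q: "qs = q1 @ c # q2" "c \<notin> set q1" "q2 \<noteq> []" by (rule split_loop)
      define E R where "E = c # q1 @ [c]" and "R = c # q2"
      have eQ: "el Q = el E @ el R" using el_append[of "c # q1" c q2] by (simp add: Q q E_def R_def)
      have lR: "length R \<le> m" using Q q by (simp add: R_def)
      have lastR: "last R = last Q" using Q q by (simp add: R_def)
      have aE: "alts Z False (el E)" and aR: "alts Z (odd (length (el E))) (el R)"
        using aQ unfolding eQ alts_append by auto
      have dE: "distinct (el E)" "set (el E) \<inter> set (el R) = {}" using dd unfolding eQ by auto
      have EE: "set (el E) \<subseteq> nsets {1..n} 2" using EQ eQ by auto
      have chE: "chunk L (el E)" using chunkI[of L "L0 @ el P @ D" "el E" "el R @ L1"] L eQ by simp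
      show ?thesis
      proof (cases "even (length (el E))")
        case True
        \<comment> \<open>Relative to \<open>Z\<close> the even excursion \<open>E\<close> starts
          with an absent edge; reversed, it starts with a present one, as \<open>excursion\<close>
          requires. \<open>P\<close> stays held and the edges of \<open>E\<close> join
          \<open>D\<close>.\<close>
        have er: "el (rev E) = rev (el E)" by (rule el_rev)
        have ok: "pfx_ok n L 2 0 (el (rev E))" unfolding er by (rule pfx_ok_chunk[OF dL chunk_rev[OF chE]])
        have nc: "hd (rev E) \<notin> set (butlast (tl (rev E)))" "2 \<le> length (rev E)" "last (rev E) = hd (rev E)"
          using q by (auto simp: E_def butlast_append)
        have EE': "set (el (rev E)) \<subseteq> nsets {1..n} 2" "distinct (el (rev E))" "even (length (el (rev E)))"
          "alts Z True (el (rev E))"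
          unfolding er alts_rev using EE dE True aE by auto
        note X = excursion[OF Zg nc(2) EE'(1,2,4) nc(1) impI[OF EE'(3)] ok]
        let ?Z1 = "sd Z (set (el E))"
        have "set (el (rev E)) = set (el E)" using er by simp
        then have r1: "reach n L X Z ?Z1 Z ?Z1" and e1: "eqdeg n Z ?Z1"
          using reach_exc[OF X(1) base] X(2)[OF nc(3)] by simp_all
        have Z1: "?Z1 = sd X (set (L0 @ (D @ el E)))" using dd unfolding Z eQ by (auto simp: set_eq_iff)
        have "set (el P) \<inter> set (el E) = {}" "set (el R) \<inter> set (el E) = {}" using dd dE unfolding eQ by auto
        note di = alts_disjoint[OF this(1)] alts_disjoint[OF this(2)]
        have b: "odd (length (el E)) = False" using True by blast
        have a: "alts ?Z1 True (el P)" "alts ?Z1 False (el R)"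
          unfolding di using aP(1) aR[unfolded b] by blast+
        have r2: "reach n L X ?Z1 (sd ?Z1 (set (el P @ el R))) ?Z1 (sd ?Z1 (set (el P @ el R))) \<and>
            (last R = c \<longrightarrow> eqdeg n ?Z1 (sd ?Z1 (set (el P @ el R))))"
          by (intro IHH[OF lR R_def q(3) P, of L0 "D @ el E" L1 ?Z1])
            (use L eQ Z1 a aP cl lastR True in auto)
        have "set (el E) \<inter> set (el P @ el R) = {}" using dd dE unfolding eQ by auto
        then have eq: "sd ?Z1 (set (el P @ el R)) = sd Z (set (el P @ el Q))"
          unfolding eQ sd_assoc by (subst sd_disjoint) (auto intro: arg_cong[where f = "sd Z"])
        show ?thesis
          using step[OF r1 e1 Zg conjunct1[OF r2] conjunct2[OF r2]] unfolding eq lastR .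
      next
        case False
        \<comment> \<open>Two odd excursions of opposite starting colours are flipped together; the
          rest \<open>R\<close> then starts with a present edge and is free again.\<close>
        have dPE: "distinct (el P @ el E)" using dd dE unfolding eQ by auto
        have ncE: "c \<notin> set (butlast (q1 @ [c]))" "q1 @ [c] \<noteq> []" using q by (auto simp: butlast_append)
        have lastE: "last E = c" by (simp add: E_def)
        have X: "excursion_conn n L 16 9 Z (sd Z (set (el P @ el E)))" "eqdeg n Z (sd Z (set (el P @ el E)))"
          using combine[OF Zg dL P E_def ncE(2,1) chP chE EP EE dPE aP(1) aE aP(2)] False lastE by auto
        let ?Z1 = "sd Z (set (el P @ el E))"
        have r1: "reach n L X Z ?Z1 Z ?Z1" using reach_exc[OF X(1) base] by simp
        have Z1: "?Z1 = sd X (set (L0 @ el P @ D @ el E))" using dd unfolding Z eQ by (auto simp: set_eq_iff)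
        have b: "odd (length (el E)) = True" using False by blast
        have di: "set (el R) \<inter> set (el P @ el E) = {}" using dd dE unfolding eQ by auto
        have a: "alts ?Z1 True (el R)" unfolding alts_disjoint[OF di] using aR[unfolded b] .
        have r2: "reach n L X ?Z1 (sd ?Z1 (set (el R))) ?Z1 (sd ?Z1 (set (el R))) \<and>
            (last R = c \<longrightarrow> eqdeg n ?Z1 (sd ?Z1 (set (el R))))"
          by (intro IHC[OF lR R_def q(3), of "L0 @ el P @ D @ el E" L1 ?Z1])
            (use L eQ Z1 a cl lastR False in auto)
        have "set (el P @ el E) \<inter> set (el R) = {}" using di by blast
        then have eq: "sd ?Z1 (set (el R)) = sd Z (set (el P @ el Q))"
          unfolding eQ sd_assoc by (subst sd_disjoint) (auto intro: arg_cong[where f = "sd Z"])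
        show ?thesis
          using step[OF r1 X(2) Zg conjunct1[OF r2] conjunct2[OF r2]] unfolding eq lastR .
      qed
    qed
  qed
  show ?case
    unfolding free_ok_def held_ok_def
    by (intro conjI allI impI; (rule C[THEN conjunct1] C[THEN conjunct2, THEN mp] H[THEN conjunct1] H[THEN conjunct2, THEN mp]; assumption))
qed

text \<open>A trail that starts with an absent edge starts with a present one once it is flipped, so
  in that case the path is built from the far end and reversed. Describing it relative to
  \<open>X\<close> instead of the flipped \<open>X\<close> costs two more prefixes, hence
  21.\<close>

lemma trail_reach:
  assumes dL: "distinct L" and LE: "set L \<subseteq> nsets {1..n} 2" and X: "X \<in> graphs n"
    and L: "L = L0 @ el T @ L1" and Z: "Z = sd X (set L0)" and alt: "alts Z b (el T)"
    and len: "2 \<le> length T" and closed: "last T = hd T \<Longrightarrow> even (length (el T))"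
  shows "conn n {U. (eqdeg n Z U \<or> eqdeg n (sd Z (set (el T))) U) \<and> sd X U \<in> near_prefixes n L 21 9}
    Z (sd Z (set (el T)))"
proof -
  obtain c ts where T: "T = c # ts" "ts \<noteq> []" using len by (cases T; cases "tl T") auto
  have cl: "last T = c \<longrightarrow> even (length (el T))" using closed T by auto
  show ?thesis
  proof (cases b)
    case True
    have aT: "alts Z True (el T)" using alt True by simp
    have "reach n L X Z (sd Z (set (el T))) Z (sd Z (set (el T)))"
      by (rule conjunct1[OF trail_reach_aux[OF dL LE X, THEN conjunct1, unfolded free_ok_def, rule_format,
            OF order_refl T L Z aT]]) (use cl in blast)
    then show ?thesis unfolding reach_def
      by (rule conn_mono) (use near_prefixes_mono[of 19 21 9 9 _ n L] in auto)
  next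
    case False
    let ?Z' = "sd Z (set (el T))" and ?X' = "sd X (set (el T))"
    have X': "?X' \<in> graphs n" by (rule graphs_sd[OF X]) (use LE L in auto)
    have aT: "alts ?Z' True (el T)" using alt False alts_flip[of "el T" "set (el T)" Z True] by simp
    have Z': "?Z' = sd ?X' (set L0)" unfolding Z by (simp add: sd_ac)
    have restore: "sd ?Z' (set (el T)) = Z" by (simp add: sd_assoc)
    have "reach n L ?X' ?Z' (sd ?Z' (set (el T))) ?Z' (sd ?Z' (set (el T)))"
      by (rule conjunct1[OF trail_reach_aux[OF dL LE X', THEN conjunct1, unfolded free_ok_def, rule_format,
            OF order_refl T L Z' aT]]) (use cl in blast)
    then have "reach n L ?X' ?Z' Z ?Z' Z" unfolding restore .
    then have "conn n {U. (eqdeg n Z U \<or> eqdeg n ?Z' U) \<and> sd X U \<in> near_prefixes n L 21 9} ?Z' Z"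
      unfolding reach_def
    proof (rule conn_mono, intro subsetI)
      fix U assume "U \<in> {U. (eqdeg n ?Z' U \<or> eqdeg n Z U) \<and> sd ?X' U \<in> near_prefixes n L 19 9}"
      then have *: "eqdeg n Z U \<or> eqdeg n ?Z' U" and S: "sd ?X' U \<in> near_prefixes n L 19 9" by auto
      have "set (el T) \<in> near_prefixes n L 2 0" using pfx_ok_set[OF pfx_ok_chunk[OF dL chunkI[OF L]]] .
      from near_prefixes_sd[OF this S] have "sd X U \<in> near_prefixes n L (2 + 19) (0 + 9)" by (simp add: sd_ac)
      then show "U \<in> {U. (eqdeg n Z U \<or> eqdeg n ?Z' U) \<and> sd X U \<in> near_prefixes n L 21 9}" using * by simp
    qed
    then show ?thesis by (rule conn_sym)
  qed
qed

section \<open>Pairings and their trails\<close>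

definition nb :: "graph \<Rightarrow> nat \<Rightarrow> nat set" where
  "nb G v = {w. {v, w} \<in> G}"

text \<open>
  A pairing \<open>\<psi>\<close> pairs the edges \<open>{v, w}\<close> and \<open>{v, \<psi> v w}\<close> at \<open>v\<close>; fixed points of \<open>\<psi> v\<close> are
  edges unpaired at \<open>v\<close>.
\<close>

definition involutive :: "graph \<Rightarrow> (nat \<Rightarrow> nat \<Rightarrow> nat) \<Rightarrow> bool" where
  "involutive G \<psi> \<longleftrightarrow> (\<forall>v. \<forall>w\<in>nb G v. \<psi> v w \<in> nb G v \<and> \<psi> v (\<psi> v w) = w)"

lemma involutiveD:
  assumes "involutive G \<psi>" "w \<in> nb G v"
  shows "\<psi> v w \<in> nb G v" "\<psi> v (\<psi> v w) = w" "\<psi> v w = u \<Longrightarrow> \<psi> v u = w"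
proof -
  show "\<psi> v w \<in> nb G v" "\<psi> v (\<psi> v w) = w" using assms by (simp_all add: involutive_def)
  then show "\<psi> v w = u \<Longrightarrow> \<psi> v u = w" by simp
qed

definition linked :: "(nat \<Rightarrow> nat \<Rightarrow> nat) \<Rightarrow> nat list \<Rightarrow> bool" where
  "linked \<psi> t \<longleftrightarrow> (\<forall>i. Suc (Suc i) < length t \<longrightarrow> \<psi> (t ! Suc i) (t ! i) = t ! Suc (Suc i))"

definition closes :: "(nat \<Rightarrow> nat \<Rightarrow> nat) \<Rightarrow> nat list \<Rightarrow> bool" where
  "closes \<psi> t \<longleftrightarrow> hd t = last t \<and> \<psi> (hd t) (t ! 1) = t ! (length t - 2)"

definition stops :: "(nat \<Rightarrow> nat \<Rightarrow> nat) \<Rightarrow> nat list \<Rightarrow> bool" where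
  "stops \<psi> t \<longleftrightarrow> \<psi> (last t) (t ! (length t - 2)) = t ! (length t - 2)"

text \<open>Closing means more than \<open>hd t = last t\<close>: the end edges have to be partners.
  The second alternative admits a trail that returns to its first vertex with both end edges
  unpaired there.\<close>

definition trail_ok :: "(nat \<Rightarrow> nat \<Rightarrow> nat) \<Rightarrow> nat list \<Rightarrow> bool" where
  "trail_ok \<psi> t \<longleftrightarrow> 2 \<le> length t \<and> linked \<psi> t \<and>
     (closes \<psi> t \<or> (\<psi> (hd t) (t ! 1) = t ! 1 \<and> stops \<psi> t))"

definition decomp :: "(nat \<Rightarrow> nat \<Rightarrow> nat) \<Rightarrow> graph \<Rightarrow> nat list list \<Rightarrow> bool" where
  "decomp \<psi> G Ts \<longleftrightarrow> distinct (concat (map el Ts)) \<and> set (concat (map el Ts)) = G \<and>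
     (\<forall>t\<in>set Ts. trail_ok \<psi> t)"

lemma loopless: "G \<subseteq> nsets V 2 \<Longrightarrow> {v, w} \<in> G \<Longrightarrow> v \<noteq> w"
  by (drule subsetD, assumption) (simp add: doubleton_nsets)

section \<open>Partners along a trail\<close>

lemma dart_position:
  assumes "{v, w} \<in> set (el t)"
  obtains i where "Suc i < length t" "el t ! i = {v, w}" "v = t ! i" "w = t ! Suc i"
  | i where "Suc i < length t" "el t ! i = {v, w}" "v = t ! Suc i" "w = t ! i"
proof -
  obtain i where i: "i < length (el t)" "el t ! i = {v, w}" using assms by (metis in_set_conv_nth)
  then have "Suc i < length t" by simp
  moreover from nth_el[OF this] have "{t ! i, t ! Suc i} = {v, w}" using i by simp
  ultimately have "Suc i < length t" "(v = t ! i \<and> w = t ! Suc i) \<or> (v = t ! Suc i \<and> w = t ! i)"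
    by (auto simp: doubleton_eq_iff)
  then show ?thesis using that i(2) by blast
qed

text \<open>A dart \<open>(v, w)\<close> is an edge seen from its endpoint \<open>v\<close>. At an
  inner position its partner is the adjacent entry of the list; only the two end darts differ, and
  there the partner is the opposite end edge or the edge itself.\<close>

lemma dart_partner:
  assumes t: "trail_ok \<psi> t" and inv: "involutive G \<psi>" and G: "set (el t) \<subseteq> G"
    and e: "{v, w} \<in> set (el t)"
  obtains (inner_fwd) i where "Suc (Suc i) < length t" "el t ! Suc i = {v, w}" "el t ! i = {v, \<psi> v w}"
      "(v, w) = (t ! Suc i, t ! Suc (Suc i))" "\<psi> v w = t ! i"
  | (inner_bwd) i where "Suc (Suc i) < length t" "el t ! i = {v, w}" "el t ! Suc i = {v, \<psi> v w}"
      "(v, w) = (t ! Suc i, t ! i)" "\<psi> v w = t ! Suc (Suc i)"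
  | (outer) "(v, w) = (hd t, t ! 1) \<or> (v, w) = (last t, t ! (length t - 2))" "{v, \<psi> v w} \<in> set (el t)"
proof -
  have len: "2 \<le> length t" and link: "linked \<psi> t" using t by (auto simp: trail_ok_def)
  have ne: "t \<noteq> []" using len by auto
  have hd0: "hd t = t ! 0" and lastk: "last t = t ! (length t - 1)" using ne by (simp_all add: hd_conv_nth last_conv_nth)
  have lastE: "{last t, t ! (length t - 2)} \<in> set (el t)"
  proof -
    have "el t ! (length t - 2) \<in> set (el t)" using len by (intro nth_mem) simp
    moreover have "el t ! (length t - 2) = {t ! (length t - 2), t ! Suc (length t - 2)}" using len by (intro nth_el) simp
    moreover have "Suc (length t - 2) = length t - 1" using len by simp
    ultimately show ?thesis by (simp add: lastk insert_commute)
  qed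
  have hdE: "{hd t, t ! 1} \<in> set (el t)"
  proof -
    have "el t ! 0 \<in> set (el t)" using len by (intro nth_mem) simp
    moreover have "el t ! 0 = {t ! 0, t ! Suc 0}" using len by (intro nth_el) simp
    ultimately show ?thesis by (simp add: hd0)
  qed
  from e show ?thesis
  proof (cases rule: dart_position)
    case (1 i)
    show ?thesis
    proof (cases i)
      case 0
      then have vw: "v = hd t" "w = t ! 1" using 1 hd0 by auto
      have "{v, \<psi> v w} \<in> set (el t)"
        using t lastE hdE vw unfolding trail_ok_def closes_def by auto
      show ?thesis by (rule outer) (use vw \<open>{v, \<psi> v w} \<in> set (el t)\<close> in auto)
    next
      case (Suc i')
      have "\<psi> (t ! Suc i') (t ! i') = t ! Suc (Suc i')" using link 1(1) Suc by (simp add: linked_def)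
      then have p: "\<psi> v (t ! i') = w" using 1(3,4) Suc by simp
      have ei: "el t ! i' = {t ! i', v}" using nth_el[of i' t] 1(1,3) Suc by simp
      moreover have "el t ! i' \<in> set (el t)" using 1(1) Suc by (intro nth_mem) simp
      ultimately have "t ! i' \<in> nb G v" using G by (auto simp: nb_def insert_commute)
      then have "\<psi> v w = t ! i'" using p by (rule involutiveD(3)[OF inv])
      show ?thesis
      proof (rule inner_fwd[of i'])
        show "Suc (Suc i') < length t" using 1(1) Suc by simp
        show "el t ! Suc i' = {v, w}" using 1(2) Suc by simp
        show "(v, w) = (t ! Suc i', t ! Suc (Suc i'))" using 1(3,4) Suc by simp
        show "\<psi> v w = t ! i'" by fact
        then show "el t ! i' = {v, \<psi> v w}" using ei by (simp add: insert_commute)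
      qed
    qed
  next
    case (2 i)
    show ?thesis
    proof (cases "Suc (Suc i) < length t")
      case True
      then have p: "\<psi> v w = t ! Suc (Suc i)" using link 2(3,4) by (simp add: linked_def)
      show ?thesis
      proof (rule inner_bwd[of i])
        show "Suc (Suc i) < length t" by (rule True)
        show "el t ! i = {v, w}" by (rule 2(2))
        show "(v, w) = (t ! Suc i, t ! i)" using 2(3,4) by simp
        show "\<psi> v w = t ! Suc (Suc i)" by (rule p)
        show "el t ! Suc i = {v, \<psi> v w}" using nth_el[of "Suc i" t] True p 2(3) by simp
      qed
    next
      case False
      then have l: "length t = Suc (Suc i)" using 2 by simp
      then have vw: "v = last t" "w = t ! (length t - 2)" using 2 lastk by auto
      have "{v, \<psi> v w} \<in> set (el t)"
      proof (cases "closes \<psi> t")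
        case True
        have "t ! 1 \<in> nb G v" using hdE True G vw by (auto simp: nb_def closes_def)
        moreover have "hd t = last t" "\<psi> (hd t) (t ! 1) = t ! (length t - 2)"
          using True by (auto simp: closes_def)
        then have "\<psi> v (t ! 1) = w" using vw by simp
        ultimately have "\<psi> v w = t ! 1" by (rule involutiveD(3)[OF inv])
        then show ?thesis using hdE True vw by (simp add: closes_def)
      next
        case False
        then show ?thesis using t vw lastE by (simp add: trail_ok_def stops_def)
      qed
      show ?thesis by (rule outer) (use vw \<open>{v, \<psi> v w} \<in> set (el t)\<close> in auto)
    qed
  qed
qed

lemma trail_partner:
  assumes "trail_ok \<psi> t" "involutive G \<psi>" "set (el t) \<subseteq> G" "{v, w} \<in> set (el t)"
  shows "{v, \<psi> v w} \<in> set (el t)"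
  using assms
proof (cases rule: dart_partner)
  case (inner_fwd i)
  have "el t ! i \<in> set (el t)" using inner_fwd by (intro nth_mem) simp
  then show ?thesis using inner_fwd by simp
next
  case (inner_bwd i)
  have "el t ! Suc i \<in> set (el t)" using inner_bwd by (intro nth_mem) simp
  then show ?thesis using inner_bwd by simp
qed

definition cut_darts :: "graph \<Rightarrow> (nat \<Rightarrow> nat \<Rightarrow> nat) \<Rightarrow> graph \<Rightarrow> (nat \<times> nat) set" where
  "cut_darts G \<psi> S = {(v, w). {v, w} \<in> G \<and> ({v, w} \<in> S) \<noteq> ({v, \<psi> v w} \<in> S)}"

lemma nth_in_take: "distinct xs \<Longrightarrow> i < length xs \<Longrightarrow> xs ! i \<in> set (take j xs) \<longleftrightarrow> i < j"
proof
  assume d: "distinct xs" "i < length xs" and "xs ! i \<in> set (take j xs)"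
  then obtain k where "k < length (take j xs)" "take j xs ! k = xs ! i" by (metis in_set_conv_nth)
  then show "i < j" using d by (simp add: nth_eq_iff_index_eq)
next
  assume d: "distinct xs" "i < length xs" "i < j"
  have "take j xs ! i \<in> set (take j xs)" using d by (intro nth_mem) simp
  then show "xs ! i \<in> set (take j xs)" using d by simp
qed

text \<open>Cutting the list at the vertex \<open>t ! j\<close> separates the two edges that meet
  there, and on a closed trail also the first edge from the last. This gives four darts.\<close>

lemma trail_cut:
  assumes "trail_ok \<psi> t" "involutive G \<psi>" "set (el t) \<subseteq> G" "{v, w} \<in> set (el t)" "distinct (el t)"
    and "({v, w} \<in> set (take j (el t))) \<noteq> ({v, \<psi> v w} \<in> set (take j (el t)))"
  shows "(v, w) \<in> {(hd t, t ! 1), (last t, t ! (length t - 2)), (t ! j, t ! Suc j), (t ! j, t ! (j - 1))}"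
  using assms(1-4)
proof (cases rule: dart_partner)
  case (inner_fwd i)
  have "el t ! Suc i \<in> set (take j (el t)) \<longleftrightarrow> Suc i < j" "el t ! i \<in> set (take j (el t)) \<longleftrightarrow> i < j"
    using inner_fwd(1) assms(5) by (auto intro!: nth_in_take)
  then have "(Suc i < j) \<noteq> (i < j)" using assms(6) inner_fwd by simp
  then have "j = Suc i" by auto
  then show ?thesis using inner_fwd by simp
next
  case (inner_bwd i)
  have "el t ! Suc i \<in> set (take j (el t)) \<longleftrightarrow> Suc i < j" "el t ! i \<in> set (take j (el t)) \<longleftrightarrow> i < j"
    using inner_bwd(1) assms(5) by (auto intro!: nth_in_take)
  then have "(Suc i < j) \<noteq> (i < j)" using assms(6) inner_bwd by simp
  then have "j = Suc i" by auto
  then show ?thesis using inner_bwd by simp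
next
  case outer
  then show ?thesis by auto
qed

section \<open>Decomposition of an edge set into trails\<close>

lemma maximal_trail_end:
  assumes inv: "involutive G \<psi>" and GV: "G \<subseteq> nsets V 2"
    and len: "2 \<le> length t" and d: "distinct (el t)" and G: "set (el t) \<subseteq> G" and link: "linked \<psi> t"
    and max: "\<And>w. distinct (el (t @ [w])) \<Longrightarrow> set (el (t @ [w])) \<subseteq> G \<Longrightarrow> \<not> linked \<psi> (t @ [w])"
  shows "closes \<psi> t \<or> stops \<psi> t"
proof (rule ccontr)
  assume no: "\<not> ?thesis"
  define k where "k = length t - 1"
  have k: "1 \<le> k" "length t = Suc k" "length t - 2 = k - 1" using len by (auto simp: k_def)
  have ne: "t \<noteq> []" using len by auto
  define z y where "z = t ! k" and "y = t ! (k - 1)"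
  define w where "w = \<psi> z y"
  have lz: "last t = z" using ne k by (simp add: last_conv_nth z_def)
  have h0: "hd t = t ! 0" using ne by (simp add: hd_conv_nth)
  have elast: "el t ! (k - 1) = {y, z}" using nth_el[of "k - 1" t] k by (simp add: y_def z_def)
  have "el t ! (k - 1) \<in> set (el t)" using k by (intro nth_mem) simp
  then have yz: "{z, y} \<in> G" using G elast by (auto simp: insert_commute)
  then have "y \<in> nb G z" by (simp add: nb_def)
  then have wn: "w \<in> nb G z" and wy: "\<psi> z w = y" using involutiveD(1,2)[OF inv] by (simp_all add: w_def)
  have "w \<noteq> y" using no k lz by (simp add: stops_def w_def y_def)
  have "t = butlast t @ [z]" using append_butlast_last_id[OF ne] lz by simp
  then obtain bt where bt: "t = bt @ [z]" by blast
  have eap: "el (t @ [w]) = el t @ [{z, w}]"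
    using el_append[of bt z "[w]"] by (simp add: bt)
  have "linked \<psi> (t @ [w])"
    unfolding linked_def
  proof (intro allI impI)
    fix i assume i: "Suc (Suc i) < length (t @ [w])"
    show "\<psi> ((t @ [w]) ! Suc i) ((t @ [w]) ! i) = (t @ [w]) ! Suc (Suc i)"
    proof (cases "Suc (Suc i) < length t")
      case True then show ?thesis using link by (simp add: linked_def nth_append)
    next
      case False
      then have "Suc i = k" using i k by simp
      then show ?thesis using k by (auto simp: nth_append z_def y_def w_def)
    qed
  qed
  moreover have "set (el (t @ [w])) \<subseteq> G" using G wn by (simp add: eap nb_def)
  ultimately have "\<not> distinct (el (t @ [w]))" using max by blast
  \<comment> \<open>The extension can only fail because its edge is on the trail already. Its
    partner at \<open>z\<close> is the last edge \<open>{y, z}\<close>, which by involutivity and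
    distinctness excludes every place but the start of the trail, where the trail closes.\<close>
  then have "{z, w} \<in> set (el t)" using d by (simp add: eap)
  then show False
  proof (cases rule: dart_position)
    case (1 i)
    show False
    proof (cases i)
      case 0
      then have "closes \<psi> t" using 1 wy lz h0 k by (simp add: closes_def y_def)
      then show False using no by simp
    next
      case (Suc j)
      have "\<psi> (t ! Suc j) (t ! j) = t ! Suc (Suc j)" using link 1 Suc by (simp add: linked_def)
      then have p: "\<psi> z (t ! j) = w" using 1 Suc by simp
      have ej: "el t ! j = {t ! j, z}" using nth_el[of j t] 1 Suc by simp
      moreover have "el t ! j \<in> set (el t)" using 1 Suc by (intro nth_mem) simp
      ultimately have "t ! j \<in> nb G z" using G by (auto simp: nb_def insert_commute)
      then have "\<psi> z w = t ! j" using p by (rule involutiveD(3)[OF inv])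
      then have "el t ! j = el t ! (k - 1)" using ej elast wy by simp
      moreover have "j < length (el t)" "k - 1 < length (el t)" using 1 Suc k by simp_all
      ultimately have "j = k - 1" using d by (simp add: nth_eq_iff_index_eq)
      then show False using 1 Suc k by simp
    qed
  next
    case (2 i)
    show False
    proof (cases "Suc i = k")
      case True
      then show False using 2 \<open>w \<noteq> y\<close> by (auto simp: y_def)
    next
      case False
      then have i: "Suc (Suc i) < length t" using 2 k by simp
      then have "\<psi> z w = t ! Suc (Suc i)" using link 2 by (simp add: linked_def)
      then have "el t ! Suc i = {z, y}" using nth_el[of "Suc i" t] i 2 wy by simp
      then have "el t ! Suc i = el t ! (k - 1)" using elast by (simp add: insert_commute)
      moreover have "Suc i < length (el t)" "k - 1 < length (el t)" using i k by simp_all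
      ultimately have "Suc i = k - 1" using d by (simp add: nth_eq_iff_index_eq)
      then have "z = y" using 2 by (simp add: y_def)
      then show False using loopless[OF GV yz] by simp
    qed
  qed
qed

lemma linked_rev:
  assumes inv: "involutive G \<psi>" and G: "set (el t) \<subseteq> G" and link: "linked \<psi> t"
  shows "linked \<psi> (rev t)"
  unfolding linked_def
proof (intro allI impI)
  fix i assume i: "Suc (Suc i) < length (rev t)"
  define j where "j = length t - Suc (Suc (Suc i))"
  have j: "Suc (Suc j) < length t" using i by (simp add: j_def)
  have r: "rev t ! i = t ! Suc (Suc j)" "rev t ! Suc i = t ! Suc j" "rev t ! Suc (Suc i) = t ! j"
    using i by (auto simp: rev_nth j_def Suc_diff_Suc)
  have "el t ! j \<in> set (el t)" using j by (intro nth_mem) simp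
  then have "t ! j \<in> nb G (t ! Suc j)" using G nth_el[of j t] j by (auto simp: nb_def insert_commute)
  moreover have "\<psi> (t ! Suc j) (t ! j) = t ! Suc (Suc j)" using link j by (simp add: linked_def)
  ultimately show "\<psi> (rev t ! Suc i) (rev t ! i) = rev t ! Suc (Suc i)"
    unfolding r using involutiveD(3)[OF inv] by blast
qed

text \<open>A longest linked trail cannot be extended at either end, the second end being treated by
  reversal. It contains the partners of all its edges, so the pairing stays involutive on the
  remaining edges and induction applies.\<close>

lemma decomp_exists:
  assumes "finite G" "G \<subseteq> nsets V 2" "involutive G \<psi>"
  shows "\<exists>Ts. decomp \<psi> G Ts"
  using assms
proof (induction "card G" arbitrary: G rule: less_induct)
  case less
  show ?case
  proof (cases "G = {}")
    case True
    then show ?thesis by (intro exI[of _ "[]"]) (simp add: decomp_def)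
  next
    case False
    define pre where "pre t \<longleftrightarrow> 2 \<le> length t \<and> distinct (el t) \<and> set (el t) \<subseteq> G \<and> linked \<psi> t" for t
    obtain e where e: "e \<in> G" using False by auto
    then obtain a b where ab: "e = {a, b}" using less.prems(2) by (meson nsets2E subsetD)
    have p0: "pre [a, b]" using e ab by (simp add: pre_def linked_def)
    have bound: "length t \<le> Suc (card G)" if "pre t" for t
    proof -
      have "length (el t) = card (set (el t))"
        using that by (simp only: pre_def distinct_card)
      also have "\<dots> \<le> card G" using that less.prems(1) by (intro card_mono) (auto simp: pre_def)
      finally show ?thesis by simp
    qed
    have "\<exists>t. pre t \<and> (\<forall>s. pre s \<longrightarrow> length s \<le> length t)"
      by (rule Lattices_Big.ex_has_greatest_nat[where k = "[a, b]" and b = "Suc (Suc (card G))"])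
        (use p0 bound le_imp_less_Suc in blast)+
    then obtain t where t: "pre t" and mx: "\<And>s. pre s \<Longrightarrow> length s \<le> length t" by blast
    have t': "2 \<le> length t" "distinct (el t)" "set (el t) \<subseteq> G" "linked \<psi> t" using t by (auto simp: pre_def)
    have max: "\<not> linked \<psi> (s @ [w])"
      if "pre s" "length s = length t" "distinct (el (s @ [w]))" "set (el (s @ [w])) \<subseteq> G" for s w
    proof
      assume "linked \<psi> (s @ [w])"
      then have "pre (s @ [w])" using that by (simp add: pre_def)
      then show False using mx[of "s @ [w]"] that(2) by simp
    qed
    have end1: "closes \<psi> t \<or> stops \<psi> t"
      by (rule maximal_trail_end[OF less.prems(3,2) t']) (use max t in blast)
    have rp: "pre (rev t)" using t' linked_rev[OF less.prems(3) t'(3,4)] by (simp add: pre_def el_rev)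
    then have rp': "2 \<le> length (rev t)" "distinct (el (rev t))" "set (el (rev t)) \<subseteq> G" "linked \<psi> (rev t)"
      by (auto simp: pre_def)
    have end2: "closes \<psi> (rev t) \<or> stops \<psi> (rev t)"
      by (rule maximal_trail_end[OF less.prems(3,2) rp']) (use max[OF rp] in simp)
    have ne: "t \<noteq> []" using t' by auto
    have r1: "rev t ! 1 = t ! (length t - 2)" "rev t ! (length t - 2) = t ! 1"
      using t'(1) by (simp_all add: rev_nth Suc_diff_Suc numeral_2_eq_2)
    have ok: "trail_ok \<psi> t"
    proof (cases "closes \<psi> t")
      case True then show ?thesis using t' by (simp add: trail_ok_def)
    next
      case False
      have "\<not> closes \<psi> (rev t)"
      proof
        assume "closes \<psi> (rev t)"
        then have c: "hd t = last t" "\<psi> (hd t) (t ! (length t - 2)) = t ! 1"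
          using r1 ne by (auto simp: closes_def hd_rev last_rev)
        have "el t ! (length t - 2) \<in> set (el t)" using t' by (intro nth_mem) simp
        moreover have "el t ! (length t - 2) = {t ! (length t - 2), t ! (length t - 1)}"
          using t'(1) nth_el[of "length t - 2" t] by (simp add: Suc_diff_Suc numeral_2_eq_2)
        ultimately have "t ! (length t - 2) \<in> nb G (hd t)"
          using t'(3) c(1) ne by (auto simp: nb_def last_conv_nth insert_commute)
        then have "\<psi> (hd t) (t ! 1) = t ! (length t - 2)" using c(2) by (rule involutiveD(3)[OF less.prems(3)])
        then show False using False c by (simp add: closes_def)
      qed
      then have "stops \<psi> (rev t)" using end2 by blast
      then have "\<psi> (hd t) (t ! 1) = t ! 1" using r1 ne by (simp add: stops_def last_rev)
      then show ?thesis using end1 False t' by (simp add: trail_ok_def)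
    qed
    let ?G' = "G - set (el t)"
    have "el t ! 0 \<in> set (el t)" using t' by (intro nth_mem) simp
    then have "card ?G' < card G" using t'(3) less.prems(1) by (intro psubset_card_mono) auto
    moreover have "involutive ?G' \<psi>"
      unfolding involutive_def
    proof (intro allI ballI)
      fix v w assume w: "w \<in> nb ?G' v"
      then have w': "w \<in> nb G v" by (simp add: nb_def)
      note p = involutiveD(1,2)[OF less.prems(3) w']
      have "{v, \<psi> v w} \<notin> set (el t)"
        using trail_partner[OF ok less.prems(3) t'(3), of v "\<psi> v w"] p w by (auto simp: nb_def)
      then show "\<psi> v w \<in> nb ?G' v \<and> \<psi> v (\<psi> v w) = w" using p by (simp add: nb_def)
    qed
    ultimately obtain Ts where Ts: "decomp \<psi> ?G' Ts"
      using less.hyps[of ?G'] less.prems(1,2) by blast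
    have "decomp \<psi> G (t # Ts)"
      using Ts ok t'(2,3) unfolding decomp_def by auto
    then show ?thesis by blast
  qed
qed

section \<open>Pairs separated by prefixes of the edge list\<close>

lemma take_concat_split:
  "Ls \<noteq> [] \<Longrightarrow> \<exists>A x B j. Ls = A @ x # B \<and> take b (concat Ls) = concat A @ take j x"
proof (induction Ls arbitrary: b)
  case (Cons x xs)
  show ?case
  proof (cases "xs = [] \<or> b \<le> length x")
    case True
    then have "x # xs = [] @ x # xs \<and> take b (concat (x # xs)) = concat [] @ take b x" by auto
    then show ?thesis by blast
  next
    case False
    then obtain A y B j where *: "xs = A @ y # B" "take (b - length x) (concat xs) = concat A @ take j y"
      using Cons.IH[of "b - length x"] by blast
    have "x # xs = (x # A) @ y # B \<and> take b (concat (x # xs)) = concat (x # A) @ take j y"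
      using False * by simp
    then show ?thesis by blast
  qed
qed simp

lemma decomp_trail:
  assumes "decomp \<psi> G Ts" "e \<in> G"
  obtains t where "t \<in> set Ts" "e \<in> set (el t)"
  using assms unfolding decomp_def by auto

lemma decomp_trailD:
  assumes "decomp \<psi> G Ts" "t \<in> set Ts"
  shows "trail_ok \<psi> t" "set (el t) \<subseteq> G" "distinct (el t)"
  using assms unfolding decomp_def by (auto dest!: split_list)

text \<open>A prefix contains each trail entirely or not at all, except for one trail that it may
  cut. Trails are closed under partners, so only that one contributes, by
  \<open>trail_cut\<close>.\<close>

lemma cut_prefix:
  assumes D: "decomp \<psi> G Ts" and inv: "involutive G \<psi>"
  shows "finite (cut_darts G \<psi> (set (take b (concat (map el Ts))))) \<and>
    card (cut_darts G \<psi> (set (take b (concat (map el Ts))))) \<le> 4"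
proof (cases "Ts = []")
  case True
  then show ?thesis by (simp add: cut_darts_def)
next
  case False
  let ?S = "set (take b (concat (map el Ts)))"
  obtain A x B j where AB: "map el Ts = A @ x # B" "take b (concat (map el Ts)) = concat A @ take j x"
    using take_concat_split[of "map el Ts" b] False by auto
  from AB(1) obtain Ts1 Ts' where T1: "Ts = Ts1 @ Ts'" "A = map el Ts1" "x # B = map el Ts'"
    by (auto simp: map_eq_append_conv)
  then obtain t Ts2 where T2: "Ts' = t # Ts2" "x = el t" by (cases Ts') auto
  have Ts: "Ts = Ts1 @ t # Ts2" using T1 T2 by simp
  have S: "?S = set (concat (map el Ts1)) \<union> set (take j (el t))" unfolding AB(2) using T1 T2 by simp
  have dist: "set (concat (map el Ts1)) \<inter> set (el t) = {}" "set (concat (map el Ts1)) \<inter> set (concat (map el Ts2)) = {}"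
    "set (el t) \<inter> set (concat (map el Ts2)) = {}"
    using D unfolding decomp_def Ts by auto
  note tD = decomp_trailD[OF D, of t]
  let ?C = "{(hd t, t ! 1), (last t, t ! (length t - 2)), (t ! j, t ! Suc j), (t ! j, t ! (j - 1))}"
  have sub: "cut_darts G \<psi> ?S \<subseteq> ?C"
  proof (intro subsetI)
    fix p assume "p \<in> cut_darts G \<psi> ?S"
    then obtain v w where p: "p = (v, w)" "{v, w} \<in> G" and ne: "({v, w} \<in> ?S) \<noteq> ({v, \<psi> v w} \<in> ?S)"
      by (auto simp: cut_darts_def)
    obtain t' where t': "t' \<in> set Ts" "{v, w} \<in> set (el t')" using decomp_trail[OF D p(2)] by blast
    have pt: "{v, \<psi> v w} \<in> set (el t')"
      by (rule trail_partner[OF decomp_trailD(1)[OF D t'(1)] inv decomp_trailD(2)[OF D t'(1)] t'(2)])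
    have tt: "set (take j (el t)) \<subseteq> set (el t)" by (rule set_take_subset)
    consider "t' \<in> set Ts1" | "t' = t" | "t' \<in> set Ts2" using t'(1) Ts by auto
    then show "p \<in> ?C"
    proof cases
      case 1
      then have "{v, w} \<in> ?S" "{v, \<psi> v w} \<in> ?S" unfolding S using t'(2) pt by auto
      then show ?thesis using ne by simp
    next
      case 2
      have "{v, w} \<notin> set (concat (map el Ts1))" "{v, \<psi> v w} \<notin> set (concat (map el Ts1))"
        using dist(1) t'(2) pt 2 by auto
      then have "({v, w} \<in> set (take j (el t))) \<noteq> ({v, \<psi> v w} \<in> set (take j (el t)))" using ne unfolding S by simp
      then show ?thesis
        unfolding p using trail_cut[OF tD(1) inv tD(2) _ tD(3)] t'(2) 2 Ts by simp
    next
      case 3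
      then have "{v, w} \<in> set (concat (map el Ts2))" "{v, \<psi> v w} \<in> set (concat (map el Ts2))"
        using t'(2) pt by auto
      then have "{v, w} \<notin> ?S" "{v, \<psi> v w} \<notin> ?S" unfolding S using dist(2,3) tt by auto
      then show ?thesis using ne by simp
    qed
  qed
  have f: "finite ?C" "card ?C \<le> 4" by (auto simp: card_insert_if)
  show ?thesis
    using finite_subset[OF sub f(1)] le_trans[OF card_mono[OF f(1) sub] f(2)] by (rule conjI)
qed

lemma cut_ps:
  assumes D: "decomp \<psi> G Ts" and inv: "involutive G \<psi>"
  shows "finite (cut_darts G \<psi> (prefix_flip (concat (map el Ts)) bs)) \<and>
    card (cut_darts G \<psi> (prefix_flip (concat (map el Ts)) bs)) \<le> 4 * length bs"
proof (induction bs)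
  case Nil
  show ?case by (simp add: cut_darts_def)
next
  case (Cons b bs)
  let ?A = "cut_darts G \<psi> (set (take b (concat (map el Ts))))" and ?B = "cut_darts G \<psi> (prefix_flip (concat (map el Ts)) bs)"
  have sub: "cut_darts G \<psi> (prefix_flip (concat (map el Ts)) (b # bs)) \<subseteq> ?A \<union> ?B"
    unfolding cut_darts_def by auto
  have A: "finite ?A" "card ?A \<le> 4" using cut_prefix[OF D inv, of b] by auto
  have "card (?A \<union> ?B) \<le> 4 + 4 * length bs" using card_Un_le[of ?A ?B] A Cons by linarith
  moreover have f: "finite (?A \<union> ?B)" using A Cons by blast
  ultimately show ?case using finite_subset[OF sub f] card_mono[OF f sub] by simp
qed

text \<open>An unpaired edge is its own partner and therefore counts as a defect.\<close>

definition defects :: "graph \<Rightarrow> graph \<Rightarrow> (nat \<Rightarrow> nat \<Rightarrow> nat) \<Rightarrow> nat \<Rightarrow> nat set" where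
  "defects G X \<psi> v = {w \<in> nb G v. ({v, w} \<in> X) = ({v, \<psi> v w} \<in> X)}"

lemma defects_flip: "defects G (sd X S) \<psi> v \<subseteq> defects G X \<psi> v \<union> {w. (v, w) \<in> cut_darts G \<psi> S}"
  unfolding defects_def cut_darts_def nb_def by auto

section \<open>Degrees after flipping a set closed under partners\<close>

lemma nb_graph: "G \<in> graphs n \<Longrightarrow> nb G v \<subseteq> {1..n}"
  unfolding nb_def graphs_def by (auto simp: doubleton_nsets dest!: subsetD)

lemma nb_graph_self: "G \<in> graphs n \<Longrightarrow> v \<notin> nb G v"
  unfolding nb_def graphs_def by (auto simp: nsets_def dest!: subsetD)

lemma finite_nb: "G \<in> graphs n \<Longrightarrow> finite (nb G v)"
  using finite_subset[OF nb_graph] by blast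

lemma nb_outside: "G \<in> graphs n \<Longrightarrow> v \<notin> {1..n} \<Longrightarrow> nb G v = {}"
  unfolding nb_def graphs_def by (auto simp: doubleton_nsets dest!: subsetD)

lemma deg_nb: "G \<in> graphs n \<Longrightarrow> deg G v = card (nb G v)"
proof -
  assume G: "G \<in> graphs n"
  have "bij_betw (\<lambda>w. {v, w}) (nb G v) {e \<in> G. v \<in> e}"
    unfolding bij_betw_def
  proof
    show "inj_on (\<lambda>w. {v, w}) (nb G v)" by (auto simp: inj_on_def doubleton_eq_iff)
    show "(\<lambda>w. {v, w}) ` nb G v = {e \<in> G. v \<in> e}"
    proof (intro equalityI subsetI)
      fix e assume e: "e \<in> {e \<in> G. v \<in> e}"
      then have "e \<in> nsets {1..n} 2" using G by (auto simp: graphs_def)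
      then obtain a b where "e = {a, b}" by (rule nsets2E)
      then have "e = {v, a} \<or> e = {v, b}" using e by auto
      then show "e \<in> (\<lambda>w. {v, w}) ` nb G v" using e by (auto simp: nb_def)
    qed (auto simp: nb_def)
  qed
  then show ?thesis unfolding deg_def by (simp add: bij_betw_same_card)
qed

lemma nb_sd: "nb (sd X S) v = sd (nb X v) (nb S v)"
  by (auto simp: nb_def)

text \<open>Flipping a part of \<open>sd X Y\<close> in both graphs exchanges edges between them, so
  that union and intersection of the two neighbourhoods stay the same.\<close>

lemma deg_sum:
  assumes "X \<in> graphs n" "Y \<in> graphs n" "S \<subseteq> sd X Y"
  shows "deg (sd X S) v + deg (sd Y S) v = deg X v + deg Y v"
proof -
  have "sd X Y \<subseteq> nsets {1..n} 2" using assms(1,2) by (intro sd_subset) (simp_all add: graphs_def)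
  with assms(3) have S: "S \<subseteq> nsets {1..n} 2" by (rule subset_trans)
  have g: "sd X S \<in> graphs n" "sd Y S \<in> graphs n" using graphs_sd[OF assms(1) S] graphs_sd[OF assms(2) S] .
  have f: "finite (nb X v)" "finite (nb Y v)" using finite_nb assms by blast+
  have sub: "nb S v \<subseteq> sd (nb X v) (nb Y v)" using assms(3) by (auto simp: nb_def)
  have eqs: "card (nb (sd X S) v \<union> nb (sd Y S) v) + card (nb (sd X S) v \<inter> nb (sd Y S) v)
      = card (nb (sd X S) v) + card (nb (sd Y S) v)"
    "card (nb X v \<union> nb Y v) + card (nb X v \<inter> nb Y v) = card (nb X v) + card (nb Y v)"
    using card_Un_Int[OF finite_nb[OF g(1)] finite_nb[OF g(2)]] card_Un_Int[OF f] by simp_all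
  have "nb (sd X S) v \<union> nb (sd Y S) v = nb X v \<union> nb Y v" "nb (sd X S) v \<inter> nb (sd Y S) v = nb X v \<inter> nb Y v"
    unfolding nb_sd using sub by auto
  then show ?thesis using eqs g assms(1,2) by (simp add: deg_nb)
qed

text \<open>On the paired edges of \<open>S\<close> at \<open>v\<close> the partner map is a
  bijection between those in \<open>X\<close> and those outside, so they leave the degree alone.
  Only the unpaired ones count.\<close>

lemma flip_degree:
  assumes X: "X \<in> graphs n" and inv: "involutive G \<psi>" and SG: "S \<subseteq> G" and G: "G \<subseteq> nsets {1..n} 2"
    and closed: "\<And>w. w \<in> nb S v \<Longrightarrow> \<psi> v w \<in> nb S v"
    and alt: "\<And>w. w \<in> nb G v \<Longrightarrow> \<psi> v w \<noteq> w \<Longrightarrow> ({v, w} \<in> X) \<noteq> ({v, \<psi> v w} \<in> X)"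
  shows "int (deg (sd X S) v) = int (deg X v) - int (card {w \<in> nb S v. \<psi> v w = w \<and> {v, w} \<in> X})
    + int (card {w \<in> nb S v. \<psi> v w = w \<and> {v, w} \<notin> X})"
proof -
  have SV: "S \<subseteq> nsets {1..n} 2" using SG G by blast
  have Sg: "S \<in> graphs n" using SV by (simp add: graphs_def)
  let ?A = "nb X v" and ?N = "nb S v"
  have fA: "finite ?A" and fN: "finite ?N" using finite_nb X Sg by blast+
  let ?R = "{w \<in> ?N. \<psi> v w \<noteq> w \<and> {v, w} \<in> X}" and ?B = "{w \<in> ?N. \<psi> v w \<noteq> w \<and> {v, w} \<notin> X}"
  let ?FR = "{w \<in> ?N. \<psi> v w = w \<and> {v, w} \<in> X}" and ?FB = "{w \<in> ?N. \<psi> v w = w \<and> {v, w} \<notin> X}"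
  have NG: "w \<in> nb G v" if "w \<in> ?N" for w using that SG by (auto simp: nb_def)
  have pp: "\<psi> v (\<psi> v w) = w" if "w \<in> ?N" for w using involutiveD(2)[OF inv NG[OF that]] .
  have "bij_betw (\<psi> v) ?R ?B"
  proof (rule bij_betw_byWitness[where f' = "\<psi> v"])
    show "\<forall>a\<in>?R. \<psi> v (\<psi> v a) = a" "\<forall>a\<in>?B. \<psi> v (\<psi> v a) = a" using pp by auto
    have flip: "\<psi> v w \<in> ?N" "\<psi> v (\<psi> v w) \<noteq> \<psi> v w" "({v, w} \<in> X) \<noteq> ({v, \<psi> v w} \<in> X)"
      if "w \<in> ?N" "\<psi> v w \<noteq> w" for w
      using closed[OF that(1)] pp[OF that(1)] that(2) alt[OF NG[OF that(1)] that(2)] by simp_all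
    show "\<psi> v ` ?R \<subseteq> ?B" "\<psi> v ` ?B \<subseteq> ?R" using flip by blast+
  qed
  then have RB: "card ?R = card ?B" by (rule bij_betw_same_card)
  have "?N \<inter> ?A = ?R \<union> ?FR" "?R \<inter> ?FR = {}" by (auto simp: nb_def)
  then have c1: "card (?N \<inter> ?A) = card ?R + card ?FR" using fN by (simp add: card_Un_disjoint)
  have "?N - ?A = ?B \<union> ?FB" "?B \<inter> ?FB = {}" by (auto simp: nb_def)
  then have c2: "card (?N - ?A) = card ?B + card ?FB" using fN by (simp add: card_Un_disjoint)
  have "nb (sd X S) v = (?A - ?N) \<union> (?N - ?A)" unfolding nb_sd by auto
  moreover have "(?A - ?N) \<inter> (?N - ?A) = {}" by auto
  ultimately have "card (nb (sd X S) v) = card (?A - ?N) + card (?N - ?A)"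
    using fA fN card_Un_disjoint[of "?A - ?N" "?N - ?A"] by simp
  moreover have "card ?A = card (?A - ?N) + card (?N \<inter> ?A)"
  proof -
    have "?A = (?A - ?N) \<union> (?N \<inter> ?A)" "(?A - ?N) \<inter> (?N \<inter> ?A) = {}" by auto
    then show ?thesis using fA fN card_Un_disjoint[of "?A - ?N" "?N \<inter> ?A"] by simp
  qed
  ultimately show ?thesis
    using c1 c2 RB deg_nb[OF X] deg_nb[OF graphs_sd[OF X SV]] by simp
qed

text \<open>Off the neighbourhoods the values are pinned to the identity, and outside
  \<open>{1..n}\<close> to \<open>undefined\<close>, so that the set is a finite product over the
  vertices.\<close>

definition pairings :: "nat \<Rightarrow> graph \<Rightarrow> (nat \<Rightarrow> nat \<Rightarrow> nat) set" where
  "pairings n G = (\<Pi>\<^sub>E v\<in>{1..n}. {p. (\<forall>w\<in>nb G v. p w \<in> nb G v \<and> p (p w) = w) \<and> (\<forall>w. w \<notin> nb G v \<longrightarrow> p w = w)})"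

lemma pairings_involutive: "\<psi> \<in> pairings n G \<Longrightarrow> G \<in> graphs n \<Longrightarrow> involutive G \<psi>"
  unfolding involutive_def
proof (intro allI ballI)
  fix v w assume p: "\<psi> \<in> pairings n G" and G: "G \<in> graphs n" and w: "w \<in> nb G v"
  have v: "v \<in> {1..n}" using nb_outside[OF G, of v] w by blast
  then have "\<psi> v \<in> {p. (\<forall>w\<in>nb G v. p w \<in> nb G v \<and> p (p w) = w) \<and> (\<forall>w. w \<notin> nb G v \<longrightarrow> p w = w)}"
    using PiE_mem[OF p[unfolded pairings_def] v] by simp
  then show "\<psi> v w \<in> nb G v \<and> \<psi> v (\<psi> v w) = w" using w by simp
qed

text \<open>With truncated subtraction the sum is the absolute difference of the two degrees, the
  least possible number of edges left over at \<open>v\<close>. All defects are unpaired edges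
  rather than pairs of one colour.\<close>

definition good_pairings :: "nat \<Rightarrow> graph \<Rightarrow> graph \<Rightarrow> (nat \<Rightarrow> nat \<Rightarrow> nat) set" where
  "good_pairings n X Y = {\<psi> \<in> pairings n (sd X Y). \<forall>v\<in>{1..n}. \<forall>w\<in>defects (sd X Y) X \<psi> v. \<psi> v w = w} \<inter>
     {\<psi>. \<forall>v\<in>{1..n}. card (defects (sd X Y) X \<psi> v) = (deg X v - deg Y v) + (deg Y v - deg X v)}"

lemma sd_graphs: "X \<in> graphs n \<Longrightarrow> Y \<in> graphs n \<Longrightarrow> sd X Y \<in> graphs n"
  by (auto simp: graphs_def)

lemma good_alt:
  assumes "\<psi> \<in> good_pairings n X Y" "X \<in> graphs n" "Y \<in> graphs n" "w \<in> nb (sd X Y) v" "\<psi> v w \<noteq> w"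
  shows "({v, w} \<in> X) \<noteq> ({v, \<psi> v w} \<in> X)"
proof -
  have "v \<in> {1..n}" using nb_outside[OF sd_graphs[OF assms(2,3)], of v] assms(4) by blast
  then have "w \<notin> defects (sd X Y) X \<psi> v" using assms(1,5) by (auto simp: good_pairings_def)
  then show ?thesis using assms(4) by (simp add: defects_def)
qed

text \<open>The unpaired edges are as many as the degrees differ, so all of them belong to the graph
  with more edges at \<open>v\<close>. A set closed under partners thus moves the degree from that
  of \<open>X\<close> towards that of \<open>Y\<close>, by one for each unpaired edge it
  contains.\<close>

lemma good_flip:
  assumes \<psi>: "\<psi> \<in> good_pairings n X Y" and X: "X \<in> graphs n" and Y: "Y \<in> graphs n"
    and S: "S \<subseteq> sd X Y" and closed: "\<And>w. w \<in> nb S v \<Longrightarrow> \<psi> v w \<in> nb S v" and v: "v \<in> {1..n}"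
  defines "f \<equiv> card {w \<in> nb S v. \<psi> v w = w}"
  shows "if deg Y v \<le> deg X v then deg (sd X S) v + f = deg X v \<and> deg (sd X S) v \<ge> deg Y v
     else deg (sd X S) v = deg X v + f \<and> deg (sd X S) v \<le> deg Y v"
proof -
  let ?G = "sd X Y"
  have Gg: "?G \<in> graphs n" by (rule sd_graphs[OF X Y])
  have GV: "?G \<subseteq> nsets {1..n} 2" using Gg by (simp add: graphs_def)
  have inv: "involutive ?G \<psi>" using \<psi> Gg pairings_involutive by (auto simp: good_pairings_def)
  note alt = good_alt[OF \<psi> X Y]
  let ?F = "{w \<in> nb ?G v. \<psi> v w = w}"
  have fin: "finite (nb ?G v)" by (rule finite_nb[OF Gg])
  have dF: "defects ?G X \<psi> v = ?F" using \<psi> v alt by (auto simp: defects_def good_pairings_def)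
  have cF: "card ?F = (deg X v - deg Y v) + (deg Y v - deg X v)"
    using \<psi> v unfolding dF[symmetric] by (simp add: good_pairings_def)
  let ?FR = "{w \<in> nb ?G v. \<psi> v w = w \<and> {v, w} \<in> X}" and ?FB = "{w \<in> nb ?G v. \<psi> v w = w \<and> {v, w} \<notin> X}"
  let ?SR = "{w \<in> nb S v. \<psi> v w = w \<and> {v, w} \<in> X}" and ?SB = "{w \<in> nb S v. \<psi> v w = w \<and> {v, w} \<notin> X}"
  have g1: "int (deg (sd X ?G) v) = int (deg X v) - int (card ?FR) + int (card ?FB)"
    by (rule flip_degree[OF X inv order_refl GV involutiveD(1)[OF inv] alt])
  have g2: "int (deg (sd X S) v) = int (deg X v) - int (card ?SR) + int (card ?SB)"
    by (rule flip_degree[OF X inv S GV closed alt])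
  have "?F = ?FR \<union> ?FB" "?FR \<inter> ?FB = {}" by auto
  then have cs: "card ?F = card ?FR + card ?FB" using fin by (simp add: card_Un_disjoint)
  have Ssub: "nb S v \<subseteq> nb ?G v" using S by (auto simp: nb_def)
  have finS: "finite (nb S v)" using Ssub fin by (rule finite_subset)
  have "{w \<in> nb S v. \<psi> v w = w} = ?SR \<union> ?SB" "?SR \<inter> ?SB = {}" by auto
  then have fs: "f = card ?SR + card ?SB" unfolding f_def using finS by (simp add: card_Un_disjoint)
  have le: "card ?SR \<le> card ?FR" "card ?SB \<le> card ?FB" using Ssub fin by (auto intro!: card_mono)
  have "sd X ?G = Y" by simp
  then have g1': "int (deg Y v) = int (deg X v) - int (card ?FR) + int (card ?FB)" using g1 by simp
  show ?thesis
  proof (cases "deg Y v \<le> deg X v")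
    case True
    then have "card ?FB = 0" using g1' cs cF by linarith
    then show ?thesis using True le g2 g1' fs by simp
  next
    case False
    then have "card ?FR = 0" using g1' cs cF by linarith
    then show ?thesis using False le g2 g1' fs by simp
  qed
qed

text \<open>Consecutive edges are distinct, hence genuine partners, and those differ in colour. If
  the trail closes, its first and last edges are partners too; a closed trail of one edge would be a
  loop.\<close>

lemma trail_alts:
  assumes t: "trail_ok \<psi> t" and d: "distinct (el t)" and G: "set (el t) \<subseteq> G"
    and alt: "\<And>v w. w \<in> nb G v \<Longrightarrow> \<psi> v w \<noteq> w \<Longrightarrow> ({v, w} \<in> X) \<noteq> ({v, \<psi> v w} \<in> X)"
  shows "alts X (el t ! 0 \<in> X) (el t)"
    and "closes \<psi> t \<Longrightarrow> G \<subseteq> nsets V 2 \<Longrightarrow> even (length (el t))"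
proof -
  have len: "2 \<le> length t" and link: "linked \<psi> t" using t by (auto simp: trail_ok_def)
  have step: "(el t ! Suc i \<in> X) \<noteq> (el t ! i \<in> X)" if "Suc i < length (el t)" for i
  proof -
    have i: "Suc (Suc i) < length t" using that by simp
    have e1: "el t ! i = {t ! Suc i, t ! i}" using nth_el[of i t] i by (simp add: insert_commute)
    have e2: "el t ! Suc i = {t ! Suc i, t ! Suc (Suc i)}" using nth_el[of "Suc i" t] i by simp
    have p: "\<psi> (t ! Suc i) (t ! i) = t ! Suc (Suc i)" using link i by (simp add: linked_def)
    have "el t ! i \<noteq> el t ! Suc i" using d that by (simp add: nth_eq_iff_index_eq)
    then have ne: "\<psi> (t ! Suc i) (t ! i) \<noteq> t ! i" using e1 e2 p by auto
    have "el t ! i \<in> set (el t)" using that by (intro nth_mem) simp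
    then have "t ! i \<in> nb G (t ! Suc i)" using G e1 by (auto simp: nb_def)
    from alt[OF this ne] show ?thesis using e1 e2 p by auto
  qed
  have main: "i < length (el t) \<Longrightarrow> el t ! i \<in> X \<longleftrightarrow> even i = (el t ! 0 \<in> X)" for i
  proof (induction i)
    case (Suc i)
    then show ?case using step[of i] by (cases "el t ! 0 \<in> X") auto
  qed simp
  show "alts X (el t ! 0 \<in> X) (el t)" unfolding alts_nth using main by blast
  assume c: "closes \<psi> t" and GV: "G \<subseteq> nsets V 2"
  define k where "k = length t - 2"
  have k: "length t = Suc (Suc k)" "length (el t) = Suc k" using len by (auto simp: k_def)
  have ne: "t \<noteq> []" using len by auto
  have h0: "hd t = t ! 0" "last t = t ! Suc k" using ne k by (simp_all add: hd_conv_nth last_conv_nth)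
  have e0: "el t ! 0 = {hd t, t ! 1}" using nth_el[of 0 t] k h0 by simp
  have ek: "el t ! k = {hd t, t ! k}" using nth_el[of k t] k h0 c by (simp add: closes_def insert_commute)
  have m0: "el t ! 0 \<in> set (el t)" using k by (intro nth_mem) simp
  then have n0: "t ! 1 \<in> nb G (hd t)" using G e0 by (auto simp: nb_def)
  have "k \<noteq> 0"
  proof
    assume "k = 0"
    then have "t ! 1 = hd t" using c h0 by (simp add: closes_def)
    then show False using loopless[OF GV, of "hd t" "t ! 1"] n0 by (simp add: nb_def)
  qed
  then have "el t ! 0 \<noteq> el t ! k" using d k by (simp add: nth_eq_iff_index_eq)
  then have "\<psi> (hd t) (t ! 1) \<noteq> t ! 1" using c e0 ek k by (auto simp: closes_def)
  note a0 = alt[OF n0 this]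
  have p: "\<psi> (hd t) (t ! 1) = t ! k" using c unfolding closes_def k_def by (rule conjunct2)
  have "(el t ! 0 \<in> X) \<noteq> (el t ! k \<in> X)" using a0 unfolding p e0 ek .
  then have "odd k" using main[of k] k by (cases "el t ! 0 \<in> X") auto
  then show "even (length (el t))" using k by simp
qed

section \<open>Counting pairings\<close>

lemma card_small_subsets:
  assumes "finite N"
  shows "finite {F. F \<subseteq> N \<and> card F \<le> m}" "card {F. F \<subseteq> N \<and> card F \<le> m} \<le> (card N + 1) ^ m"
proof -
  \<comment> \<open>Lists of length exactly \<open>m\<close>, with \<open>None\<close> as filler for
    smaller sets.\<close>
  let ?L = "{xs. set xs \<subseteq> insert None (Some ` N) \<and> length xs = m}"
  have sub: "{F. F \<subseteq> N \<and> card F \<le> m} \<subseteq> (\<lambda>xs. the ` (set xs - {None})) ` ?L"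
  proof
    fix F assume F: "F \<in> {F. F \<subseteq> N \<and> card F \<le> m}"
    then have "finite F" using assms finite_subset by blast
    from finite_distinct_list[OF this] obtain ys where "set ys = F" "distinct ys" by blast
    then have ys: "set ys = F" "length ys = card F" using distinct_card[of ys] by auto
    let ?xs = "map Some ys @ replicate (m - card F) None"
    have "?xs \<in> ?L" using F ys by auto
    moreover have "the ` (set ?xs - {None}) = F" using ys by force
    ultimately show "F \<in> (\<lambda>xs. the ` (set xs - {None})) ` ?L"
      by (intro image_eqI[of _ _ ?xs]) simp_all
  qed
  have fin: "finite ?L" using assms by (intro finite_lists_length_eq) simp
  show "finite {F. F \<subseteq> N \<and> card F \<le> m}" using finite_subset[OF sub] fin by blast
  have "card {F. F \<subseteq> N \<and> card F \<le> m} \<le> card ?L" using surj_card_le[OF fin sub] .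
  also have "\<dots> = card (insert None (Some ` N)) ^ m" using assms by (intro card_lists_length_eq) simp
  also have "card (insert None (Some ` N)) = card N + 1" using assms by (simp add: card_image)
  finally show "card {F. F \<subseteq> N \<and> card F \<le> m} \<le> (card N + 1) ^ m" .
qed

section \<open>Involutions of a two-coloured set with few monochromatic points\<close>

definition involutions :: "'a set \<Rightarrow> ('a \<Rightarrow> 'a) set" where
  "involutions N = {p. (\<forall>w\<in>N. p w \<in> N \<and> p (p w) = w) \<and> (\<forall>w. w \<notin> N \<longrightarrow> p w = w)}"

definition mono_pts :: "'a set \<Rightarrow> 'a set \<Rightarrow> ('a \<Rightarrow> 'a) \<Rightarrow> 'a set" where
  "mono_pts N A p = {w \<in> N. (w \<in> A) = (p w \<in> A)}"

lemma finite_involutions: "finite N \<Longrightarrow> finite (involutions N)"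
proof -
  assume N: "finite N"
  have "inj_on (\<lambda>p. restrict p N) (involutions N)"
  proof (rule inj_onI, rule ext)
    fix p q x assume "p \<in> involutions N" "q \<in> involutions N" and eq: "restrict p N = restrict q N"
    moreover have "p x = q x" if "x \<in> N" using fun_cong[OF eq, of x] that by simp
    ultimately show "p x = q x" by (cases "x \<in> N") (auto simp: involutions_def)
  qed
  moreover have "(\<lambda>p. restrict p N) ` involutions N \<subseteq> N \<rightarrow>\<^sub>E N" by (auto simp: involutions_def)
  moreover have "finite (N \<rightarrow>\<^sub>E N)" using N by (intro finite_PiE) auto
  ultimately show ?thesis using finite_imageD finite_subset by blast
qed

lemma card_injections:
  assumes "finite B" "finite C"
  shows "card {f \<in> B \<rightarrow>\<^sub>E C. inj_on f B} = prod ((-) (card C)) {0..<card B}"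
  using card_inj_on_subset_funcset[OF assms subset_refl] by simp

text \<open>\<open>prod ((-) r) {0..<b}\<close> is the falling factorial of \<open>r\<close>, the
  form in which injections are counted.\<close>

lemma prod_diff_fact: "b \<le> r \<Longrightarrow> prod ((-) r) {0..<b} * fact (r - b) = (fact r :: nat)"
proof (induction b)
  case (Suc b)
  then have "fact (r - b) = (r - b) * (fact (r - Suc b) :: nat)"
    using fact_Suc[of "r - Suc b", where ?'a = nat] Suc_diff_Suc[of b r] by simp
  then show ?case using Suc by (simp add: mult.assoc)
qed simp

text \<open>
  Away from its monochromatic points an involution is a bijection between the two colour classes,
  and it is determined by its values there and on one of the classes.
\<close>

lemma involutions_prescribed:
  fixes N A :: "'a set"
  assumes N: "finite N"
  defines "P F q \<equiv> {p \<in> involutions N. mono_pts N A p = F \<and> (\<forall>x\<in>F. p x = q x)}"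
  shows "card (P F q) \<le> fact ((card N - card F) div 2)"
    and "p \<in> P F q \<Longrightarrow> card (N \<inter> A - F) = card (N - A - F)"
proof -
  let ?A = "N \<inter> A - F" and ?B = "N - A - F"
  have bij: "bij_betw p ?B ?A" if "p \<in> P F q" for p
  proof -
    have p: "p \<in> involutions N" and F: "mono_pts N A p = F" using that by (auto simp: P_def)
    have pN: "p w \<in> N" "p (p w) = w" if "w \<in> N" for w using p that by (auto simp: involutions_def)
    have Fp: "w \<in> F \<longleftrightarrow> (w \<in> A) = (p w \<in> A)" if "w \<in> N" for w using F that by (auto simp: mono_pts_def)
    have pF: "p w \<in> F \<longleftrightarrow> w \<in> F" if "w \<in> N" for w using Fp[OF that] Fp[OF pN(1)[OF that]] pN(2)[OF that] by auto
    show ?thesis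
    proof (rule bij_betw_byWitness[where f' = p])
      show "p ` ?B \<subseteq> ?A" "p ` ?A \<subseteq> ?B" using pN Fp pF by auto
    qed (use pN in auto)
  qed
  have fin: "finite ?A" "finite ?B" using N by auto
  show card_eq: "card ?A = card ?B" if "p \<in> P F q" for p
    using bij_betw_same_card[OF bij[OF that]] by simp
  show "card (P F q) \<le> fact ((card N - card F) div 2)"
  proof (cases "P F q = {}")
    case False
    then obtain p0 where p0: "p0 \<in> P F q" by auto
    then have FN: "F \<subseteq> N" by (auto simp: P_def mono_pts_def)
    have "N = F \<union> (?A \<union> ?B)" using FN by auto
    moreover have "F \<inter> (?A \<union> ?B) = {}" "?A \<inter> ?B = {}" "finite F" using FN N finite_subset by auto
    ultimately have "card N = card F + (card ?A + card ?B)"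
      using fin card_Un_disjoint[of F "?A \<union> ?B"] card_Un_disjoint[of ?A ?B] by simp
    then have k: "(card N - card F) div 2 = card ?B" using card_eq[OF p0] by simp
    let ?I = "{f \<in> ?B \<rightarrow>\<^sub>E ?A. inj_on f ?B}"
    have "inj_on (\<lambda>p. restrict p ?B) (P F q)"
    proof (rule inj_onI, rule ext)
      fix p r x assume pr: "p \<in> P F q" "r \<in> P F q" and eq: "restrict p ?B = restrict r ?B"
      have B: "p y = r y" if "y \<in> ?B" for y using fun_cong[OF eq, of y] that by simp
      have inv: "p (p y) = y" "r (r y) = y" if "y \<in> N" for y using pr that by (auto simp: P_def involutions_def)
      consider "x \<notin> N" | "x \<in> F" | "x \<in> ?B" | "x \<in> ?A" by blast
      then show "p x = r x"
      proof cases
        case 1 then show ?thesis using pr by (auto simp: P_def involutions_def)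
      next
        case 2 then show ?thesis using pr by (auto simp: P_def)
      next
        case 3 then show ?thesis by (rule B)
      next
        case 4
        then obtain y where y: "y \<in> ?B" "x = p y" using bij[OF pr(1)] by (auto simp: bij_betw_def)
        then have "x = r y" using B by simp
        moreover have "y \<in> N" using y by simp
        ultimately show ?thesis using inv[of y] y(2) by metis
      qed
    qed
    moreover have "(\<lambda>p. restrict p ?B) ` P F q \<subseteq> ?I"
    proof (intro image_subsetI)
      fix p assume "p \<in> P F q"
      then show "restrict p ?B \<in> ?I" using bij[of p] by (auto simp: bij_betw_def inj_on_def)
    qed
    moreover have "finite ?I" using fin by (intro finite_subset[OF _ finite_PiE[of ?B "\<lambda>_. ?A"]]) auto
    ultimately have "card (P F q) \<le> card ?I" using card_inj_on_le by blast
    also have "\<dots> = prod ((-) (card ?B)) {0..<card ?B}" using card_injections[OF fin(2,1)] card_eq[OF p0] by simp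
    also have "\<dots> = fact (card ?B)" using prod_diff_fact[of "card ?B" "card ?B"] by simp
    finally show ?thesis using k by simp
  qed simp
qed

text \<open>The set of monochromatic points and the values on it can be chosen in at most
  \<open>(card N + 1) ^ m\<close> ways each; \<open>involutions_prescribed\<close> counts the rest.
  The polynomial loss is affordable because the bound is used at boundedly many vertices.\<close>

lemma card_involutions_crude:
  fixes N A :: "'a set"
  assumes N: "finite N"
  shows "card {p \<in> involutions N. card (mono_pts N A p) \<le> m}
    \<le> (card N + 1) ^ m * (card N + 1) ^ m * fact ((card N + 1) div 2)"
proof -
  let ?P = "\<lambda>F q. {p \<in> involutions N. mono_pts N A p = F \<and> (\<forall>x\<in>F. p x = q x)}"
  let ?Fs = "{F. F \<subseteq> N \<and> card F \<le> m}"
  have fF: "finite ?Fs" using card_small_subsets(1)[OF N] .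
  have sub: "{p \<in> involutions N. card (mono_pts N A p) \<le> m} \<subseteq> (\<Union>F\<in>?Fs. \<Union>q\<in>F \<rightarrow>\<^sub>E N. ?P F q)"
  proof
    fix p assume p: "p \<in> {p \<in> involutions N. card (mono_pts N A p) \<le> m}"
    let ?F = "mono_pts N A p"
    have "?F \<subseteq> N" by (auto simp: mono_pts_def)
    moreover have "restrict p ?F \<in> ?F \<rightarrow>\<^sub>E N" using p by (auto simp: mono_pts_def involutions_def)
    moreover have "p \<in> ?P ?F (restrict p ?F)" using p by simp
    ultimately show "p \<in> (\<Union>F\<in>?Fs. \<Union>q\<in>F \<rightarrow>\<^sub>E N. ?P F q)" using p by blast
  qed
  have fq: "finite (F \<rightarrow>\<^sub>E N)" and cq: "card (F \<rightarrow>\<^sub>E N) \<le> (card N + 1) ^ m" if "F \<in> ?Fs" for F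
  proof -
    have "finite F" using that N finite_subset by blast
    then show "finite (F \<rightarrow>\<^sub>E N)" using N by (intro finite_PiE) auto
    have "card (F \<rightarrow>\<^sub>E N) = card N ^ card F" using \<open>finite F\<close> by (simp add: card_PiE)
    also have "\<dots> \<le> (card N + 1) ^ card F" by (intro power_mono) auto
    also have "\<dots> \<le> (card N + 1) ^ m" using that by (intro power_increasing) auto
    finally show "card (F \<rightarrow>\<^sub>E N) \<le> (card N + 1) ^ m" .
  qed
  have fP: "finite (?P F q)" for F q using finite_involutions[OF N] by (rule rev_finite_subset) auto
  let ?f = "fact ((card N + 1) div 2) :: nat"
  have cP: "card (?P F q) \<le> ?f" for F q
    using le_trans[OF involutions_prescribed(1)[OF N, of A F q] fact_mono] by (simp add: div_le_mono)
  have "card (\<Union>q\<in>F \<rightarrow>\<^sub>E N. ?P F q) \<le> (card N + 1) ^ m * ?f" if "F \<in> ?Fs" for F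
  proof -
    have "card (\<Union>q\<in>F \<rightarrow>\<^sub>E N. ?P F q) \<le> (\<Sum>q\<in>F \<rightarrow>\<^sub>E N. card (?P F q))" using fq[OF that] by (rule card_UN_le)
    also have "\<dots> \<le> card (F \<rightarrow>\<^sub>E N) * ?f" using sum_bounded_above[of "F \<rightarrow>\<^sub>E N" "\<lambda>q. card (?P F q)" ?f] cP by simp
    also have "\<dots> \<le> (card N + 1) ^ m * ?f" using cq[OF that] by (rule mult_right_mono) simp
    finally show ?thesis .
  qed
  then have s: "(\<Sum>F\<in>?Fs. card (\<Union>q\<in>F \<rightarrow>\<^sub>E N. ?P F q)) \<le> card ?Fs * ((card N + 1) ^ m * ?f)"
    using sum_bounded_above[of ?Fs "\<lambda>F. card (\<Union>q\<in>F \<rightarrow>\<^sub>E N. ?P F q)" "(card N + 1) ^ m * ?f"] by simp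
  have "finite (\<Union>F\<in>?Fs. \<Union>q\<in>F \<rightarrow>\<^sub>E N. ?P F q)" by (intro finite_UN_I fF fq fP)
  then have "card {p \<in> involutions N. card (mono_pts N A p) \<le> m} \<le> card (\<Union>F\<in>?Fs. \<Union>q\<in>F \<rightarrow>\<^sub>E N. ?P F q)"
    using sub by (rule card_mono)
  also have "\<dots> \<le> (\<Sum>F\<in>?Fs. card (\<Union>q\<in>F \<rightarrow>\<^sub>E N. ?P F q))" using fF by (rule card_UN_le)
  also note s
  also have "card ?Fs * ((card N + 1) ^ m * ?f) \<le> (card N + 1) ^ m * ((card N + 1) ^ m * ?f)"
    using card_small_subsets(2)[OF N, of m] by (rule mult_right_mono) simp
  finally show ?thesis by (simp add: mult.assoc)
qed

text \<open>No extra factor is affordable here, as the bound is multiplied over almost all vertices.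
  For even \<open>card N\<close> there is no monochromatic point. For odd \<open>card N\<close>
  there is exactly one; it is fixed and lies in the larger colour class, which has
  \<open>card N div 2 + 1\<close> elements and so supplies the last factor of the factorial.\<close>

lemma card_involutions_exact:
  fixes N A :: "'a set"
  assumes N: "finite N"
  shows "card {p \<in> involutions N. card (mono_pts N A p) \<le> 1} \<le> fact ((card N + 1) div 2)"
proof -
  let ?P = "\<lambda>F. {p \<in> involutions N. mono_pts N A p = F \<and> (\<forall>x\<in>F. p x = x)}"
  let ?k = "card N div 2"
  have par: "card N = card F + 2 * card (N \<inter> A - F)" and eq: "card (N \<inter> A - F) = card (N - A - F)"
    if "p \<in> ?P F" for p F
  proof -
    show e: "card (N \<inter> A - F) = card (N - A - F)"
      using involutions_prescribed(2)[OF N, of p A F "\<lambda>x. x"] that by simp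
    have FN: "F \<subseteq> N" using that by (auto simp: mono_pts_def)
    have "N = F \<union> ((N \<inter> A - F) \<union> (N - A - F))" using FN by auto
    moreover have "F \<inter> ((N \<inter> A - F) \<union> (N - A - F)) = {}" "(N \<inter> A - F) \<inter> (N - A - F) = {}" by auto
    moreover have "finite F" using FN N by (rule finite_subset)
    ultimately have "card N = card F + (card (N \<inter> A - F) + card (N - A - F))"
      using N card_Un_disjoint[of F "(N \<inter> A - F) \<union> (N - A - F)"] card_Un_disjoint[of "N \<inter> A - F" "N - A - F"] by simp
    then show "card N = card F + 2 * card (N \<inter> A - F)" using e by simp
  qed
  have cP: "card (?P F) \<le> fact ((card N - card F) div 2)" for F
    using involutions_prescribed(1)[OF N, of A F "\<lambda>x. x"] by simp
  have fP: "finite (?P F)" for F using finite_involutions[OF N] by (rule rev_finite_subset) auto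
  have mem: "p \<in> ?P {} \<or> (\<exists>x\<in>N. p \<in> ?P {x})"
    if p: "p \<in> involutions N" and c: "card (mono_pts N A p) \<le> 1" for p
  proof -
    have fin: "finite (mono_pts N A p)" using N by (simp add: mono_pts_def)
    have "mono_pts N A p = {} \<or> (\<exists>x. mono_pts N A p = {x})"
      using c fin card_1_singletonE[of "mono_pts N A p"] card_0_eq[OF fin] by (cases "card (mono_pts N A p)") auto
    then show ?thesis
    proof
      assume "\<exists>x. mono_pts N A p = {x}"
      then obtain x where x: "mono_pts N A p = {x}" by blast
      then have xN: "x \<in> N" "(x \<in> A) = (p x \<in> A)" by (auto simp: mono_pts_def)
      \<comment> \<open>The image of a monochromatic point is monochromatic, so a unique one is
        fixed.\<close>
      have "p x \<in> N" "p (p x) = x" using p xN by (auto simp: involutions_def)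
      then have "p x \<in> mono_pts N A p" using xN by (auto simp: mono_pts_def)
      then show ?thesis using x p xN by auto
    qed (use p in auto)
  qed
  show ?thesis
  proof (cases "even (card N)")
    case True
    have "p \<notin> ?P {x}" for p x
    proof
      assume "p \<in> ?P {x}"
      from par[OF this] have "odd (card N)" by simp
      then show False using True by simp
    qed
    then have "{p \<in> involutions N. card (mono_pts N A p) \<le> 1} \<subseteq> ?P {}" using mem by blast
    then have "card {p \<in> involutions N. card (mono_pts N A p) \<le> 1} \<le> card (?P {})" by (rule card_mono[OF fP])
    also have "\<dots> \<le> fact ?k" using cP[of "{}"] by simp
    finally show ?thesis using True by simp
  next
    case False
    have nP: "p \<notin> ?P {}" for p
    proof
      assume "p \<in> ?P {}"
      from par[OF this] have "even (card N)" by simp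
      then show False using False by simp
    qed
    define M where "M = {x \<in> N. ?P {x} \<noteq> {}}"
    have MN: "finite M" using N by (simp add: M_def)
    have cM: "card M \<le> Suc ?k"
    proof -
      have a: "card (N \<inter> A) = Suc ?k \<and> card (N - A) = ?k" if x: "x \<in> M" "x \<in> A" for x
      proof -
        obtain p where p: "p \<in> ?P {x}" using x by (auto simp: M_def)
        have "N - A - {x} = N - A" "x \<in> N \<inter> A" using x by (auto simp: M_def)
        then have "card (N \<inter> A) = Suc (card (N \<inter> A - {x}))" using N card.remove[of "N \<inter> A" x] by simp
        then show ?thesis using par[OF p] eq[OF p] \<open>N - A - {x} = N - A\<close> by simp
      qed
      have b: "card (N - A) = Suc ?k \<and> card (N \<inter> A) = ?k" if x: "x \<in> M" "x \<notin> A" for x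
      proof -
        obtain p where p: "p \<in> ?P {x}" using x by (auto simp: M_def)
        have "N \<inter> A - {x} = N \<inter> A" "x \<in> N - A" using x by (auto simp: M_def)
        then have "card (N - A) = Suc (card (N - A - {x}))" using N card.remove[of "N - A" x] by simp
        then show ?thesis using par[OF p] eq[OF p] \<open>N \<inter> A - {x} = N \<inter> A\<close> by simp
      qed
      have "M \<subseteq> N \<inter> A \<and> card (N \<inter> A) = Suc ?k \<or> M \<subseteq> N - A \<and> card (N - A) = Suc ?k \<or> M = {}"
      proof (cases "\<exists>x\<in>M. x \<in> A")
        case True
        then have c: "card (N \<inter> A) = Suc ?k" using a by blast
        have "y \<in> A" if "y \<in> M" for y using b[OF that] c by (cases "y \<in> A") simp_all
        then show ?thesis using c by (auto simp: M_def)
      next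
        case False
        then show ?thesis using b by (auto simp: M_def)
      qed
      then show ?thesis
        using N card_mono[of "N \<inter> A" M] card_mono[of "N - A" M] by (elim disjE conjE) simp_all
    qed
    have "{p \<in> involutions N. card (mono_pts N A p) \<le> 1} \<subseteq> (\<Union>x\<in>M. ?P {x})"
    proof
      fix p assume "p \<in> {p \<in> involutions N. card (mono_pts N A p) \<le> 1}"
      then obtain x where "x \<in> N" "p \<in> ?P {x}" using mem[of p] nP[of p] by auto
      then show "p \<in> (\<Union>x\<in>M. ?P {x})" unfolding M_def by blast
    qed
    then have "card {p \<in> involutions N. card (mono_pts N A p) \<le> 1} \<le> card (\<Union>x\<in>M. ?P {x})"
      by (rule card_mono[OF finite_UN_I[OF MN fP]])
    also have "\<dots> \<le> (\<Sum>x\<in>M. card (?P {x}))" using MN by (rule card_UN_le)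
    also have "\<dots> \<le> card M * fact ?k"
    proof -
      have "card (?P {x}) \<le> fact ?k" for x
        using le_trans[OF cP[of "{x}"] fact_mono[of "(card N - card {x}) div 2" ?k]] by (simp add: div_le_mono)
      then show ?thesis using sum_bounded_above[of M "\<lambda>x. card (?P {x})" "fact ?k"] by simp
    qed
    also have "\<dots> \<le> Suc ?k * fact ?k" using cM by (rule mult_right_mono) simp
    also have "\<dots> = fact (Suc ?k)" by simp
    also have "Suc ?k = (card N + 1) div 2" using False by presburger
    finally show ?thesis .
  qed
qed

text \<open>An injection of the smaller colour class \<open>W\<close> into the larger one
  \<open>U\<close> gives an involution that swaps each point of \<open>W\<close> with its image and
  fixes the rest. There are \<open>fact (card U)\<close> divided by
  \<open>fact (card U - card W)\<close> injections, and \<open>card U\<close> is at least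
  \<open>(card N + 1) div 2\<close>.\<close>

lemma card_involutions_lower:
  fixes N A :: "'a set"
  assumes N: "finite N"
  defines "a \<equiv> card (N \<inter> A)" and "b \<equiv> card (N - A)"
  shows "fact ((card N + 1) div 2) \<le>
    card {p \<in> involutions N. (\<forall>w\<in>mono_pts N A p. p w = w) \<and> card (mono_pts N A p) = (a - b) + (b - a)} *
    fact ((a - b) + (b - a))"
proof -
  have main: "fact ((card N + 1) div 2) \<le>
      card {p \<in> involutions N. (\<forall>w\<in>mono_pts N A p. p w = w) \<and> card (mono_pts N A p) = card U - card W} *
      fact (card U - card W)"
    if UW: "N = U \<union> W" "U \<inter> W = {}" and le: "card W \<le> card U"
      and col: "\<And>p. p \<in> involutions N \<Longrightarrow> mono_pts N A p = {w \<in> N. (w \<in> U) = (p w \<in> U)}" for U W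
  proof -
    have fin: "finite U" "finite W" using N UW by auto
    let ?I = "{f \<in> W \<rightarrow>\<^sub>E U. inj_on f W}"
    let ?T = "{p \<in> involutions N. (\<forall>w\<in>mono_pts N A p. p w = w) \<and> card (mono_pts N A p) = card U - card W}"
    define \<Phi> where "\<Phi> f = (\<lambda>x. if x \<in> W then f x else if x \<in> f ` W then the_inv_into W f x else x)"
      for f :: "'a \<Rightarrow> 'a"
    have inj: "inj_on \<Phi> ?I"
    proof (rule inj_onI, rule ext)
      fix f g x assume f: "f \<in> ?I" and g: "g \<in> ?I" and eq: "\<Phi> f = \<Phi> g"
      show "f x = g x"
      proof (cases "x \<in> W")
        case True then show ?thesis using fun_cong[OF eq, of x] by (simp add: \<Phi>_def)
      next
        case False
        then have "f x = undefined" "g x = undefined" using f g by (auto simp: PiE_def extensional_def)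
        then show ?thesis by simp
      qed
    qed
    have sub: "\<Phi> ` ?I \<subseteq> ?T"
    proof (intro image_subsetI)
      fix f assume f: "f \<in> ?I"
      then have fU: "\<And>x. x \<in> W \<Longrightarrow> f x \<in> U" and fi: "inj_on f W" by auto
      have fW: "f x \<notin> W" if "x \<in> W" for x using fU[OF that] UW by auto
      have v1: "\<Phi> f x = f x" if "x \<in> W" for x using that by (simp add: \<Phi>_def)
      have v2: "\<Phi> f (f x) = x" if "x \<in> W" for x
        using that fW[OF that] fi by (simp add: \<Phi>_def the_inv_into_f_f)
      have v3: "\<Phi> f x = x" if "x \<notin> W" "x \<notin> f ` W" for x using that by (simp add: \<Phi>_def)
      have inv: "\<Phi> f \<in> involutions N"
        unfolding involutions_def
      proof (intro CollectI conjI ballI allI impI)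
        fix w assume "w \<in> N"
        consider "w \<in> W" | x where "x \<in> W" "w = f x" | "w \<notin> W" "w \<notin> f ` W" by auto
        then show "\<Phi> f w \<in> N"
          by cases (use v1 v2 v3 fU UW \<open>w \<in> N\<close> in auto)
        consider "w \<in> W" | x where "x \<in> W" "w = f x" | "w \<notin> W" "w \<notin> f ` W" by auto
        then show "\<Phi> f (\<Phi> f w) = w"
          by cases (use v1 v2 v3 in auto)
      next
        fix w assume "w \<notin> N"
        then show "\<Phi> f w = w" using v3 fU UW by auto
      qed
      have mp: "mono_pts N A (\<Phi> f) = U - f ` W"
      proof (intro equalityI subsetI)
        fix w assume "w \<in> mono_pts N A (\<Phi> f)"
        then have w: "w \<in> N" "(w \<in> U) = (\<Phi> f w \<in> U)" unfolding col[OF inv] by auto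
        have "w \<notin> W" using w v1 fU UW by auto
        moreover have "w \<notin> f ` W" using w v2 fU UW by auto
        ultimately show "w \<in> U - f ` W" using w UW by auto
      next
        fix w assume w: "w \<in> U - f ` W"
        then have "w \<notin> W" using UW by auto
        then have "\<Phi> f w = w" using v3 w by auto
        then show "w \<in> mono_pts N A (\<Phi> f)" unfolding col[OF inv] using w UW by auto
      qed
      have "card (U - f ` W) = card U - card W"
        using fin fU fi by (subst card_Diff_subset) (auto simp: card_image)
      moreover have "\<Phi> f w = w" if "w \<in> U - f ` W" for w using v3 that UW by auto
      ultimately show "\<Phi> f \<in> ?T" using inv mp by auto
    qed
    have "finite ?T" using finite_involutions[OF N] by (rule rev_finite_subset) auto
    then have "card ?I \<le> card ?T" using card_inj_on_le[OF inj sub] by blast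
    then have "card ?I * fact (card U - card W) \<le> card ?T * fact (card U - card W)" by (rule mult_right_mono) simp
    moreover have "card ?I * fact (card U - card W) = fact (card U)"
      using card_injections[OF fin(2,1)] prod_diff_fact[OF le] by simp
    moreover have "(fact ((card N + 1) div 2) :: nat) \<le> fact (card U)"
    proof (rule fact_mono)
      have "card N = card U + card W" using UW fin card_Un_disjoint[of U W] by simp
      then show "(card N + 1) div 2 \<le> card U" using le by simp
    qed
    ultimately show ?thesis by linarith
  qed
  show ?thesis
  proof (cases "b \<le> a")
    case True
    have "mono_pts N A p = {w \<in> N. (w \<in> N \<inter> A) = (p w \<in> N \<inter> A)}" if "p \<in> involutions N" for p
      using that by (auto simp: mono_pts_def involutions_def)
    then show ?thesis using main[of "N \<inter> A" "N - A"] True unfolding a_def b_def by auto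
  next
    case False
    have "mono_pts N A p = {w \<in> N. (w \<in> N - A) = (p w \<in> N - A)}" if "p \<in> involutions N" for p
      using that by (auto simp: mono_pts_def involutions_def)
    then show ?thesis using main[of "N - A" "N \<inter> A"] False unfolding a_def b_def by auto
  qed
qed

text \<open>Up to the losses estimated below, this is the number of pairings adapted to a colouring
  of \<open>G\<close>, yet it does not mention the colouring. It can therefore normalise a flow
  whose intermediate graphs colour the same edge set differently.\<close>

definition pairing_weight :: "nat \<Rightarrow> graph \<Rightarrow> nat" where
  "pairing_weight n G = (\<Prod>v\<in>{1..n}. fact ((card (nb G v) + 1) div 2))"

lemma pairing_weight_pos: "0 < pairing_weight n G"
  by (simp add: pairing_weight_def prod_pos)

section \<open>Counting pairings as products over the vertices\<close>

lemma pairings_PiE: "pairings n G = (\<Pi>\<^sub>E v\<in>{1..n}. involutions (nb G v))"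
  by (simp add: pairings_def involutions_def)

lemma finite_pairings: "G \<in> graphs n \<Longrightarrow> finite (pairings n G)"
  unfolding pairings_PiE by (intro finite_PiE finite_involutions finite_nb) auto

lemma defects_mono_pts: "defects G B \<psi> v = mono_pts (nb G v) (nb B v) (\<psi> v)"
  by (auto simp: defects_def mono_pts_def nb_def)

definition near_pairings :: "nat \<Rightarrow> graph \<Rightarrow> graph \<Rightarrow> nat \<Rightarrow> nat \<Rightarrow> (nat \<Rightarrow> nat \<Rightarrow> nat) set" where
  "near_pairings n G B \<kappa> m = {\<psi> \<in> pairings n G.
     card {v \<in> {1..n}. 1 < card (defects G B \<psi> v)} \<le> \<kappa> \<and> (\<forall>v\<in>{1..n}. card (defects G B \<psi> v) \<le> m)}"

text \<open>At most \<open>\<kappa>\<close> exceptional vertices are chosen and get the crude bound;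
  all others have at most one defect and get the exact bound, whose product is
  \<open>pairing_weight\<close>.\<close>

lemma card_near_pairings:
  assumes G: "G \<in> graphs n"
  shows "card (near_pairings n G B \<kappa> m) \<le> (n + 1) ^ \<kappa> * ((n + 1) ^ (2 * m)) ^ \<kappa> * pairing_weight n G"
proof -
  let ?V = "{1..n}"
  let ?f = "\<lambda>v. fact ((card (nb G v) + 1) div 2) :: nat"
  let ?I = "\<lambda>v k. {p \<in> involutions (nb G v). card (mono_pts (nb G v) (nb B v) p) \<le> k}"
  define Q where "Q V' = (\<Pi>\<^sub>E v\<in>?V. ?I v (if v \<in> V' then m else 1))" for V'
  let ?Vs = "{V'. V' \<subseteq> ?V \<and> card V' \<le> \<kappa>}"
  have fVs: "finite ?Vs" and cVs: "card ?Vs \<le> (n + 1) ^ \<kappa>"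
    using card_small_subsets[of ?V \<kappa>] by simp_all
  have fI: "finite (?I v k)" for v k
    using finite_involutions[OF finite_nb[OF G]] by (rule rev_finite_subset) auto
  have fQ: "finite (Q V')" for V' unfolding Q_def using fI by (intro finite_PiE) auto
  have sub: "near_pairings n G B \<kappa> m \<subseteq> (\<Union>V'\<in>?Vs. Q V')"
  proof
    fix \<psi> assume \<psi>: "\<psi> \<in> near_pairings n G B \<kappa> m"
    define V' where "V' = {v \<in> ?V. 1 < card (defects G B \<psi> v)}"
    have "V' \<in> ?Vs" using \<psi> by (auto simp: V'_def near_pairings_def)
    moreover have "\<psi> \<in> Q V'"
      unfolding Q_def
    proof (rule PiE_I)
      have P: "\<psi> \<in> (\<Pi>\<^sub>E v\<in>?V. involutions (nb G v))" using \<psi> by (simp add: near_pairings_def pairings_PiE)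
      fix v assume v: "v \<in> ?V"
      have "card (defects G B \<psi> v) \<le> (if v \<in> V' then m else 1)"
        using \<psi> v by (auto simp: near_pairings_def V'_def)
      then show "\<psi> v \<in> ?I v (if v \<in> V' then m else 1)" using PiE_mem[OF P v] by (simp add: defects_mono_pts)
    next
      fix v assume "v \<notin> ?V"
      moreover have "\<psi> \<in> (\<Pi>\<^sub>E v\<in>?V. involutions (nb G v))" using \<psi> by (simp add: near_pairings_def pairings_PiE)
      ultimately show "\<psi> v = undefined" by (meson PiE_arb)
    qed
    ultimately show "\<psi> \<in> (\<Union>V'\<in>?Vs. Q V')" by blast
  qed
  have cQ: "card (Q V') \<le> ((n + 1) ^ (2 * m)) ^ \<kappa> * pairing_weight n G" if V': "V' \<in> ?Vs" for V'
  proof -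
    let ?c = "(n + 1) ^ (2 * m)"
    have "card (Q V') = (\<Prod>v\<in>?V. card (?I v (if v \<in> V' then m else 1)))"
      unfolding Q_def by (rule card_PiE) simp
    also have "\<dots> \<le> (\<Prod>v\<in>?V. (if v \<in> V' then ?c else 1) * ?f v)"
    proof (rule prod_mono)
      fix v assume "v \<in> ?V"
      have fin: "finite (nb G v)" by (rule finite_nb[OF G])
      have cn: "card (nb G v) \<le> n" using card_mono[OF _ nb_graph[OF G, of v]] by simp
      have "card (?I v m) \<le> (card (nb G v) + 1) ^ m * (card (nb G v) + 1) ^ m * ?f v"
        by (rule card_involutions_crude[OF fin])
      also have "\<dots> \<le> (n + 1) ^ m * (n + 1) ^ m * ?f v"
        using cn by (intro mult_mono power_mono) auto
      also have "(n + 1) ^ m * (n + 1) ^ m = ?c" by (simp only: mult_2 power_add)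
      finally have 1: "card (?I v m) \<le> ?c * ?f v" .
      have 2: "card (?I v 1) \<le> ?f v" by (rule card_involutions_exact[OF fin])
      show "0 \<le> card (?I v (if v \<in> V' then m else 1)) \<and>
          card (?I v (if v \<in> V' then m else 1)) \<le> (if v \<in> V' then ?c else 1) * ?f v"
        using 1 2 by (cases "v \<in> V'") simp_all
    qed
    also have "\<dots> = (\<Prod>v\<in>?V. if v \<in> V' then ?c else 1) * pairing_weight n G"
      by (simp only: prod.distrib pairing_weight_def)
    also have "(\<Prod>v\<in>?V. if v \<in> V' then ?c else 1) = ?c ^ card (?V \<inter> V')"
      by (subst prod.inter_restrict[symmetric]) simp_all
    also have "?c ^ card (?V \<inter> V') * pairing_weight n G \<le> ?c ^ \<kappa> * pairing_weight n G"
    proof (rule mult_right_mono)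
      have "?V \<inter> V' = V'" using V' by auto
      then show "?c ^ card (?V \<inter> V') \<le> ?c ^ \<kappa>" using V' by (intro power_increasing) auto
    qed simp
    finally show ?thesis .
  qed
  have "finite (\<Union>V'\<in>?Vs. Q V')" by (rule finite_UN_I[OF fVs fQ])
  then have "card (near_pairings n G B \<kappa> m) \<le> card (\<Union>V'\<in>?Vs. Q V')" using sub by (rule card_mono)
  also have "\<dots> \<le> (\<Sum>V'\<in>?Vs. card (Q V'))" by (rule card_UN_le[OF fVs])
  also have "\<dots> \<le> card ?Vs * (((n + 1) ^ (2 * m)) ^ \<kappa> * pairing_weight n G)"
    using sum_bounded_above[of ?Vs "\<lambda>V'. card (Q V')" "((n + 1) ^ (2 * m)) ^ \<kappa> * pairing_weight n G"] cQ by simp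
  also have "\<dots> \<le> (n + 1) ^ \<kappa> * (((n + 1) ^ (2 * m)) ^ \<kappa> * pairing_weight n G)"
    using cVs by (rule mult_right_mono) simp
  finally show ?thesis by (simp only: mult.assoc)
qed

lemma finite_near_pairings: "G \<in> graphs n \<Longrightarrow> finite (near_pairings n G B \<kappa> m)"
  unfolding near_pairings_def using finite_pairings by simp

text \<open>\<open>card_involutions_lower\<close> vertex by vertex. For two realizations of a thin
  interval the factorials on the right are 1; for a graph with excess they are the price of its
  excess vertices.\<close>

lemma card_good_pairings:
  assumes X: "X \<in> graphs n" and Y: "Y \<in> graphs n"
  shows "pairing_weight n (sd X Y) \<le> card (good_pairings n X Y) *
    (\<Prod>v\<in>{1..n}. fact ((deg X v - deg Y v) + (deg Y v - deg X v)))"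
proof -
  let ?V = "{1..n}" and ?G = "sd X Y"
  let ?s = "\<lambda>v. (deg X v - deg Y v) + (deg Y v - deg X v)"
  let ?T = "\<lambda>v. {p \<in> involutions (nb ?G v). (\<forall>w\<in>mono_pts (nb ?G v) (nb X v) p. p w = w) \<and>
      card (mono_pts (nb ?G v) (nb X v) p) = ?s v}"
  have eq: "good_pairings n X Y = (\<Pi>\<^sub>E v\<in>?V. ?T v)"
    unfolding good_pairings_def pairings_PiE defects_mono_pts
    by (rule set_eqI) (simp only: PiE_iff Int_iff mem_Collect_eq, blast)
  have "pairing_weight n ?G \<le> (\<Prod>v\<in>?V. card (?T v) * fact (?s v))"
    unfolding pairing_weight_def
  proof (rule prod_mono)
    fix v assume "v \<in> ?V"
    have Gg: "?G \<in> graphs n" by (rule sd_graphs[OF X Y])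
    have fX: "finite (nb X v)" and fY: "finite (nb Y v)" using finite_nb X Y by blast+
    have nG: "nb ?G v = sd (nb X v) (nb Y v)" by (rule nb_sd)
    have a: "nb ?G v \<inter> nb X v = nb X v - nb Y v" and b: "nb ?G v - nb X v = nb Y v - nb X v"
      unfolding nG by auto
    have "card (nb X v) = card (nb X v - nb Y v) + card (nb X v \<inter> nb Y v)"
      "card (nb Y v) = card (nb Y v - nb X v) + card (nb X v \<inter> nb Y v)"
      using card_Diff_subset_Int[of "nb X v" "nb Y v"] card_Diff_subset_Int[of "nb Y v" "nb X v"] fX fY
        card_mono[of "nb X v" "nb X v \<inter> nb Y v"] card_mono[of "nb Y v" "nb X v \<inter> nb Y v"]
      by (simp_all add: Int_commute)
    then have s: "(card (nb ?G v \<inter> nb X v) - card (nb ?G v - nb X v)) +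
        (card (nb ?G v - nb X v) - card (nb ?G v \<inter> nb X v)) = ?s v"
      unfolding a b using X Y by (simp add: deg_nb)
    show "0 \<le> (fact ((card (nb ?G v) + 1) div 2) :: nat) \<and>
        fact ((card (nb ?G v) + 1) div 2) \<le> card (?T v) * fact (?s v)"
      using card_involutions_lower[OF finite_nb[OF Gg], of v "nb X v"] unfolding s by simp
  qed
  also have "\<dots> = (\<Prod>v\<in>?V. card (?T v)) * (\<Prod>v\<in>?V. fact (?s v))" by (rule prod.distrib)
  also have "(\<Prod>v\<in>?V. card (?T v)) = card (good_pairings n X Y)"
    unfolding eq by (rule card_PiE[symmetric]) simp
  finally show ?thesis .
qed

section \<open>Encoding triples by flipped pairs\<close>

definition trails :: "(nat \<Rightarrow> nat \<Rightarrow> nat) \<Rightarrow> graph \<Rightarrow> nat list list" where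
  "trails \<psi> G = (SOME Ts. decomp \<psi> G Ts)"

definition elist :: "(nat \<Rightarrow> nat \<Rightarrow> nat) \<Rightarrow> graph \<Rightarrow> nat set list" where
  "elist \<psi> G = concat (map el (trails \<psi> G))"

lemma decomp_trails:
  assumes "\<psi> \<in> pairings n G" "G \<in> graphs n"
  shows "decomp \<psi> G (trails \<psi> G)"
  unfolding trails_def
  by (rule someI_ex, rule decomp_exists[OF finite_graph[OF assms(2)] _ pairings_involutive[OF assms]])
    (use assms(2) in \<open>simp add: graphs_def\<close>)

text \<open>Each prefix cuts at most 4 darts, so the flip adds at most \<open>4 * length bs\<close>
  defects in total. This bounds the new defects at one vertex as well as the number of vertices that
  become exceptional.\<close>

lemma near_flip:
  assumes \<psi>: "\<psi> \<in> pairings n G" and G: "G \<in> graphs n"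
    and c: "card {v \<in> {1..n}. 1 < card (defects G X \<psi> v)} \<le> \<kappa>" "\<And>v. v \<in> {1..n} \<Longrightarrow> card (defects G X \<psi> v) \<le> m"
  shows "\<psi> \<in> near_pairings n G (sd X (prefix_flip (elist \<psi> G) bs)) (\<kappa> + 4 * length bs) (m + 4 * length bs)"
proof -
  let ?S = "prefix_flip (elist \<psi> G) bs" and ?V = "{1..n}"
  let ?C = "cut_darts G \<psi> ?S"
  have C: "finite ?C" "card ?C \<le> 4 * length bs"
    using cut_ps[OF decomp_trails[OF \<psi> G] pairings_involutive[OF \<psi> G], of bs] unfolding elist_def by auto
  have fin: "finite (defects G X \<psi> v)" for v using finite_nb[OF G, of v] by (simp add: defects_def)
  have Cv: "finite {w. (v, w) \<in> ?C}" "card {w. (v, w) \<in> ?C} \<le> 4 * length bs" for v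
  proof -
    have sub: "Pair v ` {w. (v, w) \<in> ?C} \<subseteq> ?C" by auto
    then have "finite (Pair v ` {w. (v, w) \<in> ?C})" using C(1) by (rule finite_subset)
    then show "finite {w. (v, w) \<in> ?C}" by (rule finite_imageD) (auto simp: inj_on_def)
    have "card {w. (v, w) \<in> ?C} \<le> card ?C"
      by (rule card_inj_on_le[OF _ sub C(1)]) (auto simp: inj_on_def)
    then show "card {w. (v, w) \<in> ?C} \<le> 4 * length bs" using C(2) by simp
  qed
  have le: "card (defects G (sd X ?S) \<psi> v) \<le> card (defects G X \<psi> v) + card {w. (v, w) \<in> ?C}" for v
    using card_mono[OF _ defects_flip[of G X ?S \<psi> v]] card_Un_le[of "defects G X \<psi> v" "{w. (v, w) \<in> ?C}"] fin Cv(1)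
    by (meson finite_UnI le_trans)
  have "card (defects G (sd X ?S) \<psi> v) \<le> m + 4 * length bs" if "v \<in> ?V" for v
    using le[of v] c(2)[OF that] Cv(2)[of v] by linarith
  moreover have "card {v \<in> ?V. 1 < card (defects G (sd X ?S) \<psi> v)} \<le> \<kappa> + 4 * length bs"
  proof -
    have "{v \<in> ?V. 1 < card (defects G (sd X ?S) \<psi> v)} \<subseteq> {v \<in> ?V. 1 < card (defects G X \<psi> v)} \<union> fst ` ?C"
    proof
      fix v assume v: "v \<in> {v \<in> ?V. 1 < card (defects G (sd X ?S) \<psi> v)}"
      show "v \<in> {v \<in> ?V. 1 < card (defects G X \<psi> v)} \<union> fst ` ?C"
      proof (cases "{w. (v, w) \<in> ?C} = {}")
        case True
        then show ?thesis using le[of v] v by simp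
      next
        case False
        then show ?thesis by force
      qed
    qed
    then have "card {v \<in> ?V. 1 < card (defects G (sd X ?S) \<psi> v)} \<le> card ({v \<in> ?V. 1 < card (defects G X \<psi> v)} \<union> fst ` ?C)"
      using C(1) by (intro card_mono) auto
    also have "\<dots> \<le> card {v \<in> ?V. 1 < card (defects G X \<psi> v)} + card (fst ` ?C)" by (rule card_Un_le)
    also have "\<dots> \<le> \<kappa> + 4 * length bs" using c(1) card_image_le[OF C(1), of fst] C(2) by linarith
    finally show ?thesis .
  qed
  ultimately show ?thesis using \<psi> by (simp add: near_pairings_def)
qed

text \<open>
  A triple \<open>(X, Y, \<psi>)\<close> can be recovered from \<open>\<psi>\<close>, the prefix lengths and the flipped pair, since
  \<open>X \<triangle> Y\<close> and hence the edge list are not changed by the flip. This is why the trails are chosen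
  without looking at the colours.
\<close>

lemma weighted_count:
  fixes T :: "(graph \<times> graph \<times> (nat \<Rightarrow> nat \<Rightarrow> nat)) set"
  assumes T: "finite T" and P: "finite P" "P \<subseteq> graphs n \<times> graphs n"
    and ok: "\<And>X Y \<psi>. (X, Y, \<psi>) \<in> T \<Longrightarrow> \<exists>bs. length bs = q \<and> set bs \<subseteq> {..n * n} \<and>
      (sd X (prefix_flip (elist \<psi> (sd X Y)) bs), sd Y (prefix_flip (elist \<psi> (sd X Y)) bs)) \<in> P \<and>
      \<psi> \<in> near_pairings n (sd X Y) (sd X (prefix_flip (elist \<psi> (sd X Y)) bs)) \<kappa> m"
  shows "(\<Sum>(X, Y, \<psi>)\<in>T. 1 / real (pairing_weight n (sd X Y))) \<le>
    real ((n * n + 1) ^ q) * real (card P) * real ((n + 1) ^ \<kappa> * ((n + 1) ^ (2 * m)) ^ \<kappa>)"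
proof -
  let ?BS = "{bs. set bs \<subseteq> {..n * n} \<and> length bs = q}"
  let ?c = "(n + 1) ^ \<kappa> * ((n + 1) ^ (2 * m)) ^ \<kappa>"
  let ?NP = "\<lambda>(B, B'). near_pairings n (sd B B') B \<kappa> m"
  define bsf where "bsf t = (case t of (X, Y, \<psi>) \<Rightarrow> SOME bs. length bs = q \<and> set bs \<subseteq> {..n * n} \<and>
      (sd X (prefix_flip (elist \<psi> (sd X Y)) bs), sd Y (prefix_flip (elist \<psi> (sd X Y)) bs)) \<in> P \<and>
      \<psi> \<in> near_pairings n (sd X Y) (sd X (prefix_flip (elist \<psi> (sd X Y)) bs)) \<kappa> m)" for t :: "graph \<times> graph \<times> (nat \<Rightarrow> nat \<Rightarrow> nat)"
  define \<Phi> where "\<Phi> t = (case t of (X, Y, \<psi>) \<Rightarrow>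
      (bsf t, (sd X (prefix_flip (elist \<psi> (sd X Y)) (bsf t)), sd Y (prefix_flip (elist \<psi> (sd X Y)) (bsf t))), \<psi>))"
    for t :: "graph \<times> graph \<times> (nat \<Rightarrow> nat \<Rightarrow> nat)"
  define h where "h = (\<lambda>(bs :: nat list, (B, B'), \<psi> :: nat \<Rightarrow> nat \<Rightarrow> nat). 1 / real (pairing_weight n (sd B B')))"
  have bs: "length (bsf (X, Y, \<psi>)) = q" "set (bsf (X, Y, \<psi>)) \<subseteq> {..n * n}"
      "(sd X (prefix_flip (elist \<psi> (sd X Y)) (bsf (X, Y, \<psi>))), sd Y (prefix_flip (elist \<psi> (sd X Y)) (bsf (X, Y, \<psi>)))) \<in> P"
      "\<psi> \<in> near_pairings n (sd X Y) (sd X (prefix_flip (elist \<psi> (sd X Y)) (bsf (X, Y, \<psi>)))) \<kappa> m"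
    if "(X, Y, \<psi>) \<in> T" for X Y \<psi>
    using someI_ex[OF ok[OF that]] unfolding bsf_def by simp_all
  have sdsd: "sd (sd X S) (sd Y S) = sd X Y" for X Y S :: graph by (simp add: sd_ac)
  have inj: "inj_on \<Phi> T"
  proof (rule inj_onI)
    fix t t' assume "\<Phi> t = \<Phi> t'"
    obtain X Y \<psi> where t: "t = (X, Y, \<psi>)" by (cases t) auto
    obtain X' Y' \<psi>' where t': "t' = (X', Y', \<psi>')" by (cases t') auto
    let ?S = "prefix_flip (elist \<psi> (sd X Y)) (bsf t)" and ?S' = "prefix_flip (elist \<psi>' (sd X' Y')) (bsf t')"
    have e: "bsf t = bsf t'" "sd X ?S = sd X' ?S'" "sd Y ?S = sd Y' ?S'" "\<psi> = \<psi>'"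
      using \<open>\<Phi> t = \<Phi> t'\<close> unfolding \<Phi>_def t t' by auto
    have "sd X Y = sd X' Y'" using sdsd[of X ?S Y] sdsd[of X' ?S' Y'] e(2,3) by simp
    then have S: "?S = ?S'" using e by simp
    have "X = X'" "Y = Y'" using e(2,3) unfolding S by (metis sd_assoc sd_self(1,3))+
    then show "t = t'" using t t' e(4) by simp
  qed
  have img: "\<Phi> ` T \<subseteq> ?BS \<times> Sigma P ?NP"
  proof (intro image_subsetI)
    fix t assume "t \<in> T"
    obtain X Y \<psi> where t: "t = (X, Y, \<psi>)" by (cases t) auto
    then have tT: "(X, Y, \<psi>) \<in> T" using \<open>t \<in> T\<close> by simp
    show "\<Phi> t \<in> ?BS \<times> Sigma P ?NP"
      using bs[OF tT] unfolding \<Phi>_def t by (simp add: sdsd)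
  qed
  have fBS: "finite ?BS" by (rule finite_lists_length_eq) simp
  have fNP: "finite (?NP p)" if "p \<in> P" for p
    using that P(2) finite_near_pairings[OF sd_graphs] by (cases p) auto
  have fin: "finite (?BS \<times> Sigma P ?NP)" using fBS P(1) fNP by (intro finite_cartesian_product finite_SigmaI) auto
  have "(\<Sum>(X, Y, \<psi>)\<in>T. 1 / real (pairing_weight n (sd X Y))) = (\<Sum>t\<in>T. h (\<Phi> t))"
    by (rule sum.cong) (auto simp: \<Phi>_def h_def sdsd)
  also have "\<dots> = (\<Sum>y\<in>\<Phi> ` T. h y)" using sum.reindex[OF inj, of h] by simp
  also have "\<dots> \<le> (\<Sum>y\<in>?BS \<times> Sigma P ?NP. h y)"
    by (rule sum_mono2[OF fin img]) (auto simp: h_def)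
  also have "\<dots> = (\<Sum>bs\<in>?BS. \<Sum>y\<in>Sigma P ?NP. h (bs, y))"
    by (simp only: sum.cartesian_product)
       (rule sum.cong, auto)
  also have "\<dots> = (\<Sum>bs\<in>?BS. \<Sum>p\<in>P. \<Sum>\<psi>\<in>?NP p. h (bs, p, \<psi>))"
    by (rule sum.cong[OF refl], subst sum.Sigma) (use P(1) fNP in \<open>auto intro!: sum.cong\<close>)
  also have "\<dots> \<le> (\<Sum>bs\<in>?BS. \<Sum>p\<in>P. real ?c)"
  proof (intro sum_mono)
    fix bs :: "nat list" and p assume p: "p \<in> P"
    obtain B B' where BB: "p = (B, B')" by (cases p)
    then have g: "sd B B' \<in> graphs n" using p P(2) sd_graphs by blast
    \<comment> \<open>The weight depends on the symmetric difference only, so it is constant over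
      the pairings for one flipped pair and cancels against the factor \<open>pairing_weight\<close>
      in their number.\<close>
    have "(\<Sum>\<psi>\<in>?NP p. h (bs, p, \<psi>)) = real (card (near_pairings n (sd B B') B \<kappa> m)) / real (pairing_weight n (sd B B'))"
      by (simp add: BB h_def)
    also have "\<dots> \<le> real ?c"
    proof -
      have "real (card (near_pairings n (sd B B') B \<kappa> m)) \<le> real (?c * pairing_weight n (sd B B'))"
        using card_near_pairings[OF g] by (simp only: of_nat_le_iff)
      then show ?thesis using pairing_weight_pos[of n "sd B B'"] by (simp add: divide_le_eq)
    qed
    finally show "(\<Sum>\<psi>\<in>?NP p. h (bs, p, \<psi>)) \<le> real ?c" .
  qed
  also have "\<dots> = real (card ?BS) * real (card P) * real ?c" by simp
  also have "card ?BS = (n * n + 1) ^ q" by (subst card_lists_length_eq) simp_all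
  finally show ?thesis .
qed

section \<open>Degree excess\<close>

lemma interval_realizations_iff:
  "G \<in> interval_realizations n l u \<longleftrightarrow> G \<in> graphs n \<and> (\<forall>v\<in>{1..n}. l v \<le> deg G v \<and> deg G v \<le> u v)"
  (is "?L \<longleftrightarrow> ?R")
proof
  assume ?L
  then obtain d where d: "d \<in> vec_interval n l u" "G \<in> realizations n d"
    unfolding interval_realizations_def by blast
  then have "deg G v = d v" "l v \<le> d v" "d v \<le> u v" if "v \<in> {1..n}" for v
    using that unfolding vec_interval_def realizations_def by auto
  then show ?R using d(2) unfolding realizations_def by auto
next
  assume ?R
  then have "deg G \<in> vec_interval n l u" "G \<in> realizations n (deg G)"
    by (auto simp: vec_interval_def realizations_def)
  then show ?L unfolding interval_realizations_def by blast
qed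

definition excess_set :: "nat \<Rightarrow> (nat \<Rightarrow> nat) \<Rightarrow> (nat \<Rightarrow> nat) \<Rightarrow> nat \<Rightarrow> graph set" where
  "excess_set n l u k = {H \<in> graphs n. (\<forall>v\<in>{1..n}. l v \<le> deg H v) \<and> (\<Sum>v\<in>{1..n}. deg H v - u v) \<le> k}"

definition deviation_set :: "nat \<Rightarrow> (nat \<Rightarrow> nat) \<Rightarrow> (nat \<Rightarrow> nat) \<Rightarrow> nat \<Rightarrow> graph set" where
  "deviation_set n l u k = {B \<in> graphs n. (\<Sum>v\<in>{1..n}. (l v - deg B v) + (deg B v - u v)) \<le> k}"

lemma finite_subset_graphs: "A \<subseteq> graphs n \<Longrightarrow> finite A"
  using finite_subset[OF _ finite_graphs] .

lemma excess_set_0: "excess_set n l u 0 = interval_realizations n l u"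
proof (rule set_eqI)
  fix H
  have "(\<Sum>v\<in>{1..n}. deg H v - u v) \<le> 0 \<longleftrightarrow> (\<forall>v\<in>{1..n}. deg H v \<le> u v)" by simp
  then show "H \<in> excess_set n l u 0 \<longleftrightarrow> H \<in> interval_realizations n l u"
    unfolding excess_set_def interval_realizations_iff mem_Collect_eq by blast
qed

section \<open>Graphs within a few edge changes of a given set\<close>

lemma card_pairs_le: "card (nsets {1..n} 2) \<le> n * n"
proof -
  have "nsets {1..n} 2 \<subseteq> (\<lambda>(a, b). {a, b}) ` ({1..n} \<times> {1..n})"
  proof
    fix e assume "e \<in> nsets {1..n} 2"
    then obtain a b where "e = {a, b}" "a \<in> {1..n}" "b \<in> {1..n}" by (rule nsets2E)
    then show "e \<in> (\<lambda>(a, b). {a, b}) ` ({1..n} \<times> {1..n})" by auto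
  qed
  then have "card (nsets {1..n} 2) \<le> card ({1..n} \<times> {1..n})" by (intro surj_card_le) auto
  then show ?thesis by simp
qed

lemma card_edge_sets:
  "finite {R. R \<subseteq> nsets {1..n} 2 \<and> card R \<le> r}" "card {R. R \<subseteq> nsets {1..n} 2 \<and> card R \<le> r} \<le> (n * n + 1) ^ r"
proof -
  show "finite {R. R \<subseteq> nsets {1..n} 2 \<and> card R \<le> r}" by (rule card_small_subsets(1)[OF finite_pairs])
  have "card {R. R \<subseteq> nsets {1..n} 2 \<and> card R \<le> r} \<le> (card (nsets {1..n} 2) + 1) ^ r"
    by (rule card_small_subsets(2)[OF finite_pairs])
  also have "\<dots> \<le> (n * n + 1) ^ r" using card_pairs_le[of n] by (intro power_mono) auto
  finally show "card {R. R \<subseteq> nsets {1..n} 2 \<and> card R \<le> r} \<le> (n * n + 1) ^ r" .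
qed

lemma card_near:
  assumes B: "finite B" and near: "\<And>H. H \<in> A \<Longrightarrow> \<exists>R. R \<subseteq> nsets {1..n} 2 \<and> card R \<le> r \<and> sd H R \<in> B"
  shows "card A \<le> (n * n + 1) ^ r * card B"
proof -
  let ?R = "{R. R \<subseteq> nsets {1..n} 2 \<and> card R \<le> r}"
  have "A \<subseteq> (\<lambda>(R, H). sd H R) ` (?R \<times> B)"
  proof
    fix H assume "H \<in> A"
    then obtain R where "R \<in> ?R" "sd H R \<in> B" using near by blast
    moreover have "H = sd (sd H R) R" by (simp add: sd_assoc)
    ultimately show "H \<in> (\<lambda>(R, H). sd H R) ` (?R \<times> B)"
      by (intro image_eqI[of _ _ "(R, sd H R)"]) simp_all
  qed
  then have "card A \<le> card (?R \<times> B)" using card_edge_sets(1) B by (intro surj_card_le) auto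
  also have "\<dots> = card ?R * card B" by (rule card_cartesian_product)
  also have "\<dots> \<le> (n * n + 1) ^ r * card B" using card_edge_sets(2) by (rule mult_right_mono) simp
  finally show ?thesis .
qed

section \<open>Repairing deficits and small excesses\<close>

lemma deg_add_edge:
  assumes "B \<in> graphs n" "{v, w} \<notin> B" "v \<noteq> w"
  shows "deg (sd B {{v, w}}) x = deg B x + (if x = v \<or> x = w then 1 else 0)"
proof -
  have "int (deg (sd B {{v, w}}) x) = int (deg B x + (if x = v \<or> x = w then 1 else 0))"
    using deg_toggle[OF finite_graph[OF assms(1)], of "{v, w}" x] assms by auto
  then show ?thesis by linarith
qed

lemma deg_remove_edge:
  assumes "B \<in> graphs n" "{v, w} \<in> B"
  shows "deg B x = deg (sd B {{v, w}}) x + (if x = v \<or> x = w then 1 else 0)"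
proof -
  have "int (deg B x) = int (deg (sd B {{v, w}}) x + (if x = v \<or> x = w then 1 else 0))"
    using deg_toggle[OF finite_graph[OF assms(1)], of "{v, w}" x] assms by auto
  then show ?thesis by linarith
qed

lemma nonneighbour_exists:
  assumes B: "B \<in> graphs n" and v: "v \<in> {1..n}" and d: "deg B v + card F < n" and F: "v \<in> F" "finite F"
  obtains w where "w \<in> {1..n}" "w \<notin> F" "{v, w} \<notin> B"
proof -
  have "card (nb B v \<union> F) < card {1..n}"
    using card_Un_le[of "nb B v" F] d deg_nb[OF B, of v] by simp
  then have "\<not> {1..n} \<subseteq> nb B v \<union> F"
    using card_mono[of "nb B v \<union> F" "{1..n}"] finite_nb[OF B, of v] F by auto
  then obtain w where "w \<in> {1..n}" "w \<notin> F" "w \<notin> nb B v" by blast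
  then show ?thesis using that[of w] by (simp add: nb_def)
qed

text \<open>An edge is added at a deficient vertex \<open>v\<close>. It may push its other end above
  \<open>u\<close>, but \<open>v\<close> improves by one, so the total deviation does not grow while
  the total deficit shrinks. A non-neighbour of \<open>v\<close> exists because
  \<open>l v \<le> n - 1\<close>.\<close>

lemma deviation_fix:
  assumes l: "\<And>v. v \<in> {1..n} \<Longrightarrow> l v \<le> n - 1 \<and> l v \<le> u v"
    and B: "B \<in> graphs n" and d: "(\<Sum>v\<in>{1..n}. l v - deg B v) = d"
    and c: "(\<Sum>v\<in>{1..n}. (l v - deg B v) + (deg B v - u v)) \<le> c"
  shows "\<exists>R. R \<subseteq> nsets {1..n} 2 \<and> card R \<le> d \<and> sd B R \<in> excess_set n l u c"
  using B d c
proof (induction d arbitrary: B rule: less_induct)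
  case (less d)
  show ?case
  proof (cases "\<forall>v\<in>{1..n}. l v \<le> deg B v")
    case True
    then have "(\<Sum>v\<in>{1..n}. deg B v - u v) \<le> c" using less.prems(3) by (simp add: sum.distrib)
    then have "sd B {} \<in> excess_set n l u c" using True less.prems(1) by (simp add: excess_set_def)
    then show ?thesis by (intro exI[of _ "{}"]) simp
  next
    case False
    then obtain v where v: "v \<in> {1..n}" "deg B v < l v" by auto
    have "l v \<le> n - 1" using l[OF v(1)] by blast
    then have "deg B v + card {v} < n" using v(2) by simp
    then obtain w where w: "w \<in> {1..n}" "w \<notin> {v}" "{v, w} \<notin> B"
      using nonneighbour_exists[OF less.prems(1) v(1), of "{v}"] by auto
    let ?B = "sd B {{v, w}}"
    have vw: "v \<noteq> w" using w by auto
    have dg: "deg ?B x = deg B x + (if x = v \<or> x = w then 1 else 0)" for x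
      by (rule deg_add_edge[OF less.prems(1) w(3) vw])
    have Bg: "?B \<in> graphs n" by (rule graphs_sd[OF less.prems(1)]) (use v w in \<open>simp add: doubleton_nsets\<close>)
    have "(\<Sum>x\<in>{1..n}. (l x - deg ?B x) + (if x = v then 1 else 0)) \<le> (\<Sum>x\<in>{1..n}. l x - deg B x)"
      by (rule sum_mono) (use v dg in auto)
    then have d': "(\<Sum>x\<in>{1..n}. l x - deg ?B x) + 1 \<le> d" using v less.prems(2) by (simp add: sum.distrib)
    have "(\<Sum>x\<in>{1..n}. ((l x - deg ?B x) + (deg ?B x - u x)) + (if x = v then 1 else 0)) \<le>
        (\<Sum>x\<in>{1..n}. ((l x - deg B x) + (deg B x - u x)) + (if x = w then 1 else 0))"
    proof (rule sum_mono)
      fix x assume "x \<in> {1..n}"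
      then show "((l x - deg ?B x) + (deg ?B x - u x)) + (if x = v then 1 else 0) \<le>
          ((l x - deg B x) + (deg B x - u x)) + (if x = w then 1 else 0)"
        using l[of x] v vw dg[of x] by auto
    qed
    then have "(\<Sum>x\<in>{1..n}. (l x - deg ?B x) + (deg ?B x - u x)) + 1 \<le>
        (\<Sum>x\<in>{1..n}. (l x - deg B x) + (deg B x - u x)) + 1"
      using v w by (simp only: sum.distrib sum.delta finite_atLeastAtMost if_True)
    then have c': "(\<Sum>x\<in>{1..n}. (l x - deg ?B x) + (deg ?B x - u x)) \<le> c" using less.prems(3) by linarith
    obtain R where R: "R \<subseteq> nsets {1..n} 2" "card R \<le> (\<Sum>x\<in>{1..n}. l x - deg ?B x)"
      "sd ?B R \<in> excess_set n l u c"
      using less.IH[OF _ Bg refl c'] d' by auto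
    have "finite R" using R(1) finite_subset[OF _ finite_pairs] by blast
    then have "card (sd {{v, w}} R) \<le> d" using card_sd_le[of "{{v, w}}" R] R(2) d' by simp
    moreover have "sd {{v, w}} R \<subseteq> nsets {1..n} 2"
      by (rule sd_subset) (use R v w in \<open>auto simp: doubleton_nsets\<close>)
    moreover have "sd B (sd {{v, w}} R) \<in> excess_set n l u c" using R(3) by (simp add: sd_assoc)
    ultimately show ?thesis by blast
  qed
qed

lemma card_deviation_set:
  assumes l: "\<And>v. v \<in> {1..n} \<Longrightarrow> l v \<le> n - 1 \<and> l v \<le> u v"
  shows "card (deviation_set n l u c) \<le> (n * n + 1) ^ c * card (excess_set n l u c)"
proof (rule card_near)
  show "finite (excess_set n l u c)" by (rule finite_subset_graphs[of _ n]) (auto simp: excess_set_def)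
  fix B assume B: "B \<in> deviation_set n l u c"
  then have g: "B \<in> graphs n" and s: "(\<Sum>v\<in>{1..n}. (l v - deg B v) + (deg B v - u v)) \<le> c"
    by (auto simp: deviation_set_def)
  obtain R where R: "R \<subseteq> nsets {1..n} 2" "card R \<le> (\<Sum>v\<in>{1..n}. l v - deg B v)" "sd B R \<in> excess_set n l u c"
    using deviation_fix[OF l g refl s] by blast
  have "(\<Sum>v\<in>{1..n}. l v - deg B v) \<le> c" using s by (simp add: sum.distrib)
  then show "\<exists>R. R \<subseteq> nsets {1..n} 2 \<and> card R \<le> c \<and> sd B R \<in> excess_set n l u c"
    using R by (intro exI[of _ R]) auto
qed

text \<open>
  An excess of 2 at a single vertex \<open>a\<close> is not covered by weak stability. It is reduced by
  deleting an edge \<open>ab\<close> and, if \<open>b\<close> becomes deficient, adding an edge at \<open>b\<close>. If no \<open>b\<close> were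
  suitable, all neighbours of \<open>a\<close> would be adjacent to \<open>a\<close> in every realization.
\<close>

lemma excess_two_near:
  assumes l: "\<And>v. v \<in> {1..n} \<Longrightarrow> l v \<le> n - 1 \<and> l v \<le> u v"
    and X: "X \<in> interval_realizations n l u" and H: "H \<in> excess_set n l u 2"
  shows "\<exists>R. R \<subseteq> nsets {1..n} 2 \<and> card R \<le> 2 \<and> sd H R \<in>
    interval_realizations n l u \<union> (\<Union>S\<in>nsets {1..n} 2. interval_realizations n l (\<lambda>i. u i + indicator S i))"
    (is "\<exists>R. _ \<and> _ \<and> _ \<in> ?W")
proof -
  let ?V = "{1..n}"
  have Hg: "H \<in> graphs n" and Hl: "\<And>v. v \<in> ?V \<Longrightarrow> l v \<le> deg H v" and Hs: "(\<Sum>v\<in>?V. deg H v - u v) \<le> 2"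
    using H by (auto simp: excess_set_def)
  have memW: "G \<in> ?W" if "G \<in> graphs n" "\<And>v. v \<in> ?V \<Longrightarrow> l v \<le> deg G v" "a \<in> ?V" "b \<in> ?V" "a \<noteq> b"
    "\<And>v. v \<in> ?V \<Longrightarrow> deg G v \<le> u v + (if v = a \<or> v = b then 1 else 0)" for G a b
  proof -
    have "deg G v \<le> u v + indicator {a, b} v" if "v \<in> ?V" for v
      using \<open>\<And>v. v \<in> ?V \<Longrightarrow> deg G v \<le> u v + (if v = a \<or> v = b then 1 else 0)\<close>[OF that]
      by (auto simp: indicator_def)
    then have "G \<in> interval_realizations n l (\<lambda>i. u i + indicator {a, b} i)"
      using that(1,2) by (simp add: interval_realizations_iff)
    moreover have "{a, b} \<in> nsets ?V 2" using that by (simp add: doubleton_nsets)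
    ultimately show ?thesis by blast
  qed
  have two: "(deg H v - u v) + (deg H w - u w) \<le> 2" if "v \<in> ?V" "w \<in> ?V" "v \<noteq> w" for v w
  proof -
    have "(\<Sum>x\<in>{v, w}. deg H x - u x) \<le> (\<Sum>x\<in>?V. deg H x - u x)" by (rule sum_mono2) (use that in auto)
    then show ?thesis using Hs that by simp
  qed
  show ?thesis
  proof (cases "\<forall>v\<in>?V. deg H v \<le> u v")
    case True
    then have "H \<in> interval_realizations n l u" using Hg Hl by (simp add: interval_realizations_iff)
    then show ?thesis by (intro exI[of _ "{}"]) simp
  next
    case False
    then obtain a where a: "a \<in> ?V" "u a < deg H a" by auto
    show ?thesis
    proof (cases "\<exists>b\<in>?V. b \<noteq> a \<and> u b < deg H b")
      case True
      then obtain b where b: "b \<in> ?V" "b \<noteq> a" "u b < deg H b" by auto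
      have "deg H v \<le> u v + (if v = a \<or> v = b then 1 else 0)" if v: "v \<in> ?V" for v
      proof -
        have ab: "deg H a - u a = 1" "deg H b - u b = 1" using two[OF a(1) b(1)] a b by auto
        show ?thesis
        proof (cases "v = a \<or> v = b")
          case True then show ?thesis using ab by auto
        next
          case False
          have "(\<Sum>x\<in>{v, a, b}. deg H x - u x) \<le> (\<Sum>x\<in>?V. deg H x - u x)" by (rule sum_mono2) (use v a b in auto)
          then show ?thesis using Hs False ab b by simp
        qed
      qed
      then have "H \<in> ?W" using memW[OF Hg Hl a(1) b(1)] b by blast
      then show ?thesis by (intro exI[of _ "{}"]) simp
    next
      case others: False
      then have ob: "deg H v \<le> u v" if "v \<in> ?V" "v \<noteq> a" for v using that by auto
      have a2: "deg H a \<le> u a + 2"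
        using member_le_sum[of a ?V "\<lambda>x. deg H x - u x"] a(1) Hs by simp
      have "\<exists>b\<in>nb H a. l b \<le> n - 2"
      proof (rule ccontr)
        assume no: "\<not> ?thesis"
        have Xg: "X \<in> graphs n" and Xd: "\<And>v. v \<in> ?V \<Longrightarrow> l v \<le> deg X v \<and> deg X v \<le> u v"
          using X by (auto simp: interval_realizations_iff)
        have "nb H a \<subseteq> nb X a"
        proof
          fix b assume b: "b \<in> nb H a"
          then have bV: "b \<in> ?V" and ba: "b \<noteq> a" using nb_graph[OF Hg] nb_graph_self[OF Hg, of a] by blast+
          have "n - 2 < l b" using no b by auto
          moreover have "l b \<le> card (nb X b)" using Xd[OF bV] deg_nb[OF Xg, of b] by simp
          ultimately have "n - 1 \<le> card (nb X b)" by arith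
          moreover have "nb X b \<subseteq> ?V - {b}" using nb_graph[OF Xg, of b] nb_graph_self[OF Xg, of b] by blast
          moreover have "card (?V - {b}) = n - 1" using bV by simp
          ultimately have "nb X b = ?V - {b}" by (intro card_seteq) auto
          then have "a \<in> nb X b" using a(1) ba by simp
          then show "b \<in> nb X a" by (simp add: nb_def insert_commute)
        qed
        then have "deg H a \<le> deg X a" unfolding deg_nb[OF Hg] deg_nb[OF Xg] using finite_nb[OF Xg] by (rule card_mono[rotated])
        then show False using a Xd[OF a(1)] by simp
      qed
      then obtain b where b: "b \<in> nb H a" "l b \<le> n - 2" by blast
      have bV: "b \<in> ?V" and ba: "b \<noteq> a" using b(1) nb_graph[OF Hg] nb_graph_self[OF Hg, of a] by blast+
      have ab: "{a, b} \<in> H" using b(1) by (simp add: nb_def)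
      let ?H1 = "sd H {{a, b}}"
      have d1: "deg H x = deg ?H1 x + (if x = a \<or> x = b then 1 else 0)" for x by (rule deg_remove_edge[OF Hg ab])
      have abV: "{{a, b}} \<subseteq> nsets ?V 2" using a bV ba by (simp add: doubleton_nsets)
      have H1g: "?H1 \<in> graphs n" by (rule graphs_sd[OF Hg abV])
      have la: "l a \<le> deg ?H1 a" using d1[of a] a l[OF a(1)] by simp
      have ua: "deg ?H1 a \<le> u a + 1" using d1[of a] a2 by simp
      show ?thesis
      proof (cases "l b \<le> deg ?H1 b")
        case True
        have "?H1 \<in> ?W"
        proof (rule memW[OF H1g _ a(1) bV])
          show "l v \<le> deg ?H1 v" if "v \<in> ?V" for v
            using Hl[OF that] d1[of v] True la by (cases "v = a \<or> v = b") auto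
          show "deg ?H1 v \<le> u v + (if v = a \<or> v = b then 1 else 0)" if "v \<in> ?V" for v
            using ob[OF that] d1[of v] ua by (cases "v = a") auto
        qed (use ba in auto)
        then show ?thesis using abV by (intro exI[of _ "{{a, b}}"]) simp
      next
        case False
        \<comment> \<open>This is where \<open>l b \<le> n - 2\<close> enters: \<open>b\<close>
          needs a non-neighbour different from \<open>a\<close>, as adding \<open>ab\<close> again
          would undo the deletion.\<close>
        have db: "deg ?H1 b + 1 = l b" using False Hl[OF bV] d1[of b] by simp
        moreover have "card {b, a} = 2" using ba by simp
        moreover have "2 \<le> n" using a(1) bV ba by auto
        ultimately have "deg ?H1 b + card {b, a} < n" using b(2) by linarith
        then obtain c where c: "c \<in> ?V" "c \<notin> {b, a}" "{b, c} \<notin> ?H1"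
          using nonneighbour_exists[OF H1g bV, of "{b, a}"] by auto
        let ?H2 = "sd ?H1 {{b, c}}"
        have bc: "b \<noteq> c" using c by auto
        have d2: "deg ?H2 x = deg ?H1 x + (if x = b \<or> x = c then 1 else 0)" for x
          by (rule deg_add_edge[OF H1g c(3) bc])
        have bcV: "{{b, c}} \<subseteq> nsets ?V 2" using c bV by (auto simp: doubleton_nsets)
        have H2g: "?H2 \<in> graphs n" by (rule graphs_sd[OF H1g bcV])
        have "?H2 \<in> ?W"
        proof (rule memW[OF H2g _ a(1) c(1)])
          show "l v \<le> deg ?H2 v" if "v \<in> ?V" for v
            using Hl[OF that] d1[of v] d2[of v] db la by (cases "v = a"; cases "v = b") auto
          show "deg ?H2 v \<le> u v + (if v = a \<or> v = c then 1 else 0)" if "v \<in> ?V" for v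
            using ob[OF that] d1[of v] d2[of v] ua c l[OF bV] db by (cases "v = a"; cases "v = b") auto
        qed (use c in auto)
        moreover have "?H2 = sd H (sd {{a, b}} {{b, c}})" by (simp add: sd_assoc)
        moreover have "card (sd {{a, b}} {{b, c}}) \<le> 2" using card_sd_le[of "{{a, b}}" "{{b, c}}"] by simp
        moreover have "sd {{a, b}} {{b, c}} \<subseteq> nsets ?V 2" using abV bcV by (rule sd_subset)
        ultimately show ?thesis by (intro exI[of _ "sd {{a, b}} {{b, c}}"]) simp
      qed
    qed
  qed
qed

lemma card_excess_two:
  assumes l: "\<And>v. v \<in> {1..n} \<Longrightarrow> l v \<le> n - 1 \<and> l v \<le> u v" and ne: "interval_realizations n l u \<noteq> {}"
  shows "card (excess_set n l u 2) \<le> (n * n + 1) ^ 2 * (card (interval_realizations n l u) +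
    card (\<Union>S\<in>nsets {1..n} 2. interval_realizations n l (\<lambda>i. u i + indicator S i)))"
proof -
  let ?A = "interval_realizations n l u" and ?B = "\<Union>S\<in>nsets {1..n} 2. interval_realizations n l (\<lambda>i. u i + indicator S i)"
  obtain X where X: "X \<in> ?A" using ne by blast
  have fin: "finite (?A \<union> ?B)" by (rule finite_subset_graphs[of _ n]) (auto simp: interval_realizations_iff)
  have "card (excess_set n l u 2) \<le> (n * n + 1) ^ 2 * card (?A \<union> ?B)"
    by (rule card_near[OF fin]) (rule excess_two_near[OF l X])
  also have "\<dots> \<le> (n * n + 1) ^ 2 * (card ?A + card ?B)" by (rule mult_left_mono[OF card_Un_le]) simp
  finally show ?thesis .
qed

section \<open>Lowering the excess by flipping one trail\<close>

lemma fixed_in_trail: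
  assumes "trail_ok \<psi> t" "involutive G \<psi>" "set (el t) \<subseteq> G" "distinct (el t)"
    and "{v, w} \<in> set (el t)" "\<psi> v w = w"
  shows "(v, w) \<in> {(hd t, t ! 1), (last t, t ! (length t - 2))}"
  using assms(1-3,5)
proof (cases rule: dart_partner)
  case (inner_fwd i)
  then have "el t ! Suc i = el t ! i" using assms(6) by simp
  moreover have "Suc i < length (el t)" "i < length (el t)" using inner_fwd by simp_all
  ultimately show ?thesis using assms(4) by (simp add: nth_eq_iff_index_eq)
next
  case (inner_bwd i)
  then have "el t ! Suc i = el t ! i" using assms(6) by simp
  moreover have "Suc i < length (el t)" "i < length (el t)" using inner_bwd by simp_all
  ultimately show ?thesis using assms(4) by (simp add: nth_eq_iff_index_eq)
next
  case outer
  then show ?thesis by auto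
qed

lemma length_elist:
  assumes "decomp \<psi> G Ts" "G \<in> graphs n"
  shows "length (concat (map el Ts)) \<le> n * n"
proof -
  have "length (concat (map el Ts)) = card (set (concat (map el Ts)))"
    using assms(1) distinct_card unfolding decomp_def by metis
  also have "\<dots> = card G" using assms(1) unfolding decomp_def by simp
  also have "\<dots> \<le> card (nsets {1..n} 2)" using assms(2) by (intro card_mono[OF finite_pairs]) (simp add: graphs_def)
  also have "\<dots> \<le> n * n" by (rule card_pairs_le)
  finally show ?thesis .
qed

lemma trail_as_ps:
  assumes D: "decomp \<psi> G Ts" and t: "t \<in> set Ts"
  obtains bs where "length bs = 2" "set bs \<subseteq> {..length (concat (map el Ts))}"
    "prefix_flip (concat (map el Ts)) bs = set (el t)"
proof -
  let ?L = "concat (map el Ts)"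
  obtain Ts1 Ts2 where "Ts = Ts1 @ t # Ts2" using t by (meson split_list)
  then have L: "?L = concat (map el Ts1) @ el t @ concat (map el Ts2)" by simp
  let ?a = "length (concat (map el Ts1))" and ?b = "length (concat (map el Ts1)) + length (el t)"
  have d: "distinct ?L" using D by (simp add: decomp_def)
  have "drop ?a (take ?b ?L) = el t" unfolding L by simp
  then have "sd (set (take ?a ?L)) (set (take ?b ?L)) = set (el t)" using sd_take[OF d, of ?a ?b] by simp
  then have "prefix_flip ?L [?a, ?b] = set (el t)" by simp
  moreover have "set [?a, ?b] \<subseteq> {..length ?L}" unfolding L by simp
  ultimately show ?thesis using that[of "[?a, ?b]"] by simp
qed

text \<open>The factor 1 of the factorial is free. In a thin interval the degree difference at a
  vertex is at most one more than the excess there, so each unit of excess costs one factor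
  \<open>n + 1\<close> and vertices without excess cost nothing.\<close>

lemma fact_le_power_diff: "s \<le> n \<Longrightarrow> s \<le> Suc e \<Longrightarrow> (fact s :: nat) \<le> (n + 1) ^ e"
proof (induction s arbitrary: e)
  case (Suc s)
  show ?case
  proof (cases e)
    case 0
    then show ?thesis using Suc by simp
  next
    case (Suc e')
    then have "fact s \<le> (n + 1) ^ e'" using Suc.IH[of e'] Suc.prems by simp
    then have "Suc s * fact s \<le> (n + 1) * (n + 1) ^ e'" using Suc.prems by (intro mult_mono) auto
    then show ?thesis using Suc by simp
  qed
qed simp

text \<open>At an excess vertex \<open>a\<close> the graph \<open>H\<close> has a larger degree than
  \<open>X\<close>, so some edge at \<open>a\<close> is unpaired. Flipping its trail lowers the
  degree of \<open>H\<close> at \<open>a\<close> and raises no excess of \<open>H\<close>, while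
  \<open>X\<close> gains at most one unit of excess for each unpaired end of the trail.\<close>

lemma excess_flip:
  assumes H: "H \<in> excess_set n l u k" and pos: "(\<Sum>v\<in>{1..n}. deg H v - u v) = k" "0 < k"
    and X: "X \<in> interval_realizations n l u" and \<psi>: "\<psi> \<in> good_pairings n H X"
  shows "\<exists>bs. length bs = 2 \<and> set bs \<subseteq> {..n * n} \<and>
    (sd H (prefix_flip (elist \<psi> (sd H X)) bs), sd X (prefix_flip (elist \<psi> (sd H X)) bs)) \<in> excess_set n l u (k - 1) \<times> excess_set n l u 2"
proof -
  let ?V = "{1..n}" and ?G = "sd H X"
  have Hg: "H \<in> graphs n" and Hl: "\<And>v. v \<in> ?V \<Longrightarrow> l v \<le> deg H v" using H by (auto simp: excess_set_def)
  have Xg: "X \<in> graphs n" and Xd: "\<And>v. v \<in> ?V \<Longrightarrow> l v \<le> deg X v \<and> deg X v \<le> u v"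
    using X by (auto simp: interval_realizations_iff)
  have Gg: "?G \<in> graphs n" by (rule sd_graphs[OF Hg Xg])
  have P: "\<psi> \<in> pairings n ?G" using \<psi> by (simp add: good_pairings_def)
  have inv: "involutive ?G \<psi>" by (rule pairings_involutive[OF P Gg])
  have D: "decomp \<psi> ?G (trails \<psi> ?G)" by (rule decomp_trails[OF P Gg])
  have "\<exists>a\<in>?V. 0 < deg H a - u a"
  proof (rule ccontr)
    assume "\<not> ?thesis"
    then have "deg H v - u v = 0" if "v \<in> ?V" for v using that by (meson gr0I)
    then have "(\<Sum>v\<in>?V. deg H v - u v) = 0" by (intro sum.neutral) blast
    then show False using pos by simp
  qed
  then obtain a where a: "a \<in> ?V" "u a < deg H a" by auto
  have "card (defects ?G H \<psi> a) = (deg H a - deg X a) + (deg X a - deg H a)"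
    using \<psi> a(1) by (simp add: good_pairings_def)
  then have "defects ?G H \<psi> a \<noteq> {}" using a Xd[OF a(1)] by auto
  then obtain w where w: "w \<in> defects ?G H \<psi> a" by blast
  then have fw: "\<psi> a w = w" "{a, w} \<in> ?G" using \<psi> a(1) by (auto simp: good_pairings_def defects_def nb_def)
  obtain t where t: "t \<in> set (trails \<psi> ?G)" "{a, w} \<in> set (el t)" by (rule decomp_trail[OF D fw(2)])
  note tD = decomp_trailD[OF D t(1)]
  obtain bs where bs: "length bs = 2" "set bs \<subseteq> {..length (elist \<psi> ?G)}" "prefix_flip (elist \<psi> ?G) bs = set (el t)"
    using trail_as_ps[OF D t(1)] unfolding elist_def by blast
  have bs': "set bs \<subseteq> {..n * n}" using bs(2) length_elist[OF D Gg] unfolding elist_def by auto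
  let ?S = "set (el t)"
  have closed: "\<psi> v w \<in> nb ?S v" if "w \<in> nb ?S v" for v w
    using trail_partner[OF tD(1) inv tD(2), of v w] that by (simp add: nb_def)
  define f where "f v = card {w \<in> nb ?S v. \<psi> v w = w}" for v
  have fl: "if deg X v \<le> deg H v then deg (sd H ?S) v + f v = deg H v \<and> deg (sd H ?S) v \<ge> deg X v
     else deg (sd H ?S) v = deg H v + f v \<and> deg (sd H ?S) v \<le> deg X v" if "v \<in> ?V" for v
    unfolding f_def by (rule good_flip[OF \<psi> Hg Xg tD(2) closed that])
  have SV: "?S \<subseteq> nsets ?V 2" using tD(2) Gg by (auto simp: graphs_def simp del: in_sd)
  have g: "sd H ?S \<in> graphs n" "sd X ?S \<in> graphs n" using graphs_sd[OF Hg SV] graphs_sd[OF Xg SV] .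
  have ds: "deg (sd H ?S) v + deg (sd X ?S) v = deg H v + deg X v" for v
    by (rule deg_sum[OF Hg Xg tD(2)])
  have fin: "finite {w \<in> nb ?S v. \<psi> v w = w}" for v
    using finite_nb[of ?S n v] SV by (simp add: graphs_def)
  have fa: "0 < f a"
  proof -
    have "w \<in> {w \<in> nb ?S a. \<psi> a w = w}" using t(2) fw(1) by (simp add: nb_def)
    then show ?thesis unfolding f_def using fin card_gt_0_iff by blast
  qed
  have "sd H ?S \<in> excess_set n l u (k - 1)"
  proof -
    have low: "l v \<le> deg (sd H ?S) v" if "v \<in> ?V" for v
      using fl[OF that] Hl[OF that] Xd[OF that] by (cases "deg X v \<le> deg H v") auto
    have le: "deg (sd H ?S) v - u v \<le> deg H v - u v" if "v \<in> ?V" for v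
      using fl[OF that] Xd[OF that] by (cases "deg X v \<le> deg H v") auto
    have "deg (sd H ?S) a - u a < deg H a - u a"
      using fl[OF a(1)] Xd[OF a(1)] a fa by (cases "deg X a \<le> deg H a") auto
    then have "(\<Sum>v\<in>?V. deg (sd H ?S) v - u v) < (\<Sum>v\<in>?V. deg H v - u v)"
      using le a(1) by (intro sum_strict_mono_ex1) auto
    then show ?thesis using low g(1) pos by (simp add: excess_set_def)
  qed
  moreover have "sd X ?S \<in> excess_set n l u 2"
  proof -
    have low: "l v \<le> deg (sd X ?S) v" if "v \<in> ?V" for v
      using fl[OF that] ds[of v] Hl[OF that] Xd[OF that] by (cases "deg X v \<le> deg H v") auto
    have le: "deg (sd X ?S) v - u v \<le> f v" if "v \<in> ?V" for v
      using fl[OF that] ds[of v] Xd[OF that] by (cases "deg X v \<le> deg H v") auto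
    have "(\<Sum>v\<in>?V. deg (sd X ?S) v - u v) \<le> (\<Sum>v\<in>?V. f v)" using le by (rule sum_mono)
    also have "\<dots> = card (SIGMA v:?V. {w \<in> nb ?S v. \<psi> v w = w})"
      unfolding f_def using fin by (intro card_SigmaI[symmetric]) auto
    \<comment> \<open>An inner dart that is its own partner would repeat an edge in the list. Hence
      only the two ends can be unpaired, which is the origin of the 2 in
      \<open>excess_set n l u 2\<close>.\<close>
    also have "\<dots> \<le> card {(hd t, t ! 1), (last t, t ! (length t - 2))}"
    proof (rule card_mono)
      show "(SIGMA v:?V. {w \<in> nb ?S v. \<psi> v w = w}) \<subseteq> {(hd t, t ! 1), (last t, t ! (length t - 2))}"
      proof (intro subsetI)
        fix p assume "p \<in> (SIGMA v:?V. {w \<in> nb ?S v. \<psi> v w = w})"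
        then obtain v w where p: "p = (v, w)" "{v, w} \<in> ?S" "\<psi> v w = w" by (auto simp: nb_def)
        show "p \<in> {(hd t, t ! 1), (last t, t ! (length t - 2))}"
          unfolding p(1) by (rule fixed_in_trail[OF tD(1) inv tD(2,3) p(2,3)])
      qed
    qed simp
    also have "\<dots> \<le> 2" by (simp add: card_insert_if)
    finally show ?thesis using low g(2) by (simp add: excess_set_def)
  qed
  ultimately show ?thesis using bs(1,3) bs' by (intro exI[of _ bs]) simp
qed

text \<open>\<open>(n + 1) ^ k\<close> bounds the factorials of \<open>card_good_pairings\<close>.
  The rest is the loss in \<open>weighted_count\<close> for the two prefixes that describe one
  trail: 8 = 4 * 2 cut darts, on top of at most \<open>k\<close> exceptional vertices and at most
  \<open>k + 1\<close> defects at each.\<close>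

definition excess_factor :: "nat \<Rightarrow> nat \<Rightarrow> nat" where
  "excess_factor n k = (n + 1) ^ k * ((n * n + 1) ^ 2 *
     ((n + 1) ^ (k + 8) * ((n + 1) ^ (2 * (k + 9))) ^ (k + 8)))"

text \<open>
  Flipping the trail at an excess vertex moves a pair from \<open>E\<^sub>k \<times> E\<^sub>0\<close> to \<open>E\<^sub>k\<^sub>-\<^sub>1 \<times> E\<^sub>2\<close>; the counts
  compare as for matchings with a growing number of unmatched vertices.
\<close>

lemma card_excess_step:
  assumes thin: "thin n l u" and k: "0 < k"
  shows "real (card (excess_set n l u k)) * real (card (interval_realizations n l u)) \<le>
    real (card (excess_set n l u (k - 1))) * real (card (interval_realizations n l u)) +
    real (excess_factor n k) * real (card (excess_set n l u (k - 1))) * real (card (excess_set n l u 2))"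
proof -
  let ?V = "{1..n}" and ?Om = "interval_realizations n l u"
  let ?E = "excess_set n l u"
  define E' where "E' = {H \<in> ?E k. (\<Sum>v\<in>?V. deg H v - u v) = k}"
  have finE: "finite (?E j)" for j by (rule finite_subset_graphs[of _ n]) (auto simp: excess_set_def)
  have finOm: "finite ?Om" by (rule finite_subset_graphs[of _ n]) (auto simp: interval_realizations_iff)
  have finE': "finite E'" using finE[of k] by (simp add: E'_def)
  have "?E k \<subseteq> ?E (k - 1) \<union> E'" by (auto simp: excess_set_def E'_def)
  then have "card (?E k) \<le> card (?E (k - 1) \<union> E')" using finE finE' by (intro card_mono) auto
  also have "\<dots> \<le> card (?E (k - 1)) + card E'" by (rule card_Un_le)
  finally have cE: "card (?E k) \<le> card (?E (k - 1)) + card E'" .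
  define T where "T = (SIGMA H:E'. SIGMA X:?Om. good_pairings n H X)"
  have Hg: "H \<in> graphs n" if "H \<in> E'" for H using that by (auto simp: E'_def excess_set_def)
  have Xg: "X \<in> graphs n" if "X \<in> ?Om" for X using that by (simp add: interval_realizations_iff)
  have fgood: "finite (good_pairings n H X)" if "H \<in> E'" "X \<in> ?Om" for H X
    using finite_pairings[OF sd_graphs[OF Hg[OF that(1)] Xg[OF that(2)]]] by (simp add: good_pairings_def)
  have finT: "finite T" unfolding T_def using finE' finOm fgood by (intro finite_SigmaI) auto
  have s_le: "(deg H v - deg X v) + (deg X v - deg H v) \<le> Suc (deg H v - u v)"
    if "H \<in> E'" "X \<in> ?Om" "v \<in> ?V" for H X v
  proof -
    have "l v \<le> deg H v" using that by (auto simp: E'_def excess_set_def)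
    moreover have "l v \<le> deg X v" "deg X v \<le> u v" using that by (auto simp: interval_realizations_iff)
    moreover have "u v \<le> l v + 1" using thin that(3) by (simp add: thin_def)
    ultimately show ?thesis by arith
  qed
  have s_n: "(deg H v - deg X v) + (deg X v - deg H v) \<le> n" if "H \<in> graphs n" "X \<in> graphs n" for H X v
  proof -
    have "card (nb H v) \<le> card ?V" "card (nb X v) \<le> card ?V"
      using nb_graph[OF that(1)] nb_graph[OF that(2)] by (simp_all only: card_mono finite_atLeastAtMost)
    then show ?thesis using that by (simp add: deg_nb)
  qed
  have lower: "1 \<le> real ((n + 1) ^ k) * (\<Sum>\<psi>\<in>good_pairings n H X. 1 / real (pairing_weight n (sd H X)))"
    if HX: "H \<in> E'" "X \<in> ?Om" for H X
  proof -
    let ?s = "\<lambda>v. (deg H v - deg X v) + (deg X v - deg H v)"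
    have "(\<Prod>v\<in>?V. fact (?s v)) \<le> (\<Prod>v\<in>?V. (n + 1) ^ (deg H v - u v) :: nat)"
      using fact_le_power_diff[OF s_n[OF Hg[OF HX(1)] Xg[OF HX(2)]] s_le[OF HX]] by (intro prod_mono) simp
    also have "\<dots> = (n + 1) ^ k"
      using HX(1) by (simp add: power_sum[symmetric] E'_def)
    finally have "pairing_weight n (sd H X) \<le> card (good_pairings n H X) * (n + 1) ^ k"
      using card_good_pairings[OF Hg[OF HX(1)] Xg[OF HX(2)]] by (meson le_trans mult_le_mono2)
    then have "real (pairing_weight n (sd H X)) \<le> real (card (good_pairings n H X)) * real ((n + 1) ^ k)"
      by (metis of_nat_le_iff of_nat_mult)
    then show ?thesis using pairing_weight_pos[of n "sd H X"] by (simp add: field_simps)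
  qed
  have up: "(\<Sum>(H, X, \<psi>)\<in>T. 1 / real (pairing_weight n (sd H X))) \<le>
      real ((n * n + 1) ^ 2) * real (card (?E (k - 1) \<times> ?E 2)) *
      real ((n + 1) ^ (k + 8) * ((n + 1) ^ (2 * (k + 9))) ^ (k + 8))"
  proof (rule weighted_count[OF finT])
    show "finite (?E (k - 1) \<times> ?E 2)" using finE by blast
    show "?E (k - 1) \<times> ?E 2 \<subseteq> graphs n \<times> graphs n" by (auto simp: excess_set_def)
    fix H X \<psi> assume "(H, X, \<psi>) \<in> T"
    then have HX: "H \<in> E'" "X \<in> ?Om" and \<psi>: "\<psi> \<in> good_pairings n H X" by (auto simp: T_def)
    let ?G = "sd H X"
    have P: "\<psi> \<in> pairings n ?G" using \<psi> by (simp add: good_pairings_def)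
    have cd: "card (defects ?G H \<psi> v) = (deg H v - deg X v) + (deg X v - deg H v)" if "v \<in> ?V" for v
      using \<psi> that by (simp add: good_pairings_def)
    have sumk: "(\<Sum>v\<in>?V. deg H v - u v) = k" using HX(1) by (simp add: E'_def)
    have m: "card (defects ?G H \<psi> v) \<le> k + 1" if v: "v \<in> ?V" for v
      using cd[OF v] s_le[OF HX v] member_le_sum[of v ?V "\<lambda>v. deg H v - u v"] v sumk by simp
    \<comment> \<open>Two or more defects at \<open>v\<close> force a positive excess of
      \<open>H\<close> there, and the excesses sum up to \<open>k\<close>.\<close>
    have "card {v \<in> ?V. 1 < card (defects ?G H \<psi> v)} = (\<Sum>v\<in>{v \<in> ?V. 1 < card (defects ?G H \<psi> v)}. 1)" by simp
    also have "\<dots> \<le> (\<Sum>v\<in>{v \<in> ?V. 1 < card (defects ?G H \<psi> v)}. deg H v - u v)"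
    proof (rule sum_mono)
      fix v assume "v \<in> {v \<in> ?V. 1 < card (defects ?G H \<psi> v)}"
      then show "1 \<le> deg H v - u v" using cd[of v] s_le[OF HX, of v] by auto
    qed
    also have "\<dots> \<le> (\<Sum>v\<in>?V. deg H v - u v)" by (rule sum_mono2) auto
    finally have \<kappa>: "card {v \<in> ?V. 1 < card (defects ?G H \<psi> v)} \<le> k" using sumk by simp
    have HE: "H \<in> ?E k" using HX(1) by (simp add: E'_def)
    obtain bs where bs: "length bs = 2" "set bs \<subseteq> {..n * n}"
      "(sd H (prefix_flip (elist \<psi> ?G) bs), sd X (prefix_flip (elist \<psi> ?G) bs)) \<in> ?E (k - 1) \<times> ?E 2"
      using excess_flip[OF HE sumk k HX(2) \<psi>] by blast
    have near: "\<psi> \<in> near_pairings n ?G (sd H (prefix_flip (elist \<psi> ?G) bs)) (k + 4 * length bs) (k + 1 + 4 * length bs)"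
      by (rule near_flip[OF P sd_graphs[OF Hg[OF HX(1)] Xg[OF HX(2)]] \<kappa> m])
    have eq: "k + 4 * 2 = k + 8" "k + 1 + 4 * 2 = k + 9" by simp_all
    show "\<exists>bs. length bs = 2 \<and> set bs \<subseteq> {..n * n} \<and>
        (sd H (prefix_flip (elist \<psi> ?G) bs), sd X (prefix_flip (elist \<psi> ?G) bs)) \<in> ?E (k - 1) \<times> ?E 2 \<and>
        \<psi> \<in> near_pairings n ?G (sd H (prefix_flip (elist \<psi> ?G) bs)) (k + 8) (k + 9)"
      using bs near[unfolded bs(1) eq] by blast
  qed
  have "real (card E') * real (card ?Om) = (\<Sum>H\<in>E'. \<Sum>X\<in>?Om. 1)" by simp
  also have "\<dots> \<le> (\<Sum>H\<in>E'. \<Sum>X\<in>?Om. real ((n + 1) ^ k) * (\<Sum>\<psi>\<in>good_pairings n H X. 1 / real (pairing_weight n (sd H X))))"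
    by (intro sum_mono lower)
  also have "\<dots> = real ((n + 1) ^ k) * (\<Sum>H\<in>E'. \<Sum>X\<in>?Om. \<Sum>\<psi>\<in>good_pairings n H X. 1 / real (pairing_weight n (sd H X)))"
    by (simp only: sum_distrib_left)
  also have "(\<Sum>H\<in>E'. \<Sum>X\<in>?Om. \<Sum>\<psi>\<in>good_pairings n H X. 1 / real (pairing_weight n (sd H X))) =
      (\<Sum>(H, X, \<psi>)\<in>T. 1 / real (pairing_weight n (sd H X)))"
  proof -
    have "(\<Sum>X\<in>?Om. \<Sum>\<psi>\<in>good_pairings n H X. 1 / real (pairing_weight n (sd H X))) =
        (\<Sum>(X, \<psi>)\<in>(SIGMA X:?Om. good_pairings n H X). 1 / real (pairing_weight n (sd H X)))" if "H \<in> E'" for H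
      using finOm fgood[OF that] by (intro sum.Sigma) auto
    then have "(\<Sum>H\<in>E'. \<Sum>X\<in>?Om. \<Sum>\<psi>\<in>good_pairings n H X. 1 / real (pairing_weight n (sd H X))) =
        (\<Sum>H\<in>E'. \<Sum>(X, \<psi>)\<in>(SIGMA X:?Om. good_pairings n H X). 1 / real (pairing_weight n (sd H X)))"
      by (intro sum.cong) auto
    also have "\<dots> = (\<Sum>(H, X, \<psi>)\<in>T. 1 / real (pairing_weight n (sd H X)))"
      unfolding T_def using finE' finOm fgood by (subst sum.Sigma) (auto intro!: finite_SigmaI)
    finally show ?thesis .
  qed
  also have "real ((n + 1) ^ k) * (\<Sum>(H, X, \<psi>)\<in>T. 1 / real (pairing_weight n (sd H X))) \<le> real ((n + 1) ^ k) *
      (real ((n * n + 1) ^ 2) * real (card (?E (k - 1) \<times> ?E 2)) *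
      real ((n + 1) ^ (k + 8) * ((n + 1) ^ (2 * (k + 9))) ^ (k + 8)))"
    using up by (rule mult_left_mono) simp
  also have "\<dots> = real (excess_factor n k) * real (card (?E (k - 1))) * real (card (?E 2))"
    unfolding excess_factor_def card_cartesian_product of_nat_mult by (simp only: ac_simps)
  finally have "real (card E') * real (card ?Om) \<le> real (excess_factor n k) * real (card (?E (k - 1))) * real (card (?E 2))" .
  moreover have "real (card (?E k)) * real (card ?Om) \<le> (real (card (?E (k - 1))) + real (card E')) * real (card ?Om)"
    using cE by (intro mult_right_mono) (simp_all flip: of_nat_add)
  ultimately show ?thesis by (simp only: distrib_right)
qed

section \<open>The flow between two realizations\<close>

lemma prefix_flip_min: "prefix_flip L (map (min (length L)) bs) = prefix_flip L bs"
proof (induction bs)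
  case (Cons b bs)
  have "take (min (length L) b) L = take b L" by (simp add: min_def)
  then show ?case using Cons by simp
qed simp

lemma prefix_flip_replicate: "prefix_flip L (bs @ replicate j 0) = prefix_flip L bs"
  by (induction j) (simp_all add: prefix_flip_append replicate_app_Cons_same)

lemma prefix_flip_subset: "prefix_flip L bs \<subseteq> set L"
proof (induction bs)
  case (Cons b bs)
  then show ?case using set_take_subset[of b L] sd_subset[of "set (take b L)" "set L" "prefix_flip L bs"] by simp
qed simp

text \<open>Padding with empty prefixes and capping the lengths at \<open>length L\<close> does not
  change the set, but makes the descriptions easy to count: exactly \<open>k\<close> numbers from a
  fixed range.\<close>

lemma near_prefixes_normal:
  assumes "S \<in> near_prefixes n L k r"
  obtains bs R where "length bs = k" "set bs \<subseteq> {..length L}" "R \<subseteq> nsets {1..n} 2" "card R \<le> r" "S = sd (prefix_flip L bs) R"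
proof -
  obtain cs R where 1: "length cs \<le> k" "R \<subseteq> nsets {1..n} 2" "card R \<le> r" "S = sd (prefix_flip L cs) R"
    using assms unfolding near_prefixes_def by blast
  let ?bs = "map (min (length L)) cs @ replicate (k - length cs) 0"
  have "prefix_flip L ?bs = prefix_flip L cs" by (simp only: prefix_flip_replicate prefix_flip_min)
  moreover have "length ?bs = k" "set ?bs \<subseteq> {..length L}" using 1(1) by auto
  ultimately show ?thesis using that[of ?bs R] 1 by simp
qed

definition flow_states :: "nat \<Rightarrow> (nat \<Rightarrow> nat) \<Rightarrow> (nat \<Rightarrow> nat) \<Rightarrow> graph \<Rightarrow> graph \<Rightarrow> (nat \<Rightarrow> nat \<Rightarrow> nat) \<Rightarrow> graph set" where
  "flow_states n l u X Y \<psi> = {U \<in> interval_realizations n l u.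
     (\<forall>v\<in>{1..n}. deg U v \<in> {deg X v, deg Y v}) \<and> sd X U \<in> near_prefixes n (elist \<psi> (sd X Y)) 21 9}"

context
  fixes n l u X Y \<psi>
  assumes thin: "thin n l u"
    and X: "X \<in> interval_realizations n l u" and Y: "Y \<in> interval_realizations n l u"
    and \<psi>: "\<psi> \<in> good_pairings n X Y"
begin

lemma realization_facts:
  "X \<in> graphs n" "Y \<in> graphs n" "sd X Y \<in> graphs n" "\<psi> \<in> pairings n (sd X Y)"
  "involutive (sd X Y) \<psi>" "decomp \<psi> (sd X Y) (trails \<psi> (sd X Y))"
  "v \<in> {1..n} \<Longrightarrow> deg X v \<le> deg Y v + 1 \<and> deg Y v \<le> deg X v + 1"
  "v \<in> {1..n} \<Longrightarrow> card (defects (sd X Y) X \<psi> v) = (deg X v - deg Y v) + (deg Y v - deg X v)"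
proof -
  show 1: "X \<in> graphs n" "Y \<in> graphs n" using X Y by (simp_all add: interval_realizations_iff)
  show 2: "sd X Y \<in> graphs n" by (rule sd_graphs[OF 1])
  show 3: "\<psi> \<in> pairings n (sd X Y)" using \<psi> by (simp add: good_pairings_def)
  show "involutive (sd X Y) \<psi>" by (rule pairings_involutive[OF 3 2])
  show "decomp \<psi> (sd X Y) (trails \<psi> (sd X Y))" by (rule decomp_trails[OF 3 2])
  show "deg X v \<le> deg Y v + 1 \<and> deg Y v \<le> deg X v + 1" if v: "v \<in> {1..n}"
  proof -
    have "l v \<le> deg X v" "deg X v \<le> u v" "l v \<le> deg Y v" "deg Y v \<le> u v" "u v \<le> l v + 1"
      using X Y thin v by (auto simp: interval_realizations_iff thin_def)
    then show ?thesis by linarith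
  qed
  show "card (defects (sd X Y) X \<psi> v) = (deg X v - deg Y v) + (deg Y v - deg X v)" if "v \<in> {1..n}"
    using \<psi> that by (simp add: good_pairings_def)
qed

text \<open>By thinness the degrees of \<open>X\<close> and \<open>Y\<close> at \<open>v\<close>
  differ by at most one, so the monotone change in \<open>good_flip\<close> leaves nothing in
  between.\<close>

lemma flip_closed_deg:
  assumes S: "S \<subseteq> sd X Y" and closed: "\<And>v w. w \<in> nb S v \<Longrightarrow> \<psi> v w \<in> nb S v" and v: "v \<in> {1..n}"
  shows "deg (sd X S) v \<in> {deg X v, deg Y v}"
  using good_flip[OF \<psi> realization_facts(1,2) S closed v] realization_facts(7)[OF v]
  by (cases "deg Y v \<le> deg X v") auto

lemma flow_states_connected: "conn n (flow_states n l u X Y \<psi>) X Y"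
proof -
  let ?G = "sd X Y"
  let ?L = "elist \<psi> ?G" and ?Ts = "trails \<psi> ?G"
  note f = realization_facts
  have dL: "distinct ?L" and sL: "set ?L = ?G" using f(6) by (auto simp: decomp_def elist_def simp del: in_sd)
  have LE: "set ?L \<subseteq> nsets {1..n} 2" unfolding sL using f(3) by (simp add: graphs_def)
  have closed: "\<psi> v w \<in> nb (set (concat (map el As))) v"
    if A: "set As \<subseteq> set ?Ts" and W: "w \<in> nb (set (concat (map el As))) v" for As v w
  proof -
    obtain t where t: "t \<in> set As" "{v, w} \<in> set (el t)" using W by (auto simp: nb_def)
    then have "t \<in> set ?Ts" using A by blast
    note tD = decomp_trailD[OF f(6) this]
    have "{v, \<psi> v w} \<in> set (el t)" by (rule trail_partner[OF tD(1) f(5) tD(2) t(2)])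
    then show ?thesis using t(1) by (auto simp: nb_def)
  qed
  have deg_in: "deg (sd X (set (concat (map el As)))) v \<in> {deg X v, deg Y v}"
    if "set As \<subseteq> set ?Ts" "v \<in> {1..n}" for As v
  proof (rule flip_closed_deg[OF _ _ that(2)])
    show "set (concat (map el As)) \<subseteq> ?G"
      using that(1) decomp_trailD(2)[OF f(6)] by (auto simp del: in_sd)
    show "\<And>v w. w \<in> nb (set (concat (map el As))) v \<Longrightarrow> \<psi> v w \<in> nb (set (concat (map el As))) v"
      by (rule closed[OF that(1)])
  qed
  have main: "conn n (flow_states n l u X Y \<psi>) X (sd X (set (concat (map el As))))"
    if "?Ts = As @ Bs" for As Bs
    using that
  proof (induction As arbitrary: Bs rule: rev_induct)
    case Nil
    show ?case by simp
  next
    case (snoc t As)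
    let ?M = "concat (map el As)"
    let ?Z = "sd X (set ?M)"
    have IH: "conn n (flow_states n l u X Y \<psi>) X ?Z" using snoc.IH[of "t # Bs"] snoc.prems by simp
    have t: "t \<in> set ?Ts" using snoc.prems by simp
    have L: "?L = ?M @ el t @ concat (map el Bs)" unfolding elist_def snoc.prems by simp
    note tD = decomp_trailD[OF f(6) t]
    have dis: "set (el t) \<inter> set ?M = {}" using dL unfolding L by auto
    note alt = good_alt[OF \<psi> f(1,2)]
    have "alts X (el t ! 0 \<in> X) (el t)" by (rule trail_alts(1)[OF tD(1,3,2) alt])
    then have alt': "alts ?Z (el t ! 0 \<in> X) (el t)" unfolding alts_disjoint[OF dis] .
    have len: "2 \<le> length t" using tD(1) by (simp add: trail_ok_def)
    have GE: "?G \<subseteq> nsets {1..n} 2" using f(3) by (simp add: graphs_def)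
    have cl: "even (length (el t))" if lh: "last t = hd t"
    proof (cases "closes \<psi> t")
      case True
      show ?thesis by (rule trail_alts(2)[OF tD(1,3,2) alt True GE])
    next
      case False
      then have fx: "\<psi> (hd t) (t ! 1) = t ! 1" "\<psi> (hd t) (t ! (length t - 2)) = t ! (length t - 2)"
        using tD(1) lh by (auto simp: trail_ok_def stops_def)
      define k where "k = length t - 2"
      have k: "length t = Suc (Suc k)" "length (el t) = Suc k" using len by (auto simp: k_def)
      have ne: "t \<noteq> []" using len by auto
      have e0: "el t ! 0 = {hd t, t ! 1}" using nth_el[of 0 t] k ne by (simp add: hd_conv_nth)
      have ek: "el t ! k = {hd t, t ! k}"
        using nth_el[of k t] k ne lh by (simp add: last_conv_nth insert_commute)
      have mem: "el t ! 0 \<in> ?G" "el t ! k \<in> ?G" using tD(2) k nth_mem[of 0 "el t"] nth_mem[of k "el t"]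
        by (auto simp del: in_sd)
      then have in_d: "t ! 1 \<in> defects ?G X \<psi> (hd t)" "t ! k \<in> defects ?G X \<psi> (hd t)"
        using fx e0 ek by (auto simp: defects_def nb_def k_def simp del: in_sd)
      have hV: "hd t \<in> {1..n}" using mem(1) GE e0 doubleton_nsets[of "hd t" "t ! 1" "{1..n}"] by auto
      \<comment> \<open>A trail that returns without closing has two unpaired end darts at one
        vertex. Thinness allows only one, so they coincide, the trail is a single edge, and that
        edge would be a loop.\<close>
      have "card (defects ?G X \<psi> (hd t)) \<le> 1" using f(7,8)[OF hV] by linarith
      moreover have "finite (defects ?G X \<psi> (hd t))" using finite_nb[OF f(3)] by (simp add: defects_def)
      ultimately have "t ! 1 = t ! k" using in_d card_le_Suc0_iff_eq by (metis One_nat_def)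
      then have "el t ! 0 = el t ! k" using e0 ek by simp
      then have "k = 0" using tD(3) k by (simp add: nth_eq_iff_index_eq)
      then have "t ! 1 = hd t" using lh k ne by (simp add: last_conv_nth)
      then have "{hd t, hd t} \<in> nsets {1..n} 2" using mem(1) GE e0 by (auto simp del: in_sd)
      then show ?thesis by (simp add: doubleton_nsets del: insert_absorb2)
    qed
    have c: "conn n {U. (eqdeg n ?Z U \<or> eqdeg n (sd ?Z (set (el t))) U) \<and> sd X U \<in> near_prefixes n ?L 21 9}
        ?Z (sd ?Z (set (el t)))"
      by (rule trail_reach[OF dL LE f(1) L refl alt' len cl])
    have Zt: "sd ?Z (set (el t)) = sd X (set (concat (map el (As @ [t]))))"
    proof -
      have "set ?M \<inter> set (el t) = {}" using dis by blast
      then show ?thesis by (simp only: sd_assoc sd_disjoint) simp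
    qed
    \<comment> \<open>Both ends of the path arise from \<open>X\<close> by flipping unions of whole
      trails, so its degrees are everywhere those of \<open>X\<close> or \<open>Y\<close> and it
      stays in the interval.\<close>
    have "{U. (eqdeg n ?Z U \<or> eqdeg n (sd ?Z (set (el t))) U) \<and> sd X U \<in> near_prefixes n ?L 21 9} \<subseteq> flow_states n l u X Y \<psi>"
    proof
      fix U assume U: "U \<in> {U. (eqdeg n ?Z U \<or> eqdeg n (sd ?Z (set (el t))) U) \<and> sd X U \<in> near_prefixes n ?L 21 9}"
      have sub: "set As \<subseteq> set ?Ts" "set (As @ [t]) \<subseteq> set ?Ts" using snoc.prems by auto
      have dU: "deg U v \<in> {deg X v, deg Y v}" if v: "v \<in> {1..n}" for v
        using U deg_in[OF sub(1) v] deg_in[OF sub(2) v] v unfolding Zt eqdeg_def by auto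
      moreover have "U \<in> graphs n" using U by (auto simp: eqdeg_def)
      moreover have "l v \<le> deg U v \<and> deg U v \<le> u v" if v: "v \<in> {1..n}" for v
        using dU[OF v] X Y v by (auto simp: interval_realizations_iff)
      ultimately show "U \<in> flow_states n l u X Y \<psi>"
        using U by (simp add: flow_states_def interval_realizations_iff)
    qed
    then have "conn n (flow_states n l u X Y \<psi>) ?Z (sd ?Z (set (el t)))" using c conn_mono by blast
    then show ?case using IH conn_trans unfolding Zt by blast
  qed
  have "set (concat (map el ?Ts)) = ?G" using sL by (simp add: elist_def)
  then show ?thesis using main[of ?Ts "[]"] by simp
qed

lemma card_flow_states: "card (flow_states n l u X Y \<psi>) \<le> (n * n + 1) ^ 30" "finite (flow_states n l u X Y \<psi>)"
proof -
  let ?L = "elist \<psi> (sd X Y)"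
  let ?BS = "{bs. set bs \<subseteq> {..n * n} \<and> length bs = 21}" and ?R = "{R. R \<subseteq> nsets {1..n} 2 \<and> card R \<le> 9}"
  have len: "length ?L \<le> n * n" using length_elist[OF realization_facts(6,3)] by (simp add: elist_def)
  have sub: "flow_states n l u X Y \<psi> \<subseteq> (\<lambda>(bs, R). sd X (sd (prefix_flip ?L bs) R)) ` (?BS \<times> ?R)"
  proof
    fix U assume "U \<in> flow_states n l u X Y \<psi>"
    then have "sd X U \<in> near_prefixes n ?L 21 9" by (simp add: flow_states_def)
    then obtain bs R where b: "length bs = 21" "set bs \<subseteq> {..length ?L}" "R \<subseteq> nsets {1..n} 2" "card R \<le> 9"
      "sd X U = sd (prefix_flip ?L bs) R" by (rule near_prefixes_normal)
    have "U = sd X (sd X U)" by simp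
    then have "U = sd X (sd (prefix_flip ?L bs) R)" using b(5) by simp
    moreover have "set bs \<subseteq> {..n * n}" using b(2) len by auto
    ultimately show "U \<in> (\<lambda>(bs, R). sd X (sd (prefix_flip ?L bs) R)) ` (?BS \<times> ?R)"
      using b by (intro image_eqI[of _ _ "(bs, R)"]) simp_all
  qed
  have fB: "finite ?BS" by (rule finite_lists_length_eq) simp
  have fin: "finite (?BS \<times> ?R)" using fB card_edge_sets(1) by (rule finite_cartesian_product)
  show "finite (flow_states n l u X Y \<psi>)" using sub finite_imageI[OF fin] by (rule finite_subset)
  have "card (flow_states n l u X Y \<psi>) \<le> card (?BS \<times> ?R)" using fin sub by (rule surj_card_le)
  also have "\<dots> = card ?BS * card ?R" by (rule card_cartesian_product)
  also have "card ?BS = (n * n + 1) ^ 21" by (subst card_lists_length_eq) simp_all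
  also have "(n * n + 1) ^ 21 * card ?R \<le> (n * n + 1) ^ 21 * (n * n + 1) ^ 9"
    by (rule mult_left_mono[OF card_edge_sets(2)]) simp
  also have "\<dots> = (n * n + 1) ^ 30" by (simp flip: power_add)
  finally show "card (flow_states n l u X Y \<psi>) \<le> (n * n + 1) ^ 30" .
qed

end

section \<open>Load of a single state\<close>

lemma sum_deg:
  assumes "R \<subseteq> nsets {1..n} 2"
  shows "(\<Sum>v\<in>{1..n}. deg R v) = 2 * card R"
proof -
  have fin: "finite R" using assms by (rule finite_subset) (rule finite_pairs)
  have "(\<Sum>v\<in>{1..n}. deg R v) = (\<Sum>v\<in>{1..n}. \<Sum>e\<in>R. if v \<in> e then 1 else 0)"
    unfolding deg_def using fin by (simp add: sum.If_cases Int_def)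
  also have "\<dots> = (\<Sum>e\<in>R. \<Sum>v\<in>{1..n}. if v \<in> e then 1 else 0)" by (rule sum.swap)
  also have "\<dots> = (\<Sum>e\<in>R. 2)"
  proof (rule sum.cong[OF refl])
    fix e assume "e \<in> R"
    then have "e \<in> nsets {1..n} 2" using assms by blast
    then have e: "e \<subseteq> {1..n}" "card e = 2" by (auto simp: nsets_def)
    have "(\<Sum>v\<in>{1..n}. if v \<in> e then 1 else 0) = card ({1..n} \<inter> e)" by (simp add: sum.If_cases Int_def)
    also have "{1..n} \<inter> e = e" using e by auto
    finally show "(\<Sum>v\<in>{1..n}. if v \<in> e then 1 else 0) = (2 :: nat)" using e by simp
  qed
  finally show ?thesis by simp
qed

lemma deg_sd_bounds:
  assumes "A \<in> graphs n" "R \<in> graphs n"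
  shows "deg (sd A R) v \<le> deg A v + deg R v" "deg A v \<le> deg (sd A R) v + deg R v"
proof -
  have le: "deg (sd A R) v \<le> deg A v + deg R v" if "A \<in> graphs n" for A
    using card_sd_le[of "nb A v" "nb R v"] finite_nb that assms(2) sd_graphs[OF that assms(2)]
    by (simp add: deg_nb nb_sd)
  show "deg (sd A R) v \<le> deg A v + deg R v" by (rule le[OF assms(1)])
  show "deg A v \<le> deg (sd A R) v + deg R v"
    using le[OF sd_graphs[OF assms]] by (simp add: sd_assoc)
qed

text \<open>
  The constants come from the 21 prefixes and 9 single edges describing a flow state:
  \<open>30 = 21 + 9\<close>, \<open>84 = 4 * 21\<close> and \<open>85 = 1 + 84\<close>, as flipping a prefix breaks up at most two pairs.
\<close>

definition flow_factor :: "nat \<Rightarrow> nat" where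
  "flow_factor n = (n * n + 1) ^ 30 * ((n + 1) ^ 84 * ((n + 1) ^ (2 * 85)) ^ 84)"

text \<open>A state \<open>a\<close> is \<open>X\<close> with a prefix set \<open>S\<close> and few
  edges \<open>R\<close> flipped. The flipped pair consists of \<open>sd a R\<close>, with few
  choices, and \<open>sd Y S\<close>, whose degrees are those of \<open>X\<close> and
  \<open>Y\<close> together minus those of \<open>sd a R\<close>. As \<open>a\<close> has the degree
  of \<open>X\<close> or of \<open>Y\<close> at each vertex, \<open>sd Y S\<close> leaves the bounds
  at \<open>v\<close> by at most \<open>deg R v\<close>, in total by at most 2 * 9 = 18.\<close>

lemma flow_load:
  assumes thin: "thin n l u" and a: "a \<in> interval_realizations n l u"
  defines "T \<equiv> {(X, Y, \<psi>). X \<in> interval_realizations n l u \<and> Y \<in> interval_realizations n l u \<and>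
      \<psi> \<in> good_pairings n X Y \<and> a \<in> flow_states n l u X Y \<psi>}"
  shows "(\<Sum>(X, Y, \<psi>)\<in>T. 1 / real (pairing_weight n (sd X Y))) \<le> real (flow_factor n) * real (card (deviation_set n l u 18))"
    and "finite T"
proof -
  let ?V = "{1..n}" and ?Om = "interval_realizations n l u" and ?D = "deviation_set n l u 18"
  let ?R = "{R. R \<subseteq> nsets ?V 2 \<and> card R \<le> 9}"
  define P where "P = (\<lambda>R. sd a R) ` ?R \<times> ?D"
  have ag: "a \<in> graphs n" using a by (simp add: interval_realizations_iff)
  have Og: "X \<in> graphs n" if "X \<in> ?Om" for X using that by (simp add: interval_realizations_iff)
  have finOm: "finite ?Om" by (rule finite_subset_graphs[of _ n]) (auto simp: interval_realizations_iff)
  have sub: "T \<subseteq> (SIGMA X:?Om. SIGMA Y:?Om. good_pairings n X Y)" by (auto simp: T_def)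
  have "finite (SIGMA X:?Om. SIGMA Y:?Om. good_pairings n X Y)"
    using finOm finite_pairings[OF sd_graphs[OF Og Og]] by (intro finite_SigmaI) (auto simp: good_pairings_def)
  with sub show finT: "finite T" by (rule finite_subset)
  have finD: "finite ?D" by (rule finite_subset_graphs[of _ n]) (auto simp: deviation_set_def)
  have finP: "finite P" unfolding P_def by (intro finite_cartesian_product finite_imageI card_edge_sets(1) finD)
  have Pg: "P \<subseteq> graphs n \<times> graphs n" using graphs_sd[OF ag] by (auto simp: P_def deviation_set_def)
  have "(\<Sum>(X, Y, \<psi>)\<in>T. 1 / real (pairing_weight n (sd X Y))) \<le>
      real ((n * n + 1) ^ 21) * real (card P) * real ((n + 1) ^ 84 * ((n + 1) ^ (2 * 85)) ^ 84)"
  proof (rule weighted_count[OF finT finP Pg])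
    fix X Y \<psi> assume "(X, Y, \<psi>) \<in> T"
    then have X: "X \<in> ?Om" and Y: "Y \<in> ?Om" and \<psi>: "\<psi> \<in> good_pairings n X Y" and as: "a \<in> flow_states n l u X Y \<psi>"
      by (auto simp: T_def)
    let ?G = "sd X Y" and ?L = "elist \<psi> (sd X Y)"
    note f = realization_facts[OF thin X Y \<psi>]
    have len: "length ?L \<le> n * n" using length_elist[OF f(6,3)] by (simp add: elist_def)
    have "sd X a \<in> near_prefixes n ?L 21 9" using as by (simp add: flow_states_def)
    then obtain bs R where b: "length bs = 21" "set bs \<subseteq> {..length ?L}" "R \<subseteq> nsets ?V 2" "card R \<le> 9"
      "sd X a = sd (prefix_flip ?L bs) R" by (rule near_prefixes_normal)
    let ?S = "prefix_flip ?L bs"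
    have "sd X ?S = sd X (sd (sd ?S R) R)" by (simp add: sd_assoc)
    also have "\<dots> = sd X (sd (sd X a) R)" by (simp only: b(5))
    also have "\<dots> = sd a R" by (simp add: sd_assoc)
    finally have BX: "sd X ?S = sd a R" .
    have SG: "?S \<subseteq> ?G" using prefix_flip_subset[of ?L bs] f(6) unfolding elist_def decomp_def by blast
    have SV: "?S \<subseteq> nsets ?V 2" using SG f(3) unfolding graphs_def by blast
    have Yg: "sd Y ?S \<in> graphs n" by (rule graphs_sd[OF f(2) SV])
    have Rg: "R \<in> graphs n" using b(3) by (simp add: graphs_def)
    have "(\<Sum>v\<in>?V. (l v - deg (sd Y ?S) v) + (deg (sd Y ?S) v - u v)) \<le> (\<Sum>v\<in>?V. deg R v)"
    proof (rule sum_mono)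
      fix v assume v: "v \<in> ?V"
      have "deg (sd X ?S) v + deg (sd Y ?S) v = deg X v + deg Y v" by (rule deg_sum[OF f(1,2) SG])
      moreover have "deg a v = deg X v \<or> deg a v = deg Y v" using as v by (auto simp: flow_states_def)
      moreover have "l v \<le> deg X v" "deg X v \<le> u v" "l v \<le> deg Y v" "deg Y v \<le> u v"
        using X Y v by (auto simp: interval_realizations_iff)
      ultimately show "(l v - deg (sd Y ?S) v) + (deg (sd Y ?S) v - u v) \<le> deg R v"
        using deg_sd_bounds[OF ag Rg, of v] unfolding BX by arith
    qed
    also have "\<dots> \<le> 18" using sum_deg[OF b(3)] b(4) by simp
    finally have BY: "sd Y ?S \<in> ?D" using Yg by (simp add: deviation_set_def)
    have c1: "card (defects ?G X \<psi> v) \<le> 1" if "v \<in> ?V" for v using f(7,8)[OF that] by linarith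
    then have "{v \<in> ?V. 1 < card (defects ?G X \<psi> v)} = {}" by force
    then have c0: "card {v \<in> ?V. 1 < card (defects ?G X \<psi> v)} \<le> 0" by simp
    have near: "\<psi> \<in> near_pairings n ?G (sd X ?S) (0 + 4 * length bs) (1 + 4 * length bs)"
      by (rule near_flip[OF f(4,3) c0 c1])
    have eq: "0 + 4 * 21 = (84 :: nat)" "1 + 4 * 21 = (85 :: nat)" by simp_all
    have "(sd X ?S, sd Y ?S) \<in> P" unfolding P_def BX using b(3,4) BY by blast
    moreover have "set bs \<subseteq> {..n * n}" using b(2) len by auto
    ultimately show "\<exists>bs. length bs = 21 \<and> set bs \<subseteq> {..n * n} \<and> (sd X (prefix_flip ?L bs), sd Y (prefix_flip ?L bs)) \<in> P \<and>
        \<psi> \<in> near_pairings n ?G (sd X (prefix_flip ?L bs)) 84 85"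
      using b(1) near[unfolded b(1) eq] by blast
  qed
  also have "\<dots> \<le> real ((n * n + 1) ^ 21) * real ((n * n + 1) ^ 9 * card ?D) *
      real ((n + 1) ^ 84 * ((n + 1) ^ (2 * 85)) ^ 84)"
  proof (intro mult_right_mono mult_left_mono)
    have "card ((\<lambda>R. sd a R) ` ?R) \<le> (n * n + 1) ^ 9"
      using card_image_le[OF card_edge_sets(1)] card_edge_sets(2) le_trans by blast
    then have "card P \<le> (n * n + 1) ^ 9 * card ?D"
      unfolding P_def card_cartesian_product by (rule mult_right_mono) simp
    then show "real (card P) \<le> real ((n * n + 1) ^ 9 * card ?D)" by (simp only: of_nat_le_iff)
  qed simp_all
  also have "\<dots> = real (flow_factor n) * real (card ?D)"
  proof -
    have "(n * n + 1) ^ 21 * ((n * n + 1) ^ 9 * card ?D) = (n * n + 1) ^ 30 * card ?D"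
      by (simp flip: power_add mult.assoc)
    then show ?thesis unfolding flow_factor_def of_nat_mult[symmetric] of_nat_eq_iff by (simp only: ac_simps)
  qed
  finally show "(\<Sum>(X, Y, \<psi>)\<in>T. 1 / real (pairing_weight n (sd X Y))) \<le> real (flow_factor n) * real (card ?D)" .
qed

section \<open>Mixing of lazy symmetric chains\<close>

lemma pmf_bind_finite:
  assumes "set_pmf \<mu> \<subseteq> \<Omega>" "finite \<Omega>"
  shows "pmf (bind_pmf \<mu> K) y = (\<Sum>x\<in>\<Omega>. pmf \<mu> x * pmf (K x) y)"
  unfolding pmf_bind by (subst integral_measure_pmf[OF assms(2)]) (use assms in auto)

lemma steps_Suc: "steps K (Suc t) x = bind_pmf (steps K t x) K"
  by (simp add: steps_def)

lemma set_steps: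
  assumes "\<And>x. x \<in> \<Omega> \<Longrightarrow> set_pmf (K x) \<subseteq> \<Omega>" "x \<in> \<Omega>"
  shows "set_pmf (steps K t x) \<subseteq> \<Omega>"
proof (induction t)
  case 0
  show ?case using assms(2) by (simp add: steps_def)
next
  case (Suc t)
  then show ?case using assms(1) by (auto simp: steps_Suc)
qed

lemma weighted_mean_square_le:
  fixes q f :: "'a \<Rightarrow> real"
  assumes "\<And>z. z \<in> S \<Longrightarrow> 0 \<le> q z" "sum q S = 1"
  shows "(\<Sum>z\<in>S. q z * f z)\<^sup>2 \<le> (\<Sum>z\<in>S. q z * (f z)\<^sup>2)"
proof -
  let ?m = "\<Sum>z\<in>S. q z * f z"
  have "0 \<le> (\<Sum>z\<in>S. q z * (f z - ?m)\<^sup>2)" using assms(1) by (intro sum_nonneg) simp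
  also have "\<dots> = (\<Sum>z\<in>S. q z * (f z)\<^sup>2 - 2 * ?m * (q z * f z) + ?m\<^sup>2 * q z)"
    by (intro sum.cong refl) (simp add: power2_diff algebra_simps)
  also have "\<dots> = (\<Sum>z\<in>S. q z * (f z)\<^sup>2) - 2 * ?m * ?m + ?m\<^sup>2 * sum q S"
    by (simp only: sum.distrib sum_subtractf sum_distrib_left)
  also have "\<dots> = (\<Sum>z\<in>S. q z * (f z)\<^sup>2) - ?m\<^sup>2" using assms(2) by (simp add: power2_eq_square)
  finally show ?thesis by simp
qed

lemma sum_abs_squared_le:
  fixes g :: "'a \<Rightarrow> real"
  shows "(\<Sum>x\<in>S. \<bar>g x\<bar>)\<^sup>2 \<le> real (card S) * (\<Sum>x\<in>S. (g x)\<^sup>2)"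
proof -
  have "(\<Sum>x\<in>S. 1 * \<bar>g x\<bar>)\<^sup>2 \<le> (\<Sum>x\<in>S. 1\<^sup>2) * (\<Sum>x\<in>S. \<bar>g x\<bar>\<^sup>2)"
    by (rule Cauchy_Schwarz_ineq_sum)
  then show ?thesis by simp
qed

text \<open>The last assumption is the Poincare inequality for the uniform distribution: up to the
  common factor \<open>2 * (card \<Omega>)\<^sup>2\<close> its sides are \<open>\<gamma>\<close>
  times the variance of \<open>f\<close> and the Dirichlet form.\<close>

locale lazy_chain =
  fixes \<Omega> :: "'s set" and K :: "'s \<Rightarrow> 's pmf" and \<gamma> :: real
  assumes finite: "finite \<Omega>"
    and closed: "x \<in> \<Omega> \<Longrightarrow> set_pmf (K x) \<subseteq> \<Omega>"
    and sym: "x \<in> \<Omega> \<Longrightarrow> y \<in> \<Omega> \<Longrightarrow> pmf (K x) y = pmf (K y) x"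
    and lazy: "x \<in> \<Omega> \<Longrightarrow> 1 / 2 \<le> pmf (K x) x"
    and gap: "0 < \<gamma>" "\<gamma> \<le> 1"
    and poincare: "\<gamma> * (\<Sum>x\<in>\<Omega>. \<Sum>y\<in>\<Omega>. (f x - f y)\<^sup>2) \<le>
      real (card \<Omega>) * (\<Sum>x\<in>\<Omega>. \<Sum>y\<in>\<Omega>. pmf (K x) y * (f x - f y)\<^sup>2)"
begin

lemma stochastic: "x \<in> \<Omega> \<Longrightarrow> (\<Sum>y\<in>\<Omega>. pmf (K x) y) = 1"
  by (rule sum_pmf_eq_1[OF finite closed])

lemma stochastic': "y \<in> \<Omega> \<Longrightarrow> (\<Sum>x\<in>\<Omega>. pmf (K x) y) = 1"
  using stochastic sym by (metis (no_types, lifting) sum.cong)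

text \<open>The laziness makes \<open>2 P - I\<close> stochastic, which gives \<open>\<parallel>P f\<parallel>\<^sup>2 \<le> \<langle>f, P f\<rangle>\<close>.\<close>

lemma contraction:
  assumes mean: "sum f \<Omega> = 0"
  shows "(\<Sum>y\<in>\<Omega>. (\<Sum>x\<in>\<Omega>. f x * pmf (K x) y)\<^sup>2) \<le> (1 - \<gamma>) * (\<Sum>y\<in>\<Omega>. (f y)\<^sup>2)"
proof -
  let ?P = "\<lambda>y. \<Sum>x\<in>\<Omega>. f x * pmf (K x) y"
  let ?F = "\<Sum>y\<in>\<Omega>. (f y)\<^sup>2" and ?PP = "\<Sum>y\<in>\<Omega>. (?P y)\<^sup>2" and ?fP = "\<Sum>y\<in>\<Omega>. f y * ?P y"
  define q where "q x y = 2 * pmf (K x) y - (if x = y then 1 else 0)" for x y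
  have q0: "0 \<le> q x y" if "x \<in> \<Omega>" for x y using lazy[OF that] by (auto simp: q_def)
  have q1: "(\<Sum>x\<in>\<Omega>. q x y) = 1" if "y \<in> \<Omega>" for y
    using stochastic'[OF that] finite that by (simp add: q_def sum_subtractf flip: sum_distrib_left)
  have q2: "(\<Sum>y\<in>\<Omega>. q x y) = 1" if "x \<in> \<Omega>" for x
    using stochastic[OF that] finite that by (simp add: q_def sum_subtractf flip: sum_distrib_left)
  have Q: "(\<Sum>x\<in>\<Omega>. q x y * f x) = 2 * ?P y - f y" if "y \<in> \<Omega>" for y
  proof -
    have "(\<Sum>x\<in>\<Omega>. q x y * f x) = (\<Sum>x\<in>\<Omega>. 2 * (f x * pmf (K x) y) - (if x = y then f x else 0))"
      by (intro sum.cong refl) (simp add: q_def algebra_simps)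
    also have "\<dots> = 2 * ?P y - f y"
      using finite that by (simp add: sum_subtractf flip: sum_distrib_left)
    finally show ?thesis .
  qed
  have "(\<Sum>y\<in>\<Omega>. (2 * ?P y - f y)\<^sup>2) = (\<Sum>y\<in>\<Omega>. (\<Sum>x\<in>\<Omega>. q x y * f x)\<^sup>2)"
    by (intro sum.cong refl) (simp add: Q)
  also have "\<dots> \<le> (\<Sum>y\<in>\<Omega>. \<Sum>x\<in>\<Omega>. q x y * (f x)\<^sup>2)"
    by (intro sum_mono weighted_mean_square_le q0 q1)
  also have "\<dots> = (\<Sum>x\<in>\<Omega>. (\<Sum>y\<in>\<Omega>. q x y) * (f x)\<^sup>2)" by (subst sum.swap) (simp add: sum_distrib_right)
  also have "\<dots> = ?F" by (intro sum.cong refl) (simp add: q2)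
  finally have "(\<Sum>y\<in>\<Omega>. (2 * ?P y - f y)\<^sup>2) \<le> ?F" .
  moreover have "(\<Sum>y\<in>\<Omega>. (2 * ?P y - f y)\<^sup>2) = (\<Sum>y\<in>\<Omega>. 4 * (?P y)\<^sup>2 - 4 * (f y * ?P y) + (f y)\<^sup>2)"
    by (intro sum.cong refl) (simp add: power2_diff power_mult_distrib algebra_simps)
  moreover have "\<dots> = 4 * ?PP - 4 * ?fP + ?F" by (simp only: sum.distrib sum_subtractf sum_distrib_left)
  ultimately have 1: "?PP \<le> ?fP" by linarith
  have "(\<Sum>x\<in>\<Omega>. \<Sum>y\<in>\<Omega>. pmf (K x) y * (f x - f y)\<^sup>2) =
      (\<Sum>x\<in>\<Omega>. \<Sum>y\<in>\<Omega>. pmf (K x) y * (f x)\<^sup>2) + (\<Sum>x\<in>\<Omega>. \<Sum>y\<in>\<Omega>. pmf (K x) y * (f y)\<^sup>2)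
      - 2 * (\<Sum>x\<in>\<Omega>. \<Sum>y\<in>\<Omega>. f y * (f x * pmf (K x) y))"
    by (simp only: sum_distrib_left flip: sum.distrib sum_subtractf)
      (intro sum.cong refl, simp add: power2_diff algebra_simps)
  moreover have "(\<Sum>x\<in>\<Omega>. \<Sum>y\<in>\<Omega>. pmf (K x) y * (f x)\<^sup>2) = ?F"
    by (intro sum.cong refl) (simp add: stochastic flip: sum_distrib_right)
  moreover have "(\<Sum>x\<in>\<Omega>. \<Sum>y\<in>\<Omega>. pmf (K x) y * (f y)\<^sup>2) = ?F"
    by (subst sum.swap, intro sum.cong refl) (simp add: stochastic' flip: sum_distrib_right)
  moreover have "(\<Sum>x\<in>\<Omega>. \<Sum>y\<in>\<Omega>. f y * (f x * pmf (K x) y)) = ?fP"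
    by (subst sum.swap) (simp add: sum_distrib_left)
  ultimately have 2: "(\<Sum>x\<in>\<Omega>. \<Sum>y\<in>\<Omega>. pmf (K x) y * (f x - f y)\<^sup>2) = 2 * ?F - 2 * ?fP" by linarith
  have "(\<Sum>x\<in>\<Omega>. \<Sum>y\<in>\<Omega>. (f x - f y)\<^sup>2) =
      (\<Sum>x\<in>\<Omega>. \<Sum>y\<in>\<Omega>. (f x)\<^sup>2) + (\<Sum>x\<in>\<Omega>. \<Sum>y\<in>\<Omega>. (f y)\<^sup>2) - 2 * (\<Sum>x\<in>\<Omega>. \<Sum>y\<in>\<Omega>. f x * f y)"
    by (simp only: sum_distrib_left flip: sum.distrib sum_subtractf)
      (intro sum.cong refl, simp add: power2_diff algebra_simps)
  also have "\<dots> = 2 * real (card \<Omega>) * ?F"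
    using mean by (simp add: sum_product[symmetric] mult.assoc flip: sum_distrib_left)
  finally have 3: "(\<Sum>x\<in>\<Omega>. \<Sum>y\<in>\<Omega>. (f x - f y)\<^sup>2) = 2 * real (card \<Omega>) * ?F" .
  have "?fP \<le> (1 - \<gamma>) * ?F"
  proof (cases "\<Omega> = {}")
    case False
    then have N: "0 < real (card \<Omega>)" using finite by (simp add: card_gt_0_iff)
    have arith: "fP \<le> (1 - \<gamma>) * F" if "\<gamma> * (2 * N * F) \<le> N * (2 * F - 2 * fP)" "0 < N" for N F fP :: real
    proof -
      have "N * (\<gamma> * F) \<le> N * (F - fP)" using that(1) by (simp add: algebra_simps)
      then have "\<gamma> * F \<le> F - fP" using that(2) by (rule mult_left_le_imp_le)
      then show ?thesis by (simp add: algebra_simps)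
    qed
    show ?thesis by (rule arith[OF poincare[of f, unfolded 2 3] N])
  qed simp
  then show ?thesis using 1 by linarith
qed

text \<open>The difference from the uniform distribution has sum zero at all times, so
  \<open>contraction\<close> applies to every step. At time 0 its squared norm is 1 - 1/N, where N
  is the number of states.\<close>

lemma steps_l2:
  assumes x: "x \<in> \<Omega>"
  shows "(\<Sum>y\<in>\<Omega>. (pmf (steps K t x) y - 1 / real (card \<Omega>))\<^sup>2) \<le> (1 - \<gamma>) ^ t"
proof (induction t)
  case 0
  have N: "1 \<le> real (card \<Omega>)" using x finite by (simp add: Suc_le_eq card_gt_0_iff) blast
  have "(\<Sum>y\<in>\<Omega>. (pmf (steps K 0 x) y - 1 / real (card \<Omega>))\<^sup>2) =
      (\<Sum>y\<in>\<Omega>. (if y = x then 1 - 2 / real (card \<Omega>) else 0) + (1 / real (card \<Omega>))\<^sup>2)"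
    by (intro sum.cong refl) (auto simp: steps_def pmf_return power2_diff)
  also have "\<dots> = 1 - 2 / real (card \<Omega>) + real (card \<Omega>) * (1 / real (card \<Omega>))\<^sup>2"
    using x finite by (simp add: sum.distrib)
  also have "\<dots> \<le> 1" using N by (simp add: power2_eq_square field_simps)
  finally show ?case by simp
next
  case (Suc t)
  let ?N = "real (card \<Omega>)"
  let ?g = "\<lambda>y. pmf (steps K t x) y - 1 / ?N"
  have N: "0 < ?N" using x finite by (simp add: card_gt_0_iff) blast
  have S: "set_pmf (steps K t x) \<subseteq> \<Omega>" by (rule set_steps[OF closed x])
  have "sum ?g \<Omega> = 0" using sum_pmf_eq_1[OF finite S] N by (simp add: sum_subtractf)
  note c = contraction[OF this]
  have "pmf (steps K (Suc t) x) y - 1 / ?N = (\<Sum>z\<in>\<Omega>. ?g z * pmf (K z) y)" if "y \<in> \<Omega>" for y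
    using stochastic'[OF that]
    by (simp add: steps_Suc pmf_bind_finite[OF S finite] left_diff_distrib sum_subtractf flip: sum_divide_distrib)
  then have "(\<Sum>y\<in>\<Omega>. (pmf (steps K (Suc t) x) y - 1 / ?N)\<^sup>2) = (\<Sum>y\<in>\<Omega>. (\<Sum>z\<in>\<Omega>. ?g z * pmf (K z) y)\<^sup>2)"
    by (intro sum.cong refl) simp
  also have "\<dots> \<le> (1 - \<gamma>) * (\<Sum>y\<in>\<Omega>. (?g y)\<^sup>2)" by (rule c)
  also have "\<dots> \<le> (1 - \<gamma>) * (1 - \<gamma>) ^ t" using Suc.IH gap by (intro mult_left_mono) simp_all
  finally show ?case by simp
qed

text \<open>By Cauchy-Schwarz the squared l1-distance is at most \<open>card \<Omega>\<close> times
  the squared l2-distance, hence at most \<open>exp (L - \<gamma> * s)\<close> after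
  \<open>s\<close> steps; the condition on \<open>t\<close> brings this down to the square of
  \<epsilon>.\<close>

lemma mixing_time_bound:
  assumes \<epsilon>: "0 < \<epsilon>" and card: "real (card \<Omega>) \<le> exp L"
    and t: "L + 2 * ln (1 / \<epsilon>) \<le> \<gamma> * real t"
  shows "mixing_time \<Omega> K \<epsilon> \<le> enat t"
  unfolding mixing_time_def
proof (rule Inf_lower, intro CollectI exI conjI allI impI ballI)
  fix s x assume s: "t \<le> s" and x: "x \<in> \<Omega>"
  have ne: "\<Omega> \<noteq> {}" using x by blast
  let ?N = "real (card \<Omega>)"
  let ?g = "\<lambda>y. pmf (steps K s x) y - 1 / ?N"
  have l1: "l1_dist \<Omega> (steps K s x) (pmf_of_set \<Omega>) = (\<Sum>y\<in>\<Omega>. \<bar>?g y\<bar>)"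
    unfolding l1_dist_def by (intro sum.cong refl) (simp add: pmf_of_set ne finite)
  have "(\<Sum>y\<in>\<Omega>. \<bar>?g y\<bar>)\<^sup>2 \<le> ?N * (\<Sum>y\<in>\<Omega>. (?g y)\<^sup>2)" by (rule sum_abs_squared_le)
  also have "\<dots> \<le> exp L * (1 - \<gamma>) ^ s"
    using card steps_l2[OF x, of s] by (intro mult_mono) (auto intro: sum_nonneg)
  also have "(1 - \<gamma>) ^ s \<le> exp (- \<gamma>) ^ s" using gap exp_ge_add_one_self[of "- \<gamma>"] by (intro power_mono) simp_all
  also have "exp (- \<gamma>) ^ s = exp (- (\<gamma> * real s))" by (simp add: exp_of_nat_mult[symmetric] mult.commute)
  also have "exp L * exp (- (\<gamma> * real s)) \<le> exp (2 * ln \<epsilon>)"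
  proof -
    have "\<gamma> * real t \<le> \<gamma> * real s" using s gap by (intro mult_left_mono) simp_all
    then show ?thesis using t \<epsilon> by (simp add: ln_div flip: exp_add)
  qed
  also have "exp (2 * ln \<epsilon>) = \<epsilon>\<^sup>2" using \<epsilon> by (simp add: exp_double)
  finally have "(\<Sum>y\<in>\<Omega>. \<bar>?g y\<bar>)\<^sup>2 \<le> \<epsilon>\<^sup>2" by simp
  then show "l1_dist \<Omega> (steps K s x) (pmf_of_set \<Omega>) \<le> \<epsilon>"
    unfolding l1 by (rule power2_le_imp_le) (use \<epsilon> in linarith)
qed simp

end

section \<open>The degree interval chain\<close>

text \<open>\<open>pmf_of_list\<close> merges equal entries, and the four distributions of the chain
  may well be equal, for instance when there are no vertices. The sum over distinct distributions is
  therefore regrouped into a sum over the list.\<close>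

lemma sum_filter_weights:
  fixes g :: "'a \<Rightarrow> real"
  assumes "finite S" "fst ` set xs \<subseteq> S"
  shows "(\<Sum>\<mu>\<in>S. sum_list (map snd (filter (\<lambda>z. fst z = \<mu>) xs)) * g \<mu>) = (\<Sum>(\<mu>, p)\<leftarrow>xs. p * g \<mu>)"
  using assms(2)
proof (induction xs)
  case (Cons z xs)
  obtain a p where z: "z = (a, p)" by fastforce
  have "(\<Sum>\<mu>\<in>S. sum_list (map snd (filter (\<lambda>z. fst z = \<mu>) (z # xs))) * g \<mu>) =
      (\<Sum>\<mu>\<in>S. (if a = \<mu> then p * g \<mu> else 0) + sum_list (map snd (filter (\<lambda>z. fst z = \<mu>) xs)) * g \<mu>)"
    by (intro sum.cong refl) (simp add: z distrib_right)
  also have "\<dots> = p * g a + (\<Sum>(\<mu>, p)\<leftarrow>xs. p * g \<mu>)"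
    using Cons assms(1) by (simp add: sum.distrib z)
  finally show ?case by (simp add: z)
qed simp

lemma pmf_join_pmf_of_list:
  assumes "pmf_of_list_wf xs"
  shows "pmf (join_pmf (pmf_of_list xs)) y = (\<Sum>(\<mu>, p)\<leftarrow>xs. p * pmf \<mu> y)"
proof -
  have "pmf (join_pmf (pmf_of_list xs)) y = (\<Sum>\<mu>\<in>fst ` set xs. pmf (pmf_of_list xs) \<mu> * pmf \<mu> y)"
    unfolding pmf_join
    by (subst integral_measure_pmf[of "fst ` set xs"]) (use set_pmf_of_list[OF assms] in auto)
  also have "\<dots> = (\<Sum>(\<mu>, p)\<leftarrow>xs. p * pmf \<mu> y)"
    unfolding pmf_pmf_of_list[OF assms] by (rule sum_filter_weights) simp_all
  finally show ?thesis .
qed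

section \<open>Transition probabilities and symmetry of the chain\<close>

lemma pmf_uniform_move:
  assumes "finite C"
  shows "pmf (uniform_move C f x) y =
    (if C = {} then indicator {x} y else real (card {c \<in> C. f c = y}) / real (card C))"
proof -
  have "C \<inter> f -` {y} = {c \<in> C. f c = y}" by auto
  then show ?thesis using assms
    by (auto simp: uniform_move_def pmf_map measure_pmf_of_set pmf_return indicator_def)
qed

lemma set_uniform_move: "finite C \<Longrightarrow> set_pmf (uniform_move C f x) \<subseteq> insert x (f ` C)"
  by (auto simp: uniform_move_def)

lemma uniform_move_sym:
  assumes "finite C" "\<And>c. c \<in> C \<Longrightarrow> f c = y \<longleftrightarrow> g c = x"
  shows "pmf (uniform_move C f x) y = pmf (uniform_move C g y) x"
proof -
  have "{c \<in> C. f c = y} = {c \<in> C. g c = x}" using assms(2) by blast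
  then show ?thesis using assms(1) by (auto simp: pmf_uniform_move indicator_def)
qed

lemma uniform_move_ge:
  assumes "finite C" "c \<in> C" "f c = y" "card C \<le> m"
  shows "1 / real m \<le> pmf (uniform_move C f x) y"
proof -
  have C: "C \<noteq> {}" using assms(2) by blast
  have "0 < card C" using assms(1,2) C by (simp add: card_gt_0_iff)
  moreover have "0 < card {c \<in> C. f c = y}" using assms(1,2,3) card_gt_0_iff[of "{c \<in> C. f c = y}"] by auto
  ultimately have "1 / real m \<le> real (card {c \<in> C. f c = y}) / real (card C)"
    using assms(4) by (intro frac_le) simp_all
  then show ?thesis using C assms(1) by (simp add: pmf_uniform_move)
qed

lemma pmf_interval_chain:
  "pmf (interval_chain n l u G) G' = pmf (return_pmf G) G' / 2 +
     pmf (uniform_move ({1..n} \<times> {1..n} \<times> {1..n} \<times> {1..n}) (switch n G) G) G' / 6 +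
     pmf (uniform_move ({1..n} \<times> {1..n} \<times> {1..n}) (hinge_flip n l u G) G) G' / 6 +
     pmf (uniform_move (nsets {1..n} 2) (edge_toggle n l u G) G) G' / 6"
  unfolding interval_chain_def Let_def
  by (subst pmf_join_pmf_of_list) (simp_all add: pmf_of_list_wf_def)

lemma sd_eq_iff: "sd A R = B \<longleftrightarrow> sd B R = A"
  by (auto simp: set_eq_iff)

text \<open>A target other than \<open>G\<close> is reached only by acceptance, so the test becomes
  a test of the target. In this form all three kinds of moves are visibly undone by the same choice
  of vertices.\<close>

lemma if_accept_eq:
  assumes "G \<noteq> G'"
  shows "(if P H then H else G) = G' \<longleftrightarrow> P G' \<and> H = G'"
  using assms by (cases "H = G'") simp_all

lemma switch_eq:
  assumes "G \<in> graphs n" "G \<noteq> G'"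
  shows "switch n G (a, b, c, d) = G' \<longleftrightarrow> G' \<in> graphs n \<and> (\<forall>i\<in>{1..n}. deg G' i = deg G i) \<and>
    sd G {{a, b}, {c, d}, {a, c}, {b, d}} = G'"
proof -
  have s: "switch n G (a, b, c, d) = (if sd G {{a, b}, {c, d}, {a, c}, {b, d}} \<in> graphs n \<and>
      (\<forall>i\<in>{1..n}. deg (sd G {{a, b}, {c, d}, {a, c}, {b, d}}) i = deg G i)
      then sd G {{a, b}, {c, d}, {a, c}, {b, d}} else G)"
    unfolding switch_def sd_def Let_def by simp
  show ?thesis unfolding s
    using if_accept_eq[OF assms(2), of "\<lambda>H. H \<in> graphs n \<and> (\<forall>i\<in>{1..n}. deg H i = deg G i)"] by (simp only: conj_assoc)
qed

lemma hinge_flip_eq: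
  assumes "G \<noteq> G'"
  shows "hinge_flip n l u G (a, b, c) = G' \<longleftrightarrow> card G' = card G \<and> G' \<in> interval_realizations n l u \<and>
    sd G {{a, b}, {b, c}} = G'"
proof -
  have s: "hinge_flip n l u G (a, b, c) = (if card (sd G {{a, b}, {b, c}}) = card G \<and>
      sd G {{a, b}, {b, c}} \<in> interval_realizations n l u then sd G {{a, b}, {b, c}} else G)"
    unfolding hinge_flip_def sd_def Let_def by simp
  show ?thesis unfolding s
    using if_accept_eq[OF assms, of "\<lambda>H. card H = card G \<and> H \<in> interval_realizations n l u"] by (simp only: conj_assoc)
qed

lemma edge_toggle_eq:
  assumes "G \<noteq> G'"
  shows "edge_toggle n l u G e = G' \<longleftrightarrow> G' \<in> interval_realizations n l u \<and> sd G {e} = G'"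
proof -
  have s: "edge_toggle n l u G e = (if sd G {e} \<in> interval_realizations n l u then sd G {e} else G)"
    unfolding edge_toggle_def sd_def Let_def by simp
  show ?thesis unfolding s by (rule if_accept_eq[OF assms])
qed

lemma finite_interval_realizations: "finite (interval_realizations n l u)"
  by (rule finite_subset_graphs[of _ n]) (auto simp: interval_realizations_iff)

lemma interval_chain_closed:
  assumes G: "G \<in> interval_realizations n l u"
  shows "set_pmf (interval_chain n l u G) \<subseteq> interval_realizations n l u"
proof
  fix G' assume "G' \<in> set_pmf (interval_chain n l u G)"
  then have "pmf (interval_chain n l u G) G' \<noteq> 0" by (simp add: set_pmf_iff)
  then consider "G' \<in> set_pmf (return_pmf G)"
    | "G' \<in> set_pmf (uniform_move ({1..n} \<times> {1..n} \<times> {1..n} \<times> {1..n}) (switch n G) G)"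
    | "G' \<in> set_pmf (uniform_move ({1..n} \<times> {1..n} \<times> {1..n}) (hinge_flip n l u G) G)"
    | "G' \<in> set_pmf (uniform_move (nsets {1..n} 2) (edge_toggle n l u G) G)"
    unfolding pmf_interval_chain set_pmf_iff by fastforce
  then have "G' = G \<or> G' \<in> switch n G ` ({1..n} \<times> {1..n} \<times> {1..n} \<times> {1..n}) \<or>
      G' \<in> hinge_flip n l u G ` ({1..n} \<times> {1..n} \<times> {1..n}) \<or> G' \<in> edge_toggle n l u G ` nsets {1..n} 2"
  proof cases
    case 1
    then show ?thesis by simp
  next
    case 2
    then have "G' \<in> insert G (switch n G ` ({1..n} \<times> {1..n} \<times> {1..n} \<times> {1..n}))"
      by (rule set_rev_mp[OF _ set_uniform_move]) simp
    then show ?thesis by blast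
  next
    case 3
    then have "G' \<in> insert G (hinge_flip n l u G ` ({1..n} \<times> {1..n} \<times> {1..n}))"
      by (rule set_rev_mp[OF _ set_uniform_move]) simp
    then show ?thesis by blast
  next
    case 4
    then have "G' \<in> insert G (edge_toggle n l u G ` nsets {1..n} 2)"
      by (rule set_rev_mp[OF _ set_uniform_move]) (rule finite_pairs)
    then show ?thesis by blast
  qed
  moreover have "switch n G (a, b, c, d) \<in> interval_realizations n l u" for a b c d
  proof (cases "switch n G (a, b, c, d) = G")
    case False
    then have "switch n G (a, b, c, d) \<in> graphs n \<and> (\<forall>i\<in>{1..n}. deg (switch n G (a, b, c, d)) i = deg G i)"
      using switch_eq[of G n "switch n G (a, b, c, d)" a b c d] G by (simp add: interval_realizations_iff)
    then show ?thesis using G by (simp add: interval_realizations_iff)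
  qed (simp add: G)
  moreover have "hinge_flip n l u G (a, b, c) \<in> interval_realizations n l u" for a b c
    using hinge_flip_eq[of G "hinge_flip n l u G (a, b, c)" n l u a b c] G by metis
  moreover have "edge_toggle n l u G e \<in> interval_realizations n l u" for e
    using edge_toggle_eq[of G "edge_toggle n l u G e" n l u e] G by metis
  ultimately show "G' \<in> interval_realizations n l u" using G by auto
qed

lemma interval_chain_sym:
  assumes G: "G \<in> interval_realizations n l u" and G': "G' \<in> interval_realizations n l u"
  shows "pmf (interval_chain n l u G) G' = pmf (interval_chain n l u G') G"
proof (cases "G = G'")
  case False
  then have ne: "G \<noteq> G'" "G' \<noteq> G" by auto
  have g: "G \<in> graphs n" "G' \<in> graphs n" using G G' by (simp_all add: interval_realizations_iff)
  have 1: "pmf (return_pmf G) G' = pmf (return_pmf G') G" using ne by (simp add: pmf_return)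
  have 2: "pmf (uniform_move ({1..n} \<times> {1..n} \<times> {1..n} \<times> {1..n}) (switch n G) G) G' =
      pmf (uniform_move ({1..n} \<times> {1..n} \<times> {1..n} \<times> {1..n}) (switch n G') G') G"
  proof (rule uniform_move_sym)
    show "switch n G x = G' \<longleftrightarrow> switch n G' x = G" for x
    proof (cases x)
      case (fields a b c d)
      have "(\<forall>i\<in>{1..n}. deg G' i = deg G i) \<longleftrightarrow> (\<forall>i\<in>{1..n}. deg G i = deg G' i)"
        by (rule ball_cong[OF refl]) (rule eq_commute)
      then show ?thesis unfolding fields switch_eq[OF g(1) ne(1)] switch_eq[OF g(2) ne(2)]
        by (simp only: g sd_eq_iff[of G "{{a, b}, {c, d}, {a, c}, {b, d}}" G'])
    qed
  qed simp
  have 3: "pmf (uniform_move ({1..n} \<times> {1..n} \<times> {1..n}) (hinge_flip n l u G) G) G' =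
      pmf (uniform_move ({1..n} \<times> {1..n} \<times> {1..n}) (hinge_flip n l u G') G') G"
  proof (rule uniform_move_sym)
    show "hinge_flip n l u G x = G' \<longleftrightarrow> hinge_flip n l u G' x = G" for x
    proof (cases x)
      case (fields a b c)
      show ?thesis unfolding fields hinge_flip_eq[OF ne(1)] hinge_flip_eq[OF ne(2)]
        by (simp only: G G' sd_eq_iff[of G "{{a, b}, {b, c}}" G'] eq_commute[of "card G"])
    qed
  qed simp
  have 4: "pmf (uniform_move (nsets {1..n} 2) (edge_toggle n l u G) G) G' =
      pmf (uniform_move (nsets {1..n} 2) (edge_toggle n l u G') G') G"
  proof (rule uniform_move_sym)
    show "edge_toggle n l u G e = G' \<longleftrightarrow> edge_toggle n l u G' e = G" for e
      unfolding edge_toggle_eq[OF ne(1)] edge_toggle_eq[OF ne(2)] by (simp only: G G' sd_eq_iff[of G "{e}" G'])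
  qed (rule finite_pairs)
  show ?thesis unfolding pmf_interval_chain 1 2 3 4 ..
qed simp

lemma interval_chain_lazy: "1 / 2 \<le> pmf (interval_chain n l u G) G"
  by (simp add: pmf_interval_chain)

text \<open>Each kind of move has probability 1/6 and at most \<open>(n + 1) ^ 4\<close> equally
  likely choices, at least one of which leads to \<open>G'\<close> for the kind at hand.\<close>

lemma interval_chain_move:
  assumes G: "G \<in> interval_realizations n l u" and G': "G' \<in> interval_realizations n l u"
    and ne: "G \<noteq> G'" and mv: "move n G G'"
  shows "1 / (6 * real ((n + 1) ^ 4)) \<le> pmf (interval_chain n l u G) G'"
proof -
  have g: "G \<in> graphs n" "G' \<in> graphs n" using G G' by (simp_all add: interval_realizations_iff)
  let ?A = "uniform_move ({1..n} \<times> {1..n} \<times> {1..n} \<times> {1..n}) (switch n G) G"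
  let ?B = "uniform_move ({1..n} \<times> {1..n} \<times> {1..n}) (hinge_flip n l u G) G"
  let ?C = "uniform_move (nsets {1..n} 2) (edge_toggle n l u G) G"
  let ?m = "(n + 1) ^ 4"
  consider (a) a b c d where "(a, b, c, d) \<in> {1..n} \<times> {1..n} \<times> {1..n} \<times> {1..n}" "switch n G (a, b, c, d) = G'"
    | (b) a b c where "(a, b, c) \<in> {1..n} \<times> {1..n} \<times> {1..n}" "hinge_flip n l u G (a, b, c) = G'"
    | (c) e where "e \<in> nsets {1..n} 2" "edge_toggle n l u G e = G'"
  proof -
    from mv consider
        (1) a b c d where "a \<in> {1..n}" "b \<in> {1..n}" "c \<in> {1..n}" "d \<in> {1..n}"
          "G' = sd G {{a, b}, {c, d}, {a, c}, {b, d}}" "\<forall>v\<in>{1..n}. deg G' v = deg G v"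
      | (2) a b c where "a \<in> {1..n}" "b \<in> {1..n}" "c \<in> {1..n}" "G' = sd G {{a, b}, {b, c}}" "card G' = card G"
      | (3) e where "e \<in> nsets {1..n} 2" "G' = sd G {e}"
      unfolding move_def by blast
    then show thesis
    proof cases
      case 1
      have "switch n G (a, b, c, d) = G'"
        unfolding switch_eq[OF g(1) ne] using g(2) 1(6) 1(5)[symmetric] by blast
      moreover have "(a, b, c, d) \<in> {1..n} \<times> {1..n} \<times> {1..n} \<times> {1..n}" using 1(1-4) by blast
      ultimately show thesis by (rule that(1)[rotated])
    next
      case 2
      have "hinge_flip n l u G (a, b, c) = G'"
        unfolding hinge_flip_eq[OF ne] using G' 2(5) 2(4)[symmetric] by blast
      moreover have "(a, b, c) \<in> {1..n} \<times> {1..n} \<times> {1..n}" using 2(1-3) by blast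
      ultimately show thesis by (rule that(2)[rotated])
    next
      case 3
      have "edge_toggle n l u G e = G'"
        unfolding edge_toggle_eq[OF ne] using G' 3(2)[symmetric] by blast
      with 3(1) show thesis by (rule that(3))
    qed
  qed
  then have "1 / real ?m \<le> pmf ?A G' \<or> 1 / real ?m \<le> pmf ?B G' \<or> 1 / real ?m \<le> pmf ?C G'"
  proof cases
    case a
    have "card ({1..n} \<times> {1..n} \<times> {1..n} \<times> {1..n}) = n ^ 4" by (simp add: card_cartesian_product eval_nat_numeral)
    also have "\<dots> \<le> ?m" by (rule power_mono) simp_all
    finally have "1 / real ?m \<le> pmf ?A G'" by (intro uniform_move_ge[where f = "switch n G", OF _ a(1) a(2)]) (simp_all only: finite_pairs finite_cartesian_product finite_atLeastAtMost)
    then show ?thesis by blast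
  next
    case b
    have "card ({1..n} \<times> {1..n} \<times> {1..n}) = n ^ 3" by (simp add: card_cartesian_product eval_nat_numeral)
    also have "\<dots> \<le> (n + 1) ^ 3" by (rule power_mono) simp_all
    also have "\<dots> \<le> ?m" by (rule power_increasing) simp_all
    finally have "1 / real ?m \<le> pmf ?B G'" by (intro uniform_move_ge[where f = "hinge_flip n l u G", OF _ b(1) b(2)]) (simp_all only: finite_pairs finite_cartesian_product finite_atLeastAtMost)
    then show ?thesis by blast
  next
    case c
    have "card (nsets {1..n} 2) = n choose 2" by (simp add: card_nsets)
    also have "\<dots> \<le> n ^ 2" 
      unfolding choose_two power2_eq_square by (meson diff_le_self div_le_dividend le_trans mult_le_mono2)
    also have "\<dots> \<le> (n + 1) ^ 2" by (rule power_mono) simp_all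
    also have "\<dots> \<le> ?m" by (rule power_increasing) simp_all
    finally have "1 / real ?m \<le> pmf ?C G'" by (intro uniform_move_ge[where f = "edge_toggle n l u G", OF _ c(1) c(2)]) (simp_all only: finite_pairs finite_cartesian_product finite_atLeastAtMost)
    then show ?thesis by blast
  qed
  moreover have "1 / (6 * real ?m) = (1 / real ?m) / 6" by simp
  ultimately show ?thesis unfolding pmf_interval_chain
    using pmf_nonneg[of ?A G'] pmf_nonneg[of ?B G'] pmf_nonneg[of ?C G'] pmf_nonneg[of "return_pmf G" G'] by linarith
qed

section \<open>The spectral gap\<close>

lemma relpow_difference_bound:
  fixes f :: "'a \<Rightarrow> real"
  assumes "finite R" "(x, y) \<in> R ^^ k"
  shows "\<bar>f x - f y\<bar> \<le> real k * sqrt (\<Sum>(a, b)\<in>R. (f a - f b)\<^sup>2)"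
  using assms(2)
proof (induction k arbitrary: y)
  case (Suc k)
  let ?S = "\<Sum>(a, b)\<in>R. (f a - f b)\<^sup>2"
  from Suc.prems obtain z where z: "(x, z) \<in> R ^^ k" "(z, y) \<in> R" by auto
  have "(\<lambda>(a, b). (f a - f b)\<^sup>2) (z, y) \<le> ?S" by (rule member_le_sum[OF z(2) _ assms(1)]) auto
  then have "\<bar>f z - f y\<bar> \<le> sqrt ?S" by (simp add: real_le_rsqrt)
  moreover have "\<bar>f x - f z\<bar> \<le> real k * sqrt ?S" by (rule Suc.IH[OF z(1)])
  ultimately show ?case by (simp add: algebra_simps)
qed simp

text \<open>A path need not be longer than the number of moves inside \<open>A\<close>, at most
  \<open>m * m\<close>. Bounding each of its steps by the root of the whole sum loses the factor
  \<open>m ^ 4\<close>, which is harmless for polynomial \<open>m\<close> and spares the choice of a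
  particular path.\<close>

lemma conn_difference_bound:
  fixes f :: "graph \<Rightarrow> real"
  assumes "conn n A x y" "finite A" "card A \<le> m"
  shows "(f x - f y)\<^sup>2 \<le> real (m ^ 4) * (\<Sum>(a, b)\<in>{(a, b). a \<in> A \<and> b \<in> A \<and> move n a b}. (f a - f b)\<^sup>2)"
proof -
  let ?R = "{(a, b). a \<in> A \<and> b \<in> A \<and> move n a b}"
  let ?S = "\<Sum>(a, b)\<in>?R. (f a - f b)\<^sup>2"
  have sub: "?R \<subseteq> A \<times> A" by auto
  have finR: "finite ?R" by (rule finite_subset[OF sub]) (simp add: assms(2))
  have "card ?R \<le> card A * card A" using card_mono[OF _ sub] assms(2) by (simp add: card_cartesian_product)
  also have "\<dots> \<le> m * m" using assms(3) by (intro mult_le_mono)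
  finally have cR: "card ?R \<le> m * m" .
  have "(x, y) \<in> ?R\<^sup>*" using assms(1) unfolding conn_def rtrancl_def by simp
  then obtain k where k: "k \<le> card ?R" "(x, y) \<in> ?R ^^ k" unfolding rtrancl_finite_eq_relpow[OF finR] by blast
  have S0: "0 \<le> ?S" by (rule sum_nonneg) auto
  have "\<bar>f x - f y\<bar> \<le> real k * sqrt ?S" by (rule relpow_difference_bound[OF finR k(2)])
  also have "\<dots> \<le> real (m * m) * sqrt ?S" using k(1) cR S0 by (intro mult_right_mono) (simp_all del: of_nat_mult)
  finally have "\<bar>f x - f y\<bar>\<^sup>2 \<le> (real (m * m) * sqrt ?S)\<^sup>2" by (rule power_mono) simp
  also have "\<dots> = real (m ^ 4) * ?S" using S0 by (simp add: power_mult_distrib eval_nat_numeral algebra_simps)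
  finally show ?thesis by simp
qed

text \<open>The squared difference of a pair is spread over its good pairings with weight
  \<open>1 / pairing_weight\<close> each, and for each pairing it is paid for by the moves inside
  the flow states. Exchanging the sums leaves the load of a state, bounded in
  \<open>flow_load\<close>. The exponent is 120 = 4 * 30.\<close>

lemma flow_inequality:
  fixes f :: "graph \<Rightarrow> real"
  assumes thin: "thin n l u"
  defines "\<Omega> \<equiv> interval_realizations n l u"
  shows "(\<Sum>X\<in>\<Omega>. \<Sum>Y\<in>\<Omega>. (f X - f Y)\<^sup>2) \<le>
    real ((n * n + 1) ^ 120 * flow_factor n * card (deviation_set n l u 18)) *
      (\<Sum>(a, b)\<in>{(a, b). a \<in> \<Omega> \<and> b \<in> \<Omega> \<and> move n a b}. (f a - f b)\<^sup>2)"
proof -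
  let ?E = "{(a, b). a \<in> \<Omega> \<and> b \<in> \<Omega> \<and> move n a b}"
  let ?w = "\<lambda>X Y. 1 / real (pairing_weight n (sd X Y))" and ?F = "\<lambda>X Y \<psi>. flow_states n l u X Y \<psi>"
  let ?T = "SIGMA X:\<Omega>. SIGMA Y:\<Omega>. good_pairings n X Y"
  let ?M = "real ((n * n + 1) ^ 120)"
  have \<Omega>g: "X \<in> graphs n" if "X \<in> \<Omega>" for X using that by (simp add: \<Omega>_def interval_realizations_iff)
  have fin\<Omega>: "finite \<Omega>" unfolding \<Omega>_def by (rule finite_interval_realizations)
  have finE: "finite ?E" by (rule finite_subset[of _ "\<Omega> \<times> \<Omega>"]) (use fin\<Omega> in auto)
  have finP: "finite (good_pairings n X Y)" if "X \<in> \<Omega>" "Y \<in> \<Omega>" for X Y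
    using finite_pairings[OF sd_graphs[OF \<Omega>g \<Omega>g]] that by (simp add: good_pairings_def)
  have finT: "finite ?T" using fin\<Omega> finP by (intro finite_SigmaI) auto
  \<comment> \<open>The weights of a pair sum up to at least 1: by thinness the factorials in
    \<open>card_good_pairings\<close> are all 1, so there are at least \<open>pairing_weight\<close>
    good pairings.\<close>
  have one: "1 \<le> (\<Sum>\<psi>\<in>good_pairings n X Y. ?w X Y)" if X: "X \<in> \<Omega>" and Y: "Y \<in> \<Omega>" for X Y
  proof -
    have "fact ((deg X v - deg Y v) + (deg Y v - deg X v)) = (1 :: nat)" if v: "v \<in> {1..n}" for v
    proof -
      have "l v \<le> deg X v" "deg X v \<le> u v" "l v \<le> deg Y v" "deg Y v \<le> u v" "u v \<le> l v + 1"
        using X Y thin v by (auto simp: \<Omega>_def interval_realizations_iff thin_def)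
      then have "(deg X v - deg Y v) + (deg Y v - deg X v) \<le> 1" by linarith
      then consider "(deg X v - deg Y v) + (deg Y v - deg X v) = 0" | "(deg X v - deg Y v) + (deg Y v - deg X v) = 1"
        by linarith
      then show ?thesis by cases (simp_all only: fact_0 fact_1)
    qed
    then have "(\<Prod>v\<in>{1..n}. fact ((deg X v - deg Y v) + (deg Y v - deg X v))) = (1 :: nat)"
      by (intro prod.neutral ballI)
    then have "pairing_weight n (sd X Y) \<le> card (good_pairings n X Y)"
      using card_good_pairings[OF \<Omega>g[OF X] \<Omega>g[OF Y]] by simp
    then show ?thesis using pairing_weight_pos[of n "sd X Y"] by simp
  qed
  have "(\<Sum>X\<in>\<Omega>. \<Sum>Y\<in>\<Omega>. (f X - f Y)\<^sup>2) \<le>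
      (\<Sum>X\<in>\<Omega>. \<Sum>Y\<in>\<Omega>. \<Sum>\<psi>\<in>good_pairings n X Y. ?w X Y * (f X - f Y)\<^sup>2)"
  proof (intro sum_mono)
    fix X Y assume "X \<in> \<Omega>" "Y \<in> \<Omega>"
    then have "1 * (f X - f Y)\<^sup>2 \<le> (\<Sum>\<psi>\<in>good_pairings n X Y. ?w X Y) * (f X - f Y)\<^sup>2"
      by (intro mult_right_mono one) simp_all
    then show "(f X - f Y)\<^sup>2 \<le> (\<Sum>\<psi>\<in>good_pairings n X Y. ?w X Y * (f X - f Y)\<^sup>2)"
      by (simp only: sum_distrib_right mult_1_left)
  qed
  also have "\<dots> = (\<Sum>(X, Y, \<psi>)\<in>?T. ?w X Y * (f X - f Y)\<^sup>2)"
  proof -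
    have "(\<Sum>X\<in>\<Omega>. \<Sum>Y\<in>\<Omega>. \<Sum>\<psi>\<in>good_pairings n X Y. ?w X Y * (f X - f Y)\<^sup>2) =
        (\<Sum>X\<in>\<Omega>. \<Sum>(Y, \<psi>)\<in>Sigma \<Omega> (good_pairings n X). ?w X Y * (f X - f Y)\<^sup>2)"
      by (intro sum.cong refl sum.Sigma fin\<Omega> ballI finP)
    also have "\<dots> = (\<Sum>(X, Y, \<psi>)\<in>?T. ?w X Y * (f X - f Y)\<^sup>2)"
      by (rule sum.Sigma) (use fin\<Omega> finP in auto)
    finally show ?thesis .
  qed
  also have "\<dots> \<le> (\<Sum>(X, Y, \<psi>)\<in>?T. ?w X Y * (?M * (\<Sum>(a, b)\<in>?E. if a \<in> ?F X Y \<psi> then (f a - f b)\<^sup>2 else 0)))"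
  proof (rule sum_mono, clarify)
    fix X Y \<psi> assume X: "X \<in> \<Omega>" and Y: "Y \<in> \<Omega>" and \<psi>: "\<psi> \<in> good_pairings n X Y"
    have "(f X - f Y)\<^sup>2 \<le> real (((n * n + 1) ^ 30) ^ 4) *
        (\<Sum>(a, b)\<in>{(a, b). a \<in> ?F X Y \<psi> \<and> b \<in> ?F X Y \<psi> \<and> move n a b}. (f a - f b)\<^sup>2)"
      using X Y unfolding \<Omega>_def
      by (intro conn_difference_bound flow_states_connected[OF thin _ _ \<psi>] card_flow_states[OF thin _ _ \<psi>])
    \<comment> \<open>Only the first endpoint is still required to be a flow state, since
      \<open>flow_load\<close> bounds the load of states rather than of moves.\<close>
    also have "\<dots> \<le> real (((n * n + 1) ^ 30) ^ 4) * (\<Sum>(a, b)\<in>{e \<in> ?E. fst e \<in> ?F X Y \<psi>}. (f a - f b)\<^sup>2)"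
    proof (intro mult_left_mono sum_mono2)
      show "finite {e \<in> ?E. fst e \<in> ?F X Y \<psi>}" using finE by simp
      show "{(a, b). a \<in> ?F X Y \<psi> \<and> b \<in> ?F X Y \<psi> \<and> move n a b} \<subseteq> {e \<in> ?E. fst e \<in> ?F X Y \<psi>}"
        by (auto simp: flow_states_def \<Omega>_def)
    qed auto
    also have "(\<Sum>(a, b)\<in>{e \<in> ?E. fst e \<in> ?F X Y \<psi>}. (f a - f b)\<^sup>2) =
        (\<Sum>(a, b)\<in>?E. if a \<in> ?F X Y \<psi> then (f a - f b)\<^sup>2 else 0)"
      unfolding sum.inter_filter[OF finE] by (rule sum.cong) auto
    also have "((n * n + 1) ^ 30) ^ 4 = (n * n + 1) ^ 120" by (simp flip: power_mult)
    finally show "?w X Y * (f X - f Y)\<^sup>2 \<le>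
        ?w X Y * (?M * (\<Sum>(a, b)\<in>?E. if a \<in> ?F X Y \<psi> then (f a - f b)\<^sup>2 else 0))"
      by (rule mult_left_mono) simp
  qed
  also have "\<dots> = ?M * (\<Sum>(X, Y, \<psi>)\<in>?T. \<Sum>(a, b)\<in>?E. (f a - f b)\<^sup>2 * (if a \<in> ?F X Y \<psi> then ?w X Y else 0))"
    unfolding sum_distrib_left by (intro sum.cong refl) (auto simp: sum_distrib_left split_def intro!: sum.cong)
  also have "\<dots> = ?M * (\<Sum>(a, b)\<in>?E. (f a - f b)\<^sup>2 * (\<Sum>(X, Y, \<psi>)\<in>?T. if a \<in> ?F X Y \<psi> then ?w X Y else 0))"
    unfolding split_def by (subst sum.swap) (simp only: sum_distrib_left)
  also have "\<dots> \<le> ?M * (\<Sum>(a, b)\<in>?E. (f a - f b)\<^sup>2 * (real (flow_factor n) * real (card (deviation_set n l u 18))))"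
  proof (intro mult_left_mono sum_mono, clarify)
    fix a b assume a: "a \<in> \<Omega>"
    let ?Ta = "{(X, Y, \<psi>). X \<in> \<Omega> \<and> Y \<in> \<Omega> \<and> \<psi> \<in> good_pairings n X Y \<and> a \<in> ?F X Y \<psi>}"
    have eq: "{t \<in> ?T. a \<in> ?F (fst t) (fst (snd t)) (snd (snd t))} = ?Ta" by auto
    have "(\<Sum>(X, Y, \<psi>)\<in>?T. if a \<in> ?F X Y \<psi> then ?w X Y else 0) = (\<Sum>(X, Y, \<psi>)\<in>?Ta. ?w X Y)"
      unfolding eq[symmetric] sum.inter_filter[OF finT] by (rule sum.cong) auto
    also have "\<dots> \<le> real (flow_factor n) * real (card (deviation_set n l u 18))"
      using flow_load(1)[OF thin, of a] a unfolding \<Omega>_def by blast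
    finally show "(f a - f b)\<^sup>2 * (\<Sum>(X, Y, \<psi>)\<in>?T. if a \<in> ?F X Y \<psi> then ?w X Y else 0) \<le>
        (f a - f b)\<^sup>2 * (real (flow_factor n) * real (card (deviation_set n l u 18)))"
      by (rule mult_left_mono) simp
  qed simp
  also have "\<dots> = real ((n * n + 1) ^ 120 * flow_factor n * card (deviation_set n l u 18)) * (\<Sum>(a, b)\<in>?E. (f a - f b)\<^sup>2)"
    unfolding split_def sum_distrib_right[symmetric] of_nat_mult by (simp only: ac_simps)
  finally show ?thesis .
qed

section \<open>Functions bounded by polynomials\<close>

definition poly_bounded :: "(nat \<Rightarrow> real) \<Rightarrow> bool" where
  "poly_bounded g \<longleftrightarrow> (\<exists>q. \<forall>n. 0 \<le> g n \<and> g n \<le> poly q (real n))"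

lemma poly_bounded_const: "0 \<le> c \<Longrightarrow> poly_bounded (\<lambda>n. c)"
  unfolding poly_bounded_def by (intro exI[of _ "[:c:]"]) simp

lemma poly_bounded_of_nat: "poly_bounded real"
  unfolding poly_bounded_def by (intro exI[of _ "[:0, 1:]"]) simp

lemma poly_bounded_add:
  assumes "poly_bounded f" "poly_bounded g"
  shows "poly_bounded (\<lambda>n. f n + g n)"
proof -
  obtain p q where "\<forall>n. 0 \<le> f n \<and> f n \<le> poly p (real n)" "\<forall>n. 0 \<le> g n \<and> g n \<le> poly q (real n)"
    using assms unfolding poly_bounded_def by blast
  then have "\<forall>n. 0 \<le> f n + g n \<and> f n + g n \<le> poly (p + q) (real n)" by (simp add: add_mono)
  then show ?thesis unfolding poly_bounded_def by blast
qed

lemma poly_bounded_mult: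
  assumes "poly_bounded f" "poly_bounded g"
  shows "poly_bounded (\<lambda>n. f n * g n)"
proof -
  obtain p q where pq: "\<forall>n. 0 \<le> f n \<and> f n \<le> poly p (real n)" "\<forall>n. 0 \<le> g n \<and> g n \<le> poly q (real n)"
    using assms unfolding poly_bounded_def by blast
  have "f n * g n \<le> poly p (real n) * poly q (real n)" for n
    using pq by (intro mult_mono) (auto intro: order_trans)
  then have "\<forall>n. 0 \<le> f n * g n \<and> f n * g n \<le> poly (p * q) (real n)" using pq by simp
  then show ?thesis unfolding poly_bounded_def by blast
qed

lemma poly_bounded_power: "poly_bounded f \<Longrightarrow> poly_bounded (\<lambda>n. f n ^ k)"
  by (induction k) (simp_all add: poly_bounded_const poly_bounded_mult)

lemmas poly_bounded_intros = poly_bounded_add poly_bounded_mult poly_bounded_power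
  poly_bounded_of_nat poly_bounded_const

text \<open>Absolute values of the coefficients do it. This serves the stability polynomial, whose
  values may have any sign.\<close>

lemma ex_poly_majorant: "\<exists>q. \<forall>x\<ge>0. \<bar>poly p x\<bar> \<le> poly q (x :: real)"
proof (induction p)
  case 0
  show ?case by (intro exI[of _ 0]) simp
next
  case (pCons a p)
  then obtain q where q: "\<forall>x\<ge>0. \<bar>poly p x\<bar> \<le> poly q x" by blast
  have "\<bar>poly (pCons a p) x\<bar> \<le> poly (pCons \<bar>a\<bar> q) x" if "0 \<le> x" for x
  proof -
    have "\<bar>x * poly p x\<bar> \<le> x * poly q x" using q that by (simp add: abs_mult mult_left_mono)
    then show ?thesis by simp
  qed
  then show ?case by blast
qed

lemma poly_bounded_abs_poly: "poly_bounded (\<lambda>n. \<bar>poly p (real n)\<bar>)"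
  using ex_poly_majorant[of p] unfolding poly_bounded_def by (meson abs_ge_zero of_nat_0_le_iff)

section \<open>From weak stability to a polynomial Poincare constant\<close>

lemma excess_factor_mono:
  assumes "j \<le> k"
  shows "excess_factor n j \<le> excess_factor n k"
proof -
  have p: "(n + 1) ^ i \<le> (n + 1) ^ i'" if "i \<le> i'" for i i' using that by (intro power_increasing) simp_all
  have "((n + 1) ^ (2 * (j + 9))) ^ (j + 8) \<le> ((n + 1) ^ (2 * (k + 9))) ^ (k + 8)"
    unfolding power_mult[symmetric] using assms by (intro p mult_le_mono) simp_all
  then show ?thesis unfolding excess_factor_def using assms by (intro mult_le_mono p order_refl) simp_all
qed

text \<open>Dividing \<open>card_excess_step\<close> by the number of realizations gives a factor
  \<open>1 + excess_factor n k * A\<close> for step \<open>k\<close>. Taking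
  \<open>excess_factor n m\<close> for all \<open>k \<le> m\<close> turns the product into a
  power.\<close>

lemma card_excess_bound:
  assumes thin: "thin n l u" and ne: "interval_realizations n l u \<noteq> {}" and A: "0 \<le> A"
    and two: "real (card (excess_set n l u 2)) \<le> A * real (card (interval_realizations n l u))"
    and k: "k \<le> m"
  shows "real (card (excess_set n l u k)) \<le>
    (1 + real (excess_factor n m) * A) ^ k * real (card (interval_realizations n l u))"
  using k
proof (induction k)
  case 0
  show ?case by (simp add: excess_set_0)
next
  case (Suc k)
  let ?E = "\<lambda>k. real (card (excess_set n l u k))" and ?N = "real (card (interval_realizations n l u))"
  let ?M = "real (excess_factor n m)"
  have N: "0 < ?N" using ne finite_interval_realizations by (simp add: card_gt_0_iff)
  have "?E (Suc k) * ?N \<le> ?E k * ?N + real (excess_factor n (Suc k)) * ?E k * ?E 2"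
    using card_excess_step[OF thin, of "Suc k"] by simp
  also have "\<dots> \<le> ?E k * ?N + ?M * ?E k * (A * ?N)"
    using excess_factor_mono[OF Suc.prems, of n] A by (intro add_left_mono mult_mono two) simp_all
  also have "\<dots> = ((1 + ?M * A) * ?E k) * ?N" by (simp add: algebra_simps)
  finally have "?E (Suc k) \<le> (1 + ?M * A) * ?E k" using N by (rule mult_right_le_imp_le)
  also have "\<dots> \<le> (1 + ?M * A) * ((1 + ?M * A) ^ k * ?N)"
    using Suc A by (intro mult_left_mono) simp_all
  finally show ?case by simp
qed

text \<open>Bounds the ratio of \<open>excess_set n l u 2\<close> to the realizations: two edge
  changes lead to a realization (the 1) or to a graph counted by weak stability (the
  polynomial).\<close>

definition stability_factor :: "real poly \<Rightarrow> nat \<Rightarrow> real" where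
  "stability_factor p n = (real n * real n + 1) ^ 2 * (1 + \<bar>poly p (real n)\<bar>)"

text \<open>18 = 2 * 9 is the deviation in \<open>flow_load\<close>. At most 18 edges are added
  against deficits, and then the excess is reduced in 18 steps.\<close>

definition deviation_factor :: "real poly \<Rightarrow> nat \<Rightarrow> real" where
  "deviation_factor p n = (real n * real n + 1) ^ 18 * (1 + real (excess_factor n 18) * stability_factor p n) ^ 18"

text \<open>Reciprocal of the gap: the reciprocal of the lower bound for move probabilities, times
  the loss in \<open>flow_inequality\<close> relative to the number of realizations.\<close>

definition relaxation_bound :: "real poly \<Rightarrow> nat \<Rightarrow> real" where
  "relaxation_bound p n = 6 * (real n + 1) ^ 4 * ((real n * real n + 1) ^ 120 * real (flow_factor n) * deviation_factor p n)"

lemma poly_bounded_relaxation: "poly_bounded (relaxation_bound p)"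
proof -
  have "poly_bounded (\<lambda>n. real (flow_factor n))" "poly_bounded (\<lambda>n. real (excess_factor n 18))"
    unfolding flow_factor_def excess_factor_def of_nat_mult of_nat_power of_nat_add of_nat_1
    by (intro poly_bounded_intros; simp)+
  then show ?thesis
    unfolding relaxation_bound_def deviation_factor_def stability_factor_def
    by (intro poly_bounded_intros poly_bounded_abs_poly) simp_all
qed

lemma stability_factor_nonneg: "0 \<le> stability_factor p n"
  by (simp add: stability_factor_def)

lemma deviation_factor_ge_1: "1 \<le> deviation_factor p n"
proof -
  have "1 * 1 \<le> deviation_factor p n"
    unfolding deviation_factor_def
    using stability_factor_nonneg[of p n] by (intro mult_mono one_le_power) simp_all
  then show ?thesis by simp
qed

lemma relaxation_bound_ge_1: "1 \<le> relaxation_bound p n"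
proof -
  have "1 \<le> flow_factor n" by (simp add: flow_factor_def Suc_le_eq)
  then have "1 \<le> real (flow_factor n)" by simp
  then have "(1 * 1) * ((1 * 1) * 1) \<le> relaxation_bound p n"
    unfolding relaxation_bound_def using deviation_factor_ge_1[of p n]
    by (intro mult_mono one_le_power) simp_all
  then show ?thesis by simp
qed

lemma card_deviation_bound:
  assumes deg: "degree_sequence_interval n l u" and thin: "thin n l u"
    and stable: "weakly_stable p n l u" and ne: "interval_realizations n l u \<noteq> {}"
  shows "real (card (deviation_set n l u 18)) \<le> deviation_factor p n * real (card (interval_realizations n l u))"
proof -
  let ?N = "real (card (interval_realizations n l u))" and ?A = "stability_factor p n"
  let ?W = "\<Union>S\<in>nsets {1..n} 2. interval_realizations n l (\<lambda>i. u i + indicator S i)"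
  have lu: "l v \<le> n - 1 \<and> l v \<le> u v" if "v \<in> {1..n}" for v
    using deg that by (simp add: degree_sequence_interval_def degree_sequence_def)
  have "real (card (excess_set n l u 2)) \<le> real ((n * n + 1) ^ 2 * (card (interval_realizations n l u) + card ?W))"
    using card_excess_two[OF lu ne] unfolding of_nat_le_iff .
  also have "\<dots> = (real n * real n + 1) ^ 2 * (?N + real (card ?W))" by simp
  also have "\<dots> \<le> (real n * real n + 1) ^ 2 * (?N + \<bar>poly p (real n)\<bar> * ?N)"
  proof (intro mult_left_mono add_left_mono)
    have "real (card ?W) \<le> poly p (real n) * ?N" using stable by (simp only: weakly_stable_def)
    also have "\<dots> \<le> \<bar>poly p (real n)\<bar> * ?N" by (intro mult_right_mono) simp_all
    finally show "real (card ?W) \<le> \<bar>poly p (real n)\<bar> * ?N" .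
  qed simp
  also have "\<dots> = ?A * ?N" by (simp add: stability_factor_def algebra_simps)
  finally have two: "real (card (excess_set n l u 2)) \<le> ?A * ?N" .
  have "real (card (deviation_set n l u 18)) \<le> real ((n * n + 1) ^ 18 * card (excess_set n l u 18))"
    using card_deviation_set[OF lu] unfolding of_nat_le_iff .
  also have "\<dots> = (real n * real n + 1) ^ 18 * real (card (excess_set n l u 18))"
    by (simp only: of_nat_mult of_nat_power of_nat_add of_nat_1)
  also have "\<dots> \<le> (real n * real n + 1) ^ 18 * ((1 + real (excess_factor n 18) * ?A) ^ 18 * ?N)"
    by (intro mult_left_mono card_excess_bound[OF thin ne stability_factor_nonneg two]) simp_all
  also have "\<dots> = deviation_factor p n * ?N" by (simp only: deviation_factor_def mult.assoc)
  finally show ?thesis .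
qed

lemma interval_chain_lazy_chain:
  assumes deg: "degree_sequence_interval n l u" and thin: "thin n l u"
    and stable: "weakly_stable p n l u" and ne: "interval_realizations n l u \<noteq> {}"
  shows "lazy_chain (interval_realizations n l u) (interval_chain n l u) (1 / relaxation_bound p n)"
proof
  let ?Om = "interval_realizations n l u" and ?K = "interval_chain n l u"
  let ?N = "real (card ?Om)" and ?h = "relaxation_bound p n"
  have h: "0 < ?h" using relaxation_bound_ge_1[of p n] by linarith
  show "finite ?Om" by (rule finite_interval_realizations)
  show "set_pmf (?K x) \<subseteq> ?Om" if "x \<in> ?Om" for x by (rule interval_chain_closed[OF that])
  show "pmf (?K x) y = pmf (?K y) x" if "x \<in> ?Om" "y \<in> ?Om" for x y by (rule interval_chain_sym[OF that])
  show "1 / 2 \<le> pmf (?K x) x" for x by (rule interval_chain_lazy)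
  show "0 < 1 / ?h" "1 / ?h \<le> 1" using relaxation_bound_ge_1[of p n] h by simp_all
  fix f :: "graph \<Rightarrow> real"
  let ?E = "{(a, b). a \<in> ?Om \<and> b \<in> ?Om \<and> move n a b}"
  let ?c = "6 * (real n + 1) ^ 4"
  let ?S = "\<Sum>x\<in>?Om. \<Sum>y\<in>?Om. pmf (?K x) y * (f x - f y)\<^sup>2"
  have step: "(f a - f b)\<^sup>2 \<le> ?c * (pmf (?K a) b * (f a - f b)\<^sup>2)" if "a \<in> ?Om" "b \<in> ?Om" "move n a b" for a b
  proof (cases "a = b")
    case False
    have "1 / ?c \<le> pmf (?K a) b" using interval_chain_move[OF that(1,2) False that(3)] by (simp add: add.commute)
    then have "1 \<le> ?c * pmf (?K a) b" by (simp add: divide_le_eq mult.commute)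
    then have "1 * (f a - f b)\<^sup>2 \<le> (?c * pmf (?K a) b) * (f a - f b)\<^sup>2" by (rule mult_right_mono) simp
    then show ?thesis by (simp only: mult.assoc mult_1_left)
  qed simp
  have "(\<Sum>(a, b)\<in>?E. (f a - f b)\<^sup>2) \<le> (\<Sum>(a, b)\<in>?E. ?c * (pmf (?K a) b * (f a - f b)\<^sup>2))"
    using step by (intro sum_mono) auto
  also have "\<dots> \<le> (\<Sum>(a, b)\<in>?Om \<times> ?Om. ?c * (pmf (?K a) b * (f a - f b)\<^sup>2))"
    by (rule sum_mono2) (auto simp: finite_interval_realizations)
  also have "\<dots> = ?c * ?S" by (simp only: sum.cartesian_product sum_distrib_left split_def)
  finally have E: "(\<Sum>(a, b)\<in>?E. (f a - f b)\<^sup>2) \<le> ?c * ?S" .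
  have "(\<Sum>x\<in>?Om. \<Sum>y\<in>?Om. (f x - f y)\<^sup>2) \<le>
      real ((n * n + 1) ^ 120 * flow_factor n * card (deviation_set n l u 18)) * (\<Sum>(a, b)\<in>?E. (f a - f b)\<^sup>2)"
    by (rule flow_inequality[OF thin])
  also have "\<dots> = ((real n * real n + 1) ^ 120 * real (flow_factor n)) * real (card (deviation_set n l u 18)) *
      (\<Sum>(a, b)\<in>?E. (f a - f b)\<^sup>2)" by (simp only: of_nat_mult of_nat_power of_nat_add of_nat_1)
  also have "\<dots> \<le> ((real n * real n + 1) ^ 120 * real (flow_factor n)) * (deviation_factor p n * ?N) * (?c * ?S)"
    using deviation_factor_ge_1[of p n] by (intro mult_mono order_refl card_deviation_bound[OF assms] E)
      (auto intro!: sum_nonneg mult_nonneg_nonneg)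
  also have "\<dots> = ?h * (?N * ?S)" unfolding relaxation_bound_def by (simp only: ac_simps)
  finally have "1 / ?h * (\<Sum>x\<in>?Om. \<Sum>y\<in>?Om. (f x - f y)\<^sup>2) \<le> 1 / ?h * (?h * (?N * ?S))"
    using h by (intro mult_left_mono) simp_all
  also have "\<dots> = ?N * ?S" using h by simp
  finally show "1 / ?h * (\<Sum>x\<in>?Om. \<Sum>y\<in>?Om. (f x - f y)\<^sup>2) \<le> ?N * ?S" .
qed

section \<open>From the gap to the mixing time\<close>

lemma mixing_time_empty: "mixing_time {} K \<epsilon> = 0"
proof -
  have "mixing_time {} K \<epsilon> \<le> enat 0" unfolding mixing_time_def by (rule Inf_lower) auto
  then show ?thesis by (simp flip: zero_enat_def)
qed

lemma card_interval_realizations_le: "real (card (interval_realizations n l u)) \<le> exp (real n * real n)"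
proof -
  have "interval_realizations n l u \<subseteq> Pow (nsets {1..n} 2)"
    by (auto simp: interval_realizations_iff graphs_def)
  then have "card (interval_realizations n l u) \<le> card (Pow (nsets {1..n} 2))"
    using finite_pairs[of n] by (intro card_mono) simp_all
  also have "\<dots> = 2 ^ (n choose 2)" using finite_pairs[of n] by (subst card_Pow) (simp_all add: card_nsets)
  also have "\<dots> \<le> 2 ^ (n * n)"
    by (intro power_increasing) (simp_all add: choose_two, meson diff_le_self div_le_dividend le_trans mult_le_mono2)
  finally have "real (card (interval_realizations n l u)) \<le> real (2 ^ (n * n))" by (simp only: of_nat_le_iff)
  also have "\<dots> = 2 ^ (n * n)" by simp
  also have "\<dots> \<le> exp 1 ^ (n * n)" using exp_ge_add_one_self[of 1] by (intro power_mono) simp_all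
  also have "\<dots> = exp (real n * real n)" by (simp flip: exp_of_nat_mult)
  finally show ?thesis .
qed

text \<open>The logarithm is negative for \<epsilon> > 1, so a bound linear in it might drop below
  0. The form \<open>1 + (ln (1 / \<epsilon>))\<^sup>2\<close> stays positive and dominates
  \<open>2 * ln (1 / \<epsilon>)\<close>.\<close>

lemma mixing_time_interval_chain:
  assumes "degree_sequence_interval n l u" "thin n l u" "weakly_stable p n l u" and \<epsilon>: "0 < \<epsilon>"
  shows "ereal_of_enat (mixing_time (interval_realizations n l u) (interval_chain n l u) \<epsilon>) \<le>
    ereal (relaxation_bound p n * (real n * real n + 2) * (1 + (ln (1 / \<epsilon>))\<^sup>2))"
proof (cases "interval_realizations n l u = {}")
  case True
  have "0 \<le> relaxation_bound p n * (real n * real n + 2) * (1 + (ln (1 / \<epsilon>))\<^sup>2)"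
    using relaxation_bound_ge_1[of p n] by simp
  then show ?thesis by (simp add: True mixing_time_empty flip: zero_ereal_def)
next
  case False
  let ?h = "relaxation_bound p n" and ?y = "ln (1 / \<epsilon>)" and ?N = "real n * real n"
  interpret lazy_chain "interval_realizations n l u" "interval_chain n l u" "1 / ?h"
    by (rule interval_chain_lazy_chain[OF assms(1-3) False])
  have h: "1 \<le> ?h" by (rule relaxation_bound_ge_1)
  define t where "t = nat \<lceil>?h * (?N + 2 * ?y)\<rceil>"
  have "?h * (?N + 2 * ?y) \<le> real t" unfolding t_def by (rule real_nat_ceiling_ge)
  then have "?N + 2 * ?y \<le> 1 / ?h * real t" using h by (simp add: field_simps)
  then have "mixing_time (interval_realizations n l u) (interval_chain n l u) \<epsilon> \<le> enat t"
    by (rule mixing_time_bound[OF \<epsilon> card_interval_realizations_le])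
  then have "ereal_of_enat (mixing_time (interval_realizations n l u) (interval_chain n l u) \<epsilon>) \<le> ereal (real t)"
    by (metis ereal_of_enat_le_iff ereal_of_enat_simps(1))
  also have "real t \<le> ?h * (?N + 2) * (1 + ?y\<^sup>2)"
  proof -
    have y: "2 * ?y \<le> 1 + ?y\<^sup>2" using sum_squares_bound[of 1 ?y] by simp
    have "?h * (?N + 2 * ?y) \<le> ?h * (?N + 1 + ?y\<^sup>2)" using h y by (intro mult_left_mono) linarith+
    moreover have "0 \<le> ?h * (?N + 1 + ?y\<^sup>2)" using h by simp
    \<comment> \<open>Rounding up adds at most 1, which is absorbed below because the relaxation
      bound is at least 1; the maximum accounts for \<open>nat\<close> cutting off negative
      values.\<close>
    moreover have "real t \<le> max 0 (?h * (?N + 2 * ?y)) + 1" unfolding t_def by linarith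
    ultimately have "real t \<le> ?h * (?N + 1 + ?y\<^sup>2) + 1" by linarith
    also have "\<dots> \<le> ?h * (?N + 1 + ?y\<^sup>2) + ?h * 1" using h by simp
    also have "\<dots> = ?h * (?N + 2 + ?y\<^sup>2)" by (simp add: algebra_simps)
    also have "\<dots> \<le> ?h * ((?N + 2) * (1 + ?y\<^sup>2))"
    proof (rule mult_left_mono)
      have "0 \<le> (?N + 1) * ?y\<^sup>2" by simp
      then show "?N + 2 + ?y\<^sup>2 \<le> (?N + 2) * (1 + ?y\<^sup>2)" by (simp add: algebra_simps)
    qed (use h in simp)
    finally show ?thesis by (simp only: mult.assoc)
  qed
  finally show ?thesis by simp
qed

lemma poly_map_poly_const: "poly (map_poly (\<lambda>a. [:a:]) q) [:x:] = [:poly q (x :: real):]"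
proof (induction q)
  case (pCons a q)
  then show ?case by (simp add: map_poly_pCons)
qed simp

theorem theorem2p20:
  fixes \<I> :: "(nat \<times> (nat \<Rightarrow> nat) \<times> (nat \<Rightarrow> nat)) set"
  assumes "\<forall>(n, l, u) \<in> \<I>. degree_sequence_interval n l u"
    and "weakly_P_stable \<I>"
    and "\<forall>(n, l, u) \<in> \<I>. thin n l u"
  shows "rapidly_mixing_family \<I>"
proof -
  obtain p where p: "\<forall>(n, l, u) \<in> \<I>. weakly_stable p n l u" using assms(2) by (auto simp: weakly_P_stable_def)
  have "poly_bounded (\<lambda>n. relaxation_bound p n * (real n * real n + 2))"
    by (intro poly_bounded_intros poly_bounded_relaxation) simp
  then obtain q where q: "\<And>n. relaxation_bound p n * (real n * real n + 2) \<le> poly q (real n)"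
    unfolding poly_bounded_def by blast
  \<comment> \<open>The bivariate polynomial q(X) (1 + Y^2): the coefficients of \<open>q\<close>
    become constants in the inner variable Y, and \<open>[:1, 0, 1:]\<close> is 1 + Y^2 in that
    variable.\<close>
  let ?Q = "smult [:1, 0, 1:] (map_poly (\<lambda>a. [:a:]) q)"
  have Q: "poly2 ?Q x y = poly q x * (1 + y\<^sup>2)" for x y
    by (simp add: poly2_def poly_map_poly_const power2_eq_square algebra_simps)
  show ?thesis
    unfolding rapidly_mixing_family_def
  proof (rule exI[of _ ?Q], clarify)
    fix n l u and \<epsilon> :: real
    assume I: "(n, l, u) \<in> \<I>" and \<epsilon>: "0 < \<epsilon>"
    have "degree_sequence_interval n l u" "thin n l u" "weakly_stable p n l u" using assms(1,3) p I by auto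
    then have "ereal_of_enat (mixing_time (interval_realizations n l u) (interval_chain n l u) \<epsilon>) \<le>
        ereal (relaxation_bound p n * (real n * real n + 2) * (1 + (ln (1 / \<epsilon>))\<^sup>2))"
      using \<epsilon> by (rule mixing_time_interval_chain)
    also have "\<dots> \<le> ereal (poly2 ?Q (real n) (ln (1 / \<epsilon>)))"
      unfolding Q ereal_less_eq(3) by (intro mult_right_mono q) simp
    finally show "ereal_of_enat (mixing_time (interval_realizations n l u) (interval_chain n l u) \<epsilon>)
        \<le> ereal (poly2 ?Q (real n) (ln (1 / \<epsilon>)))" .
  qed
qed

end
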